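(* Let $g\colon Z\to X$ be a faithfully flat map of noetherian schemes, and let $\pi_1\colon Z\times_XZ\to Z$ and $\pi_2\colon Z\times_XZ\to Z$ be the canonical projections. If $J$ is an idempotent $\mathcal O_Z$-ideal such that there exists an isomorphism $\pi_1^*J\cong\pi_2^*J$, then there is a unique idempotent $\mathcal O_X$-ideal $I$ such that $J=I\mathcal O_Z$.
   Context: Faithfully flat means flat and surjective. An ideal sheaf $I\subseteq\mathcal O_X$ is idempotent if it is of finite type (locally finitely generated) and $I^2=I$; equivalently, $I=a\mathcal O_X$ for some $a\in H^0(X,\mathcal O_X)$ with $a^2=a$; equivalently, $I$ restricts to $\mathcal O_U$ on some open-and-closed $U\subseteq X$ and to $0$ on $X\setminus U$. $I\mathcal O_Z$ is the ideal of $\mathcal O_Z$ generated by the image of $g^{-1}I$. *)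

theory Defs
  imports "HOL-Analysis.Abstract_Topology" "HOL-Algebra.Ideal_Product" "HOL-Algebra.Ring_Divisibility"
    "HOL-Algebra.Module" "HOL-Algebra.Free_Abelian_Groups"
begin

(* Spaces carry explicit carriers: a space is a topology on a subset of a type, and a ring of
   sections is a ring record whose carrier is a subset of a type.  Values of  sec  and  res  at
   sets that are not open are irrelevant.  Sheaves of rings and sheaves of modules
   share one record, since module records extend ring records. *)

record ('x, 'm, 'e) presheaf =
  base :: "'x topology"
  sec :: "'x set \<Rightarrow> ('m, 'e) ring_scheme"
  res :: "'x set \<Rightarrow> 'x set \<Rightarrow> 'm \<Rightarrow> 'm"  (* res F U V restricts from U to V *)

type_synonym ('x, 'a) ringed_space = "('x, 'a, unit) presheaf"
type_synonym ('x, 'a, 'm) module_sheaf = "('x, 'm, ('a, 'm, unit) module_ext) presheaf"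

definition is_presheaf :: "('x, 'm, 'e) presheaf \<Rightarrow> bool" where
  "is_presheaf F \<longleftrightarrow>
     (\<forall>U V. openin (base F) U \<and> openin (base F) V \<and> V \<subseteq> U \<longrightarrow>
        res F U V \<in> carrier (sec F U) \<rightarrow> carrier (sec F V)) \<and>
     (\<forall>U s. openin (base F) U \<and> s \<in> carrier (sec F U) \<longrightarrow> res F U U s = s) \<and>
     (\<forall>U V W s. openin (base F) U \<and> openin (base F) V \<and> openin (base F) W \<and> W \<subseteq> V \<and> V \<subseteq> U \<and>
        s \<in> carrier (sec F U) \<longrightarrow> res F V W (res F U V s) = res F U W s)"

definition is_sheaf :: "('x, 'm, 'e) presheaf \<Rightarrow> bool" where
  "is_sheaf F \<longleftrightarrow> is_presheaf F \<and>
     (\<forall>\<U> s. (\<forall>V\<in>\<U>. openin (base F) V \<and> s V \<in> carrier (sec F V)) \<and>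
        (\<forall>V\<in>\<U>. \<forall>W\<in>\<U>. res F V (V \<inter> W) (s V) = res F W (V \<inter> W) (s W)) \<longrightarrow>
        (\<exists>!t. t \<in> carrier (sec F (\<Union>\<U>)) \<and> (\<forall>V\<in>\<U>. res F (\<Union>\<U>) V t = s V)))"

definition is_ringed_space :: "('x, 'a) ringed_space \<Rightarrow> bool" where
  "is_ringed_space X \<longleftrightarrow> is_sheaf X \<and>
     (\<forall>U. openin (base X) U \<longrightarrow> cring (sec X U)) \<and>
     (\<forall>U V. openin (base X) U \<and> openin (base X) V \<and> V \<subseteq> U \<longrightarrow>
        res X U V \<in> ring_hom (sec X U) (sec X V))"

definition open_sub :: "('x, 'm, 'e) presheaf \<Rightarrow> 'x set \<Rightarrow> ('x, 'm, 'e) presheaf" where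
  "open_sub F U = F\<lparr>base := subtopology (base F) U\<rparr>"


section \<open>Stalks\<close>

definition germ :: "('x, 'm, 'e) presheaf \<Rightarrow> 'x \<Rightarrow> 'x set \<Rightarrow> 'm \<Rightarrow> ('x set \<times> 'm) set" where
  "germ F x U s = {(V, t). openin (base F) V \<and> x \<in> V \<and> t \<in> carrier (sec F V) \<and>
     (\<exists>W. openin (base F) W \<and> x \<in> W \<and> W \<subseteq> U \<inter> V \<and> res F U W s = res F V W t)}"

definition germs :: "('x, 'm, 'e) presheaf \<Rightarrow> 'x \<Rightarrow> ('x set \<times> 'm) set set" where
  "germs F x = {germ F x U s | U s. openin (base F) U \<and> x \<in> U \<and> s \<in> carrier (sec F U)}"

(* Operations on germs are computed on representatives over a common open neighbourhood. *)
definition germ_op ::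
  "('x, 'm, 'e) presheaf \<Rightarrow> ('x, 'n, 'f) presheaf \<Rightarrow> 'x \<Rightarrow> ('x set \<Rightarrow> 'm \<Rightarrow> 'n \<Rightarrow> 'n) \<Rightarrow>
   ('x set \<times> 'm) set \<Rightarrow> ('x set \<times> 'n) set \<Rightarrow> ('x set \<times> 'n) set" where
  "germ_op F G x f a b = (THE c. \<exists>U s t. openin (base F) U \<and> openin (base G) U \<and> x \<in> U \<and>
     s \<in> carrier (sec F U) \<and> t \<in> carrier (sec G U) \<and>
     a = germ F x U s \<and> b = germ G x U t \<and> c = germ G x U (f U s t))"

definition stalk_ring :: "('x, 'a) ringed_space \<Rightarrow> 'x \<Rightarrow> ('x set \<times> 'a) set ring" where
  "stalk_ring X x =
     \<lparr>carrier = germs X x,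
      monoid.mult = germ_op X X x (\<lambda>U. monoid.mult (sec X U)),
      monoid.one = germ X x (topspace (base X)) (monoid.one (sec X (topspace (base X)))),
      ring.zero = germ X x (topspace (base X)) (ring.zero (sec X (topspace (base X)))),
      ring.add = germ_op X X x (\<lambda>U. ring.add (sec X U))\<rparr>"

(* The fields  mult  and  one  of a module record carry no meaning. *)
definition stalk_module ::
  "('x, 'a) ringed_space \<Rightarrow> ('x, 'a, 'm) module_sheaf \<Rightarrow> 'x \<Rightarrow>
   (('x set \<times> 'a) set, ('x set \<times> 'm) set) module" where
  "stalk_module X M x =
     \<lparr>carrier = germs M x, monoid.mult = undefined, monoid.one = undefined,
      ring.zero = germ M x (topspace (base M)) (ring.zero (sec M (topspace (base M)))),
      ring.add = germ_op M M x (\<lambda>U. ring.add (sec M U)),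
      smult = germ_op X M x (\<lambda>U. smult (sec M U))\<rparr>"


section \<open>Locally ringed spaces\<close>

definition local_ring :: "('a, 'e) ring_scheme \<Rightarrow> bool" where
  "local_ring R \<longleftrightarrow> cring R \<and> (\<exists>!m. maximalideal m R)"

definition local_hom :: "('a, 'e) ring_scheme \<Rightarrow> ('b, 'f) ring_scheme \<Rightarrow> ('a \<Rightarrow> 'b) \<Rightarrow> bool" where
  "local_hom A B \<phi> \<longleftrightarrow> \<phi> \<in> ring_hom A B \<and>
     (\<forall>m n. maximalideal m A \<and> maximalideal n B \<longrightarrow> \<phi> ` m \<subseteq> n)"

definition locally_ringed_space :: "('x, 'a) ringed_space \<Rightarrow> bool" where
  "locally_ringed_space X \<longleftrightarrow> is_ringed_space X \<and>
     (\<forall>x \<in> topspace (base X). local_ring (stalk_ring X x))"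

(* A morphism X \<rightarrow> Y: the map of points, and for V open in Y the map from sections
   over V to sections over the preimage of V. *)
record ('x, 'a, 'y, 'b) morphism =
  pt_map :: "'x \<Rightarrow> 'y"
  sec_map :: "'y set \<Rightarrow> 'b \<Rightarrow> 'a"

definition preim :: "('x, 'a) ringed_space \<Rightarrow> ('x, 'a, 'y, 'b) morphism \<Rightarrow> 'y set \<Rightarrow> 'x set" where
  "preim X f V = {x \<in> topspace (base X). pt_map f x \<in> V}"

definition stalk_map ::
  "('x, 'a) ringed_space \<Rightarrow> ('y, 'b) ringed_space \<Rightarrow> ('x, 'a, 'y, 'b) morphism \<Rightarrow> 'x \<Rightarrow>
   ('y set \<times> 'b) set \<Rightarrow> ('x set \<times> 'a) set" where
  "stalk_map X Y f x a = (THE c. \<exists>V s. openin (base Y) V \<and> pt_map f x \<in> V \<and>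
     s \<in> carrier (sec Y V) \<and> a = germ Y (pt_map f x) V s \<and>
     c = germ X x (preim X f V) (sec_map f V s))"

definition lrs_morphism ::
  "('x, 'a) ringed_space \<Rightarrow> ('y, 'b) ringed_space \<Rightarrow> ('x, 'a, 'y, 'b) morphism \<Rightarrow> bool" where
  "lrs_morphism X Y f \<longleftrightarrow>
     continuous_map (base X) (base Y) (pt_map f) \<and>
     (\<forall>V. openin (base Y) V \<longrightarrow> sec_map f V \<in> ring_hom (sec Y V) (sec X (preim X f V))) \<and>
     (\<forall>V W s. openin (base Y) V \<and> openin (base Y) W \<and> W \<subseteq> V \<and> s \<in> carrier (sec Y V) \<longrightarrow>
        sec_map f W (res Y V W s) = res X (preim X f V) (preim X f W) (sec_map f V s)) \<and>
     (\<forall>x \<in> topspace (base X).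
        local_hom (stalk_ring Y (pt_map f x)) (stalk_ring X x) (stalk_map X Y f x))"

(* Equality of morphisms, ignoring values outside the carriers. *)
definition morphism_eq ::
  "('x, 'a) ringed_space \<Rightarrow> ('y, 'b) ringed_space \<Rightarrow>
   ('x, 'a, 'y, 'b) morphism \<Rightarrow> ('x, 'a, 'y, 'b) morphism \<Rightarrow> bool" where
  "morphism_eq X Y f g \<longleftrightarrow>
     (\<forall>x \<in> topspace (base X). pt_map f x = pt_map g x) \<and>
     (\<forall>V s. openin (base Y) V \<and> s \<in> carrier (sec Y V) \<longrightarrow> sec_map f V s = sec_map g V s)"

definition morphism_id :: "('x, 'a, 'x, 'a) morphism" where
  "morphism_id = \<lparr>pt_map = (\<lambda>x. x), sec_map = (\<lambda>V s. s)\<rparr>"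

(* The composite  g o f  of  f : X \<rightarrow> Y  and  g : Y \<rightarrow> Z;  Y  is needed
   to form preimages under g. *)
definition morphism_comp ::
  "('y, 'b) ringed_space \<Rightarrow> ('y, 'b, 'z, 'c) morphism \<Rightarrow> ('x, 'a, 'y, 'b) morphism \<Rightarrow>
   ('x, 'a, 'z, 'c) morphism" where
  "morphism_comp Y g f =
     \<lparr>pt_map = (\<lambda>x. pt_map g (pt_map f x)),
      sec_map = (\<lambda>W s. sec_map f (preim Y g W) (sec_map g W s))\<rparr>"

definition lrs_isomorphic :: "('x, 'a) ringed_space \<Rightarrow> ('y, 'b) ringed_space \<Rightarrow> bool" where
  "lrs_isomorphic X Y \<longleftrightarrow> (\<exists>f g. lrs_morphism X Y f \<and> lrs_morphism Y X g \<and>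
     morphism_eq X X (morphism_comp Y g f) morphism_id \<and>
     morphism_eq Y Y (morphism_comp X f g) morphism_id)"


section \<open>Affine schemes and schemes\<close>

definition frac :: "('a, 'e) ring_scheme \<Rightarrow> 'a set \<Rightarrow> 'a \<Rightarrow> 'a \<Rightarrow> ('a \<times> 'a) set" where
  "frac R S a s = {(b, t). b \<in> carrier R \<and> t \<in> S \<and>
     (\<exists>u\<in>S. u \<otimes>\<^bsub>R\<^esub> (t \<otimes>\<^bsub>R\<^esub> a) = u \<otimes>\<^bsub>R\<^esub> (s \<otimes>\<^bsub>R\<^esub> b))}"

definition frac_op ::
  "('a, 'e) ring_scheme \<Rightarrow> 'a set \<Rightarrow> ('a \<Rightarrow> 'a \<Rightarrow> 'a \<Rightarrow> 'a \<Rightarrow> 'a) \<Rightarrow>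
   ('a \<times> 'a) set \<Rightarrow> ('a \<times> 'a) set \<Rightarrow> ('a \<times> 'a) set" where
  "frac_op R S num x y = (THE z. \<exists>a s b t. a \<in> carrier R \<and> s \<in> S \<and> b \<in> carrier R \<and> t \<in> S \<and>
     x = frac R S a s \<and> y = frac R S b t \<and> z = frac R S (num a s b t) (s \<otimes>\<^bsub>R\<^esub> t))"

definition localization :: "('a, 'e) ring_scheme \<Rightarrow> 'a set \<Rightarrow> ('a \<times> 'a) set ring" where
  "localization R S =
     \<lparr>carrier = {frac R S a s | a s. a \<in> carrier R \<and> s \<in> S},
      monoid.mult = frac_op R S (\<lambda>a s b t. a \<otimes>\<^bsub>R\<^esub> b),
      monoid.one = frac R S \<one>\<^bsub>R\<^esub> \<one>\<^bsub>R\<^esub>,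
      ring.zero = frac R S \<zero>\<^bsub>R\<^esub> \<one>\<^bsub>R\<^esub>,
      ring.add = frac_op R S (\<lambda>a s b t. (t \<otimes>\<^bsub>R\<^esub> a) \<oplus>\<^bsub>R\<^esub> (s \<otimes>\<^bsub>R\<^esub> b))\<rparr>"

definition localization_at :: "('a, 'e) ring_scheme \<Rightarrow> 'a set \<Rightarrow> ('a \<times> 'a) set ring" where
  "localization_at R p = localization R (carrier R - p)"

definition zariski :: "('a, 'e) ring_scheme \<Rightarrow> 'a set topology" where
  "zariski R = topology_generated_by ((\<lambda>f. {p. primeideal p R \<and> f \<notin> p}) ` carrier R)"

(* Sections over U are the functions into the local rings that are locally fractions;
   they are normalised to  undefined  outside U. *)
definition Spec :: "('a, 'e) ring_scheme \<Rightarrow> ('a set, 'a set \<Rightarrow> ('a \<times> 'a) set) ringed_space" where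
  "Spec R =
     \<lparr>base = zariski R,
      sec = (\<lambda>U.
        \<lparr>carrier = {\<sigma> \<in> (\<Pi>\<^sub>E p\<in>U. carrier (localization_at R p)).
           \<forall>p\<in>U. \<exists>V a s. openin (zariski R) V \<and> p \<in> V \<and> V \<subseteq> U \<and> a \<in> carrier R \<and> s \<in> carrier R \<and>
             (\<forall>q\<in>V. s \<notin> q \<and> \<sigma> q = frac R (carrier R - q) a s)},
         monoid.mult = (\<lambda>\<sigma> \<tau>. \<lambda>p\<in>U. \<sigma> p \<otimes>\<^bsub>localization_at R p\<^esub> \<tau> p),
         monoid.one = (\<lambda>p\<in>U. \<one>\<^bsub>localization_at R p\<^esub>),
         ring.zero = (\<lambda>p\<in>U. \<zero>\<^bsub>localization_at R p\<^esub>),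
         ring.add = (\<lambda>\<sigma> \<tau>. \<lambda>p\<in>U. \<sigma> p \<oplus>\<^bsub>localization_at R p\<^esub> \<tau> p)\<rparr>),
      res = (\<lambda>U V \<sigma>. restrict \<sigma> V)\<rparr>"

(* If the open subspace U is isomorphic to Spec R, then R is isomorphic to the ring of sections
   over U.  So it is no restriction that R lives on the type of the sections of X. *)
definition scheme :: "('x, 'a) ringed_space \<Rightarrow> bool" where
  "scheme X \<longleftrightarrow> locally_ringed_space X \<and>
     (\<forall>x \<in> topspace (base X). \<exists>U (R :: 'a ring). openin (base X) U \<and> x \<in> U \<and> cring R \<and>
        lrs_isomorphic (open_sub X U) (Spec R))"

definition noetherian_scheme :: "('x, 'a) ringed_space \<Rightarrow> bool" where
  "noetherian_scheme X \<longleftrightarrow> scheme X \<and> compact_space (base X) \<and>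
     (\<forall>x \<in> topspace (base X). \<exists>U (R :: 'a ring). openin (base X) U \<and> x \<in> U \<and>
        cring R \<and> noetherian_ring R \<and> lrs_isomorphic (open_sub X U) (Spec R))"


section \<open>Fibre products\<close>

(* The universal property of the fibre product of  Y  and  Z  over  X  has to quantify over test
   schemes T of some fixed type.  With k the (infinite) cardinality of  nat + 'y + 'b + 'z + 'c,
   the true fibre product has at most 2^k points (it is covered by at most k spectra of tensor
   products of rings with at most k elements) and at most 2^k sections over each open set (it has
   a basis of at most k affine open sets, each with at most k sections).  So the fibre product
   has a copy on the following type, and the universal property among schemes on this type
   determines it up to unique isomorphism, as the fibre product in the category of all schemes. *)
type_synonym ('y, 'b, 'z, 'c) fp_type = "(nat + 'y + 'b + 'z + 'c) set"
type_synonym ('y, 'b, 'z, 'c) fp_space =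
  "(('y, 'b, 'z, 'c) fp_type, ('y, 'b, 'z, 'c) fp_type) ringed_space"

definition is_fibre_product ::
  "('x, 'a) ringed_space \<Rightarrow> ('y, 'b) ringed_space \<Rightarrow> ('z, 'c) ringed_space \<Rightarrow>
   ('y, 'b, 'x, 'a) morphism \<Rightarrow> ('z, 'c, 'x, 'a) morphism \<Rightarrow>
   ('y, 'b, 'z, 'c) fp_space \<Rightarrow>
   (('y, 'b, 'z, 'c) fp_type, ('y, 'b, 'z, 'c) fp_type, 'y, 'b) morphism \<Rightarrow>
   (('y, 'b, 'z, 'c) fp_type, ('y, 'b, 'z, 'c) fp_type, 'z, 'c) morphism \<Rightarrow> bool" where
  "is_fibre_product X Y Z f g P p q \<longleftrightarrow>
     scheme P \<and> lrs_morphism P Y p \<and> lrs_morphism P Z q \<and>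
     morphism_eq P X (morphism_comp Y f p) (morphism_comp Z g q) \<and>
     (\<forall>(T :: ('y, 'b, 'z, 'c) fp_space) a b.
        scheme T \<and> lrs_morphism T Y a \<and> lrs_morphism T Z b \<and>
        morphism_eq T X (morphism_comp Y f a) (morphism_comp Z g b) \<longrightarrow>
        (\<exists>h. lrs_morphism T P h \<and>
             morphism_eq T Y (morphism_comp P p h) a \<and> morphism_eq T Z (morphism_comp P q h) b \<and>
             (\<forall>h'. lrs_morphism T P h' \<and>
                morphism_eq T Y (morphism_comp P p h') a \<and> morphism_eq T Z (morphism_comp P q h') b
                \<longrightarrow> morphism_eq T P h' h)))"


section \<open>Base change of modules and flatness\<close>

definition module_linear ::
  "('a, 'e) ring_scheme \<Rightarrow> ('a, 'm, 'f) module_scheme \<Rightarrow> ('a, 'n, 'g) module_scheme \<Rightarrow>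
   ('m \<Rightarrow> 'n) \<Rightarrow> bool" where
  "module_linear R M N h \<longleftrightarrow> h \<in> carrier M \<rightarrow> carrier N \<and>
     (\<forall>x\<in>carrier M. \<forall>y\<in>carrier M. h (x \<oplus>\<^bsub>M\<^esub> y) = h x \<oplus>\<^bsub>N\<^esub> h y) \<and>
     (\<forall>a\<in>carrier R. \<forall>x\<in>carrier M. h (a \<odot>\<^bsub>M\<^esub> x) = a \<odot>\<^bsub>N\<^esub> h x)"

(* The tensor product of B and M over A, where B is an A-algebra via \<phi>: the free abelian group on
   B \<times> M modulo the subgroup generated by the bilinearity relations, with B acting on the left. *)
definition tensor_free ::
  "('b, 'f) ring_scheme \<Rightarrow> ('a, 'm, 'g) module_scheme \<Rightarrow> ('b \<times> 'm \<Rightarrow>\<^sub>0 int) monoid" where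
  "tensor_free B M = free_Abelian_group (carrier B \<times> carrier M)"

definition tensor_rels ::
  "('a, 'e) ring_scheme \<Rightarrow> ('b, 'f) ring_scheme \<Rightarrow> ('a \<Rightarrow> 'b) \<Rightarrow> ('a, 'm, 'g) module_scheme \<Rightarrow>
   ('b \<times> 'm \<Rightarrow>\<^sub>0 int) set" where
  "tensor_rels A B \<phi> M = generate (tensor_free B M)
     ({frag_of (b \<oplus>\<^bsub>B\<^esub> b', m) - frag_of (b, m) - frag_of (b', m) | b b' m.
         b \<in> carrier B \<and> b' \<in> carrier B \<and> m \<in> carrier M} \<union>
      {frag_of (b, m \<oplus>\<^bsub>M\<^esub> m') - frag_of (b, m) - frag_of (b, m') | b m m'.
         b \<in> carrier B \<and> m \<in> carrier M \<and> m' \<in> carrier M} \<union>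
      {frag_of (b \<otimes>\<^bsub>B\<^esub> \<phi> a, m) - frag_of (b, a \<odot>\<^bsub>M\<^esub> m) | b a m.
         b \<in> carrier B \<and> a \<in> carrier A \<and> m \<in> carrier M})"

definition tensor_class ::
  "('a, 'e) ring_scheme \<Rightarrow> ('b, 'f) ring_scheme \<Rightarrow> ('a \<Rightarrow> 'b) \<Rightarrow> ('a, 'm, 'g) module_scheme \<Rightarrow>
   ('b \<times> 'm \<Rightarrow>\<^sub>0 int) \<Rightarrow> ('b \<times> 'm \<Rightarrow>\<^sub>0 int) set" where
  "tensor_class A B \<phi> M c = tensor_rels A B \<phi> M #>\<^bsub>tensor_free B M\<^esub> c"

(* In  smult  the union is over representatives, all of which give the same coset. *)
definition base_change ::
  "('a, 'e) ring_scheme \<Rightarrow> ('b, 'f) ring_scheme \<Rightarrow> ('a \<Rightarrow> 'b) \<Rightarrow> ('a, 'm, 'g) module_scheme \<Rightarrow>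
   ('b, ('b \<times> 'm \<Rightarrow>\<^sub>0 int) set) module" where
  "base_change A B \<phi> M =
     \<lparr>carrier = carrier (tensor_free B M Mod tensor_rels A B \<phi> M),
      monoid.mult = undefined, monoid.one = undefined,
      ring.zero = monoid.one (tensor_free B M Mod tensor_rels A B \<phi> M),
      ring.add = monoid.mult (tensor_free B M Mod tensor_rels A B \<phi> M),
      smult = (\<lambda>b t. \<Union>c\<in>t. tensor_class A B \<phi> M (frag_extend (\<lambda>(b', m). frag_of (b \<otimes>\<^bsub>B\<^esub> b', m)) c))\<rparr>"

(* The map  id \<otimes> h  from  B \<otimes> M  to  B \<otimes> N. *)
definition base_change_map ::
  "('a, 'e) ring_scheme \<Rightarrow> ('b, 'f) ring_scheme \<Rightarrow> ('a \<Rightarrow> 'b) \<Rightarrow> ('a, 'n, 'g) module_scheme \<Rightarrow>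
   ('m \<Rightarrow> 'n) \<Rightarrow> ('b \<times> 'm \<Rightarrow>\<^sub>0 int) set \<Rightarrow> ('b \<times> 'n \<Rightarrow>\<^sub>0 int) set" where
  "base_change_map A B \<phi> N h t =
     (\<Union>c\<in>t. tensor_class A B \<phi> N (frag_extend (\<lambda>(b, m). frag_of (b, h m)) c))"

(* The modules M, N range over a type that contains a copy of every finitely generated A-module
   (a quotient of some A^n).  Since tensor products commute with directed unions, and an injective
   map of modules is a directed union of injective maps of finitely generated ones, this is the
   same as letting M and N range over all A-modules. *)
definition flat_hom :: "('a, 'e) ring_scheme \<Rightarrow> ('b, 'f) ring_scheme \<Rightarrow> ('a \<Rightarrow> 'b) \<Rightarrow> bool" where
  "flat_hom A B \<phi> \<longleftrightarrow>
     (\<forall>(M :: ('a, (nat \<Rightarrow> 'a) set) module) (N :: ('a, (nat \<Rightarrow> 'a) set) module) h.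
        module A M \<and> module A N \<and> module_linear A M N h \<and> inj_on h (carrier M) \<longrightarrow>
        inj_on (base_change_map A B \<phi> N h) (carrier (base_change A B \<phi> M)))"

definition flat_morphism ::
  "('x, 'a) ringed_space \<Rightarrow> ('y, 'b) ringed_space \<Rightarrow> ('x, 'a, 'y, 'b) morphism \<Rightarrow> bool" where
  "flat_morphism X Y f \<longleftrightarrow> lrs_morphism X Y f \<and>
     (\<forall>x \<in> topspace (base X).
        flat_hom (stalk_ring Y (pt_map f x)) (stalk_ring X x) (stalk_map X Y f x))"

definition faithfully_flat_morphism ::
  "('x, 'a) ringed_space \<Rightarrow> ('y, 'b) ringed_space \<Rightarrow> ('x, 'a, 'y, 'b) morphism \<Rightarrow> bool" where
  "faithfully_flat_morphism X Y f \<longleftrightarrow> flat_morphism X Y f \<and>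
     pt_map f ` topspace (base X) = topspace (base Y)"


section \<open>Pullback of module sheaves\<close>

definition pullback_fibre ::
  "('x, 'a) ringed_space \<Rightarrow> ('y, 'b) ringed_space \<Rightarrow> ('x, 'a, 'y, 'b) morphism \<Rightarrow>
   ('y, 'b, 'm) module_sheaf \<Rightarrow> 'x \<Rightarrow>
   (('x set \<times> 'a) set, (('x set \<times> 'a) set \<times> ('y set \<times> 'm) set \<Rightarrow>\<^sub>0 int) set) module" where
  "pullback_fibre X Y f M x =
     base_change (stalk_ring Y (pt_map f x)) (stalk_ring X x) (stalk_map X Y f x)
       (stalk_module Y M (pt_map f x))"

(* The O_X-module  f^*M,  the sheafification of the presheaf sending W to the colimit, over the
   open V containing f(W), of  O_X(W) \<otimes> M(V)  over  O_Y(V).  The stalk of this presheaf at x is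
   pullback_fibre, and its sheafification consists of the functions into the stalks that
   locally come from an element of the presheaf; c is such an element, written as a formal sum of
   pairs, and \<sigma> w is its image in the stalk at w. *)
definition pullback ::
  "('x, 'a) ringed_space \<Rightarrow> ('y, 'b) ringed_space \<Rightarrow> ('x, 'a, 'y, 'b) morphism \<Rightarrow>
   ('y, 'b, 'm) module_sheaf \<Rightarrow>
   ('x, 'a, 'x \<Rightarrow> (('x set \<times> 'a) set \<times> ('y set \<times> 'm) set \<Rightarrow>\<^sub>0 int) set) module_sheaf" where
  "pullback X Y f M =
     \<lparr>base = base X,
      sec = (\<lambda>U.
        \<lparr>carrier = {\<sigma> \<in> (\<Pi>\<^sub>E x\<in>U. carrier (pullback_fibre X Y f M x)).
           \<forall>x\<in>U. \<exists>W V c. openin (base X) W \<and> x \<in> W \<and> W \<subseteq> U \<and>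
             openin (base Y) V \<and> W \<subseteq> preim X f V \<and>
             c \<in> carrier (tensor_free (sec X W) (sec M V)) \<and>
             (\<forall>w\<in>W. \<sigma> w =
                tensor_class (stalk_ring Y (pt_map f w)) (stalk_ring X w) (stalk_map X Y f w)
                  (stalk_module Y M (pt_map f w))
                  (frag_extend (\<lambda>(a, m). frag_of (germ X w W a, germ M (pt_map f w) V m)) c))},
         monoid.mult = undefined, monoid.one = undefined,
         ring.zero = (\<lambda>x\<in>U. \<zero>\<^bsub>pullback_fibre X Y f M x\<^esub>),
         ring.add = (\<lambda>\<sigma> \<tau>. \<lambda>x\<in>U. \<sigma> x \<oplus>\<^bsub>pullback_fibre X Y f M x\<^esub> \<tau> x),
         smult = (\<lambda>a \<sigma>. \<lambda>x\<in>U. germ X x U a \<odot>\<^bsub>pullback_fibre X Y f M x\<^esub> \<sigma> x)\<rparr>),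
      res = (\<lambda>U V \<sigma>. restrict \<sigma> V)\<rparr>"

definition module_sheaf_isomorphic ::
  "('x, 'a) ringed_space \<Rightarrow> ('x, 'a, 'm) module_sheaf \<Rightarrow> ('x, 'a, 'n) module_sheaf \<Rightarrow> bool" where
  "module_sheaf_isomorphic X M N \<longleftrightarrow>
     (\<exists>h. (\<forall>U. openin (base X) U \<longrightarrow> module_linear (sec X U) (sec M U) (sec N U) (h U) \<and>
                bij_betw (h U) (carrier (sec M U)) (carrier (sec N U))) \<and>
          (\<forall>U V s. openin (base X) U \<and> openin (base X) V \<and> V \<subseteq> U \<and> s \<in> carrier (sec M U) \<longrightarrow>
             h V (res M U V s) = res N U V (h U s)))"


section \<open>Ideal sheaves\<close>

(* Extensionality makes equality of ideal sheaves the equality of functions. *)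
definition ideal_sheaf :: "('x, 'a) ringed_space \<Rightarrow> ('x set \<Rightarrow> 'a set) \<Rightarrow> bool" where
  "ideal_sheaf X I \<longleftrightarrow> I \<in> extensional {U. openin (base X) U} \<and>
     (\<forall>U. openin (base X) U \<longrightarrow> ideal (I U) (sec X U)) \<and>
     (\<forall>U V. openin (base X) U \<and> openin (base X) V \<and> V \<subseteq> U \<longrightarrow> res X U V ` I U \<subseteq> I V) \<and>
     (\<forall>\<U> s. (\<forall>V\<in>\<U>. openin (base X) V) \<and> s \<in> carrier (sec X (\<Union>\<U>)) \<and>
        (\<forall>V\<in>\<U>. res X (\<Union>\<U>) V s \<in> I V) \<longrightarrow> s \<in> I (\<Union>\<U>))"

(* The ideal sheaf generated by a family of sections, G W being a set of sections over W. *)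
definition generated_ideal ::
  "('x, 'a) ringed_space \<Rightarrow> ('x set \<Rightarrow> 'a set) \<Rightarrow> 'x set \<Rightarrow> 'a set" where
  "generated_ideal X G = (\<lambda>U \<in> {U. openin (base X) U}.
     {s \<in> carrier (sec X U). \<forall>x\<in>U. \<exists>V. openin (base X) V \<and> x \<in> V \<and> V \<subseteq> U \<and>
        res X U V s \<in> Idl\<^bsub>sec X V\<^esub> (\<Union>W \<in> {W. openin (base X) W \<and> V \<subseteq> W}. res X W V ` G W)})"

definition finite_type_ideal :: "('x, 'a) ringed_space \<Rightarrow> ('x set \<Rightarrow> 'a set) \<Rightarrow> bool" where
  "finite_type_ideal X I \<longleftrightarrow> (\<forall>x \<in> topspace (base X). \<exists>U S. openin (base X) U \<and> x \<in> U \<and>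
     finite S \<and> S \<subseteq> I U \<and>
     restrict I {V. openin (base (open_sub X U)) V} =
       generated_ideal (open_sub X U) (\<lambda>W. if W = U then S else {}))"

definition ideal_sheaf_square ::
  "('x, 'a) ringed_space \<Rightarrow> ('x set \<Rightarrow> 'a set) \<Rightarrow> 'x set \<Rightarrow> 'a set" where
  "ideal_sheaf_square X I = generated_ideal X (\<lambda>U. I U \<cdot>\<^bsub>sec X U\<^esub> I U)"

definition idempotent_ideal :: "('x, 'a) ringed_space \<Rightarrow> ('x set \<Rightarrow> 'a set) \<Rightarrow> bool" where
  "idempotent_ideal X I \<longleftrightarrow> ideal_sheaf X I \<and> finite_type_ideal X I \<and> ideal_sheaf_square X I = I"

(* For  f : X \<rightarrow> Y  and an ideal sheaf I on Y, the ideal sheaf  I O_X. *)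
definition extended_ideal ::
  "('x, 'a) ringed_space \<Rightarrow> ('y, 'b) ringed_space \<Rightarrow> ('x, 'a, 'y, 'b) morphism \<Rightarrow>
   ('y set \<Rightarrow> 'b set) \<Rightarrow> 'x set \<Rightarrow> 'a set" where
  "extended_ideal X Y f I = generated_ideal X
     (\<lambda>W. \<Union>V \<in> {V. openin (base Y) V \<and> preim X f V = W}. sec_map f V ` I V)"

definition ideal_module ::
  "('x, 'a) ringed_space \<Rightarrow> ('x set \<Rightarrow> 'a set) \<Rightarrow> ('x, 'a, 'a) module_sheaf" where
  "ideal_module X I =
     \<lparr>base = base X,
      sec = (\<lambda>U. \<lparr>carrier = I U, monoid.mult = undefined, monoid.one = undefined, ring.zero = \<zero>\<^bsub>sec X U\<^esub>,
                  ring.add = ring.add (sec X U), smult = monoid.mult (sec X U)\<rparr>),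
      res = res X\<rparr>"

end

theory Submission
  imports Defs "HOL-Algebra.Weak_Morphisms"
begin

text \<open>An idempotent ideal is the ideal of sections supported on an open-and-closed set: by
  Nakayama's lemma its stalks are zero or the whole local ring. Let \<open>J\<close> correspond to
  \<open>W \<subseteq> Z\<close>. The stalk of \<open>\<pi>\<^sub>i\<^sup>*J\<close> at a point \<open>y\<close> of the fibre product is nonzero if and only if
  \<open>\<pi>\<^sub>i y \<in> W\<close>, so the isomorphism forces \<open>\<pi>\<^sub>1\<close> and \<open>\<pi>\<^sub>2\<close> to have the same preimage of \<open>W\<close>.
  Two points of \<open>Z\<close> over the same point of \<open>X\<close> are the projections of a point of the fibre product
  (map the spectrum of a compositum of their residue fields into it), hence
  \<open>W\<close> is the preimage of \<open>V = g(W)\<close>. Generizations lift along the flat map \<open>g\<close>, so \<open>V\<close> and its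
  complement \<open>g(Z - W)\<close> are both stable under generization, and in a noetherian scheme this makes \<open>V\<close>
  open and closed. The ideal of sections supported on \<open>V\<close> is the one sought; it is unique because
  \<open>g\<close> is surjective.\<close>

section \<open>Stalks\<close>

text \<open>Three choices shape the proof. Points are compared through units: in an affine chart a
  point is determined by the ring elements whose germs there are units, and local homomorphisms
  preserve and reflect units, so statements about primes, generizations and image points become
  statements about unit germs. Tensor products are sets of cosets in a free abelian group: an
  element is shown to be zero by exhibiting it as a relation, and nonzero by a balanced functional
  on pairs. The universal property of the fibre product speaks of test schemes whose points and
  sections lie in \<open>fp_type\<close>; so the compositum of residue fields has to be copied to
  that type. This is possible because it is built as a quotient of the monoid ring of pairs of stalk
  elements, hence is an image of finite formal sums, and the stalks embed into
  \<open>fp_type\<close>. That the quotient is not zero is seen from a linear form on one of the two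
  residue fields over the residue field of the base.\<close>

lemma res_closed:
  assumes "is_presheaf F" "openin (base F) U" "openin (base F) V" "V \<subseteq> U" "s \<in> carrier (sec F U)"
  shows "res F U V s \<in> carrier (sec F V)"
proof -
  have "res F U V \<in> carrier (sec F U) \<rightarrow> carrier (sec F V)"
    using assms unfolding is_presheaf_def by simp
  then show ?thesis using assms by (rule_tac funcset_mem)
qed

lemma res_id:
  assumes "is_presheaf F" "openin (base F) U" "s \<in> carrier (sec F U)"
  shows "res F U U s = s"
  using assms unfolding is_presheaf_def by simp

lemma res_res:
  assumes "is_presheaf F" "openin (base F) U" "openin (base F) V" "openin (base F) W"
    "W \<subseteq> V" "V \<subseteq> U" "s \<in> carrier (sec F U)"
  shows "res F V W (res F U V s) = res F U W s"
  using assms(1)[unfolded is_presheaf_def, THEN conjunct2, THEN conjunct2] assms(2-) by simp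

text \<open>A germ is encoded as the set of all its representatives. Agreement near \<open>x\<close>
  is transitive because two neighbourhoods of agreement can be intersected, so one shared
  representative makes the two sets equal.\<close>

lemma germ_eq_iff:
  assumes F: "is_presheaf F" and U: "openin (base F) U" "x \<in> U" "s \<in> carrier (sec F U)"
    and V: "openin (base F) V" "x \<in> V" "t \<in> carrier (sec F V)"
  shows "germ F x U s = germ F x V t \<longleftrightarrow>
    (\<exists>W. openin (base F) W \<and> x \<in> W \<and> W \<subseteq> U \<inter> V \<and> res F U W s = res F V W t)" (is "_ \<longleftrightarrow> ?R")
proof
  assume eq: "germ F x U s = germ F x V t"
  have "(V, t) \<in> germ F x V t"
    unfolding germ_def using V by auto
  then have "(V, t) \<in> germ F x U s" using eq by simp
  then show ?R by (auto simp: germ_def)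
next
  have sub: "germ F x U' s' \<subseteq> germ F x V' t'"
    if U': "openin (base F) U'" "s' \<in> carrier (sec F U')"
    and V': "openin (base F) V'" "t' \<in> carrier (sec F V')"
    and W: "openin (base F) W" "x \<in> W" "W \<subseteq> U' \<inter> V'" "res F U' W s' = res F V' W t'"
    for U' V' s' t' W
  proof
    fix p assume "p \<in> germ F x U' s'"
    then obtain N n W' where p: "p = (N, n)" and N: "openin (base F) N" "x \<in> N" "n \<in> carrier (sec F N)"
      and W': "openin (base F) W'" "x \<in> W'" "W' \<subseteq> U' \<inter> N" "res F U' W' s' = res F N W' n"
      unfolding germ_def by auto
    have o: "openin (base F) (W \<inter> W')" using W W' by auto
    have "res F V' (W \<inter> W') t' = res F W (W \<inter> W') (res F V' W t')"
      using res_res[OF F V'(1) W(1) o _ _ V'(2)] W by auto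
    also have "\<dots> = res F W (W \<inter> W') (res F U' W s')" using W by simp
    also have "\<dots> = res F U' (W \<inter> W') s'"
      using res_res[OF F U'(1) W(1) o _ _ U'(2)] W by auto
    also have "\<dots> = res F W' (W \<inter> W') (res F U' W' s')"
      using res_res[OF F U'(1) W'(1) o _ _ U'(2)] W' by auto
    also have "\<dots> = res F W' (W \<inter> W') (res F N W' n)" using W' by simp
    also have "\<dots> = res F N (W \<inter> W') n"
      using res_res[OF F N(1) W'(1) o _ _ N(3)] W' by auto
    finally have "\<exists>M. openin (base F) M \<and> x \<in> M \<and> M \<subseteq> V' \<inter> N \<and> res F V' M t' = res F N M n"
      using o W(2,3) W'(2,3) by (intro exI[of _ "W \<inter> W'"]) auto
    then show "p \<in> germ F x V' t'"
      unfolding germ_def p using N by simp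
  qed
  assume ?R
  then obtain W where W: "openin (base F) W" "x \<in> W" "W \<subseteq> U \<inter> V" "res F U W s = res F V W t" by auto
  have W': "W \<subseteq> V \<inter> U" "res F V W t = res F U W s" using W by auto
  show "germ F x U s = germ F x V t"
    using sub[OF U(1,3) V(1,3) W] sub[OF V(1,3) U(1,3) W(1,2) W'] by (rule equalityI)
qed

lemma germ_res:
  assumes F: "is_presheaf F" and U: "openin (base F) U" "s \<in> carrier (sec F U)"
    and W: "openin (base F) W" "x \<in> W" "W \<subseteq> U"
  shows "germ F x W (res F U W s) = germ F x U s"
proof -
  have "res F W W (res F U W s) = res F U W s" using res_id[OF F W(1) res_closed[OF F U(1) W(1,3) U(2)]] .
  then have "\<exists>N. openin (base F) N \<and> x \<in> N \<and> N \<subseteq> W \<inter> U \<and> res F W N (res F U W s) = res F U N s"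
    using W by (intro exI[of _ W]) simp
  then show ?thesis
    by (rule germ_eq_iff[OF F W(1,2) res_closed[OF F U(1) W(1,3) U(2)] U(1) subsetD[OF W(3,2)] U(2), THEN iffD2])
qed

lemma germ_in_germs:
  assumes "openin (base F) U" "x \<in> U" "s \<in> carrier (sec F U)"
  shows "germ F x U s \<in> germs F x"
  using assms unfolding germs_def by blast

lemma germsE:
  assumes "a \<in> germs F x"
  obtains U s where "openin (base F) U" "x \<in> U" "s \<in> carrier (sec F U)" "a = germ F x U s"
proof -
  have "\<exists>U s. a = germ F x U s \<and> openin (base F) U \<and> x \<in> U \<and> s \<in> carrier (sec F U)"
    using assms unfolding germs_def mem_Collect_eq .
  then show ?thesis using that by metis
qed

lemma germsE_within:
  assumes F: "is_presheaf F" and a: "a \<in> germs F x" and N: "openin (base F) N" "x \<in> N"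
  obtains U s where "openin (base F) U" "x \<in> U" "U \<subseteq> N" "s \<in> carrier (sec F U)" "a = germ F x U s"
proof -
  obtain V s where V: "openin (base F) V" "x \<in> V" "s \<in> carrier (sec F V)" "a = germ F x V s"
    using a by (rule germsE)
  have o: "openin (base F) (V \<inter> N)" using V N by auto
  show ?thesis
  proof (rule that[OF o])
    show x: "x \<in> V \<inter> N" using V N by simp
    show "res F V (V \<inter> N) s \<in> carrier (sec F (V \<inter> N))" by (rule res_closed[OF F V(1) o _ V(3)]) simp
    show "a = germ F x (V \<inter> N) (res F V (V \<inter> N) s)"
      unfolding V(4) by (rule germ_res[OF F V(1,3) o x, symmetric]) simp
  qed simp
qed

text \<open>\<open>germ_op\<close> picks its value by description among all simultaneous
  representatives, so the content is independence of the representatives: it follows from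
  \<open>r\<close> after restriction to a common \<open>W\<close>. Two presheaves occur so that
  scalar multiplication on a stalk is covered as well.\<close>

lemma germ_op_germ:
  assumes F: "is_presheaf F" and G: "is_presheaf G" and b: "base F = base G"
    and c: "\<And>U s t. openin (base F) U \<Longrightarrow> s \<in> carrier (sec F U) \<Longrightarrow> t \<in> carrier (sec G U) \<Longrightarrow>
      f U s t \<in> carrier (sec G U)"
    and r: "\<And>U V s t. openin (base F) U \<Longrightarrow> openin (base F) V \<Longrightarrow> V \<subseteq> U \<Longrightarrow> s \<in> carrier (sec F U) \<Longrightarrow>
      t \<in> carrier (sec G U) \<Longrightarrow> res G U V (f U s t) = f V (res F U V s) (res G U V t)"
    and U: "openin (base F) U" "x \<in> U" "s \<in> carrier (sec F U)" "t \<in> carrier (sec G U)"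
  shows "germ_op F G x f (germ F x U s) (germ G x U t) = germ G x U (f U s t)"
  unfolding germ_op_def
proof (rule the_equality)
  show "\<exists>U' s' t'. openin (base F) U' \<and> openin (base G) U' \<and> x \<in> U' \<and> s' \<in> carrier (sec F U') \<and>
    t' \<in> carrier (sec G U') \<and> germ F x U s = germ F x U' s' \<and> germ G x U t = germ G x U' t' \<and>
    germ G x U (f U s t) = germ G x U' (f U' s' t')"
    using U b by auto
next
  fix c' assume "\<exists>U' s' t'. openin (base F) U' \<and> openin (base G) U' \<and> x \<in> U' \<and> s' \<in> carrier (sec F U') \<and>
    t' \<in> carrier (sec G U') \<and> germ F x U s = germ F x U' s' \<and> germ G x U t = germ G x U' t' \<and>
    c' = germ G x U' (f U' s' t')"
  then obtain V s' t' where V: "openin (base F) V" "x \<in> V" "s' \<in> carrier (sec F V)"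
    "t' \<in> carrier (sec G V)" and e: "germ F x U s = germ F x V s'" "germ G x U t = germ G x V t'"
    and c': "c' = germ G x V (f V s' t')" by auto
  have GU: "openin (base G) U" "openin (base G) V" using U V b by auto
  obtain W1 where W1: "openin (base F) W1" "x \<in> W1" "W1 \<subseteq> U \<inter> V" "res F U W1 s = res F V W1 s'"
    using e(1) germ_eq_iff[OF F U(1-3) V(1-3)] by auto
  obtain W2 where W2: "openin (base F) W2" "x \<in> W2" "W2 \<subseteq> U \<inter> V" "res G U W2 t = res G V W2 t'"
    using e(2) germ_eq_iff[OF G GU(1) U(2,4) GU(2) V(2,4)] b by auto
  define W where "W = W1 \<inter> W2"
  have W: "openin (base F) W" "openin (base G) W" "x \<in> W" "W \<subseteq> U" "W \<subseteq> V" "W \<subseteq> W1" "W \<subseteq> W2"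
    using W1 W2 b unfolding W_def by auto
  have "res F U W s = res F V W s'"
    using res_res[OF F U(1) W1(1) W(1,6) _ U(3)] res_res[OF F V(1) W1(1) W(1,6) _ V(3)] W1 by auto
  moreover have "res G U W t = res G V W t'"
    using res_res[OF G GU(1) _ W(2,7) _ U(4)] res_res[OF G GU(2) _ W(2,7) _ V(4)] W2 b by auto
  ultimately have "res G U W (f U s t) = res G V W (f V s' t')"
    using r[OF U(1) W(1,4) U(3,4)] r[OF V(1) W(1,5) V(3,4)] by simp
  then show "c' = germ G x U (f U s t)"
    unfolding c' using germ_eq_iff[OF G GU(2) V(2) c[OF V(1,3,4)] GU(1) U(2) c[OF U(1,3,4)]] W
    by (metis le_inf_iff)
qed

section \<open>Ringed spaces and their stalk rings\<close>

locale ringed =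
  fixes X :: "('x, 'a) ringed_space"
  assumes ringed: "is_ringed_space X"
begin

abbreviation "op \<equiv> openin (base X)"

lemma sheaf: "is_sheaf X"
  using ringed unfolding is_ringed_space_def by blast

lemma presheaf: "is_presheaf X"
  using sheaf unfolding is_sheaf_def by blast

lemma sec_cring: "op U \<Longrightarrow> cring (sec X U)"
  using ringed unfolding is_ringed_space_def by auto

lemma sec_ring: "op U \<Longrightarrow> ring (sec X U)"
  using sec_cring cring.axioms(1) by blast

lemma res_hom: "op U \<Longrightarrow> op V \<Longrightarrow> V \<subseteq> U \<Longrightarrow> res X U V \<in> ring_hom (sec X U) (sec X V)"
  using ringed unfolding is_ringed_space_def by auto

lemmas rclosed = res_closed[OF presheaf]
lemmas rid = res_id[OF presheaf]
lemmas rres = res_res[OF presheaf]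
lemmas germ_eq = germ_eq_iff[OF presheaf]
lemmas germ_rs = germ_res[OF presheaf]

lemma res_ring_hom: "op U \<Longrightarrow> op V \<Longrightarrow> V \<subseteq> U \<Longrightarrow> ring_hom_ring (sec X U) (sec X V) (res X U V)"
  by (rule ring_hom_ringI2) (simp_all add: sec_ring res_hom)

lemma res_add: "op U \<Longrightarrow> op V \<Longrightarrow> V \<subseteq> U \<Longrightarrow> s \<in> carrier (sec X U) \<Longrightarrow> t \<in> carrier (sec X U) \<Longrightarrow>
  res X U V (s \<oplus>\<^bsub>sec X U\<^esub> t) = res X U V s \<oplus>\<^bsub>sec X V\<^esub> res X U V t"
  using ring_hom_add[OF res_hom] by simp

lemma res_mult: "op U \<Longrightarrow> op V \<Longrightarrow> V \<subseteq> U \<Longrightarrow> s \<in> carrier (sec X U) \<Longrightarrow> t \<in> carrier (sec X U) \<Longrightarrow>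
  res X U V (s \<otimes>\<^bsub>sec X U\<^esub> t) = res X U V s \<otimes>\<^bsub>sec X V\<^esub> res X U V t"
  using ring_hom_mult[OF res_hom] by simp

lemma res_one: "op U \<Longrightarrow> op V \<Longrightarrow> V \<subseteq> U \<Longrightarrow> res X U V \<one>\<^bsub>sec X U\<^esub> = \<one>\<^bsub>sec X V\<^esub>"
  using ring_hom_one[OF res_hom] by simp

lemma res_zero: "op U \<Longrightarrow> op V \<Longrightarrow> V \<subseteq> U \<Longrightarrow> res X U V \<zero>\<^bsub>sec X U\<^esub> = \<zero>\<^bsub>sec X V\<^esub>"
  using ring_hom_zero[OF res_hom sec_ring sec_ring] by simp

lemma one_closed [simp]: "op U \<Longrightarrow> \<one>\<^bsub>sec X U\<^esub> \<in> carrier (sec X U)"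
  using sec_ring by (simp add: ring.ring_simprules)

lemma zero_closed [simp]: "op U \<Longrightarrow> \<zero>\<^bsub>sec X U\<^esub> \<in> carrier (sec X U)"
  using sec_ring by (simp add: ring.ring_simprules)

lemma mult_closed [simp]: "op U \<Longrightarrow> s \<in> carrier (sec X U) \<Longrightarrow> t \<in> carrier (sec X U) \<Longrightarrow>
    s \<otimes>\<^bsub>sec X U\<^esub> t \<in> carrier (sec X U)"
  using sec_ring by (simp add: ring.ring_simprules)

lemma add_closed [simp]: "op U \<Longrightarrow> s \<in> carrier (sec X U) \<Longrightarrow> t \<in> carrier (sec X U) \<Longrightarrow>
    s \<oplus>\<^bsub>sec X U\<^esub> t \<in> carrier (sec X U)"
  using sec_ring by (simp add: ring.ring_simprules)

lemma germs_iff: "a \<in> carrier (stalk_ring X x) \<longleftrightarrow> (\<exists>U s. op U \<and> x \<in> U \<and> s \<in> carrier (sec X U) \<and> a = germ X x U s)"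
  unfolding stalk_ring_def germs_def by auto

lemma germ_closed: "op U \<Longrightarrow> x \<in> U \<Longrightarrow> s \<in> carrier (sec X U) \<Longrightarrow> germ X x U s \<in> carrier (stalk_ring X x)"
  using germs_iff by blast

lemma germ_mult: "op U \<Longrightarrow> x \<in> U \<Longrightarrow> s \<in> carrier (sec X U) \<Longrightarrow> t \<in> carrier (sec X U) \<Longrightarrow>
  germ X x U s \<otimes>\<^bsub>stalk_ring X x\<^esub> germ X x U t = germ X x U (s \<otimes>\<^bsub>sec X U\<^esub> t)"
  unfolding stalk_ring_def by (simp, rule germ_op_germ) (auto simp: presheaf res_mult)

lemma germ_add: "op U \<Longrightarrow> x \<in> U \<Longrightarrow> s \<in> carrier (sec X U) \<Longrightarrow> t \<in> carrier (sec X U) \<Longrightarrow>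
  germ X x U s \<oplus>\<^bsub>stalk_ring X x\<^esub> germ X x U t = germ X x U (s \<oplus>\<^bsub>sec X U\<^esub> t)"
  unfolding stalk_ring_def by (simp, rule germ_op_germ) (auto simp: presheaf res_add)

lemma germ_one: "op U \<Longrightarrow> x \<in> U \<Longrightarrow> germ X x U \<one>\<^bsub>sec X U\<^esub> = \<one>\<^bsub>stalk_ring X x\<^esub>"
  using germ_rs[of "topspace (base X)" "\<one>\<^bsub>sec X (topspace (base X))\<^esub>" U x] openin_subset[of "base X" U]
  unfolding stalk_ring_def by (simp add: res_one)

lemma germ_zero: "op U \<Longrightarrow> x \<in> U \<Longrightarrow> germ X x U \<zero>\<^bsub>sec X U\<^esub> = \<zero>\<^bsub>stalk_ring X x\<^esub>"
  using germ_rs[of "topspace (base X)" "\<zero>\<^bsub>sec X (topspace (base X))\<^esub>" U x] openin_subset[of "base X" U]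
  unfolding stalk_ring_def by (simp add: res_zero)

lemma stalkE:
  assumes "a \<in> carrier (stalk_ring X x)" "op N" "x \<in> N"
  obtains U s where "op U" "x \<in> U" "U \<subseteq> N" "s \<in> carrier (sec X U)" "a = germ X x U s"
  using germsE_within[OF presheaf _ assms(2,3), of a] assms(1) unfolding stalk_ring_def by auto

lemma stalkE2:
  assumes "a \<in> carrier (stalk_ring X x)" "b \<in> carrier (stalk_ring X x)" "op N" "x \<in> N"
  obtains U s t where "op U" "x \<in> U" "U \<subseteq> N" "s \<in> carrier (sec X U)" "t \<in> carrier (sec X U)"
    "a = germ X x U s" "b = germ X x U t"
proof -
  obtain V t where V: "op V" "x \<in> V" "V \<subseteq> N" "t \<in> carrier (sec X V)" "b = germ X x V t"
    using stalkE[OF assms(2-4)] .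
  obtain U s where U: "op U" "x \<in> U" "U \<subseteq> V" "s \<in> carrier (sec X U)" "a = germ X x U s"
    using stalkE[OF assms(1) V(1,2)] .
  show ?thesis
    by (rule that[OF U(1,2) _ U(4) rclosed[OF V(1) U(1,3) V(4)]]) (use U V in \<open>auto simp: germ_rs\<close>)
qed

lemma stalkE3:
  assumes "a \<in> carrier (stalk_ring X x)" "b \<in> carrier (stalk_ring X x)" "c \<in> carrier (stalk_ring X x)"
   "op N" "x \<in> N"
  obtains U s t u where "op U" "x \<in> U" "U \<subseteq> N" "s \<in> carrier (sec X U)" "t \<in> carrier (sec X U)" "u \<in> carrier (sec X U)"
    "a = germ X x U s" "b = germ X x U t" "c = germ X x U u"
proof -
  obtain V t u where V: "op V" "x \<in> V" "V \<subseteq> N" "t \<in> carrier (sec X V)" "b = germ X x V t"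
     "u \<in> carrier (sec X V)" "c = germ X x V u"
    using stalkE2[OF assms(2-5)] .
  obtain U s where U: "op U" "x \<in> U" "U \<subseteq> V" "s \<in> carrier (sec X U)" "a = germ X x U s"
    using stalkE[OF assms(1) V(1,2)] .
  show ?thesis
    by (rule that[OF U(1,2) _ U(4) rclosed[OF V(1) U(1,3) V(4)] rclosed[OF V(1) U(1,3) V(6)]])
      (use U V in \<open>auto simp: germ_rs\<close>)
qed

text \<open>Each ring axiom involves at most three germs. They have representatives over one open
  set \<open>U\<close>, where the axiom holds in \<open>sec X U\<close>.\<close>

lemma stalk_cring:
  assumes x: "x \<in> topspace (base X)"
  shows "cring (stalk_ring X x)"
proof -
  let ?A = "stalk_ring X x" and ?T = "topspace (base X)"
  have T: "op ?T" by simp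
  note E2 = stalkE2[OF _ _ T x] and E3 = stalkE3[OF _ _ _ T x] and E1 = stalkE[OF _ T x]
  note g = germ_mult germ_add germ_closed
  have z: "\<zero>\<^bsub>?A\<^esub> \<in> carrier ?A" and o: "\<one>\<^bsub>?A\<^esub> \<in> carrier ?A"
    using germ_zero[OF T x] germ_one[OF T x] germ_closed[OF T x] zero_closed[OF T] one_closed[OF T] by metis+
  have R: "cring (sec X U)" "ring (sec X U)" if "op U" for U using sec_cring sec_ring that by auto
  show ?thesis
  proof (rule cringI)
    show "abelian_group ?A"
    proof (rule abelian_groupI)
      fix a b assume ab: "a \<in> carrier ?A" "b \<in> carrier ?A"
      show "a \<oplus>\<^bsub>?A\<^esub> b \<in> carrier ?A" by (rule E2[OF ab]) (simp add: g)
      show "a \<oplus>\<^bsub>?A\<^esub> b = b \<oplus>\<^bsub>?A\<^esub> a"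
      proof (rule E2[OF ab])
        fix U s t assume *: "op U" "x \<in> U" "s \<in> carrier (sec X U)" "t \<in> carrier (sec X U)"
          "a = germ X x U s" "b = germ X x U t"
        interpret cring "sec X U" using R * by simp
        show ?thesis using * by (simp add: g a_comm)
      qed
    next
      fix a b c assume abc: "a \<in> carrier ?A" "b \<in> carrier ?A" "c \<in> carrier ?A"
      show "a \<oplus>\<^bsub>?A\<^esub> b \<oplus>\<^bsub>?A\<^esub> c = a \<oplus>\<^bsub>?A\<^esub> (b \<oplus>\<^bsub>?A\<^esub> c)"
      proof (rule E3[OF abc])
        fix U s t u assume *: "op U" "x \<in> U" "s \<in> carrier (sec X U)" "t \<in> carrier (sec X U)"
          "u \<in> carrier (sec X U)" "a = germ X x U s" "b = germ X x U t" "c = germ X x U u"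
        interpret cring "sec X U" using R * by simp
        show ?thesis using * by (simp add: g a_assoc)
      qed
    next
      fix a assume a: "a \<in> carrier ?A"
      show "\<zero>\<^bsub>?A\<^esub> \<oplus>\<^bsub>?A\<^esub> a = a"
      proof (rule E1[OF a])
        fix U s assume *: "op U" "x \<in> U" "s \<in> carrier (sec X U)" "a = germ X x U s"
        interpret cring "sec X U" using R * by simp
        show ?thesis using * by (simp add: g germ_zero[symmetric])
      qed
      show "\<exists>y\<in>carrier ?A. y \<oplus>\<^bsub>?A\<^esub> a = \<zero>\<^bsub>?A\<^esub>"
      proof (rule E1[OF a])
        fix U s assume *: "op U" "x \<in> U" "s \<in> carrier (sec X U)" "a = germ X x U s"
        interpret cring "sec X U" using R * by simp
        show ?thesis using * by (intro bexI[of _ "germ X x U (\<ominus>\<^bsub>sec X U\<^esub> s)"])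
            (simp_all add: g germ_zero[symmetric] l_neg)
      qed
    qed (fact z)
    show "Group.comm_monoid ?A"
    proof (rule comm_monoidI)
      fix a b assume ab: "a \<in> carrier ?A" "b \<in> carrier ?A"
      show "a \<otimes>\<^bsub>?A\<^esub> b \<in> carrier ?A" by (rule E2[OF ab]) (simp add: g)
      show "a \<otimes>\<^bsub>?A\<^esub> b = b \<otimes>\<^bsub>?A\<^esub> a"
      proof (rule E2[OF ab])
        fix U s t assume *: "op U" "x \<in> U" "s \<in> carrier (sec X U)" "t \<in> carrier (sec X U)"
          "a = germ X x U s" "b = germ X x U t"
        interpret cring "sec X U" using R * by simp
        show ?thesis using * by (simp add: g m_comm)
      qed
    next
      fix a b c assume abc: "a \<in> carrier ?A" "b \<in> carrier ?A" "c \<in> carrier ?A"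
      show "a \<otimes>\<^bsub>?A\<^esub> b \<otimes>\<^bsub>?A\<^esub> c = a \<otimes>\<^bsub>?A\<^esub> (b \<otimes>\<^bsub>?A\<^esub> c)"
      proof (rule E3[OF abc])
        fix U s t u assume *: "op U" "x \<in> U" "s \<in> carrier (sec X U)" "t \<in> carrier (sec X U)"
          "u \<in> carrier (sec X U)" "a = germ X x U s" "b = germ X x U t" "c = germ X x U u"
        interpret cring "sec X U" using R * by simp
        show ?thesis using * by (simp add: g m_assoc)
      qed
    next
      fix a assume a: "a \<in> carrier ?A"
      show "\<one>\<^bsub>?A\<^esub> \<otimes>\<^bsub>?A\<^esub> a = a"
      proof (rule E1[OF a])
        fix U s assume *: "op U" "x \<in> U" "s \<in> carrier (sec X U)" "a = germ X x U s"
        interpret cring "sec X U" using R * by simp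
        show ?thesis using * by (simp add: g germ_one[symmetric])
      qed
    qed (fact o)
    fix a b c assume abc: "a \<in> carrier ?A" "b \<in> carrier ?A" "c \<in> carrier ?A"
    show "(a \<oplus>\<^bsub>?A\<^esub> b) \<otimes>\<^bsub>?A\<^esub> c = a \<otimes>\<^bsub>?A\<^esub> c \<oplus>\<^bsub>?A\<^esub> b \<otimes>\<^bsub>?A\<^esub> c"
    proof (rule E3[OF abc])
      fix U s t u assume *: "op U" "x \<in> U" "s \<in> carrier (sec X U)" "t \<in> carrier (sec X U)"
        "u \<in> carrier (sec X U)" "a = germ X x U s" "b = germ X x U t" "c = germ X x U u"
      interpret cring "sec X U" using R * by simp
      show ?thesis using * by (simp add: g l_distr)
    qed
  qed
qed

lemma germ_hom:
  assumes "op U" "x \<in> U"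
  shows "germ X x U \<in> ring_hom (sec X U) (stalk_ring X x)"
  by (rule ring_hom_memI) (use assms in \<open>auto simp: germ_closed germ_mult germ_add germ_one\<close>)

text \<open>The inverse germ is a section near \<open>x\<close>, and its equation with 1, being an
  equality of germs, holds after one more shrinking. This turns invertibility in the stalk into an
  equation between sections, which morphisms can transport.\<close>

lemma germ_unit_iff:
  assumes "op U" "x \<in> U" "s \<in> carrier (sec X U)"
  shows "germ X x U s \<in> Units (stalk_ring X x) \<longleftrightarrow>
    (\<exists>V t. op V \<and> x \<in> V \<and> V \<subseteq> U \<and> t \<in> carrier (sec X V) \<and> res X U V s \<otimes>\<^bsub>sec X V\<^esub> t = \<one>\<^bsub>sec X V\<^esub>)"
proof
  let ?A = "stalk_ring X x"
  assume "germ X x U s \<in> Units ?A"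
  then obtain b where b: "b \<in> carrier ?A" "germ X x U s \<otimes>\<^bsub>?A\<^esub> b = \<one>\<^bsub>?A\<^esub>" unfolding Units_def by auto
  obtain V t where V: "op V" "x \<in> V" "V \<subseteq> U" "t \<in> carrier (sec X V)" "b = germ X x V t"
    using stalkE[OF b(1) assms(1,2)] .
  have "germ X x V (res X U V s \<otimes>\<^bsub>sec X V\<^esub> t) = germ X x V \<one>\<^bsub>sec X V\<^esub>"
    using V b assms by (simp add: germ_mult[symmetric] rclosed germ_rs germ_one)
  then obtain W where W: "op W" "x \<in> W" "W \<subseteq> V" "res X V W (res X U V s \<otimes>\<^bsub>sec X V\<^esub> t) = res X V W \<one>\<^bsub>sec X V\<^esub>"
    using germ_eq[of V x _ V] V assms by (auto simp: rclosed)
  then have "res X U W s \<otimes>\<^bsub>sec X W\<^esub> res X V W t = \<one>\<^bsub>sec X W\<^esub>"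
    using V assms by (simp add: res_mult rclosed rres res_one)
  then show "\<exists>V t. op V \<and> x \<in> V \<and> V \<subseteq> U \<and> t \<in> carrier (sec X V) \<and> res X U V s \<otimes>\<^bsub>sec X V\<^esub> t = \<one>\<^bsub>sec X V\<^esub>"
    using W V by (metis rclosed subset_trans)
next
  let ?A = "stalk_ring X x"
  assume "\<exists>V t. op V \<and> x \<in> V \<and> V \<subseteq> U \<and> t \<in> carrier (sec X V) \<and> res X U V s \<otimes>\<^bsub>sec X V\<^esub> t = \<one>\<^bsub>sec X V\<^esub>"
  then obtain V t where V: "op V" "x \<in> V" "V \<subseteq> U" "t \<in> carrier (sec X V)"
     "res X U V s \<otimes>\<^bsub>sec X V\<^esub> t = \<one>\<^bsub>sec X V\<^esub>" by auto
  have "x \<in> topspace (base X)" using assms openin_subset by blast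
  then interpret A: cring ?A by (rule stalk_cring)
  have "germ X x U s \<otimes>\<^bsub>?A\<^esub> germ X x V t = \<one>\<^bsub>?A\<^esub>"
    using germ_mult[of V x "res X U V s" t] V assms by (simp add: germ_rs rclosed germ_one)
  then show "germ X x U s \<in> Units ?A"
    using germ_closed[OF assms] germ_closed[OF V(1,2,4)] A.Units_one_closed
    unfolding Units_def using A.m_comm by fastforce
qed

text \<open>Both \<open>s\<close> and 0 glue the family of zero sections over the cover by all open
  sets on which \<open>s\<close> vanishes, and gluing is unique.\<close>

lemma zero_if_germs_zero:
  assumes U: "op U" "s \<in> carrier (sec X U)"
    and z: "\<And>x. x \<in> U \<Longrightarrow> \<exists>V. op V \<and> x \<in> V \<and> V \<subseteq> U \<and> res X U V s = \<zero>\<^bsub>sec X V\<^esub>"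
  shows "s = \<zero>\<^bsub>sec X U\<^esub>"
proof -
  define \<U> where "\<U> = {V. op V \<and> V \<subseteq> U \<and> res X U V s = \<zero>\<^bsub>sec X V\<^esub>}"
  have un: "\<Union>\<U> = U" unfolding \<U>_def using z by blast
  have "\<exists>!t. t \<in> carrier (sec X (\<Union>\<U>)) \<and> (\<forall>V\<in>\<U>. res X (\<Union>\<U>) V t = \<zero>\<^bsub>sec X V\<^esub>)"
  proof -
    have "(\<forall>V\<in>\<U>. op V \<and> \<zero>\<^bsub>sec X V\<^esub> \<in> carrier (sec X V)) \<and>
        (\<forall>V\<in>\<U>. \<forall>W\<in>\<U>. res X V (V \<inter> W) \<zero>\<^bsub>sec X V\<^esub> = res X W (V \<inter> W) \<zero>\<^bsub>sec X W\<^esub>)"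
      by (auto simp: \<U>_def res_zero openin_Int)
    then show ?thesis
      using sheaf[unfolded is_sheaf_def, THEN conjunct2, rule_format, of \<U> "\<lambda>V. \<zero>\<^bsub>sec X V\<^esub>"] by blast
  qed
  moreover have "s \<in> carrier (sec X (\<Union>\<U>)) \<and> (\<forall>V\<in>\<U>. res X (\<Union>\<U>) V s = \<zero>\<^bsub>sec X V\<^esub>)"
    unfolding un using U by (auto simp: \<U>_def)
  moreover have "\<zero>\<^bsub>sec X U\<^esub> \<in> carrier (sec X (\<Union>\<U>)) \<and> (\<forall>V\<in>\<U>. res X (\<Union>\<U>) V \<zero>\<^bsub>sec X U\<^esub> = \<zero>\<^bsub>sec X V\<^esub>)"
    unfolding un using U by (auto simp: \<U>_def res_zero)
  ultimately show ?thesis by blast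
qed

text \<open>The condition at points is vacuous, so this is the uniqueness of gluing for a cover of
  the empty set.\<close>

lemma sec_empty:
  assumes "s \<in> carrier (sec X {})" shows "s = \<zero>\<^bsub>sec X {}\<^esub>"
  by (rule zero_if_germs_zero) (use assms in auto)

end

section \<open>Ideals\<close>

text \<open>Zorn's lemma, kept general in \<open>M\<close>: a multiplicative set gives primes, and
  the singleton of 1 gives maximal ideals.\<close>

lemma (in cring) maximal_disjoint_ideal:
  assumes I: "ideal I R" and IM: "I \<inter> M = {}"
  obtains P where "ideal P R" "I \<subseteq> P" "P \<inter> M = {}"
    "\<forall>Q. ideal Q R \<and> P \<subseteq> Q \<and> Q \<inter> M = {} \<longrightarrow> Q = P"
proof -
  define A where "A = {Q. ideal Q R \<and> I \<subseteq> Q \<and> Q \<inter> M = {}}"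
  have "\<exists>P\<in>A. \<forall>Q\<in>A. P \<subseteq> Q \<longrightarrow> Q = P"
  proof (rule subset_Zorn_nonempty)
    show "A \<noteq> {}" unfolding A_def using I IM by auto
    fix C assume C: "C \<noteq> {}" "subset.chain A C"
    have CA: "C \<subseteq> A" using C(2) unfolding pred_on.chain_def by auto
    have "subset.chain {Q. ideal Q R} C"
      using C(2) unfolding pred_on.chain_def A_def by auto
    then have "ideal (\<Union>C) R" using chain_Union_is_ideal[of C] C(1) by simp
    moreover have "I \<subseteq> \<Union>C" "\<Union>C \<inter> M = {}"
      using CA C(1) unfolding A_def by auto
    ultimately show "\<Union>C \<in> A" unfolding A_def by simp
  qed
  then obtain P where P: "P \<in> A" "\<And>Q. Q \<in> A \<Longrightarrow> P \<subseteq> Q \<Longrightarrow> Q = P" by auto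
  show ?thesis
  proof (rule that)
    show "\<forall>Q. ideal Q R \<and> P \<subseteq> Q \<and> Q \<inter> M = {} \<longrightarrow> Q = P"
    proof (intro allI impI)
      fix Q assume Q: "ideal Q R \<and> P \<subseteq> Q \<and> Q \<inter> M = {}"
      then have "Q \<in> A" using P(1) unfolding A_def by auto
      then show "Q = P" using P(2) Q by blast
    qed
  qed (use P(1) in \<open>auto simp: A_def\<close>)
qed

lemma (in cring) ideal_add_element:
  assumes I: "ideal I R" and a: "a \<in> carrier R"
  shows "ideal (I <+> PIdl a) R" "I \<subseteq> I <+> PIdl a" "a \<in> I <+> PIdl a"
    "b \<in> I <+> PIdl a \<longleftrightarrow> (\<exists>i\<in>I. \<exists>r\<in>carrier R. b = i \<oplus> r \<otimes> a)"
proof -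
  interpret I: ideal I R by fact
  show i: "ideal (I <+> PIdl a) R" by (rule add_ideals[OF I cgenideal_ideal[OF a]])
  show b: "b \<in> I <+> PIdl a \<longleftrightarrow> (\<exists>i\<in>I. \<exists>r\<in>carrier R. b = i \<oplus> r \<otimes> a)" for b
    unfolding set_add_def' cgenideal_def by auto
  show "a \<in> I <+> PIdl a"
    unfolding b using a by (intro bexI[of _ \<zero>] bexI[of _ \<one>]) auto
  show "I \<subseteq> I <+> PIdl a"
  proof
    fix i assume "i \<in> I"
    then show "i \<in> I <+> PIdl a"
      unfolding b using a by (intro bexI[of _ i] bexI[of _ \<zero>]) auto
  qed
qed

text \<open>An ideal maximal among those missing \<open>M\<close> is prime: if neither
  \<open>a\<close> nor \<open>b\<close> lies in \<open>P\<close>, adding either one makes the ideal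
  meet \<open>M\<close>. The product of the two meeting points lies in \<open>M\<close> and, once
  \<open>a \<otimes> b\<close> is in \<open>P\<close>, also in \<open>P\<close>.\<close>

lemma (in cring) prime_ideal_disjoint:
  assumes I: "ideal I R" and IM: "I \<inter> M = {}" and M: "M \<subseteq> carrier R" "\<one> \<in> M"
    "\<And>a b. a \<in> M \<Longrightarrow> b \<in> M \<Longrightarrow> a \<otimes> b \<in> M"
  obtains P where "primeideal P R" "I \<subseteq> P" "P \<inter> M = {}"
proof -
  obtain P where P: "ideal P R" "I \<subseteq> P" "P \<inter> M = {}"
    "\<forall>Q. ideal Q R \<and> P \<subseteq> Q \<and> Q \<inter> M = {} \<longrightarrow> Q = P"
    using maximal_disjoint_ideal[OF I IM] .
  interpret P: ideal P R by (rule P(1))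
  have meets: "\<exists>i r. i \<in> P \<and> r \<in> carrier R \<and> i \<oplus> r \<otimes> a \<in> M" if a: "a \<in> carrier R" "a \<notin> P" for a
  proof -
    have "P <+> PIdl a \<noteq> P" using ideal_add_element(3)[OF P(1) a(1)] a by auto
    then have "(P <+> PIdl a) \<inter> M \<noteq> {}"
      using P(4) ideal_add_element(1,2)[OF P(1) a(1)] by blast
    then obtain x where x: "x \<in> P <+>\<^bsub>R\<^esub> PIdl a" "x \<in> M" by auto
    show ?thesis using x ideal_add_element(4)[OF P(1) a(1), of x] by auto
  qed
  have "primeideal P R"
  proof (rule primeidealI[OF P(1) is_cring])
    show "carrier R \<noteq> P" using P(3) M by auto
    fix a b assume ab: "a \<in> carrier R" "b \<in> carrier R" "a \<otimes> b \<in> P"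
    show "a \<in> P \<or> b \<in> P"
    proof (rule ccontr)
      assume n: "\<not> (a \<in> P \<or> b \<in> P)"
      obtain i r where i: "i \<in> P" "r \<in> carrier R" "i \<oplus> r \<otimes> a \<in> M" using meets[of a] ab n by blast
      obtain j s where j: "j \<in> P" "s \<in> carrier R" "j \<oplus> s \<otimes> b \<in> M" using meets[of b] ab n by blast
      have c: "i \<in> carrier R" "j \<in> carrier R" using i j P.Icarr by auto
      have "(i \<oplus> r \<otimes> a) \<otimes> (j \<oplus> s \<otimes> b) = i \<otimes> (j \<oplus> s \<otimes> b) \<oplus> ((r \<otimes> a) \<otimes> j \<oplus> (r \<otimes> s) \<otimes> (a \<otimes> b))"
        using c i j ab by algebra
      moreover have "\<dots> \<in> P"
        using i j ab c by (intro P.a_closed P.I_l_closed[OF j(1)] P.I_l_closed[OF ab(3)] P.I_r_closed[OF i(1)]) auto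
      ultimately show False using P(3) M(3)[OF i(3) j(3)] by auto
    qed
  qed
  then show ?thesis using that P by blast
qed

lemma (in cring) maximal_ideal_above:
  assumes I: "ideal I R" and "\<one> \<notin> I"
  obtains m where "maximalideal m R" "I \<subseteq> m"
proof -
  obtain P where P: "ideal P R" "I \<subseteq> P" "P \<inter> {\<one>} = {}"
    "\<forall>Q. ideal Q R \<and> P \<subseteq> Q \<and> Q \<inter> {\<one>} = {} \<longrightarrow> Q = P"
    using maximal_disjoint_ideal[OF I, of "{\<one>}"] assms(2) by blast
  have "maximalideal P R"
  proof (rule maximalidealI[OF P(1)])
    show "carrier R \<noteq> P" using P(3) by auto
    fix J assume J: "ideal J R" "P \<subseteq> J" "J \<subseteq> carrier R"
    show "J = P \<or> J = carrier R"
      using P(4) J(1,2) ideal.one_imp_carrier[OF J(1)] by blast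
  qed
  then show ?thesis using that P by blast
qed

lemma (in cring) nonunit_maximal_ideal:
  assumes a: "a \<in> carrier R" "a \<notin> Units R"
  obtains m where "maximalideal m R" "a \<in> m"
proof -
  have "\<one> \<notin> PIdl a"
  proof
    assume "\<one> \<in> PIdl a"
    then obtain r where "r \<in> carrier R" "r \<otimes> a = \<one>" unfolding cgenideal_def by auto
    then show False using a m_comm unfolding Units_def by auto
  qed
  then obtain m where m: "maximalideal m R" "PIdl a \<subseteq> m"
    using maximal_ideal_above[OF cgenideal_ideal[OF a(1)]] by blast
  then show ?thesis using that cgenideal_self[OF a(1)] by blast
qed

lemma (in cring) maximal_ideal_nonunits:
  assumes "maximalideal m R" "a \<in> m"
  shows "a \<in> carrier R" "a \<notin> Units R"
proof -
  interpret m: maximalideal m R by fact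
  show "a \<in> carrier R" using assms m.Icarr by auto
  show "a \<notin> Units R"
  proof
    assume "a \<in> Units R"
    then have "inv a \<otimes> a = \<one>" "inv a \<in> carrier R" by auto
    then have "\<one> \<in> m" using m.I_l_closed[OF assms(2)] by metis
    then show False using m.one_imp_carrier m.I_notcarr by auto
  qed
qed

text \<open>Every nonunit lies in some maximal ideal, and there is only one; conversely a maximal
  ideal contains no unit.\<close>

lemma local_ring_nonunits:
  fixes R (structure)
  assumes "local_ring R"
  shows "maximalideal (carrier R - Units R) R"
    and "maximalideal m R \<Longrightarrow> m = carrier R - Units R"
proof -
  interpret cring R using assms unfolding local_ring_def by simp
  have ex1: "\<exists>!m. maximalideal m R" using assms unfolding local_ring_def by simp
  define m0 where "m0 = (THE m. maximalideal m R)"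
  have m01: "maximalideal m0 R" unfolding m0_def by (rule theI'[OF ex1])
  have m02: "m = m0" if "maximalideal m R" for m
    unfolding m0_def by (rule the1_equality[OF ex1 that, symmetric])
  note m0 = m01 m02
  have e: "m0 = carrier R - Units R"
  proof
    show "m0 \<subseteq> carrier R - Units R" using maximal_ideal_nonunits[OF m0(1)] by blast
    show "carrier R - Units R \<subseteq> m0"
    proof
      fix a assume "a \<in> carrier R - Units R"
      then obtain m where "maximalideal m R" "a \<in> m" using nonunit_maximal_ideal[of a] by auto
      then show "a \<in> m0" using m0(2)[of m] by simp
    qed
  qed
  show "maximalideal (carrier R - Units R) R" using m0(1) e by simp
  show "maximalideal m R \<Longrightarrow> m = carrier R - Units R" using m0(2)[of m] e by simp
qed

lemma local_ring_one_not_zero: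
  fixes R (structure)
  assumes "local_ring R"
  shows "\<one>\<^bsub>R\<^esub> \<noteq> \<zero>\<^bsub>R\<^esub>"
proof
  interpret cring R using assms unfolding local_ring_def by simp
  interpret m: maximalideal "carrier R - Units R" R by (rule local_ring_nonunits(1)[OF assms])
  assume "\<one>\<^bsub>R\<^esub> = \<zero>\<^bsub>R\<^esub>"
  then have "\<one> \<in> carrier R - Units R" using m.zero_closed by simp
  then show False by simp
qed

lemma ring_hom_Units:
  assumes "cring A" "cring B" "\<phi> \<in> ring_hom A B" "a \<in> Units A"
  shows "\<phi> a \<in> Units B"
proof -
  interpret A: cring A by fact
  interpret B: cring B by fact
  have a: "a \<in> carrier A" "inv\<^bsub>A\<^esub> a \<in> carrier A" "inv\<^bsub>A\<^esub> a \<otimes>\<^bsub>A\<^esub> a = \<one>\<^bsub>A\<^esub>" using assms(4) by auto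
  have "\<phi> (inv\<^bsub>A\<^esub> a) \<otimes>\<^bsub>B\<^esub> \<phi> a = \<one>\<^bsub>B\<^esub>"
    using a ring_hom_mult[OF assms(3) a(2,1)] ring_hom_one[OF assms(3)] by simp
  moreover have "\<phi> a \<in> carrier B" "\<phi> (inv\<^bsub>A\<^esub> a) \<in> carrier B"
    using a assms(3) ring_hom_closed by metis+
  ultimately show ?thesis unfolding Units_def using B.m_comm[of "\<phi> a" "\<phi> (inv\<^bsub>A\<^esub> a)"] by auto
qed

text \<open>Nonunits go to nonunits because \<open>\<phi>\<close> sends the maximal ideal into the
  maximal ideal. This is the form in which locality is used to follow points through
  morphisms.\<close>

lemma local_hom_unit_iff:
  assumes "local_ring A" "local_ring B" "local_hom A B \<phi>" "a \<in> carrier A"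
  shows "\<phi> a \<in> Units B \<longleftrightarrow> a \<in> Units A"
proof
  have c: "cring A" "cring B" using assms unfolding local_ring_def by auto
  have h: "\<phi> \<in> ring_hom A B" using assms unfolding local_hom_def by auto
  show "a \<in> Units A \<Longrightarrow> \<phi> a \<in> Units B" by (rule ring_hom_Units[OF c h])
  assume u: "\<phi> a \<in> Units B"
  have "\<phi> ` (carrier A - Units A) \<subseteq> carrier B - Units B"
    using assms(3) local_ring_nonunits(1)[OF assms(1)] local_ring_nonunits(1)[OF assms(2)]
    unfolding local_hom_def by simp
  then show "a \<in> Units A" using u assms(4) by blast
qed

text \<open>The preimage of \<open>I\<close> under \<open>\<phi>\<close> is an ideal containing
  \<open>S\<close>, hence it contains everything that \<open>S\<close> generates. This carries ideal
  membership of sections over to stalks.\<close>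

lemma ring_hom_Idl:
  assumes A: "ring A" and B: "ring B" and \<phi>: "\<phi> \<in> ring_hom A B" and S: "S \<subseteq> carrier A"
    and a: "a \<in> Idl\<^bsub>A\<^esub> S" and I: "ideal I B" "\<phi> ` S \<subseteq> I"
  shows "\<phi> a \<in> I"
proof -
  interpret h: ring_hom_ring A B \<phi> by (rule ring_hom_ringI2[OF A B \<phi>])
  have "ideal {r \<in> carrier A. \<phi> r \<in> I} A" by (rule h.ideal_vimage[OF I(1)])
  then have "Idl\<^bsub>A\<^esub> S \<subseteq> {r \<in> carrier A. \<phi> r \<in> I}"
    using S I(2) by (intro ring.genideal_minimal[OF A]) auto
  then show ?thesis using a by blast
qed

lemma (in ring) Idl_mono:
  assumes "S \<subseteq> T" shows "Idl S \<subseteq> Idl T"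
  using assms unfolding genideal_def by blast

text \<open>Nakayama's lemma, by removing generators one at a time.\<close>

lemma local_ring_Nakayama:
  fixes R (structure)
  assumes R: "local_ring R" and S: "finite S" "S \<subseteq> carrier R"
    and N: "S \<subseteq> ideal_prod R (carrier R - Units R) (Idl\<^bsub>R\<^esub> S)"
  shows "S \<subseteq> {\<zero>\<^bsub>R\<^esub>}"
proof -
  let ?m = "carrier R - Units R"
  interpret cring R using R unfolding local_ring_def by simp
  interpret m: maximalideal ?m R by (rule local_ring_nonunits(1)[OF R])
  show ?thesis using S N
  proof (induction S)
    case (insert s S)
    have s: "s \<in> carrier R" and S: "S \<subseteq> carrier R" using insert by auto
    let ?K = "Idl S"
    have K: "ideal ?K R" by (rule genideal_ideal[OF S])
    interpret K: ideal ?K R by (rule K)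
    have mK: "ideal (ideal_prod R ?m ?K) R" by (rule ideal_prod_is_ideal[OF m.is_ideal K])
    interpret mK: ideal "ideal_prod R ?m ?K" R by (rule mK)
    have "Idl (insert s S) \<subseteq> ?K <+> PIdl s"
      using ideal_add_element(1,2,3)[OF K s] genideal_self[OF S] by (intro genideal_minimal) auto
    then have gen: "\<exists>i\<in>?K. \<exists>r\<in>carrier R. j = i \<oplus> r \<otimes> s" if "j \<in> Idl (insert s S)" for j
      using that ideal_add_element(4)[OF K s, of j] by auto
    \<comment> \<open>Modulo the product of \<open>?m\<close> and \<open>?K\<close> only the
      generator \<open>s\<close> contributes, with a coefficient in the maximal ideal.\<close>
    have split: "\<exists>a\<in>?m. \<exists>t\<in>ideal_prod R ?m ?K. x = a \<otimes> s \<oplus> t"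
      if "x \<in> ideal_prod R ?m (Idl (insert s S))" for x
      using that
    proof induction
      case (prod i j)
      obtain k r where k: "k \<in> ?K" "r \<in> carrier R" "j = k \<oplus> r \<otimes> s" using gen[OF prod(2)] by auto
      have "i \<otimes> j = (i \<otimes> r) \<otimes> s \<oplus> i \<otimes> k"
        using k prod(1) s K.Icarr[OF k(1)] m.Icarr[OF prod(1)] by algebra
      then show ?case
        using m.I_r_closed[OF prod(1) k(2)] ideal_prod.prod[OF prod(1) k(1)] by blast
    next
      case (sum x y)
      then obtain a t b u where *: "a \<in> ?m" "t \<in> ideal_prod R ?m ?K" "x = a \<otimes> s \<oplus> t"
        "b \<in> ?m" "u \<in> ideal_prod R ?m ?K" "y = b \<otimes> s \<oplus> u" by blast
      have "x \<oplus> y = (a \<oplus> b) \<otimes> s \<oplus> (t \<oplus> u)"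
        using * s m.Icarr[OF *(1)] m.Icarr[OF *(4)] mK.Icarr[OF *(2)] mK.Icarr[OF *(5)] by algebra
      then show ?case using m.a_closed[OF *(1,4)] mK.a_closed[OF *(2,5)] by blast
    qed
    obtain a t where a: "a \<in> ?m" "t \<in> ideal_prod R ?m ?K" "s = a \<otimes> s \<oplus> t"
      using split[of s] insert.prems(2) by auto
    have ac: "a \<in> carrier R" "t \<in> carrier R" using m.Icarr[OF a(1)] mK.Icarr[OF a(2)] by auto
    \<comment> \<open>Were it a nonunit, adding \<open>a\<close> would put 1 into the maximal ideal.
      Dividing \<open>(1 - a) s = t\<close> by it places \<open>s\<close> in \<open>?K\<close>, so
      \<open>s\<close> is redundant as a generator and the induction hypothesis applies to
      \<open>S\<close>.\<close>
    have "\<one> \<ominus> a \<in> Units R"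
    proof (rule ccontr)
      assume "\<one> \<ominus> a \<notin> Units R"
      then have "\<one> \<ominus> a \<in> ?m" using ac by auto
      then have "(\<one> \<ominus> a) \<oplus> a \<in> ?m" using m.a_closed[OF _ a(1)] by simp
      moreover have "(\<one> \<ominus> a) \<oplus> a = \<one>" using ac by algebra
      ultimately show False by simp
    qed
    then have u: "inv (\<one> \<ominus> a) \<in> carrier R" "inv (\<one> \<ominus> a) \<otimes> (\<one> \<ominus> a) = \<one>" by auto
    have "(\<one> \<ominus> a) \<otimes> s = t"
    proof -
      have "(\<one> \<ominus> a) \<otimes> s = s \<ominus> a \<otimes> s" using ac s by algebra
      also have "\<dots> = (a \<otimes> s \<oplus> t) \<ominus> a \<otimes> s" using a(3) by simp
      also have "\<dots> = t" using ac s by algebra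
      finally show ?thesis .
    qed
    then have "s = inv (\<one> \<ominus> a) \<otimes> t"
      using u ac s m_assoc[of "inv (\<one> \<ominus> a)" "\<one> \<ominus> a" s] by simp
    then have "s \<in> ideal_prod R ?m ?K" using mK.I_l_closed[OF a(2) u(1)] by simp
    then have sK: "s \<in> ?K" using ideal_prod_inter[OF m.is_ideal K] by blast
    have "Idl (insert s S) \<subseteq> ?K"
      using sK genideal_self[OF S] by (intro genideal_minimal[OF K]) auto
    then have "Idl (insert s S) = ?K" using Idl_mono[of S "insert s S"] by blast
    then have S0: "S \<subseteq> {\<zero>}" using insert.IH[OF S] insert.prems(2) by auto
    have "?K \<subseteq> {\<zero>}" by (rule genideal_minimal[OF zeroideal S0])
    then show ?case using S0 sK by blast
  qed simp
qed

text \<open>Stands in for the finiteness of the set of minimal primes. Noetherian induction on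
  ideals: an ideal maximal among the counterexamples is proper and not prime, so it contains a
  product \<open>a \<otimes> b\<close> without its factors. A prime above it contains
  \<open>a\<close> or \<open>b\<close>, so the lists for the two larger ideals together serve for
  it.\<close>

lemma finite_primes_below_primes:
  fixes R (structure)
  assumes "cring R" "noetherian_ring R"
  obtains Ps where "finite Ps" "\<And>p. p \<in> Ps \<Longrightarrow> primeideal p R"
    "\<And>q. primeideal q R \<Longrightarrow> \<exists>p\<in>Ps. p \<subseteq> q"
proof -
  interpret cring R by fact
  interpret noetherian_ring R by fact
  \<comment> \<open>The version relative to an ideal \<open>I\<close>, on which the induction runs;
    the zero ideal gives the claim.\<close>
  define ok where "ok I \<longleftrightarrow> (\<exists>Ps. finite Ps \<and> (\<forall>p\<in>Ps. primeideal p R) \<and>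
    (\<forall>q. primeideal q R \<and> I \<subseteq> q \<longrightarrow> (\<exists>p\<in>Ps. p \<subseteq> q)))" for I
  have "ok {\<zero>}"
  proof (rule ccontr)
    assume n: "\<not> ok {\<zero>}"
    define A where "A = {I. ideal I R \<and> \<not> ok I}"
    have "\<exists>I\<in>A. \<forall>J\<in>A. I \<subseteq> J \<longrightarrow> J = I"
    proof (rule subset_Zorn_nonempty)
      show "A \<noteq> {}" unfolding A_def using n zeroideal by auto
      fix C assume C: "C \<noteq> {}" "subset.chain A C"
      have CA: "C \<subseteq> A" using C(2) unfolding pred_on.chain_def by auto
      have "subset.chain {Q. ideal Q R} C"
        using C(2) unfolding pred_on.chain_def A_def by auto
      \<comment> \<open>In a noetherian ring the union of a chain of ideals is a member of the
        chain, so it is again a counterexample.\<close>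
      then show "\<Union>C \<in> A" using ideal_chain_is_trivial[OF C(1)] CA by blast
    qed
    then obtain I where I: "ideal I R" "\<not> ok I" and mx: "\<And>J. ideal J R \<Longrightarrow> I \<subseteq> J \<Longrightarrow> J \<noteq> I \<Longrightarrow> ok J"
      unfolding A_def by blast
    have "\<not> primeideal I R"
    proof
      assume "primeideal I R"
      then have "ok I" unfolding ok_def by (intro exI[of _ "{I}"]) auto
      then show False using I by simp
    qed
    \<comment> \<open>No prime contains the whole ring, so for that ideal the empty list would
      serve.\<close>
    moreover have "carrier R \<noteq> I"
    proof
      assume c: "carrier R = I"
      have "False" if q: "primeideal q R" "I \<subseteq> q" for q
      proof -
        interpret q: primeideal q R by (rule q)
        show ?thesis using q q.I_notcarr q.a_subset c by auto
      qed
      then have "ok I" unfolding ok_def by (intro exI[of _ "{}"]) auto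
      then show False using I by simp
    qed
    ultimately obtain a b where ab: "a \<in> carrier R" "b \<in> carrier R" "a \<otimes> b \<in> I" "a \<notin> I" "b \<notin> I"
      using ideal.primeidealCD[OF I(1) is_cring] by blast
    have "ok (I <+> PIdl a)" "ok (I <+> PIdl b)"
      using mx[OF ideal_add_element(1,2)[OF I(1) ab(1)]] mx[OF ideal_add_element(1,2)[OF I(1) ab(2)]]
        ideal_add_element(3)[OF I(1) ab(1)] ideal_add_element(3)[OF I(1) ab(2)] ab(4,5) by auto
    then obtain Ps Qs where P0: "finite Ps" "\<forall>p\<in>Ps. primeideal p R"
      "\<forall>q. primeideal q R \<and> I <+> PIdl a \<subseteq> q \<longrightarrow> (\<exists>p\<in>Ps. p \<subseteq> q)"
      and Q0: "finite Qs" "\<forall>p\<in>Qs. primeideal p R"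
      "\<forall>q. primeideal q R \<and> I <+> PIdl b \<subseteq> q \<longrightarrow> (\<exists>p\<in>Qs. p \<subseteq> q)"
      unfolding ok_def by (elim exE conjE)
    then have P: "finite Ps" "\<forall>p\<in>Ps. primeideal p R"
      "\<And>q. primeideal q R \<Longrightarrow> I <+> PIdl a \<subseteq> q \<Longrightarrow> \<exists>p\<in>Ps. p \<subseteq> q"
      and Q: "finite Qs" "\<forall>p\<in>Qs. primeideal p R"
      "\<And>q. primeideal q R \<Longrightarrow> I <+> PIdl b \<subseteq> q \<Longrightarrow> \<exists>p\<in>Qs. p \<subseteq> q" for q
      by simp_all
    have "\<exists>p\<in>Ps \<union> Qs. p \<subseteq> q" if q: "primeideal q R" "I \<subseteq> q" for q
    proof -
      interpret q: primeideal q R by (rule q)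
      have sub: "I <+> PIdl c \<subseteq> q" if c: "c \<in> q" for c
      proof
        fix x assume "x \<in> I <+>\<^bsub>R\<^esub> PIdl c"
        then obtain i r where "i \<in> I" "r \<in> carrier R" "x = i \<oplus> r \<otimes> c"
          using ideal_add_element(4)[OF I(1) q.Icarr[OF c], of x] by auto
        then show "x \<in> q" using c q q.I_l_closed q.a_closed by blast
      qed
      have "a \<in> q \<or> b \<in> q" using ab q q.I_prime by blast
      then show ?thesis using sub P(3)[OF q(1)] Q(3)[OF q(1)] by blast
    qed
    then have "ok I" unfolding ok_def using P(1,2) Q(1,2) by (intro exI[of _ "Ps \<union> Qs"]) auto
    then show False using I by simp
  qed
  then obtain Ps where Ps: "finite Ps" "\<forall>p\<in>Ps. primeideal p R"
    "\<forall>q. primeideal q R \<and> {\<zero>} \<subseteq> q \<longrightarrow> (\<exists>p\<in>Ps. p \<subseteq> q)" unfolding ok_def by auto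
  have "{\<zero>} \<subseteq> q" if "primeideal q R" for q
  proof -
    interpret q: primeideal q R by (rule that)
    show ?thesis using q.zero_closed by simp
  qed
  then show ?thesis using that[of Ps] Ps by blast
qed

section \<open>Idempotent ideals and open-and-closed sets\<close>

text \<open>Support is expressed by vanishing on \<open>U - V\<close>, which is open for closed
  \<open>V\<close>; so no idempotent section, equal to 1 on \<open>V\<close> and to 0 elsewhere, has
  to be glued.\<close>

definition clopen_ideal :: "('x, 'a) ringed_space \<Rightarrow> 'x set \<Rightarrow> 'x set \<Rightarrow> 'a set" where
  "clopen_ideal X V = (\<lambda>U \<in> {U. openin (base X) U}.
     {s \<in> carrier (sec X U). res X U (U - V) s = \<zero>\<^bsub>sec X (U - V)\<^esub>})"

locale lringed =
  fixes X :: "('x, 'a) ringed_space"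
  assumes lringed: "locally_ringed_space X"

sublocale lringed \<subseteq> ringed
  using lringed by unfold_locales (simp add: locally_ringed_space_def)

lemma (in lringed) stalk_local: "x \<in> topspace (base X) \<Longrightarrow> local_ring (stalk_ring X x)"
  using lringed unfolding locally_ringed_space_def by simp

context ringed
begin

lemma op_topspace: "op U \<Longrightarrow> x \<in> U \<Longrightarrow> x \<in> topspace (base X)"
  using openin_subset by blast

lemma ideal_sheaf_res: "ideal_sheaf X I \<Longrightarrow> op U \<Longrightarrow> op V \<Longrightarrow> V \<subseteq> U \<Longrightarrow> s \<in> I U \<Longrightarrow> res X U V s \<in> I V"
  unfolding ideal_sheaf_def by (simp add: image_subset_iff)

lemma ideal_sheaf_ideal: "ideal_sheaf X I \<Longrightarrow> op U \<Longrightarrow> ideal (I U) (sec X U)"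
  unfolding ideal_sheaf_def by simp

lemma ideal_sheaf_carrier: "ideal_sheaf X I \<Longrightarrow> op U \<Longrightarrow> s \<in> I U \<Longrightarrow> s \<in> carrier (sec X U)"
  using ideal.Icarr[OF ideal_sheaf_ideal] .

lemma ideal_sheaf_local:
  assumes I: "ideal_sheaf X I" and U: "op U" "s \<in> carrier (sec X U)"
    and loc: "\<And>x. x \<in> U \<Longrightarrow> \<exists>V. op V \<and> x \<in> V \<and> V \<subseteq> U \<and> res X U V s \<in> I V"
  shows "s \<in> I U"
proof -
  define \<U> where "\<U> = {V. op V \<and> V \<subseteq> U \<and> res X U V s \<in> I V}"
  have un: "\<Union>\<U> = U" unfolding \<U>_def using loc by blast
  have "(\<forall>V\<in>\<U>. op V) \<and> s \<in> carrier (sec X (\<Union>\<U>)) \<and> (\<forall>V\<in>\<U>. res X (\<Union>\<U>) V s \<in> I V)"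
    unfolding un using U by (auto simp: \<U>_def)
  then have "s \<in> I (\<Union>\<U>)"
    using I[unfolded ideal_sheaf_def, THEN conjunct2, THEN conjunct2, THEN conjunct2, rule_format, of \<U> s] by simp
  then show ?thesis unfolding un .
qed

lemma ideal_sheaf_one:
  assumes "ideal_sheaf X I" "op U" "\<one>\<^bsub>sec X U\<^esub> \<in> I U"
  shows "I U = carrier (sec X U)"
  using ideal.one_imp_carrier[OF ideal_sheaf_ideal] assms by metis

lemma generated_ideal_mem:
  assumes "op U"
  shows "s \<in> generated_ideal X G U \<longleftrightarrow> s \<in> carrier (sec X U) \<and> (\<forall>x\<in>U. \<exists>V. op V \<and> x \<in> V \<and> V \<subseteq> U \<and>
        res X U V s \<in> Idl\<^bsub>sec X V\<^esub> (\<Union>W \<in> {W. op W \<and> V \<subseteq> W}. res X W V ` G W))"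
  using assms unfolding generated_ideal_def by simp

text \<open>Minimality of the generated ideal sheaf: near every point the restriction lies in an
  ideal generated by sections of \<open>I\<close>, and membership in an ideal sheaf can be tested
  locally.\<close>

lemma generated_ideal_subset:
  assumes I: "ideal_sheaf X I" and G: "\<And>W. op W \<Longrightarrow> G W \<subseteq> I W" and U: "op U"
  shows "generated_ideal X G U \<subseteq> I U"
proof
  fix s assume "s \<in> generated_ideal X G U"
  then have s: "s \<in> carrier (sec X U)" "\<forall>x\<in>U. \<exists>V. op V \<and> x \<in> V \<and> V \<subseteq> U \<and>
        res X U V s \<in> Idl\<^bsub>sec X V\<^esub> (\<Union>W \<in> {W. op W \<and> V \<subseteq> W}. res X W V ` G W)"
    using generated_ideal_mem[OF U] by auto
  show "s \<in> I U"
  proof (rule ideal_sheaf_local[OF I U s(1)])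
    fix x assume "x \<in> U"
    then obtain V where V: "op V" "x \<in> V" "V \<subseteq> U"
      "res X U V s \<in> Idl\<^bsub>sec X V\<^esub> (\<Union>W \<in> {W. op W \<and> V \<subseteq> W}. res X W V ` G W)" using s(2) by meson
    have "(\<Union>W \<in> {W. op W \<and> V \<subseteq> W}. res X W V ` G W) \<subseteq> I V"
    proof (rule UN_least)
      fix W assume "W \<in> {W. op W \<and> V \<subseteq> W}"
      then have W: "op W" "V \<subseteq> W" by auto
      show "res X W V ` G W \<subseteq> I V"
        using ideal_sheaf_res[OF I W(1) V(1) W(2)] G[OF W(1)] by blast
    qed
    then have "res X U V s \<in> I V"
      using ring.genideal_minimal[OF sec_ring[OF V(1)] ideal_sheaf_ideal[OF I V(1)]] V(4) by blast
    then show "\<exists>V. op V \<and> x \<in> V \<and> V \<subseteq> U \<and> res X U V s \<in> I V" using V by blast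
  qed
qed

lemma clopen_ideal_mem:
  assumes "op U"
  shows "s \<in> clopen_ideal X V U \<longleftrightarrow> s \<in> carrier (sec X U) \<and> res X U (U - V) s = \<zero>\<^bsub>sec X (U - V)\<^esub>"
  using assms unfolding clopen_ideal_def by simp

text \<open>Over \<open>U\<close> this is the kernel of restriction to the open set
  \<open>U - V\<close>. The gluing clause holds since a section that vanishes off \<open>V\<close>
  on each member of a cover vanishes off \<open>V\<close> on the union.\<close>

lemma clopen_ideal_sheaf:
  assumes V: "closedin (base X) V"
  shows "ideal_sheaf X (clopen_ideal X V)"
proof -
  note d = openin_diff[OF _ V]
  show ?thesis
    unfolding ideal_sheaf_def
  proof (intro conjI allI impI)
    show "clopen_ideal X V \<in> extensional {U. op U}" unfolding clopen_ideal_def by simp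
    fix U assume U: "op U"
    interpret h: ring_hom_ring "sec X U" "sec X (U - V)" "res X U (U - V)"
      by (rule res_ring_hom[OF U d[OF U]]) simp
    have "ideal {s \<in> carrier (sec X U). res X U (U - V) s \<in> {\<zero>\<^bsub>sec X (U - V)\<^esub>}} (sec X U)"
      by (rule h.ideal_vimage[OF h.S.zeroideal])
    then show "ideal (clopen_ideal X V U) (sec X U)"
      unfolding clopen_ideal_def using U by simp
  next
    fix U W assume *: "op U \<and> op W \<and> W \<subseteq> U"
    show "res X U W ` clopen_ideal X V U \<subseteq> clopen_ideal X V W"
    proof
      fix t assume "t \<in> res X U W ` clopen_ideal X V U"
      then obtain s where s: "s \<in> carrier (sec X U)" "res X U (U - V) s = \<zero>\<^bsub>sec X (U - V)\<^esub>" "t = res X U W s"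
        using clopen_ideal_mem * by blast
      have sub: "W - V \<subseteq> U - V" "W - V \<subseteq> W" "W - V \<subseteq> U" "U - V \<subseteq> U" using * by auto
      have o: "op (U - V)" "op (W - V)" using d * by auto
      have "res X W (W - V) t = res X (U - V) (W - V) (res X U (U - V) s)"
      proof -
        have U: "op U" and W: "op W" "W \<subseteq> U" using * by auto
        show ?thesis
          unfolding s(3) rres[OF U W(1) o(2) sub(2) W(2) s(1)] rres[OF U o sub(1) _ s(1)]
          using rres[OF U o sub(1) _ s(1)] by auto
      qed
      also have "\<dots> = \<zero>\<^bsub>sec X (W - V)\<^esub>" unfolding s(2) by (rule res_zero[OF o sub(1)])
      finally show "t \<in> clopen_ideal X V W"
        using clopen_ideal_mem[of W t V] * s rclosed by auto
    qed
  next
    fix \<U> s assume *: "(\<forall>W\<in>\<U>. op W) \<and> s \<in> carrier (sec X (\<Union>\<U>)) \<and> (\<forall>W\<in>\<U>. res X (\<Union>\<U>) W s \<in> clopen_ideal X V W)"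
    let ?U = "\<Union>\<U>"
    have U: "op ?U" using * by auto
    have s: "s \<in> carrier (sec X ?U)" using * by simp
    have oU: "op (?U - V)" by (rule d[OF U])
    have "res X ?U (?U - V) s = \<zero>\<^bsub>sec X (?U - V)\<^esub>"
    proof (rule zero_if_germs_zero[OF oU rclosed[OF U oU _ s]])
      fix x assume x: "x \<in> ?U - V"
      then obtain W where W: "W \<in> \<U>" "x \<in> W" by auto
      have oW: "op W" "op (W - V)" using * W d by auto
      have "res X (?U - V) (W - V) (res X ?U (?U - V) s) = res X ?U (W - V) s"
        by (rule rres[OF U oU oW(2) _ _ s]) (use W in auto)
      also have "\<dots> = res X W (W - V) (res X ?U W s)"
        by (rule rres[OF U oW(1) oW(2) _ _ s, symmetric]) (use W in auto)
      also have "\<dots> = \<zero>\<^bsub>sec X (W - V)\<^esub>"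
        using clopen_ideal_mem[OF oW(1)] * W by auto
      finally show "\<exists>N. op N \<and> x \<in> N \<and> N \<subseteq> ?U - V \<and> res X (?U - V) N (res X ?U (?U - V) s) = \<zero>\<^bsub>sec X N\<^esub>"
        using oW W x by (intro exI[of _ "W - V"]) auto
    qed auto
    then show "s \<in> clopen_ideal X V ?U" using clopen_ideal_mem[OF U] s by simp
  qed
qed

lemma clopen_ideal_inside:
  assumes "op U" "U \<subseteq> V"
  shows "clopen_ideal X V U = carrier (sec X U)"
proof -
  have e: "U - V = {}" using assms by auto
  have "res X U {} s = \<zero>\<^bsub>sec X {}\<^esub>" if "s \<in> carrier (sec X U)" for s
    by (rule sec_empty, rule rclosed) (use assms that in auto)
  then show ?thesis using clopen_ideal_mem[OF assms(1), of _ V] unfolding e by blast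
qed

lemma clopen_ideal_outside:
  assumes "op U" "U \<inter> V = {}"
  shows "clopen_ideal X V U = {\<zero>\<^bsub>sec X U\<^esub>}"
proof -
  have e: "U - V = U" using assms by auto
  show ?thesis unfolding clopen_ideal_def using assms e by (auto simp: rid)
qed

text \<open>Serves both for the square of an ideal and for its extension along a morphism. Near
  points of \<open>V\<close> the generators contain 1 and generate everything; off \<open>V\<close>
  the section to be generated is zero, which every ideal contains.\<close>

lemma generated_ideal_eq_clopen_ideal:
  assumes V: "closedin (base X) V" "op V"
    and G: "\<And>W. op W \<Longrightarrow> G W \<subseteq> clopen_ideal X V W"
    and one: "\<And>U x. op U \<Longrightarrow> x \<in> U \<inter> V \<Longrightarrow> \<exists>N W. op N \<and> op W \<and> x \<in> N \<and> N \<subseteq> U \<and> N \<subseteq> W \<and>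
      \<one>\<^bsub>sec X N\<^esub> \<in> res X W N ` G W"
  shows "generated_ideal X G = clopen_ideal X V"
proof
  note I = clopen_ideal_sheaf[OF V(1)]
  fix U
  show "generated_ideal X G U = clopen_ideal X V U"
  proof (cases "op U")
    case False
    then show ?thesis unfolding generated_ideal_def clopen_ideal_def by simp
  next
    case U: True
    show ?thesis
    proof
      show "generated_ideal X G U \<subseteq> clopen_ideal X V U"
        by (rule generated_ideal_subset[OF I G U])
      show "clopen_ideal X V U \<subseteq> generated_ideal X G U"
      proof
        fix s assume "s \<in> clopen_ideal X V U"
        then have s: "s \<in> carrier (sec X U)" "res X U (U - V) s = \<zero>\<^bsub>sec X (U - V)\<^esub>"
          using clopen_ideal_mem[OF U] by auto
        have sub: "(\<Union>W \<in> {W. op W \<and> N \<subseteq> W}. res X W N ` G W) \<subseteq> carrier (sec X N)" if N: "op N" for N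
        proof (rule UN_least)
          fix W assume "W \<in> {W. op W \<and> N \<subseteq> W}"
          then have W: "op W" "N \<subseteq> W" by auto
          show "res X W N ` G W \<subseteq> carrier (sec X N)"
            using ideal_sheaf_carrier[OF I W(1)] G[OF W(1)] rclosed[OF W(1) N W(2)] by blast
        qed
        have "\<exists>N. op N \<and> x \<in> N \<and> N \<subseteq> U \<and>
          res X U N s \<in> Idl\<^bsub>sec X N\<^esub> (\<Union>W \<in> {W. op W \<and> N \<subseteq> W}. res X W N ` G W)" if x: "x \<in> U" for x
        proof (cases "x \<in> V")
          case True
          then obtain N W where N: "op N" "op W" "x \<in> N" "N \<subseteq> U" "N \<subseteq> W"
            "\<one>\<^bsub>sec X N\<^esub> \<in> res X W N ` G W" using one[OF U, of x] x by auto
          let ?S = "\<Union>W \<in> {W. op W \<and> N \<subseteq> W}. res X W N ` G W"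
          have "\<one>\<^bsub>sec X N\<^esub> \<in> Idl\<^bsub>sec X N\<^esub> ?S"
            using ring.genideal_self[OF sec_ring[OF N(1)] sub[OF N(1)]] N by auto
          then have "Idl\<^bsub>sec X N\<^esub> ?S = carrier (sec X N)"
            using ideal.one_imp_carrier[OF ring.genideal_ideal[OF sec_ring[OF N(1)] sub[OF N(1)]]] by simp
          then show ?thesis using N rclosed[OF U N(1,4) s(1)] by (intro exI[of _ N]) simp
        next
          case False
          let ?N = "U - V"
          have N: "op ?N" by (rule openin_diff[OF U V(1)])
          have "\<zero>\<^bsub>sec X ?N\<^esub> \<in> Idl\<^bsub>sec X ?N\<^esub> (\<Union>W \<in> {W. op W \<and> ?N \<subseteq> W}. res X W ?N ` G W)"
            by (rule additive_subgroup.zero_closed, rule ideal.axioms(1),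
                rule ring.genideal_ideal[OF sec_ring[OF N] sub[OF N]])
          then show ?thesis using N s False x by (intro exI[of _ ?N]) simp
        qed
        then show "s \<in> generated_ideal X G U" using generated_ideal_mem[OF U] s by simp
      qed
    qed
  qed
qed

text \<open>All generators live over \<open>U\<close> itself, so among the open sets containing
  \<open>N\<close> only \<open>U\<close> contributes; the condition on the open subspace then
  becomes one on \<open>X\<close>.\<close>

lemma finite_type_iff:
  assumes I: "I \<in> extensional {U. op U}"
  shows "finite_type_ideal X I \<longleftrightarrow> (\<forall>x \<in> topspace (base X). \<exists>U S. op U \<and> x \<in> U \<and> finite S \<and> S \<subseteq> I U \<and>
    (\<forall>V s. op V \<and> V \<subseteq> U \<longrightarrow> (s \<in> I V \<longleftrightarrow> s \<in> carrier (sec X V) \<and>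
      (\<forall>y\<in>V. \<exists>N. op N \<and> y \<in> N \<and> N \<subseteq> V \<and> res X V N s \<in> Idl\<^bsub>sec X N\<^esub> (res X U N ` S)))))"
proof -
  have E: "restrict I {V. openin (base (open_sub X U)) V} =
       generated_ideal (open_sub X U) (\<lambda>W. if W = U then S else {}) \<longleftrightarrow>
    (\<forall>V s. op V \<and> V \<subseteq> U \<longrightarrow> (s \<in> I V \<longleftrightarrow> s \<in> carrier (sec X V) \<and>
      (\<forall>y\<in>V. \<exists>N. op N \<and> y \<in> N \<and> N \<subseteq> V \<and> res X V N s \<in> Idl\<^bsub>sec X N\<^esub> (res X U N ` S))))"
    if U: "op U" for U S
  proof -
    have b: "openin (base (open_sub X U)) V \<longleftrightarrow> op V \<and> V \<subseteq> U" for V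
      unfolding open_sub_def using openin_open_subtopology[OF U, of V] by auto
    have r: "res (open_sub X U) = res X" "sec (open_sub X U) = sec X" unfolding open_sub_def by auto
    have un: "(\<Union>W \<in> {W. (op W \<and> W \<subseteq> U) \<and> N \<subseteq> W}. res X W N ` (if W = U then S else {})) = res X U N ` S"
      if "N \<subseteq> U" for N using that U by (auto split: if_splits)
    have "generated_ideal (open_sub X U) (\<lambda>W. if W = U then S else {}) =
      (\<lambda>V\<in>{V. op V \<and> V \<subseteq> U}. {s \<in> carrier (sec X V). \<forall>y\<in>V. \<exists>N. op N \<and> y \<in> N \<and> N \<subseteq> V \<and>
        res X V N s \<in> Idl\<^bsub>sec X N\<^esub> (res X U N ` S)})"
      unfolding generated_ideal_def b r
    proof (rule restrict_ext, rule Collect_cong, rule conj_cong[OF refl], rule ball_cong[OF refl], rule ex_cong1)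
      fix V s y N assume "V \<in> {V. op V \<and> V \<subseteq> U}"
      then show "((op N \<and> N \<subseteq> U) \<and> y \<in> N \<and> N \<subseteq> V \<and> res X V N s \<in> Idl\<^bsub>sec X N\<^esub>
          (\<Union>W \<in> {W. (op W \<and> W \<subseteq> U) \<and> N \<subseteq> W}. res X W N ` (if W = U then S else {}))) \<longleftrightarrow>
        (op N \<and> y \<in> N \<and> N \<subseteq> V \<and> res X V N s \<in> Idl\<^bsub>sec X N\<^esub> (res X U N ` S))"
        using un[of N] by (cases "N \<subseteq> U") auto
    qed
    then show ?thesis unfolding b by (auto simp: fun_eq_iff restrict_def)
  qed
  then show ?thesis unfolding finite_type_ideal_def
    by (intro ball_cong[OF refl] ex_cong1 conj_cong[OF refl] E)
qed

text \<open>One generator, 1, over \<open>V\<close>, and none over the complement.\<close>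

lemma clopen_ideal_finite_type:
  assumes V: "closedin (base X) V" "op V"
  shows "finite_type_ideal X (clopen_ideal X V)"
proof -
  let ?I = "clopen_ideal X V"
  note I = clopen_ideal_sheaf[OF V(1)]
  have "?I \<in> extensional {U. op U}" unfolding clopen_ideal_def by simp
  then show ?thesis unfolding finite_type_iff[OF \<open>?I \<in> extensional {U. op U}\<close>]
  proof (intro ballI)
    fix x assume x: "x \<in> topspace (base X)"
    show "\<exists>U S. op U \<and> x \<in> U \<and> finite S \<and> S \<subseteq> ?I U \<and>
    (\<forall>N s. op N \<and> N \<subseteq> U \<longrightarrow> (s \<in> ?I N \<longleftrightarrow> s \<in> carrier (sec X N) \<and>
      (\<forall>y\<in>N. \<exists>M. op M \<and> y \<in> M \<and> M \<subseteq> N \<and> res X N M s \<in> Idl\<^bsub>sec X M\<^esub> (res X U M ` S))))"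
    proof (cases "x \<in> V")
      case True
      have "s \<in> ?I N \<longleftrightarrow> s \<in> carrier (sec X N) \<and>
        (\<forall>y\<in>N. \<exists>M. op M \<and> y \<in> M \<and> M \<subseteq> N \<and> res X N M s \<in> Idl\<^bsub>sec X M\<^esub> (res X V M ` {\<one>\<^bsub>sec X V\<^esub>}))"
        if N: "op N" "N \<subseteq> V" for N s
      proof -
        have "res X V N ` {\<one>\<^bsub>sec X V\<^esub>} = {\<one>\<^bsub>sec X N\<^esub>}" using res_one[OF V(2) N] by simp
        then have "Idl\<^bsub>sec X N\<^esub> (res X V N ` {\<one>\<^bsub>sec X V\<^esub>}) = carrier (sec X N)"
          using ring.genideal_one[OF sec_ring[OF N(1)]] by simp
          then show ?thesis unfolding clopen_ideal_inside[OF N]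
          by (intro iffI conjI ballI exI[of _ N]) (use N rid[OF N(1), of s] in auto)
      qed
      then show ?thesis using True V clopen_ideal_inside[OF V(2)]
        by (intro exI[of _ V] exI[of _ "{\<one>\<^bsub>sec X V\<^esub>}"]) auto
    next
      case False
      let ?U = "topspace (base X) - V"
      have U: "op ?U" using V(1) by blast
      have "s \<in> ?I N \<longleftrightarrow> s \<in> carrier (sec X N) \<and>
        (\<forall>y\<in>N. \<exists>M. op M \<and> y \<in> M \<and> M \<subseteq> N \<and> res X N M s \<in> Idl\<^bsub>sec X M\<^esub> (res X ?U M ` {}))"
        if N: "op N" "N \<subseteq> ?U" for N s
      proof -
        have i: "Idl\<^bsub>sec X M\<^esub> (res X ?U M ` {}) = {\<zero>\<^bsub>sec X M\<^esub>}" if M: "op M" for M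
        proof
          interpret ring "sec X M" by (rule sec_ring[OF M])
          show "Idl\<^bsub>sec X M\<^esub> (res X ?U M ` {}) \<subseteq> {\<zero>\<^bsub>sec X M\<^esub>}"
            by (rule genideal_minimal[OF zeroideal]) simp
          show "{\<zero>\<^bsub>sec X M\<^esub>} \<subseteq> Idl\<^bsub>sec X M\<^esub> (res X ?U M ` {})"
            using additive_subgroup.zero_closed[OF ideal.axioms(1)[OF genideal_ideal[of "{}"]]] by simp
        qed
        have "N \<inter> V = {}" using N by auto
        then have e: "?I N = {\<zero>\<^bsub>sec X N\<^esub>}" by (rule clopen_ideal_outside[OF N(1)])
        show ?thesis
        proof
          assume "s \<in> ?I N"
          then have s: "s = \<zero>\<^bsub>sec X N\<^esub>" using e by simp
          show "s \<in> carrier (sec X N) \<and>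
            (\<forall>y\<in>N. \<exists>M. op M \<and> y \<in> M \<and> M \<subseteq> N \<and> res X N M s \<in> Idl\<^bsub>sec X M\<^esub> (res X ?U M ` {}))"
            unfolding s using N i[OF N(1)] by (auto simp: rid intro!: exI[of _ N])
        next
          assume *: "s \<in> carrier (sec X N) \<and>
            (\<forall>y\<in>N. \<exists>M. op M \<and> y \<in> M \<and> M \<subseteq> N \<and> res X N M s \<in> Idl\<^bsub>sec X M\<^esub> (res X ?U M ` {}))"
          have "s = \<zero>\<^bsub>sec X N\<^esub>"
            by (rule zero_if_germs_zero) (use * N i in blast)+
          then show "s \<in> ?I N" using e by simp
        qed
      qed
      then show ?thesis using False x U by (intro exI[of _ ?U] exI[of _ "{}"]) auto
    qed
  qed
qed

text \<open>Over \<open>U \<inter> V\<close> the ideal contains 1, and 1 is its own square, so the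
  square contains 1 near each point of \<open>V\<close>.\<close>

lemma clopen_ideal_idempotent:
  assumes V: "closedin (base X) V" "op V"
  shows "idempotent_ideal X (clopen_ideal X V)"
proof -
  let ?I = "clopen_ideal X V"
  note I = clopen_ideal_sheaf[OF V(1)]
  have "ideal_sheaf_square X ?I = ?I"
    unfolding ideal_sheaf_square_def
  proof (rule generated_ideal_eq_clopen_ideal[OF V])
    fix W assume W: "op W"
    interpret ring "sec X W" by (rule sec_ring[OF W])
    show "?I W \<cdot>\<^bsub>sec X W\<^esub> ?I W \<subseteq> ?I W"
      using ideal_prod_inter[OF ideal_sheaf_ideal[OF I W] ideal_sheaf_ideal[OF I W]] by simp
  next
    fix U x assume U: "op U" "x \<in> U \<inter> V"
    let ?N = "U \<inter> V"
    have N: "op ?N" using U V by auto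
    have "\<one>\<^bsub>sec X ?N\<^esub> \<in> ?I ?N" using clopen_ideal_inside[OF N] N by simp
    then have "\<one>\<^bsub>sec X ?N\<^esub> \<otimes>\<^bsub>sec X ?N\<^esub> \<one>\<^bsub>sec X ?N\<^esub> \<in> ?I ?N \<cdot>\<^bsub>sec X ?N\<^esub> ?I ?N"
      by (intro ideal_prod.prod)
    moreover have "\<one>\<^bsub>sec X ?N\<^esub> \<otimes>\<^bsub>sec X ?N\<^esub> \<one>\<^bsub>sec X ?N\<^esub> = \<one>\<^bsub>sec X ?N\<^esub>"
      using sec_ring[OF N] by (simp add: ring.ring_simprules)
    ultimately have "\<one>\<^bsub>sec X ?N\<^esub> \<in> res X ?N ?N ` (?I ?N \<cdot>\<^bsub>sec X ?N\<^esub> ?I ?N)"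
      using rid[OF N one_closed[OF N]] by (intro image_eqI[of _ _ "\<one>\<^bsub>sec X ?N\<^esub>"]) auto
    then show "\<exists>N W. op N \<and> op W \<and> x \<in> N \<and> N \<subseteq> U \<and> N \<subseteq> W \<and>
      \<one>\<^bsub>sec X N\<^esub> \<in> res X W N ` (?I W \<cdot>\<^bsub>sec X W\<^esub> ?I W)"
      using N U by (intro exI[of _ ?N]) auto
  qed
  then show ?thesis unfolding idempotent_ideal_def using I clopen_ideal_finite_type[OF V] by simp
qed

end

section \<open>Dichotomy at the points: an idempotent ideal is locally everything or zero\<close>

context lringed
begin

lemma germ_one_not_zero:
  assumes "op U" "x \<in> U" shows "germ X x U \<one>\<^bsub>sec X U\<^esub> \<noteq> germ X x U \<zero>\<^bsub>sec X U\<^esub>"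
  using local_ring_one_not_zero[OF stalk_local[OF op_topspace[OF assms]]] germ_one[OF assms] germ_zero[OF assms] by simp

lemma sec_one_not_zero:
  assumes "op U" "x \<in> U" shows "\<one>\<^bsub>sec X U\<^esub> \<noteq> \<zero>\<^bsub>sec X U\<^esub>"
  using germ_one_not_zero[OF assms] by auto

text \<open>If 1 lies in \<open>J\<close> over no neighbourhood of \<open>x\<close>, all germs of
  \<open>J\<close> at \<open>x\<close> are nonunits. As \<open>J\<close> is its own square, its
  finitely many generators at \<open>x\<close> lie in the maximal ideal times the ideal they
  generate, so they vanish by Nakayama's lemma; being finitely many, they vanish on one
  neighbourhood.\<close>

lemma idempotent_one_or_zero:
  assumes J: "idempotent_ideal X J" and x: "x \<in> topspace (base X)"
    and no1: "\<And>N. op N \<Longrightarrow> x \<in> N \<Longrightarrow> \<one>\<^bsub>sec X N\<^esub> \<notin> J N"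
  obtains N where "op N" "x \<in> N" "\<And>M. op M \<Longrightarrow> M \<subseteq> N \<Longrightarrow> J M = {\<zero>\<^bsub>sec X M\<^esub>}"
proof -
  have Js: "ideal_sheaf X J" and Jf: "finite_type_ideal X J" and J2: "ideal_sheaf_square X J = J"
    using J unfolding idempotent_ideal_def by auto
  have Je: "J \<in> extensional {U. op U}" using Js unfolding ideal_sheaf_def by simp
  let ?A = "stalk_ring X x"
  note loc = stalk_local[OF x]
  interpret A: cring ?A by (rule stalk_cring[OF x])
  let ?m = "carrier ?A - Units ?A"
  interpret m: maximalideal ?m ?A by (rule local_ring_nonunits(1)[OF loc])
  obtain U S where U: "op U" "x \<in> U" and S: "finite S" "S \<subseteq> J U"
    and gen: "\<forall>V s. op V \<and> V \<subseteq> U \<longrightarrow> (s \<in> J V \<longleftrightarrow> s \<in> carrier (sec X V) \<and>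
      (\<forall>y\<in>V. \<exists>N. op N \<and> y \<in> N \<and> N \<subseteq> V \<and> res X V N s \<in> Idl\<^bsub>sec X N\<^esub> (res X U N ` S)))"
    using Jf[unfolded finite_type_iff[OF Je], rule_format, OF x] by (elim exE conjE)
  have Sc: "S \<subseteq> carrier (sec X U)" using S(2) ideal_sheaf_carrier[OF Js U(1)] by auto
  define Sx where "Sx = germ X x U ` S"
  have Sx: "finite Sx" "Sx \<subseteq> carrier ?A" unfolding Sx_def using S(1) Sc U germ_closed by auto
  \<comment> \<open>A unit germ in \<open>J\<close> becomes invertible over some \<open>V\<close>,
    and multiplying by the inverse puts 1 into \<open>J V\<close>.\<close>
  have Jm: "germ X x N j \<in> ?m" if N: "op N" "x \<in> N" "j \<in> J N" for N j
  proof -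
    have jc: "j \<in> carrier (sec X N)" by (rule ideal_sheaf_carrier[OF Js N(1,3)])
    have "germ X x N j \<notin> Units ?A"
    proof
      assume "germ X x N j \<in> Units ?A"
      then obtain V t where V: "op V" "x \<in> V" "V \<subseteq> N" "t \<in> carrier (sec X V)"
        "res X N V j \<otimes>\<^bsub>sec X V\<^esub> t = \<one>\<^bsub>sec X V\<^esub>"
        unfolding germ_unit_iff[OF N(1,2) jc] by (elim exE conjE)
      have "res X N V j \<in> J V" by (rule ideal_sheaf_res[OF Js N(1) V(1,3) N(3)])
      then have "\<one>\<^bsub>sec X V\<^esub> \<in> J V"
        using ideal.I_r_closed[OF ideal_sheaf_ideal[OF Js V(1)] _ V(4)] V(5) by fastforce
      then show False using no1 V by blast
    qed
    then show ?thesis using germ_closed[OF N(1,2) jc] by simp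
  qed
  have resS: "res X U N ` S \<subseteq> carrier (sec X N)" if "op N" "N \<subseteq> U" for N
    using rclosed[OF U(1) that] Sc by blast
  have JIdl: "germ X x N j \<in> Idl\<^bsub>?A\<^esub> Sx" if N: "op N" "x \<in> N" "j \<in> J N" for N j
  proof -
    have jc: "j \<in> carrier (sec X N)" by (rule ideal_sheaf_carrier[OF Js N(1,3)])
    let ?N = "N \<inter> U"
    have N': "op ?N" "?N \<subseteq> U" "?N \<subseteq> N" "x \<in> ?N" using N U by auto
    have "res X N ?N j \<in> J ?N" by (rule ideal_sheaf_res[OF Js N(1) N'(1,3) N(3)])
    then obtain M where M: "op M" "x \<in> M" "M \<subseteq> ?N"
       "res X ?N M (res X N ?N j) \<in> Idl\<^bsub>sec X M\<^esub> (res X U M ` S)"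
      using gen[rule_format, of ?N "res X N ?N j"] N' by blast
    have MU: "M \<subseteq> U" "M \<subseteq> N" using M(3) by auto
    have "germ X x M (res X ?N M (res X N ?N j)) \<in> Idl\<^bsub>?A\<^esub> Sx"
    proof (rule ring_hom_Idl[OF sec_ring[OF M(1)] A.ring_axioms germ_hom[OF M(1,2)] resS[OF M(1) MU(1)] M(4)
        A.genideal_ideal[OF Sx(2)]])
      have "germ X x M ` res X U M ` S = Sx"
        unfolding Sx_def image_image using germ_rs[OF U(1) _ M(1,2) MU(1)] Sc by (intro image_cong) auto
      then show "germ X x M ` res X U M ` S \<subseteq> Idl\<^bsub>?A\<^esub> Sx"
        using A.genideal_self[OF Sx(2)] by simp
    qed
    then show ?thesis
      using rres[OF N(1) N'(1) M(1,3) N'(3) jc] germ_rs[OF N(1) jc M(1,2) MU(2)] by simp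
  qed
  have K: "ideal (Idl\<^bsub>?A\<^esub> Sx) ?A" by (rule A.genideal_ideal[OF Sx(2)])
  have P: "ideal (ideal_prod ?A ?m (Idl\<^bsub>?A\<^esub> Sx)) ?A" by (rule A.ideal_prod_is_ideal[OF m.is_ideal K])
  \<comment> \<open>In a product of two sections of \<open>J\<close> the germ of the first factor is
    a nonunit by \<open>Jm\<close>, and the germ of the second is a combination of the generators by
    \<open>JIdl\<close>.\<close>
  have "Sx \<subseteq> ideal_prod ?A ?m (Idl\<^bsub>?A\<^esub> Sx)"
  proof
    fix a assume "a \<in> Sx"
    then obtain s where s: "s \<in> S" "a = germ X x U s" unfolding Sx_def by auto
    have sc: "s \<in> carrier (sec X U)" using Sc s by auto
    have "s \<in> generated_ideal X (\<lambda>U. J U \<cdot>\<^bsub>sec X U\<^esub> J U) U"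
      using S(2) s J2 unfolding ideal_sheaf_square_def by auto
    then obtain V where V: "op V" "x \<in> V" "V \<subseteq> U"
      "res X U V s \<in> Idl\<^bsub>sec X V\<^esub> (\<Union>W \<in> {W. op W \<and> V \<subseteq> W}. res X W V ` (J W \<cdot>\<^bsub>sec X W\<^esub> J W))"
      unfolding generated_ideal_mem[OF U(1)] using U by meson
    have JJ: "J W \<cdot>\<^bsub>sec X W\<^esub> J W \<subseteq> carrier (sec X W)" if "op W" for W
      by (rule ring.ideal_prod_in_carrier[OF sec_ring[OF that] ideal_sheaf_ideal[OF Js that] ideal_sheaf_ideal[OF Js that]])
    have sub: "(\<Union>W \<in> {W. op W \<and> V \<subseteq> W}. res X W V ` (J W \<cdot>\<^bsub>sec X W\<^esub> J W)) \<subseteq> carrier (sec X V)"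
    proof (rule UN_least)
      fix W assume "W \<in> {W. op W \<and> V \<subseteq> W}"
      then have W: "op W" "V \<subseteq> W" by auto
      show "res X W V ` (J W \<cdot>\<^bsub>sec X W\<^esub> J W) \<subseteq> carrier (sec X V)"
        using JJ[OF W(1)] rclosed[OF W(1) V(1) W(2)] by blast
    qed
    have "germ X x V (res X U V s) \<in> ideal_prod ?A ?m (Idl\<^bsub>?A\<^esub> Sx)"
    proof (rule ring_hom_Idl[OF sec_ring[OF V(1)] A.ring_axioms germ_hom[OF V(1,2)] sub V(4) P])
      show "germ X x V ` (\<Union>W \<in> {W. op W \<and> V \<subseteq> W}. res X W V ` (J W \<cdot>\<^bsub>sec X W\<^esub> J W)) \<subseteq>
        ideal_prod ?A ?m (Idl\<^bsub>?A\<^esub> Sx)"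
      proof
        fix b assume "b \<in> germ X x V ` (\<Union>W \<in> {W. op W \<and> V \<subseteq> W}. res X W V ` (J W \<cdot>\<^bsub>sec X W\<^esub> J W))"
        then obtain W w where W: "op W" "V \<subseteq> W" "w \<in> J W \<cdot>\<^bsub>sec X W\<^esub> J W" "b = germ X x V (res X W V w)" by auto
        have xW: "x \<in> W" using W V by auto
        have "b = germ X x W w" using germ_rs[OF W(1) subsetD[OF JJ[OF W(1)] W(3)] V(1,2) W(2)] W(4) by simp
        moreover have "germ X x W w \<in> ideal_prod ?A ?m (Idl\<^bsub>?A\<^esub> Sx)"
          using W(3)
        proof induction
          case (prod i j)
          note c = ideal_sheaf_carrier[OF Js W(1)]
          have "germ X x W i \<otimes>\<^bsub>?A\<^esub> germ X x W j \<in> ideal_prod ?A ?m (Idl\<^bsub>?A\<^esub> Sx)"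
            by (rule ideal_prod.prod[OF Jm[OF W(1) xW prod(1)] JIdl[OF W(1) xW prod(2)]])
          then show ?case using germ_mult[OF W(1) xW c[OF prod(1)] c[OF prod(2)]] by simp
        next
          case (sum i j)
          note c = subsetD[OF JJ[OF W(1)]]
          show ?case
            using ideal_prod.sum[OF sum.IH] germ_add[OF W(1) xW c[OF sum.hyps(1)] c[OF sum.hyps(2)]] by simp
        qed
        ultimately show "b \<in> ideal_prod ?A ?m (Idl\<^bsub>?A\<^esub> Sx)" by simp
      qed
    qed
    then show "a \<in> ideal_prod ?A ?m (Idl\<^bsub>?A\<^esub> Sx)"
      using germ_rs[OF U(1) sc V(1,2,3)] s by simp
  qed
  then have Sx0: "Sx \<subseteq> {\<zero>\<^bsub>?A\<^esub>}" by (rule local_ring_Nakayama[OF loc Sx])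
  \<comment> \<open>Induction over finite sets of generators intersects the neighbourhoods on which
    single generators vanish.\<close>
  have "\<exists>N. op N \<and> x \<in> N \<and> N \<subseteq> U \<and> (\<forall>s\<in>T. res X U N s = \<zero>\<^bsub>sec X N\<^esub>)" if "finite T" "T \<subseteq> S" for T
    using that
  proof induction
    case empty
    then show ?case using U by auto
  next
    case (insert s T)
    then obtain N where N: "op N" "x \<in> N" "N \<subseteq> U" "\<forall>s\<in>T. res X U N s = \<zero>\<^bsub>sec X N\<^esub>" by auto
    have s: "s \<in> S" "s \<in> carrier (sec X U)" using insert Sc by auto
    have "germ X x U s = germ X x U \<zero>\<^bsub>sec X U\<^esub>"
      using Sx0 s germ_zero[OF U] unfolding Sx_def by auto
    then obtain W where W: "op W" "x \<in> W" "W \<subseteq> U" "res X U W s = \<zero>\<^bsub>sec X W\<^esub>"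
      using germ_eq[OF U s(2) U zero_closed[OF U(1)]] res_zero[OF U(1)] by auto
    let ?M = "N \<inter> W"
    have M: "op ?M" "x \<in> ?M" "?M \<subseteq> N" "?M \<subseteq> W" "?M \<subseteq> U" using N W by auto
    have "res X U ?M t = \<zero>\<^bsub>sec X ?M\<^esub>" if "t \<in> insert s T" for t
    proof (cases "t = s")
      case True
      have "res X U ?M s = res X W ?M (res X U W s)"
        by (rule rres[OF U(1) W(1) M(1,4) W(3) s(2), symmetric])
      then show ?thesis using W(4) res_zero[OF W(1) M(1,4)] True by simp
    next
      case False
      then have t: "t \<in> T" "t \<in> carrier (sec X U)" using that insert Sc by auto
      have "res X U ?M t = res X N ?M (res X U N t)"
        by (rule rres[OF U(1) N(1) M(1,3) N(3) t(2), symmetric])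
      then show ?thesis using N(4) res_zero[OF N(1) M(1,3)] t by simp
    qed
    then show ?case using M by (intro exI[of _ ?M]) simp
  qed
  then obtain N where N: "op N" "x \<in> N" "N \<subseteq> U" "\<forall>s\<in>S. res X U N s = \<zero>\<^bsub>sec X N\<^esub>"
    using S(1) by blast
  show ?thesis
  proof (rule that[OF N(1,2)])
    fix M assume M: "op M" "M \<subseteq> N"
    have MU: "M \<subseteq> U" using M N by auto
    have "j = \<zero>\<^bsub>sec X M\<^esub>" if j: "j \<in> J M" for j
    proof (rule zero_if_germs_zero[OF M(1) ideal_sheaf_carrier[OF Js M(1) j]])
      fix y assume "y \<in> M"
      then obtain L where L: "op L" "y \<in> L" "L \<subseteq> M" "res X M L j \<in> Idl\<^bsub>sec X L\<^esub> (res X U L ` S)"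
        using gen[rule_format, of M j] M(1) MU j by blast
      interpret L: ring "sec X L" by (rule sec_ring[OF L(1)])
      have LN: "L \<subseteq> N" using L M by auto
      have "res X U L s = \<zero>\<^bsub>sec X L\<^esub>" if "s \<in> S" for s
      proof -
        have "res X U L s = res X N L (res X U N s)"
          by (rule rres[OF U(1) N(1) L(1) LN N(3) subsetD[OF Sc that], symmetric])
        then show ?thesis using N(4) that res_zero[OF N(1) L(1) LN] by simp
      qed
      then have "Idl\<^bsub>sec X L\<^esub> (res X U L ` S) \<subseteq> {\<zero>\<^bsub>sec X L\<^esub>}"
        by (intro L.genideal_minimal[OF L.zeroideal]) auto
      then show "\<exists>V. op V \<and> y \<in> V \<and> V \<subseteq> M \<and> res X M V j = \<zero>\<^bsub>sec X V\<^esub>" using L by blast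
    qed
    moreover have "\<zero>\<^bsub>sec X M\<^esub> \<in> J M"
      using additive_subgroup.zero_closed[OF ideal.axioms(1)[OF ideal_sheaf_ideal[OF Js M(1)]]] .
    ultimately show "J M = {\<zero>\<^bsub>sec X M\<^esub>}" by blast
  qed
qed

text \<open>The union \<open>V\<close> of the open sets over which \<open>J\<close> contains 1 is
  open. By the dichotomy every other point has a neighbourhood on which \<open>J\<close> is zero,
  and this neighbourhood misses \<open>V\<close> because 1 differs from 0 over nonempty open sets.
  So \<open>V\<close> is also closed, and \<open>J\<close> agrees locally with the ideal of
  \<open>V\<close>.\<close>

lemma idempotent_is_clopen_ideal:
  assumes J: "idempotent_ideal X J"
  obtains V where "closedin (base X) V" "op V" "J = clopen_ideal X V"
proof -
  have Js: "ideal_sheaf X J" using J unfolding idempotent_ideal_def by auto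
  have Je: "J \<in> extensional {U. op U}" using Js unfolding ideal_sheaf_def by simp
  define V where "V = \<Union>{N. op N \<and> \<one>\<^bsub>sec X N\<^esub> \<in> J N}"
  have V: "op V" unfolding V_def by auto
  have zero: "\<exists>N. op N \<and> x \<in> N \<and> (\<forall>M. op M \<and> M \<subseteq> N \<longrightarrow> J M = {\<zero>\<^bsub>sec X M\<^esub>})"
    if x: "x \<in> topspace (base X)" "x \<notin> V" for x
  proof -
    have "\<one>\<^bsub>sec X N\<^esub> \<notin> J N" if "op N" "x \<in> N" for N using that x(2) unfolding V_def by auto
    then have n: "\<And>N. op N \<Longrightarrow> x \<in> N \<Longrightarrow> \<one>\<^bsub>sec X N\<^esub> \<notin> J N" .
    show ?thesis by (rule idempotent_one_or_zero[OF J x(1) n], assumption+) (intro exI conjI allI impI, assumption+, simp)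
  qed
  have disj: "N \<inter> V = {}" if N: "op N" "\<forall>M. op M \<and> M \<subseteq> N \<longrightarrow> J M = {\<zero>\<^bsub>sec X M\<^esub>}" for N
  proof (rule ccontr)
    assume "N \<inter> V \<noteq> {}"
    then obtain y M where y: "y \<in> N" "y \<in> M" "op M" "\<one>\<^bsub>sec X M\<^esub> \<in> J M" unfolding V_def by auto
    have o: "op (M \<inter> N)" using y N by auto
    have "res X M (M \<inter> N) \<one>\<^bsub>sec X M\<^esub> \<in> J (M \<inter> N)"
      by (rule ideal_sheaf_res[OF Js y(3) o _ y(4)]) simp
    then have "\<one>\<^bsub>sec X (M \<inter> N)\<^esub> = \<zero>\<^bsub>sec X (M \<inter> N)\<^esub>"
      using res_one[OF y(3) o] N(2) o by auto
    then show False using sec_one_not_zero[OF o, of y] y by simp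
  qed
  have cl: "closedin (base X) V"
  proof -
    have "op (topspace (base X) - V)"
    proof (subst openin_subopen, intro ballI)
      fix x assume x: "x \<in> topspace (base X) - V"
      then obtain N where N: "op N" "x \<in> N" "\<forall>M. op M \<and> M \<subseteq> N \<longrightarrow> J M = {\<zero>\<^bsub>sec X M\<^esub>}"
        using zero[of x] by auto
      then show "\<exists>T. op T \<and> x \<in> T \<and> T \<subseteq> topspace (base X) - V"
        using disj[OF N(1,3)] openin_subset[OF N(1)] by blast
    qed
    then show ?thesis unfolding closedin_def using openin_subset[OF V] by simp
  qed
  have "J U = clopen_ideal X V U" if U: "op U" for U
  proof
    have oUV: "op (U - V)" by (rule openin_diff[OF U cl])
    show "J U \<subseteq> clopen_ideal X V U"
    proof
      fix s assume s: "s \<in> J U"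
      have sc: "s \<in> carrier (sec X U)" by (rule ideal_sheaf_carrier[OF Js U s])
      have "res X U (U - V) s = \<zero>\<^bsub>sec X (U - V)\<^esub>"
      proof (rule zero_if_germs_zero[OF oUV rclosed[OF U oUV _ sc]])
        fix x assume x: "x \<in> U - V"
        then obtain N where N: "op N" "x \<in> N" "\<forall>M. op M \<and> M \<subseteq> N \<longrightarrow> J M = {\<zero>\<^bsub>sec X M\<^esub>}"
          using zero[of x] op_topspace[OF U] by auto
        let ?M = "(U - V) \<inter> N"
        have M: "op ?M" using oUV N by auto
        have "res X U ?M s \<in> J ?M" by (rule ideal_sheaf_res[OF Js U M _ s]) auto
        then have "res X U ?M s = \<zero>\<^bsub>sec X ?M\<^esub>" using N(3) M by auto
        moreover have "res X (U - V) ?M (res X U (U - V) s) = res X U ?M s"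
          by (rule rres[OF U oUV M _ _ sc]) auto
        ultimately show "\<exists>W. op W \<and> x \<in> W \<and> W \<subseteq> U - V \<and> res X (U - V) W (res X U (U - V) s) = \<zero>\<^bsub>sec X W\<^esub>"
          using M N x by (intro exI[of _ ?M]) auto
      qed auto
      then show "s \<in> clopen_ideal X V U" using clopen_ideal_mem[OF U] sc by simp
    qed
    show "clopen_ideal X V U \<subseteq> J U"
    proof
      fix s assume "s \<in> clopen_ideal X V U"
      then have s: "s \<in> carrier (sec X U)" "res X U (U - V) s = \<zero>\<^bsub>sec X (U - V)\<^esub>"
        using clopen_ideal_mem[OF U] by auto
      show "s \<in> J U"
      proof (rule ideal_sheaf_local[OF Js U s(1)])
        fix x assume x: "x \<in> U"
        show "\<exists>W. op W \<and> x \<in> W \<and> W \<subseteq> U \<and> res X U W s \<in> J W"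
        proof (cases "x \<in> V")
          case True
          then obtain N where N: "op N" "x \<in> N" "\<one>\<^bsub>sec X N\<^esub> \<in> J N" unfolding V_def by auto
          let ?M = "U \<inter> N"
          have M: "op ?M" using U N by auto
          have "res X N ?M \<one>\<^bsub>sec X N\<^esub> \<in> J ?M" by (rule ideal_sheaf_res[OF Js N(1) M _ N(3)]) simp
          then have "\<one>\<^bsub>sec X ?M\<^esub> \<in> J ?M" using res_one[OF N(1) M] by simp
          then have "J ?M = carrier (sec X ?M)" by (rule ideal_sheaf_one[OF Js M])
          then show ?thesis using M N x rclosed[OF U M _ s(1)] by (intro exI[of _ ?M]) auto
        next
          case False
          have "\<zero>\<^bsub>sec X (U - V)\<^esub> \<in> J (U - V)"
            using additive_subgroup.zero_closed[OF ideal.axioms(1)[OF ideal_sheaf_ideal[OF Js oUV]]] .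
          then show ?thesis using False x oUV s by (intro exI[of _ "U - V"]) auto
        qed
      qed
    qed
  qed
  then have "J = clopen_ideal X V"
    using Je by (intro extensionalityI[OF Je, of "clopen_ideal X V"]) (auto simp: clopen_ideal_def)
  then show ?thesis using that cl V by blast
qed

text \<open>The section 1 over \<open>V\<close> lies in the first ideal, hence in the second, so 1
  equals 0 over \<open>V - W\<close>; since the stalks are nonzero, that set is empty.\<close>

lemma clopen_ideal_inj:
  assumes V: "op V" "closedin (base X) V" and W: "op W" "closedin (base X) W"
    and eq: "clopen_ideal X V = clopen_ideal X W"
  shows "V = W"
proof -
  have "V \<subseteq> W" if V: "op V" "closedin (base X) V" and W: "op W" "closedin (base X) W"
    and eq: "clopen_ideal X V = clopen_ideal X W" for V W
  proof
    fix x assume x: "x \<in> V"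
    have o: "op (V - W)" by (rule openin_diff[OF V(1) W(2)])
    have "\<one>\<^bsub>sec X V\<^esub> \<in> clopen_ideal X W V"
      using clopen_ideal_inside[OF V(1), of V] eq V by simp
    then have "res X V (V - W) \<one>\<^bsub>sec X V\<^esub> = \<zero>\<^bsub>sec X (V - W)\<^esub>"
      using clopen_ideal_mem[OF V(1)] by simp
    then have "\<one>\<^bsub>sec X (V - W)\<^esub> = \<zero>\<^bsub>sec X (V - W)\<^esub>" using res_one[OF V(1) o] by simp
    then show "x \<in> W" using sec_one_not_zero[OF o, of x] x by auto
  qed
  from this[OF V W eq] this[OF W V eq[symmetric]] show ?thesis by (rule subset_antisym)
qed

end

section \<open>Morphisms of locally ringed spaces\<close>

locale lrs_mor = X: lringed X + Y: lringed Y
  for X :: "('x, 'a) ringed_space" and Y :: "('y, 'b) ringed_space" +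
  fixes f :: "('x, 'a, 'y, 'b) morphism"
  assumes mor: "lrs_morphism X Y f"
begin

lemma cont: "continuous_map (base X) (base Y) (pt_map f)"
  using mor unfolding lrs_morphism_def by simp

lemma preim_open: "Y.op V \<Longrightarrow> X.op (preim X f V)"
  unfolding preim_def using openin_continuous_map_preimage[OF cont] by simp

lemma preim_closed: "closedin (base Y) V \<Longrightarrow> closedin (base X) (preim X f V)"
  unfolding preim_def using closedin_continuous_map_preimage[OF cont] by simp

lemma preim_mem: "x \<in> preim X f V \<longleftrightarrow> x \<in> topspace (base X) \<and> pt_map f x \<in> V"
  unfolding preim_def by simp

lemma preim_mono: "V \<subseteq> W \<Longrightarrow> preim X f V \<subseteq> preim X f W"
  unfolding preim_def by auto

lemma pt_closed: "x \<in> topspace (base X) \<Longrightarrow> pt_map f x \<in> topspace (base Y)"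
  using cont unfolding continuous_map_def by auto

lemma sec_hom: "Y.op V \<Longrightarrow> sec_map f V \<in> ring_hom (sec Y V) (sec X (preim X f V))"
  using mor unfolding lrs_morphism_def by simp

lemma sec_closed: "Y.op V \<Longrightarrow> s \<in> carrier (sec Y V) \<Longrightarrow> sec_map f V s \<in> carrier (sec X (preim X f V))"
  using ring_hom_closed[OF sec_hom] .

lemma sec_res: "Y.op V \<Longrightarrow> Y.op W \<Longrightarrow> W \<subseteq> V \<Longrightarrow> s \<in> carrier (sec Y V) \<Longrightarrow>
  sec_map f W (res Y V W s) = res X (preim X f V) (preim X f W) (sec_map f V s)"
  using mor unfolding lrs_morphism_def by simp

text \<open>\<open>stalk_map\<close> picks its value by description over all representatives;
  compatibility of \<open>f\<close> with restriction makes the value independent of them.\<close>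

lemma stalk_map_germ:
  assumes x: "x \<in> topspace (base X)" and V: "Y.op V" "pt_map f x \<in> V" "s \<in> carrier (sec Y V)"
  shows "stalk_map X Y f x (germ Y (pt_map f x) V s) = germ X x (preim X f V) (sec_map f V s)"
  unfolding stalk_map_def
proof (rule the_equality)
  show "\<exists>V' s'. Y.op V' \<and> pt_map f x \<in> V' \<and> s' \<in> carrier (sec Y V') \<and>
    germ Y (pt_map f x) V s = germ Y (pt_map f x) V' s' \<and>
    germ X x (preim X f V) (sec_map f V s) = germ X x (preim X f V') (sec_map f V' s')"
    using V by (intro exI[of _ V] exI[of _ s]) simp
  fix c assume "\<exists>V' s'. Y.op V' \<and> pt_map f x \<in> V' \<and> s' \<in> carrier (sec Y V') \<and>
    germ Y (pt_map f x) V s = germ Y (pt_map f x) V' s' \<and> c = germ X x (preim X f V') (sec_map f V' s')"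
  then obtain V' s' where V': "Y.op V'" "pt_map f x \<in> V'" "s' \<in> carrier (sec Y V')"
    "germ Y (pt_map f x) V s = germ Y (pt_map f x) V' s'" "c = germ X x (preim X f V') (sec_map f V' s')"
    by (elim exE conjE)
  obtain W where W: "Y.op W" "pt_map f x \<in> W" "W \<subseteq> V \<inter> V'" "res Y V W s = res Y V' W s'"
    using V'(4) unfolding Y.germ_eq[OF V V'(1-3)] by (elim exE conjE)
  have sub: "W \<subseteq> V" "W \<subseteq> V'" using W by auto
  have px: "x \<in> preim X f W" using x W preim_mem by simp
  have "germ X x (preim X f V) (sec_map f V s) = germ X x (preim X f W) (sec_map f W (res Y V W s))"
    unfolding sec_res[OF V(1) W(1) sub(1) V(3)]
    by (rule X.germ_rs[OF preim_open[OF V(1)] sec_closed[OF V(1,3)] preim_open[OF W(1)] px preim_mono[OF sub(1)], symmetric])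
  also have "\<dots> = c"
    unfolding W(4) V'(5) sec_res[OF V'(1) W(1) sub(2) V'(3)]
    by (rule X.germ_rs[OF preim_open[OF V'(1)] sec_closed[OF V'(1,3)] preim_open[OF W(1)] px preim_mono[OF sub(2)]])
  finally show "c = germ X x (preim X f V) (sec_map f V s)" by simp
qed

lemma stalk_map_local: "x \<in> topspace (base X) \<Longrightarrow> local_hom (stalk_ring Y (pt_map f x)) (stalk_ring X x) (stalk_map X Y f x)"
  using mor unfolding lrs_morphism_def by simp

lemma stalk_map_hom: "x \<in> topspace (base X) \<Longrightarrow> stalk_map X Y f x \<in> ring_hom (stalk_ring Y (pt_map f x)) (stalk_ring X x)"
  using stalk_map_local unfolding local_hom_def by simp

lemma stalk_map_unit_iff:
  assumes "x \<in> topspace (base X)" "a \<in> carrier (stalk_ring Y (pt_map f x))"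
  shows "stalk_map X Y f x a \<in> Units (stalk_ring X x) \<longleftrightarrow> a \<in> Units (stalk_ring Y (pt_map f x))"
  using local_hom_unit_iff[OF Y.stalk_local[OF pt_closed] X.stalk_local stalk_map_local] assms by simp

text \<open>Locates the image of a point: unit germs of pulled back sections upstairs decide which
  sections have unit germs at the image downstairs.\<close>

lemma sec_unit_iff:
  assumes "x \<in> topspace (base X)" "Y.op V" "pt_map f x \<in> V" "s \<in> carrier (sec Y V)"
  shows "germ X x (preim X f V) (sec_map f V s) \<in> Units (stalk_ring X x) \<longleftrightarrow>
    germ Y (pt_map f x) V s \<in> Units (stalk_ring Y (pt_map f x))"
  using stalk_map_unit_iff[OF assms(1) Y.germ_closed[OF assms(2-4)]] stalk_map_germ[OF assms] by simp

text \<open>A section vanishing off \<open>V\<close> pulls back to one vanishing off the preimage of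
  \<open>V\<close>, and 1 over \<open>V\<close> pulls back to 1; these are the two conditions of
  \<open>generated_ideal_eq_clopen_ideal\<close>.\<close>

lemma extended_clopen_ideal:
  assumes V: "closedin (base Y) V" "Y.op V"
  shows "extended_ideal X Y f (clopen_ideal Y V) = clopen_ideal X (preim X f V)"
  unfolding extended_ideal_def
proof (rule X.generated_ideal_eq_clopen_ideal[OF preim_closed[OF V(1)] preim_open[OF V(2)]])
  fix W assume W: "X.op W"
  show "(\<Union>N \<in> {N. Y.op N \<and> preim X f N = W}. sec_map f N ` clopen_ideal Y V N) \<subseteq> clopen_ideal X (preim X f V) W"
  proof
    fix t assume "t \<in> (\<Union>N \<in> {N. Y.op N \<and> preim X f N = W}. sec_map f N ` clopen_ideal Y V N)"
    then obtain N s where N: "Y.op N" "preim X f N = W" "s \<in> clopen_ideal Y V N" "t = sec_map f N s" by auto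
    have s: "s \<in> carrier (sec Y N)" "res Y N (N - V) s = \<zero>\<^bsub>sec Y (N - V)\<^esub>"
      using Y.clopen_ideal_mem[OF N(1)] N(3) by auto
    have o: "Y.op (N - V)" by (rule openin_diff[OF N(1) V(1)])
    have p: "preim X f (N - V) = W - preim X f V" unfolding N(2)[symmetric] preim_def by auto
    have "res X W (W - preim X f V) t = sec_map f (N - V) (res Y N (N - V) s)"
      using sec_res[OF N(1) o _ s(1)] unfolding N(2,4) p by auto
    also have "\<dots> = \<zero>\<^bsub>sec X (W - preim X f V)\<^esub>"
      unfolding s(2) p[symmetric] using ring_hom_zero[OF sec_hom[OF o] Y.sec_ring[OF o] X.sec_ring[OF preim_open[OF o]]] .
    finally show "t \<in> clopen_ideal X (preim X f V) W"
      using X.clopen_ideal_mem[OF W] sec_closed[OF N(1) s(1)] N by simp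
  qed
next
  fix U x assume U: "X.op U" "x \<in> U \<inter> preim X f V"
  let ?W = "preim X f V" and ?N = "U \<inter> preim X f V"
  have o: "X.op ?W" "X.op ?N" using U preim_open[OF V(2)] by auto
  have "\<one>\<^bsub>sec Y V\<^esub> \<in> clopen_ideal Y V V" using Y.clopen_ideal_inside[OF V(2)] V by simp
  then have "\<one>\<^bsub>sec X ?W\<^esub> \<in> (\<Union>N \<in> {N. Y.op N \<and> preim X f N = ?W}. sec_map f N ` clopen_ideal Y V N)"
    using ring_hom_one[OF sec_hom[OF V(2)]] V(2) by force
  then have "\<one>\<^bsub>sec X ?N\<^esub> \<in> res X ?W ?N ` (\<Union>N \<in> {N. Y.op N \<and> preim X f N = ?W}. sec_map f N ` clopen_ideal Y V N)"
    using X.res_one[OF o] by force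
  then show "\<exists>N W. X.op N \<and> X.op W \<and> x \<in> N \<and> N \<subseteq> U \<and> N \<subseteq> W \<and>
      \<one>\<^bsub>sec X N\<^esub> \<in> res X W N ` (\<Union>N \<in> {N. Y.op N \<and> preim X f N = W}. sec_map f N ` clopen_ideal Y V N)"
    using o U by (intro exI[of _ ?N] exI[of _ ?W]) auto
qed

end


section \<open>Fractions and spectra\<close>

locale mult_set = cring R for R (structure) +
  fixes S :: "'a set"
  assumes S_carrier: "S \<subseteq> carrier R" and S_one: "\<one> \<in> S"
    and S_mult: "\<And>s t. s \<in> S \<Longrightarrow> t \<in> S \<Longrightarrow> s \<otimes> t \<in> S"
begin

lemma S_closed [simp]: "s \<in> S \<Longrightarrow> s \<in> carrier R"
  using S_carrier by auto

lemma frac_eq_iff: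
  assumes a: "a \<in> carrier R" "s \<in> S" and b: "b \<in> carrier R" "t \<in> S"
  shows "frac R S a s = frac R S b t \<longleftrightarrow> (\<exists>u\<in>S. u \<otimes> (t \<otimes> a) = u \<otimes> (s \<otimes> b))"
proof
  assume e: "frac R S a s = frac R S b t"
  have "(b, t) \<in> frac R S b t" unfolding frac_def using b S_one by auto
  then have "(b, t) \<in> frac R S a s" unfolding e .
  then show "\<exists>u\<in>S. u \<otimes> (t \<otimes> a) = u \<otimes> (s \<otimes> b)" unfolding frac_def by simp
next
  have sub: "frac R S a s \<subseteq> frac R S b t"
    if a: "a \<in> carrier R" "s \<in> S" and b: "b \<in> carrier R" "t \<in> S"
    and u: "u \<in> S" "u \<otimes> (t \<otimes> a) = u \<otimes> (s \<otimes> b)" for a s b t u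
  proof
    fix p assume "p \<in> frac R S a s"
    then obtain c r v where p: "p = (c, r)" "c \<in> carrier R" "r \<in> S" "v \<in> S"
      "v \<otimes> (r \<otimes> a) = v \<otimes> (s \<otimes> c)" unfolding frac_def by auto
    \<comment> \<open>The middle denominator \<open>s\<close> enters as an extra factor since it
      cannot be cancelled.\<close>
    let ?w = "u \<otimes> v \<otimes> s"
    have "?w \<otimes> (r \<otimes> b) = v \<otimes> r \<otimes> (u \<otimes> (s \<otimes> b))"
      using a b u p by (simp add: m_ac)
    also have "\<dots> = v \<otimes> r \<otimes> (u \<otimes> (t \<otimes> a))" unfolding u(2) ..
    also have "\<dots> = u \<otimes> t \<otimes> (v \<otimes> (r \<otimes> a))"
      using a b u(1) p(2-4) by (simp add: m_ac)
    also have "\<dots> = u \<otimes> t \<otimes> (v \<otimes> (s \<otimes> c))" unfolding p(5) ..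
    also have "\<dots> = ?w \<otimes> (t \<otimes> c)"
      using a b u(1) p(2-4) by (simp add: m_ac)
    finally have "\<exists>w\<in>S. w \<otimes> (r \<otimes> b) = w \<otimes> (t \<otimes> c)"
      using S_mult u a p by blast
    then show "p \<in> frac R S b t" unfolding frac_def using p(1-3) by simp
  qed
  assume "\<exists>u\<in>S. u \<otimes> (t \<otimes> a) = u \<otimes> (s \<otimes> b)"
  then obtain u where u: "u \<in> S" "u \<otimes> (t \<otimes> a) = u \<otimes> (s \<otimes> b)" by auto
  show "frac R S a s = frac R S b t"
    using sub[OF a b u] sub[OF b a u(1) u(2)[symmetric]] by (rule subset_antisym)
qed

lemma frac_op_frac:
  assumes num: "\<And>a s b t a' s' b' t'. a \<in> carrier R \<Longrightarrow> s \<in> S \<Longrightarrow> b \<in> carrier R \<Longrightarrow> t \<in> S \<Longrightarrow>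
      a' \<in> carrier R \<Longrightarrow> s' \<in> S \<Longrightarrow> b' \<in> carrier R \<Longrightarrow> t' \<in> S \<Longrightarrow>
      frac R S a s = frac R S a' s' \<Longrightarrow> frac R S b t = frac R S b' t' \<Longrightarrow>
      frac R S (num a s b t) (s \<otimes> t) = frac R S (num a' s' b' t') (s' \<otimes> t')"
    and a: "a \<in> carrier R" "s \<in> S" "b \<in> carrier R" "t \<in> S"
  shows "frac_op R S num (frac R S a s) (frac R S b t) = frac R S (num a s b t) (s \<otimes> t)"
  unfolding frac_op_def
proof (rule the_equality)
  show "\<exists>a' s' b' t'. a' \<in> carrier R \<and> s' \<in> S \<and> b' \<in> carrier R \<and> t' \<in> S \<and>
     frac R S a s = frac R S a' s' \<and> frac R S b t = frac R S b' t' \<and>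
     frac R S (num a s b t) (s \<otimes> t) = frac R S (num a' s' b' t') (s' \<otimes> t')"
    using a by (intro exI[of _ a] exI[of _ s] exI[of _ b] exI[of _ t]) simp
  fix z assume "\<exists>a' s' b' t'. a' \<in> carrier R \<and> s' \<in> S \<and> b' \<in> carrier R \<and> t' \<in> S \<and>
     frac R S a s = frac R S a' s' \<and> frac R S b t = frac R S b' t' \<and>
     z = frac R S (num a' s' b' t') (s' \<otimes> t')"
  then obtain a' s' b' t' where *: "a' \<in> carrier R" "s' \<in> S" "b' \<in> carrier R" "t' \<in> S"
    "frac R S a s = frac R S a' s'" "frac R S b t = frac R S b' t'"
    "z = frac R S (num a' s' b' t') (s' \<otimes> t')" by (elim exE conjE)
  show "z = frac R S (num a s b t) (s \<otimes> t)"
    unfolding *(7) by (rule num[OF a *(1-6), symmetric])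
qed

lemma frac_mult:
  assumes "a \<in> carrier R" "s \<in> S" "b \<in> carrier R" "t \<in> S"
  shows "frac R S a s \<otimes>\<^bsub>localization R S\<^esub> frac R S b t = frac R S (a \<otimes> b) (s \<otimes> t)"
proof -
  have "frac_op R S (\<lambda>a s b t. a \<otimes> b) (frac R S a s) (frac R S b t) = frac R S (a \<otimes> b) (s \<otimes> t)"
  proof (rule frac_op_frac[of "\<lambda>a s b t. a \<otimes> b", OF _ assms])
    fix a s b t a' s' b' t' assume *: "a \<in> carrier R" "s \<in> S" "b \<in> carrier R" "t \<in> S"
      "a' \<in> carrier R" "s' \<in> S" "b' \<in> carrier R" "t' \<in> S"
      "frac R S a s = frac R S a' s'" "frac R S b t = frac R S b' t'"
    obtain u where u: "u \<in> S" "u \<otimes> (s' \<otimes> a) = u \<otimes> (s \<otimes> a')" using * frac_eq_iff[OF *(1,2,5,6)] by auto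
    obtain v where v: "v \<in> S" "v \<otimes> (t' \<otimes> b) = v \<otimes> (t \<otimes> b')" using * frac_eq_iff[OF *(3,4,7,8)] by auto
    have "(u \<otimes> v) \<otimes> ((s' \<otimes> t') \<otimes> (a \<otimes> b)) = (u \<otimes> (s' \<otimes> a)) \<otimes> (v \<otimes> (t' \<otimes> b))"
      using * u(1) v(1) by (simp add: m_ac)
    also have "\<dots> = (u \<otimes> (s \<otimes> a')) \<otimes> (v \<otimes> (t \<otimes> b'))" unfolding u v ..
    also have "\<dots> = (u \<otimes> v) \<otimes> ((s \<otimes> t) \<otimes> (a' \<otimes> b'))" using * u(1) v(1) by (simp add: m_ac)
    finally show "frac R S (a \<otimes> b) (s \<otimes> t) = frac R S (a' \<otimes> b') (s' \<otimes> t')"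
      using * S_mult S_mult[OF u(1) v(1)] by (subst frac_eq_iff) auto
  qed
  then show ?thesis unfolding localization_def by simp
qed

lemma frac_add:
  assumes "a \<in> carrier R" "s \<in> S" "b \<in> carrier R" "t \<in> S"
  shows "frac R S a s \<oplus>\<^bsub>localization R S\<^esub> frac R S b t = frac R S (t \<otimes> a \<oplus> s \<otimes> b) (s \<otimes> t)"
proof -
  have "frac_op R S (\<lambda>a s b t. t \<otimes> a \<oplus> s \<otimes> b) (frac R S a s) (frac R S b t) = frac R S (t \<otimes> a \<oplus> s \<otimes> b) (s \<otimes> t)"
  proof (rule frac_op_frac[of "\<lambda>a s b t. t \<otimes> a \<oplus> s \<otimes> b", OF _ assms])
    fix a s b t a' s' b' t' assume *: "a \<in> carrier R" "s \<in> S" "b \<in> carrier R" "t \<in> S"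
      "a' \<in> carrier R" "s' \<in> S" "b' \<in> carrier R" "t' \<in> S"
      "frac R S a s = frac R S a' s'" "frac R S b t = frac R S b' t'"
    obtain u where u: "u \<in> S" "u \<otimes> (s' \<otimes> a) = u \<otimes> (s \<otimes> a')" using * frac_eq_iff[OF *(1,2,5,6)] by auto
    obtain v where v: "v \<in> S" "v \<otimes> (t' \<otimes> b) = v \<otimes> (t \<otimes> b')" using * frac_eq_iff[OF *(3,4,7,8)] by auto
    have c: "s \<in> carrier R" "t \<in> carrier R" "s' \<in> carrier R" "t' \<in> carrier R" "u \<in> carrier R" "v \<in> carrier R"
      using * u v by auto
    have "(u \<otimes> v) \<otimes> ((s' \<otimes> t') \<otimes> (t \<otimes> a \<oplus> s \<otimes> b)) =
      (u \<otimes> (s' \<otimes> a)) \<otimes> (v \<otimes> t \<otimes> t') \<oplus> (v \<otimes> (t' \<otimes> b)) \<otimes> (u \<otimes> s \<otimes> s')"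
      using *(1,3,5,7) c by algebra
    also have "\<dots> = (u \<otimes> (s \<otimes> a')) \<otimes> (v \<otimes> t \<otimes> t') \<oplus> (v \<otimes> (t \<otimes> b')) \<otimes> (u \<otimes> s \<otimes> s')" unfolding u v ..
    also have "\<dots> = (u \<otimes> v) \<otimes> ((s \<otimes> t) \<otimes> (t' \<otimes> a' \<oplus> s' \<otimes> b'))" using *(1,3,5,7) c by algebra
    finally show "frac R S (t \<otimes> a \<oplus> s \<otimes> b) (s \<otimes> t) = frac R S (t' \<otimes> a' \<oplus> s' \<otimes> b') (s' \<otimes> t')"
      using * S_mult S_mult[OF u(1) v(1)] by (subst frac_eq_iff) auto
  qed
  then show ?thesis unfolding localization_def by simp
qed

lemma frac_closed: "a \<in> carrier R \<Longrightarrow> s \<in> S \<Longrightarrow> frac R S a s \<in> carrier (localization R S)"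
  unfolding localization_def by auto

lemma frac_add_1:
  assumes "a \<in> carrier R" "b \<in> carrier R"
  shows "frac R S a \<one> \<oplus>\<^bsub>localization R S\<^esub> frac R S b \<one> = frac R S (a \<oplus> b) \<one>"
  using frac_add[OF assms(1) S_one assms(2) S_one] assms by simp

lemma frac_mult_1:
  assumes "a \<in> carrier R" "b \<in> carrier R"
  shows "frac R S a \<one> \<otimes>\<^bsub>localization R S\<^esub> frac R S b \<one> = frac R S (a \<otimes> b) \<one>"
  using frac_mult[OF assms(1) S_one assms(2) S_one] assms by simp

end

lemma primeideal_mult_set:
  assumes "primeideal p R" shows "mult_set R (carrier R - p)"
proof -
  interpret primeideal p R by fact
  show ?thesis
    using I_prime one_imp_carrier I_notcarr by unfold_locales auto
qed

lemma zariski_basic_open: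
  assumes "a \<in> carrier R" shows "openin (zariski R) {p. primeideal p R \<and> a \<notin> p}"
  unfolding zariski_def by (rule topology_generated_by_Basis) (use assms in auto)

lemma zariski_topspace:
  fixes R (structure)
  assumes "cring R"
  shows "topspace (zariski R) = {p. primeideal p R}"
proof -
  interpret cring R by fact
  have "\<one> \<notin> p" if "primeideal p R" for p
  proof -
    interpret primeideal p R by fact
    show ?thesis using I_notcarr one_imp_carrier by auto
  qed
  then have "(\<Union>f\<in>carrier R. {p. primeideal p R \<and> f \<notin> p}) = {p. primeideal p R}"
    by blast
  then show ?thesis unfolding zariski_def topology_generated_by_topspace .
qed

text \<open>Induction on the generation of the topology. For intersections: the primes missing
  \<open>a \<otimes> b\<close> are those missing both \<open>a\<close> and \<open>b\<close>, so the
  generating sets already form a basis.\<close>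

lemma zariski_basis:
  fixes R (structure)
  assumes R: "cring R" and N: "openin (zariski R) N" "p \<in> N"
  shows "\<exists>a\<in>carrier R. a \<notin> p \<and> {q. primeideal q R \<and> a \<notin> q} \<subseteq> N"
proof -
  interpret cring R by fact
  have "generate_topology_on ((\<lambda>f. {p. primeideal p R \<and> f \<notin> p}) ` carrier R) N"
    using N(1) unfolding zariski_def openin_topology_generated_by_iff .
  then show ?thesis using N(2)
  proof induction
    case Empty
    then show ?case by simp
  next
    case (Int A B)
    then obtain a b where a: "a \<in> carrier R" "a \<notin> p" "{q. primeideal q R \<and> a \<notin> q} \<subseteq> A"
      and b: "b \<in> carrier R" "b \<notin> p" "{q. primeideal q R \<and> b \<notin> q} \<subseteq> B" by blast
    have pp: "primeideal p R"
    proof -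
      have "p \<in> topspace (zariski R)" using openin_subset[OF N(1)] N(2) by auto
      then show ?thesis unfolding zariski_topspace[OF R] by simp
    qed
    have "a \<otimes> b \<notin> p" using primeideal.I_prime[OF pp a(1) b(1)] a b by auto
    moreover have "a \<notin> q \<and> b \<notin> q" if "primeideal q R" "a \<otimes> b \<notin> q" for q
    proof -
      interpret q: primeideal q R by fact
      show ?thesis using that(2) q.I_l_closed[of b a] q.I_r_closed[of a b] a b by auto
    qed
    ultimately show ?case using a b by (intro bexI[of _ "a \<otimes> b"]) blast+
  next
    case (UN K)
    then show ?case by blast
  next
    case (Basis s)
    then show ?case by blast
  qed
qed

text \<open>A chart records what the theorem needs to know about an isomorphism between the open
  subspace \<open>U\<close> and the spectrum of \<open>R\<close>: \<open>\<pi>\<close> is the map of points and \<open>h\<close> sends an element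
  of \<open>R\<close> to the corresponding section over \<open>U\<close>.\<close>

definition chart ::
  "('x, 'a) ringed_space \<Rightarrow> 'x set \<Rightarrow> ('r, 'e) ring_scheme \<Rightarrow> ('x \<Rightarrow> 'r set) \<Rightarrow> ('r \<Rightarrow> 'a) \<Rightarrow> bool" where
  "chart X U R \<pi> h \<longleftrightarrow> openin (base X) U \<and> cring R \<and> h \<in> ring_hom R (sec X U) \<and>
     bij_betw \<pi> U {p. primeideal p R} \<and>
     (\<forall>y\<in>U. \<forall>a\<in>carrier R. germ X y U (h a) \<in> Units (stalk_ring X y) \<longleftrightarrow> a \<notin> \<pi> y) \<and>
     (\<forall>a\<in>carrier R. openin (base X) {y \<in> U. a \<notin> \<pi> y}) \<and>
     (\<forall>N y. openin (base X) N \<and> y \<in> N \<and> N \<subseteq> U \<longrightarrow>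
        (\<exists>a\<in>carrier R. a \<notin> \<pi> y \<and> {z \<in> U. a \<notin> \<pi> z} \<subseteq> N)) \<and>
     (\<forall>N y s. openin (base X) N \<and> y \<in> N \<and> N \<subseteq> U \<and> s \<in> carrier (sec X N) \<longrightarrow>
        (\<exists>a t V. a \<in> carrier R \<and> t \<in> carrier R \<and> openin (base X) V \<and> y \<in> V \<and> V \<subseteq> N \<and>
           (\<forall>z\<in>V. t \<notin> \<pi> z) \<and> res X U V (h t) \<otimes>\<^bsub>sec X V\<^esub> res X N V s = res X U V (h a)))"

section \<open>Charts from isomorphisms with spectra\<close>

locale spec_ring = cring R for R :: "('r, 'e) ring_scheme" (structure)
begin

abbreviation "Y \<equiv> Spec R"
abbreviation "P \<equiv> {p. primeideal p R}"

lemma Ybase: "base Y = zariski R" "topspace (zariski R) = P"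
  using zariski_topspace[OF is_cring] unfolding Spec_def by auto

text \<open>The canonical homomorphism from \<open>R\<close> to the global sections of its
  spectrum.\<close>

definition loc :: "'r \<Rightarrow> 'r set \<Rightarrow> ('r \<times> 'r) set" where
  "loc a = (\<lambda>p\<in>P. frac R (carrier R - p) a \<one>)"

lemma P_open: "openin (zariski R) P"
  using Ybase(2) openin_topspace[of "zariski R"] by simp

lemma frac_in_sec:
  assumes V: "openin (zariski R) V" and a: "a \<in> carrier R" and s: "s \<in> carrier R" "\<And>q. q \<in> V \<Longrightarrow> s \<notin> q"
  shows "(\<lambda>p\<in>V. frac R (carrier R - p) a s) \<in> carrier (sec Y V)"
proof -
  have V_P: "V \<subseteq> P" using openin_subset[OF V] Ybase by simp
  have "frac R (carrier R - p) a s \<in> carrier (localization_at R p)" if "p \<in> V" for p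
    unfolding localization_at_def
    by (rule mult_set.frac_closed[OF primeideal_mult_set]) (use that V_P a s in auto)
  moreover have "\<exists>W b t. openin (zariski R) W \<and> p \<in> W \<and> W \<subseteq> V \<and> b \<in> carrier R \<and> t \<in> carrier R \<and>
    (\<forall>q\<in>W. t \<notin> q \<and> (\<lambda>p\<in>V. frac R (carrier R - p) a s) q = frac R (carrier R - q) b t)" if "p \<in> V" for p
    using V a s that by (intro exI[of _ V] exI[of _ a] exI[of _ s]) simp
  ultimately show ?thesis unfolding Spec_def by auto
qed

lemma one_notin: "p \<in> P \<Longrightarrow> \<one> \<notin> p"
  using mult_set.S_one[OF primeideal_mult_set] by auto

lemma loc_closed: "a \<in> carrier R \<Longrightarrow> loc a \<in> carrier (sec Y P)"
  unfolding loc_def by (rule frac_in_sec[OF P_open]) (use one_notin in auto)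

lemma loc_hom: "loc \<in> ring_hom R (sec Y P)"
proof (rule ring_hom_memI)
  fix a b assume ab: "a \<in> carrier R" "b \<in> carrier R"
  show "loc (a \<otimes> b) = loc a \<otimes>\<^bsub>sec Y P\<^esub> loc b"
    unfolding loc_def Spec_def localization_at_def
    using mult_set.frac_mult_1[OF primeideal_mult_set ab] by (auto simp: fun_eq_iff)
  show "loc (a \<oplus> b) = loc a \<oplus>\<^bsub>sec Y P\<^esub> loc b"
    unfolding loc_def Spec_def localization_at_def
    using mult_set.frac_add_1[OF primeideal_mult_set ab] by (auto simp: fun_eq_iff)
next
  show "loc \<one> = \<one>\<^bsub>sec Y P\<^esub>"
    unfolding loc_def Spec_def localization_at_def localization_def by simp
qed (rule loc_closed)

end

locale affine_iso = ringed X + spec_ring R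
  for X :: "('x, 'a) ringed_space" and R :: "('r, 'e) ring_scheme" (structure) +
  fixes U :: "'x set" and f :: "('x, 'a, 'r set, 'r set \<Rightarrow> ('r \<times> 'r) set) morphism"
    and g :: "('r set, 'r set \<Rightarrow> ('r \<times> 'r) set, 'x, 'a) morphism"
  assumes U: "op U"
    and f: "lrs_morphism (open_sub X U) (Spec R) f" and g: "lrs_morphism (Spec R) (open_sub X U) g"
    and gf: "morphism_eq (open_sub X U) (open_sub X U) (morphism_comp (Spec R) g f) morphism_id"
    and fg: "morphism_eq (Spec R) (Spec R) (morphism_comp (open_sub X U) f g) morphism_id"
begin

abbreviation "fpre V \<equiv> {y \<in> U. pt_map f y \<in> V}"
abbreviation "gpre N \<equiv> {p \<in> P. pt_map g p \<in> N}"

lemma op_sub: "openin (base (open_sub X U)) V \<longleftrightarrow> op V \<and> V \<subseteq> U"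
  unfolding open_sub_def using openin_open_subtopology[OF U, of V] by auto

lemma sub_simps: "sec (open_sub X U) = sec X" "res (open_sub X U) = res X"
  "topspace (base (open_sub X U)) = U"
  unfolding open_sub_def using openin_subset[OF U] by auto

lemma preims: "preim (open_sub X U) f V = fpre V" "preim Y g N = gpre N"
  unfolding preim_def Ybase sub_simps by auto

lemma f_cont: "y \<in> U \<Longrightarrow> pt_map f y \<in> P" and fpre_open: "openin (zariski R) V \<Longrightarrow> op (fpre V)"
proof -
  have c: "continuous_map (base (open_sub X U)) (zariski R) (pt_map f)"
    using f Ybase unfolding lrs_morphism_def by simp
  show "y \<in> U \<Longrightarrow> pt_map f y \<in> P"
    using c Ybase(2) sub_simps(3) unfolding continuous_map_def by auto
  show "openin (zariski R) V \<Longrightarrow> op (fpre V)"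
    using openin_continuous_map_preimage[OF c, of V] unfolding sub_simps op_sub by simp
qed

lemma g_cont: "p \<in> P \<Longrightarrow> pt_map g p \<in> U" and gpre_open: "op N \<Longrightarrow> N \<subseteq> U \<Longrightarrow> openin (zariski R) (gpre N)"
proof -
  have c: "continuous_map (zariski R) (base (open_sub X U)) (pt_map g)"
    using g Ybase unfolding lrs_morphism_def by simp
  show "p \<in> P \<Longrightarrow> pt_map g p \<in> U"
    using c Ybase(2) sub_simps(3) unfolding continuous_map_def by auto
  show "op N \<Longrightarrow> N \<subseteq> U \<Longrightarrow> openin (zariski R) (gpre N)"
    using openin_continuous_map_preimage[OF c, of N] Ybase op_sub by simp
qed

lemma gf_pt: "y \<in> U \<Longrightarrow> pt_map g (pt_map f y) = y"
  using gf sub_simps(3) unfolding morphism_eq_def morphism_comp_def morphism_id_def by simp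

lemma fg_pt: "p \<in> P \<Longrightarrow> pt_map f (pt_map g p) = p"
  using fg Ybase unfolding morphism_eq_def morphism_comp_def morphism_id_def by simp

lemma f_hom: "openin (zariski R) V \<Longrightarrow> sec_map f V \<in> ring_hom (sec Y V) (sec X (fpre V))"
  using f unfolding lrs_morphism_def preims sub_simps Ybase by simp

lemma f_res: "openin (zariski R) V \<Longrightarrow> openin (zariski R) W \<Longrightarrow> W \<subseteq> V \<Longrightarrow> s \<in> carrier (sec Y V) \<Longrightarrow>
  sec_map f W (res Y V W s) = res X (fpre V) (fpre W) (sec_map f V s)"
  using f unfolding lrs_morphism_def preims sub_simps Ybase by simp

lemma g_hom: "op N \<Longrightarrow> N \<subseteq> U \<Longrightarrow> sec_map g N \<in> ring_hom (sec X N) (sec Y (gpre N))"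
  using g unfolding lrs_morphism_def preims sub_simps op_sub by simp

lemma g_res: "op N \<Longrightarrow> N \<subseteq> U \<Longrightarrow> op M \<Longrightarrow> M \<subseteq> N \<Longrightarrow> s \<in> carrier (sec X N) \<Longrightarrow>
  sec_map g M (res X N M s) = res Y (gpre N) (gpre M) (sec_map g N s)"
  using g unfolding lrs_morphism_def preims sub_simps op_sub by (meson subset_trans)

lemma gf_sec: "op N \<Longrightarrow> N \<subseteq> U \<Longrightarrow> s \<in> carrier (sec X N) \<Longrightarrow> sec_map f (gpre N) (sec_map g N s) = s"
  using gf unfolding morphism_eq_def morphism_comp_def morphism_id_def preims sub_simps op_sub by simp

lemma fg_sec: "openin (zariski R) V \<Longrightarrow> s \<in> carrier (sec Y V) \<Longrightarrow> sec_map g (fpre V) (sec_map f V s) = s"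
  using fg unfolding morphism_eq_def morphism_comp_def morphism_id_def preims Ybase by simp

lemma fpre_gpre: "N \<subseteq> U \<Longrightarrow> fpre (gpre N) = N"
  using gf_pt f_cont by auto

definition h :: "'r \<Rightarrow> 'a" where "h a = sec_map f P (loc a)"

lemma fpre_P: "fpre P = U"
  using f_cont by auto

lemma h_hom: "h \<in> ring_hom R (sec X U)"
  using ring_hom_trans[OF loc_hom f_hom[OF P_open]] unfolding fpre_P h_def comp_def .

lemma h_res:
  assumes "openin (zariski R) V" "a \<in> carrier R"
  shows "res X U (fpre V) (h a) = sec_map f V (\<lambda>p\<in>V. frac R (carrier R - p) a \<one>)"
proof -
  have VP: "V \<subseteq> P" using openin_subset[OF assms(1)] Ybase by simp
  have "res Y P V (loc a) = (\<lambda>p\<in>V. frac R (carrier R - p) a \<one>)"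
    unfolding Spec_def loc_def using VP by (auto simp: fun_eq_iff restrict_def)
  then show ?thesis
    using f_res[OF P_open assms(1) VP loc_closed[OF assms(2)]] unfolding fpre_P h_def by simp
qed

text \<open>If \<open>a\<close> is outside the prime of \<open>y\<close>, the section 1/a exists on
  the basic open set of \<open>a\<close> and transports to an inverse near \<open>y\<close>.
  Conversely an inverse near \<open>y\<close>, moved to the spectrum and evaluated at the prime, is
  a fraction b/s with \<open>u a b = u s\<close>; were \<open>a\<close> in the prime, so would be
  \<open>u s\<close>, a product of two elements outside it.\<close>

lemma h_unit_iff:
  assumes y: "y \<in> U" and a: "a \<in> carrier R"
  shows "germ X y U (h a) \<in> Units (stalk_ring X y) \<longleftrightarrow> a \<notin> pt_map f y"
proof
  note ha = ring_hom_closed[OF h_hom a]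
  assume n: "a \<notin> pt_map f y"
  define D where "D = {p. primeideal p R \<and> a \<notin> p}"
  have D: "openin (zariski R) D" unfolding D_def by (rule zariski_basic_open[OF a])
  define s t where "s = (\<lambda>p\<in>D. frac R (carrier R - p) a \<one>)" and "t = (\<lambda>p\<in>D. frac R (carrier R - p) \<one> a)"
  have s: "s \<in> carrier (sec Y D)" unfolding s_def by (rule frac_in_sec[OF D a]) (use one_notin in \<open>auto simp: D_def\<close>)
  have t: "t \<in> carrier (sec Y D)" unfolding t_def by (rule frac_in_sec[OF D _ a]) (auto simp: D_def)
  have "s p \<otimes>\<^bsub>localization_at R p\<^esub> t p = \<one>\<^bsub>localization_at R p\<^esub>" if p: "p \<in> D" for p
  proof -
    interpret M: mult_set R "carrier R - p" using p unfolding D_def by (intro primeideal_mult_set) simp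
    have aS: "a \<in> carrier R - p" using p a unfolding D_def by simp
    have "s p \<otimes>\<^bsub>localization_at R p\<^esub> t p = frac R (carrier R - p) (a \<otimes> \<one>) (\<one> \<otimes> a)"
      unfolding s_def t_def localization_at_def using M.frac_mult[OF a M.S_one one_closed aS] p by simp
    also have "\<dots> = frac R (carrier R - p) \<one> \<one>"
      using aS M.S_one by (subst M.frac_eq_iff) auto
    finally show ?thesis unfolding localization_at_def localization_def by simp
  qed
  then have "s \<otimes>\<^bsub>sec Y D\<^esub> t = \<one>\<^bsub>sec Y D\<^esub>" unfolding Spec_def by (auto simp: fun_eq_iff)
  then have "sec_map f D s \<otimes>\<^bsub>sec X (fpre D)\<^esub> sec_map f D t = \<one>\<^bsub>sec X (fpre D)\<^esub>"
    using ring_hom_mult[OF f_hom[OF D] s t] ring_hom_one[OF f_hom[OF D]] by simp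
  then show "germ X y U (h a) \<in> Units (stalk_ring X y)"
    unfolding germ_unit_iff[OF U y ha]
    using fpre_open[OF D] y n f_cont[OF y] ring_hom_closed[OF f_hom[OF D] t] h_res[OF D a]
    by (intro exI[of _ "fpre D"] exI[of _ "sec_map f D t"]) (auto simp: D_def s_def)
next
  note ha = ring_hom_closed[OF h_hom a]
  assume "germ X y U (h a) \<in> Units (stalk_ring X y)"
  then obtain V t where V: "op V" "y \<in> V" "V \<subseteq> U" "t \<in> carrier (sec X V)"
     "res X U V (h a) \<otimes>\<^bsub>sec X V\<^esub> t = \<one>\<^bsub>sec X V\<^esub>"
    unfolding germ_unit_iff[OF U y ha] by (elim exE conjE)
  define p where "p = pt_map f y"
  have p: "p \<in> P" "p \<in> gpre V" unfolding p_def using f_cont[OF y] gf_pt[OF y] V by auto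
  interpret M: mult_set R "carrier R - p" using p by (intro primeideal_mult_set) simp
  interpret p: primeideal p R using p by simp
  define \<tau> where "\<tau> = sec_map g V t"
  have \<tau>: "\<tau> \<in> carrier (sec Y (gpre V))" unfolding \<tau>_def by (rule ring_hom_closed[OF g_hom[OF V(1,3)] V(4)])
  have gU: "gpre U = P" using g_cont by auto
  have "sec_map g U (h a) = loc a"
    unfolding h_def using fg_sec[OF P_open loc_closed[OF a]] unfolding fpre_P .
  then have "sec_map g V (res X U V (h a)) = res Y P (gpre V) (loc a)"
    using g_res[OF U order_refl V(1,3) ha] unfolding gU by simp
  then have "res Y P (gpre V) (loc a) \<otimes>\<^bsub>sec Y (gpre V)\<^esub> \<tau> = \<one>\<^bsub>sec Y (gpre V)\<^esub>"
    using ring_hom_mult[OF g_hom[OF V(1,3)] rclosed[OF U V(1,3) ha] V(4)] V(5)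
      ring_hom_one[OF g_hom[OF V(1,3)]] unfolding \<tau>_def by simp
  then have "(res Y P (gpre V) (loc a) \<otimes>\<^bsub>sec Y (gpre V)\<^esub> \<tau>) p = \<one>\<^bsub>sec Y (gpre V)\<^esub> p" by simp
  then have e: "frac R (carrier R - p) a \<one> \<otimes>\<^bsub>localization R (carrier R - p)\<^esub> \<tau> p = frac R (carrier R - p) \<one> \<one>"
    using p unfolding Spec_def loc_def localization_at_def by (simp add: localization_def)
  have "\<tau> \<in> (\<Pi>\<^sub>E p\<in>gpre V. carrier (localization_at R p))"
    using \<tau> unfolding Spec_def by simp
  then have "\<tau> p \<in> carrier (localization R (carrier R - p))"
    using p(2) unfolding localization_at_def by (rule PiE_mem)
  then obtain b s where b: "b \<in> carrier R" "s \<in> carrier R - p" "\<tau> p = frac R (carrier R - p) b s"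
    unfolding localization_def by auto
  have "frac R (carrier R - p) (a \<otimes> b) (\<one> \<otimes> s) = frac R (carrier R - p) \<one> \<one>"
    using e M.frac_mult[OF a M.S_one b(1,2)] b(3) by simp
  then have "\<exists>u\<in>carrier R - p. u \<otimes> (\<one> \<otimes> (a \<otimes> b)) = u \<otimes> ((\<one> \<otimes> s) \<otimes> \<one>)"
    by (rule iffD1[OF M.frac_eq_iff[OF m_closed[OF a b(1)] M.S_mult[OF M.S_one b(2)] one_closed M.S_one]])
  then obtain u where u: "u \<in> carrier R - p" "u \<otimes> (\<one> \<otimes> (a \<otimes> b)) = u \<otimes> ((\<one> \<otimes> s) \<otimes> \<one>)"
    by (rule bexE)
  show "a \<notin> pt_map f y"
  proof
    assume "a \<in> pt_map f y"
    then have "a \<in> p" unfolding p_def .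
    then have "u \<otimes> (a \<otimes> b) \<in> p" using p.I_r_closed p.I_l_closed u(1) b(1) by auto
    then have "u \<otimes> s \<in> p" using u a b by auto
    then show False using p.I_prime u(1) b(2) by auto
  qed
qed

text \<open>Move \<open>s\<close> to the spectrum, where by definition a section is locally a
  fraction a/t; clear the denominator and move the equation back to \<open>X\<close>.\<close>

lemma local_fraction:
  assumes N: "op N" "y \<in> N" "N \<subseteq> U" and s: "s \<in> carrier (sec X N)"
  shows "\<exists>a t V. a \<in> carrier R \<and> t \<in> carrier R \<and> op V \<and> y \<in> V \<and> V \<subseteq> N \<and>
           (\<forall>z\<in>V. t \<notin> pt_map f z) \<and> res X U V (h t) \<otimes>\<^bsub>sec X V\<^esub> res X N V s = res X U V (h a)"
proof -
  define \<sigma> where "\<sigma> = sec_map g N s"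
  have \<sigma>: "\<sigma> \<in> carrier (sec Y (gpre N))" unfolding \<sigma>_def by (rule ring_hom_closed[OF g_hom[OF N(1,3)] s])
  have yU: "y \<in> U" using N by auto
  have p: "pt_map f y \<in> gpre N" using N f_cont[OF yU] gf_pt[OF yU] by auto
  have "\<forall>p\<in>gpre N. \<exists>V a s. openin (zariski R) V \<and> p \<in> V \<and> V \<subseteq> gpre N \<and> a \<in> carrier R \<and> s \<in> carrier R \<and>
             (\<forall>q\<in>V. s \<notin> q \<and> \<sigma> q = frac R (carrier R - q) a s)"
    using \<sigma> unfolding Spec_def by simp
  then obtain V a t where V: "openin (zariski R) V" "pt_map f y \<in> V" "V \<subseteq> gpre N" "a \<in> carrier R" "t \<in> carrier R"
    "\<And>q. q \<in> V \<Longrightarrow> t \<notin> q" "\<And>q. q \<in> V \<Longrightarrow> \<sigma> q = frac R (carrier R - q) a t"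
    using p by meson
  have VP: "V \<subseteq> P" using V(3) by auto
  define a' t' where "a' = (\<lambda>p\<in>V. frac R (carrier R - p) a \<one>)" and "t' = (\<lambda>p\<in>V. frac R (carrier R - p) t \<one>)"
  have t': "t' \<in> carrier (sec Y V)" unfolding t'_def by (rule frac_in_sec[OF V(1,5)]) (use one_notin VP in auto)
  define \<sigma>' where "\<sigma>' = res Y (gpre N) V \<sigma>"
  have \<sigma>'_eq: "\<sigma>' = (\<lambda>p\<in>V. frac R (carrier R - p) a t)"
    unfolding \<sigma>'_def Spec_def using V by (auto simp: fun_eq_iff restrict_def)
  have \<sigma>': "\<sigma>' \<in> carrier (sec Y V)" unfolding \<sigma>'_eq by (rule frac_in_sec[OF V(1,4,5)]) (use V in auto)
  have "t' p \<otimes>\<^bsub>localization_at R p\<^esub> \<sigma>' p = a' p" if q: "p \<in> V" for p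
  proof -
    interpret M: mult_set R "carrier R - p" using q VP by (intro primeideal_mult_set) auto
    have tS: "t \<in> carrier R - p" using V(5,6) q by auto
    have "t' p \<otimes>\<^bsub>localization_at R p\<^esub> \<sigma>' p = frac R (carrier R - p) (t \<otimes> a) (\<one> \<otimes> t)"
      unfolding t'_def \<sigma>'_eq localization_at_def using M.frac_mult[OF V(5) M.S_one V(4) tS] q by simp
    also have "\<dots> = a' p"
      unfolding a'_def using q V(4,5) tS M.S_one by (simp, subst M.frac_eq_iff) (auto simp: m_ac)
    finally show ?thesis .
  qed
  then have "t' \<otimes>\<^bsub>sec Y V\<^esub> \<sigma>' = a'" unfolding Spec_def a'_def by (auto simp: fun_eq_iff)
  then have e: "sec_map f V t' \<otimes>\<^bsub>sec X (fpre V)\<^esub> sec_map f V \<sigma>' = sec_map f V a'"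
    using ring_hom_mult[OF f_hom[OF V(1)] t' \<sigma>'] by simp
  have "sec_map f V \<sigma>' = res X N (fpre V) s"
    unfolding \<sigma>'_def f_res[OF gpre_open[OF N(1,3)] V(1,3) \<sigma>] fpre_gpre[OF N(3)]
    unfolding \<sigma>_def gf_sec[OF N(1,3) s] ..
  then have "res X U (fpre V) (h t) \<otimes>\<^bsub>sec X (fpre V)\<^esub> res X N (fpre V) s = res X U (fpre V) (h a)"
    using e h_res[OF V(1,4)] h_res[OF V(1,5)] unfolding a'_def t'_def by simp
  moreover have "fpre V \<subseteq> N" using V(3) gf_pt by auto
  ultimately show ?thesis
    using V fpre_open[OF V(1)] yU by (intro exI[of _ a] exI[of _ t] exI[of _ "fpre V"]) auto
qed

lemma chart: "chart X U R (pt_map f) h"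
  unfolding chart_def
proof (intro conjI U is_cring h_hom)
  show "bij_betw (pt_map f) U P"
    by (rule bij_betwI[of _ _ _ "pt_map g"]) (use f_cont g_cont fg_pt gf_pt in auto)
  show "\<forall>y\<in>U. \<forall>a\<in>carrier R. germ X y U (h a) \<in> Units (stalk_ring X y) \<longleftrightarrow> a \<notin> pt_map f y"
    using h_unit_iff by simp
  show "\<forall>a\<in>carrier R. op {y \<in> U. a \<notin> pt_map f y}"
  proof
    fix a assume "a \<in> carrier R"
    from fpre_open[OF zariski_basic_open[OF this]] show "op {y \<in> U. a \<notin> pt_map f y}"
      by (rule back_subst[of op]) (use f_cont in auto)
  qed
  show "\<forall>N y. op N \<and> y \<in> N \<and> N \<subseteq> U \<longrightarrow> (\<exists>a\<in>carrier R. a \<notin> pt_map f y \<and> {z \<in> U. a \<notin> pt_map f z} \<subseteq> N)"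
  proof (intro allI impI)
    fix N y assume N: "op N \<and> y \<in> N \<and> N \<subseteq> U"
    then have "openin (zariski R) (gpre N)" "pt_map f y \<in> gpre N"
      using gpre_open f_cont gf_pt by auto
    from zariski_basis[OF is_cring this] obtain a where a: "a \<in> carrier R" "a \<notin> pt_map f y"
      "{q. primeideal q R \<and> a \<notin> q} \<subseteq> gpre N" by auto
    have "z \<in> N" if "z \<in> U" "a \<notin> pt_map f z" for z
      using subsetD[OF a(3), of "pt_map f z"] that f_cont[of z] gf_pt[of z] by simp
    then show "\<exists>a\<in>carrier R. a \<notin> pt_map f y \<and> {z \<in> U. a \<notin> pt_map f z} \<subseteq> N" using a by blast
  qed
  show "\<forall>N y s. op N \<and> y \<in> N \<and> N \<subseteq> U \<and> s \<in> carrier (sec X N) \<longrightarrow>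
        (\<exists>a t V. a \<in> carrier R \<and> t \<in> carrier R \<and> op V \<and> y \<in> V \<and> V \<subseteq> N \<and>
           (\<forall>z\<in>V. t \<notin> pt_map f z) \<and> res X U V (h t) \<otimes>\<^bsub>sec X V\<^esub> res X N V s = res X U V (h a))"
    using local_fraction by simp
qed

end

lemma chart_exists:
  fixes X :: "('x, 'a) ringed_space" and R :: "('r, 'e) ring_scheme"
  assumes X: "is_ringed_space X" and U: "openin (base X) U" and R: "cring R"
    and iso: "lrs_isomorphic (open_sub X U) (Spec R)"
  obtains \<pi> h where "chart X U R \<pi> h"
proof -
  obtain f g where *: "lrs_morphism (open_sub X U) (Spec R) f" "lrs_morphism (Spec R) (open_sub X U) g"
    "morphism_eq (open_sub X U) (open_sub X U) (morphism_comp (Spec R) g f) morphism_id"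
    "morphism_eq (Spec R) (Spec R) (morphism_comp (open_sub X U) f g) morphism_id"
    using iso unfolding lrs_isomorphic_def by (elim exE conjE)
  interpret affine_iso X R U f g
    by (intro affine_iso.intro ringed.intro spec_ring.intro affine_iso_axioms.intro X U R *)
  show ?thesis by (rule that[OF chart])
qed

section \<open>Base change of modules\<close>

text \<open>Of \<open>M\<close> closure under its two operations is asked, which is what places the
  relations inside the free group. In this form the locale applies directly to stalks of an ideal
  sheaf.\<close>

locale tensor =
  fixes A :: "('a, 'e) ring_scheme" and B :: "('b, 'f) ring_scheme" and \<phi> :: "'a \<Rightarrow> 'b"
    and M :: "('a, 'm, 'g) module_scheme"
  assumes B: "ring B" and \<phi>: "\<And>a. a \<in> carrier A \<Longrightarrow> \<phi> a \<in> carrier B"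
    and M_add: "\<And>m n. m \<in> carrier M \<Longrightarrow> n \<in> carrier M \<Longrightarrow> m \<oplus>\<^bsub>M\<^esub> n \<in> carrier M"
    and M_smult: "\<And>a m. a \<in> carrier A \<Longrightarrow> m \<in> carrier M \<Longrightarrow> a \<odot>\<^bsub>M\<^esub> m \<in> carrier M"
begin

abbreviation "F \<equiv> carrier (tensor_free B M)"
abbreviation "rels \<equiv> tensor_rels A B \<phi> M"
abbreviation "cls \<equiv> tensor_class A B \<phi> M"

definition gens :: "('b \<times> 'm \<Rightarrow>\<^sub>0 int) set" where
  "gens = {frag_of (b \<oplus>\<^bsub>B\<^esub> b', m) - frag_of (b, m) - frag_of (b', m) | b b' m.
         b \<in> carrier B \<and> b' \<in> carrier B \<and> m \<in> carrier M} \<union>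
      {frag_of (b, m \<oplus>\<^bsub>M\<^esub> m') - frag_of (b, m) - frag_of (b, m') | b m m'.
         b \<in> carrier B \<and> m \<in> carrier M \<and> m' \<in> carrier M} \<union>
      {frag_of (b \<otimes>\<^bsub>B\<^esub> \<phi> a, m) - frag_of (b, a \<odot>\<^bsub>M\<^esub> m) | b a m.
         b \<in> carrier B \<and> a \<in> carrier A \<and> m \<in> carrier M}"

lemma rels_eq: "rels = generate (tensor_free B M) gens"
  unfolding tensor_rels_def gens_def ..

lemma F_iff: "c \<in> F \<longleftrightarrow> Poly_Mapping.keys c \<subseteq> carrier B \<times> carrier M"
  unfolding tensor_free_def by simp

lemma F_of: "b \<in> carrier B \<Longrightarrow> m \<in> carrier M \<Longrightarrow> frag_of (b, m) \<in> F"
  unfolding F_iff by simp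

lemma F_diff: "c \<in> F \<Longrightarrow> d \<in> F \<Longrightarrow> c - d \<in> F"
  unfolding F_iff using keys_diff[of c d] by blast

lemma gens_F: "gens \<subseteq> F"
proof -
  interpret ring B by (rule B)
  show ?thesis
    unfolding gens_def using \<phi> M_add M_smult by (auto intro!: F_diff F_of)
qed

lemma group_F: "group (tensor_free B M)"
  unfolding tensor_free_def by simp

lemma F_ops: "x \<otimes>\<^bsub>tensor_free B M\<^esub> y = x + y" "\<one>\<^bsub>tensor_free B M\<^esub> = 0"
  "x \<in> F \<Longrightarrow> inv\<^bsub>tensor_free B M\<^esub> x = - x"
  unfolding tensor_free_def by auto

lemma rels_subgroup: "subgroup rels (tensor_free B M)"
  unfolding rels_eq by (rule group.generate_is_subgroup[OF group_F gens_F])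

lemma rels_F: "c \<in> rels \<Longrightarrow> c \<in> F"
  using subgroup.mem_carrier[OF rels_subgroup] .

lemma rels_zero: "0 \<in> rels"
  using subgroup.one_closed[OF rels_subgroup] unfolding F_ops .

lemma rels_add: "c \<in> rels \<Longrightarrow> d \<in> rels \<Longrightarrow> c + d \<in> rels"
  using subgroup.m_closed[OF rels_subgroup] unfolding F_ops .

lemma rels_minus: "c \<in> rels \<Longrightarrow> - c \<in> rels"
  using subgroup.m_inv_closed[OF rels_subgroup] F_ops(3)[OF rels_F] by metis

lemma rels_diff: "c \<in> rels \<Longrightarrow> d \<in> rels \<Longrightarrow> c - d \<in> rels"
  using rels_add[OF _ rels_minus] by (metis uminus_add_conv_diff add.commute)

lemma rels_gens: "c \<in> gens \<Longrightarrow> c \<in> rels"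
  unfolding rels_eq by (rule generate.incl)

lemma rels_add_left:
  assumes "b \<in> carrier B" "b' \<in> carrier B" "m \<in> carrier M"
  shows "frag_of (b \<oplus>\<^bsub>B\<^esub> b', m) - frag_of (b, m) - frag_of (b', m) \<in> rels"
  by (rule rels_gens) (use assms in \<open>auto simp: gens_def\<close>)

lemma rels_add_right:
  assumes "b \<in> carrier B" "m \<in> carrier M" "m' \<in> carrier M"
  shows "frag_of (b, m \<oplus>\<^bsub>M\<^esub> m') - frag_of (b, m) - frag_of (b, m') \<in> rels"
  by (rule rels_gens) (use assms in \<open>auto simp: gens_def\<close>)

lemma rels_scalar:
  assumes "b \<in> carrier B" "a \<in> carrier A" "m \<in> carrier M"
  shows "frag_of (b \<otimes>\<^bsub>B\<^esub> \<phi> a, m) - frag_of (b, a \<odot>\<^bsub>M\<^esub> m) \<in> rels"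
  by (rule rels_gens) (use assms in \<open>auto simp: gens_def\<close>)

text \<open>Additivity in the second argument equates the pure tensor of \<open>b\<close> and
  \<open>m\<close> with twice itself. Stated by \<open>m + m = m\<close>, it applies without
  identifying the zero element of \<open>M\<close>.\<close>

lemma rels_idem:
  assumes "b \<in> carrier B" "m \<in> carrier M" "m \<oplus>\<^bsub>M\<^esub> m = m"
  shows "frag_of (b, m) \<in> rels"
  using rels_minus[OF rels_add_right[OF assms(1,2,2)]] assms(3) by simp

lemma cls_eq: "cls c = (\<lambda>r. r + c) ` rels"
  unfolding tensor_class_def r_coset_def F_ops by auto

lemma cls_self: "c \<in> cls c"
  unfolding cls_eq using rels_zero by force

lemma cls_eq_iff: "cls c = cls d \<longleftrightarrow> c - d \<in> rels"
proof
  assume "cls c = cls d"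
  then have "c \<in> cls d" using cls_self by blast
  then show "c - d \<in> rels" unfolding cls_eq by auto
next
  have sub: "cls c \<subseteq> cls d" if "c - d \<in> rels" for c d
  proof
    fix x assume "x \<in> cls c"
    then obtain r where r: "r \<in> rels" "x = r + c" unfolding cls_eq by auto
    have "x = (r + (c - d)) + d" using r by simp
    then show "x \<in> cls d" unfolding cls_eq using rels_add[OF r(1) that] by blast
  qed
  assume cd: "c - d \<in> rels"
  then have "d - c \<in> rels" using rels_minus[of "c - d"] by simp
  then show "cls c = cls d" using sub cd by blast
qed

lemma carrier_base_change: "carrier (base_change A B \<phi> M) = cls ` F"
  unfolding base_change_def FactGroup_def RCOSETS_def tensor_class_def by auto

lemma rels_induct [consumes 1]:
  assumes c: "c \<in> rels" and P0: "P 0" and gen: "\<And>c. c \<in> gens \<Longrightarrow> P c"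
    and add: "\<And>c d. c \<in> F \<Longrightarrow> d \<in> F \<Longrightarrow> P c \<Longrightarrow> P d \<Longrightarrow> P (c + d)"
    and minus: "\<And>c. c \<in> F \<Longrightarrow> P c \<Longrightarrow> P (- c)"
  shows "P c"
  using c unfolding rels_eq
proof induction
  case one
  then show ?case using P0 unfolding F_ops .
next
  case (incl h)
  then show ?case by (rule gen)
next
  case (inv h)
  have "h \<in> F" using inv gens_F by auto
  then show ?case unfolding F_ops(3)[OF \<open>h \<in> F\<close>] by (rule minus[OF _ gen[OF inv]])
next
  case (eng h1 h2)
  then show ?case unfolding F_ops by (intro add) (auto simp: rels_eq[symmetric] intro: rels_F)
qed

text \<open>The means of proving a pure tensor nonzero: a biadditive balanced map extends to the
  free abelian group and kills the generators of the relations, hence all relations. The group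
  \<open>C\<close> is written multiplicatively.\<close>

lemma functional:
  fixes C (structure) and \<beta> :: "'b \<times> 'm \<Rightarrow> 'c"
  assumes C: "Group.comm_group C"
    and cl: "\<And>b m. b \<in> carrier B \<Longrightarrow> m \<in> carrier M \<Longrightarrow> \<beta> (b, m) \<in> carrier C"
    and l: "\<And>b b' m. b \<in> carrier B \<Longrightarrow> b' \<in> carrier B \<Longrightarrow> m \<in> carrier M \<Longrightarrow>
      \<beta> (b \<oplus>\<^bsub>B\<^esub> b', m) = \<beta> (b, m) \<otimes> \<beta> (b', m)"
    and r: "\<And>b m m'. b \<in> carrier B \<Longrightarrow> m \<in> carrier M \<Longrightarrow> m' \<in> carrier M \<Longrightarrow>
      \<beta> (b, m \<oplus>\<^bsub>M\<^esub> m') = \<beta> (b, m) \<otimes> \<beta> (b, m')"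
    and s: "\<And>b a m. b \<in> carrier B \<Longrightarrow> a \<in> carrier A \<Longrightarrow> m \<in> carrier M \<Longrightarrow>
      \<beta> (b \<otimes>\<^bsub>B\<^esub> \<phi> a, m) = \<beta> (b, a \<odot>\<^bsub>M\<^esub> m)"
    and bm: "b \<in> carrier B" "m \<in> carrier M" "frag_of (b, m) \<in> rels"
  shows "\<beta> (b, m) = \<one>"
proof -
  interpret C: Group.comm_group C by (rule C)
  interpret B: ring B by (rule B)
  have "\<beta> ` (carrier B \<times> carrier M) \<subseteq> carrier C" using cl by auto
  then obtain \<Psi> where \<Psi>: "\<Psi> \<in> hom (tensor_free B M) C"
    "\<And>x. x \<in> carrier B \<times> carrier M \<Longrightarrow> \<Psi> (frag_of x) = \<beta> x"
    unfolding tensor_free_def by (rule C.free_Abelian_group_universal) auto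
  interpret h: group_hom "tensor_free B M" C \<Psi>
    by (intro group_hom.intro group_hom_axioms.intro group_F C.is_group \<Psi>(1))
  have add: "\<Psi> (c + d) = \<Psi> c \<otimes> \<Psi> d" if "c \<in> F" "d \<in> F" for c d
    using h.hom_mult[OF that] unfolding F_ops .
  have minus: "\<Psi> (- c) = inv (\<Psi> c)" if "c \<in> F" for c
    using h.hom_inv[OF that] unfolding F_ops(3)[OF that] .
  have diff: "\<Psi> (c - d) = \<Psi> c \<otimes> inv (\<Psi> d)" if "c \<in> F" "d \<in> F" for c d
  proof -
    have "- d \<in> F" using that unfolding F_iff by simp
    then show ?thesis using add[OF that(1), of "- d"] minus[OF that(2)] by simp
  qed
  have zero: "\<Psi> 0 = \<one>" using h.hom_one unfolding F_ops .
  have gen: "\<Psi> c = \<one>" if "c \<in> gens" for c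
    using that \<phi> M_add M_smult cl l r s unfolding gens_def
    by (auto simp: diff F_of F_diff \<Psi>(2) C.m_ac C.inv_mult C.r_inv_ex)
       (simp_all add: C.m_assoc[symmetric] C.m_ac)
  have "\<Psi> c = \<one>" if "c \<in> rels" for c
    using that by (induction rule: rels_induct) (use zero gen add minus in auto)
  then have "\<Psi> (frag_of (b, m)) = \<one>" using bm(3) .
  then show ?thesis using \<Psi>(2)[of "(b, m)"] bm(1,2) by simp
qed

end

text \<open>\<open>base_change_map\<close> is a union over representatives; since the induced map on
  formal sums carries relations to relations, all members of the union are the same class.\<close>

lemma base_change_map_class:
  assumes M: "tensor A B \<phi> M" and N: "tensor A B \<phi> N" and h: "module_linear A M N h"
    and c: "c \<in> carrier (tensor_free B M)"
  shows "base_change_map A B \<phi> N h (tensor_class A B \<phi> M c) =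
    tensor_class A B \<phi> N (frag_extend (\<lambda>(b, m). frag_of (b, h m)) c)"
proof -
  interpret M: tensor A B \<phi> M by (rule M)
  interpret N: tensor A B \<phi> N by (rule N)
  let ?H = "frag_extend (\<lambda>(b, m). frag_of (b, h m))"
  have hc: "h m \<in> carrier N" if "m \<in> carrier M" for m using h that unfolding module_linear_def by auto
  have H: "?H d \<in> N.rels" if "d \<in> M.rels" for d
    using that
  proof (induction rule: M.rels_induct)
    case (2 c)
    have hl: "\<And>x y. x \<in> carrier M \<Longrightarrow> y \<in> carrier M \<Longrightarrow> h (x \<oplus>\<^bsub>M\<^esub> y) = h x \<oplus>\<^bsub>N\<^esub> h y"
      "\<And>a x. a \<in> carrier A \<Longrightarrow> x \<in> carrier M \<Longrightarrow> h (a \<odot>\<^bsub>M\<^esub> x) = a \<odot>\<^bsub>N\<^esub> h x"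
      using h unfolding module_linear_def by auto
    show ?case using 2 unfolding M.gens_def
      by (auto simp: frag_extend_diff hl hc intro!: N.rels_add_left N.rels_add_right N.rels_scalar)
  qed (auto simp: frag_extend_add frag_extend_minus N.rels_zero N.rels_add N.rels_minus)
  have eq: "N.cls (?H d) = N.cls (?H c)" if d: "d \<in> M.cls c" for d
  proof -
    obtain r where r: "r \<in> M.rels" "d = r + c" using d unfolding M.cls_eq by auto
    have "?H d - ?H c = ?H r" unfolding r(2) by (simp add: frag_extend_add)
    then show ?thesis unfolding N.cls_eq_iff using H[OF r(1)] by simp
  qed
  have "(\<Union>d\<in>M.cls c. N.cls (?H d)) = (\<Union>d\<in>M.cls c. N.cls (?H c))"
    by (rule SUP_cong[OF refl eq])
  also have "\<dots> = N.cls (?H c)"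
    by (rule UN_constant_eq[OF M.cls_self]) simp
  finally show ?thesis unfolding base_change_map_def .
qed


section \<open>Flat local homomorphisms and prime ideals\<close>

lemma primeideal_vimage:
  assumes A: "cring A" and B: "cring B" and \<phi>: "\<phi> \<in> ring_hom A B" and q: "primeideal q B"
  shows "primeideal {a \<in> carrier A. \<phi> a \<in> q} A"
proof -
  interpret q: primeideal q B by (rule q)
  interpret h: ring_hom_ring A B \<phi>
    by (rule ring_hom_ringI2[OF cring.axioms(1)[OF A] cring.axioms(1)[OF B] \<phi>])
  show ?thesis
  proof (rule primeidealI[OF h.ideal_vimage[OF q.is_ideal] A])
    have "\<one>\<^bsub>B\<^esub> \<notin> q" using q.one_imp_carrier q.I_notcarr by auto
    then have "\<one>\<^bsub>A\<^esub> \<notin> {a \<in> carrier A. \<phi> a \<in> q}" using h.hom_one by simp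
    then show "carrier A \<noteq> {a \<in> carrier A. \<phi> a \<in> q}" using h.R.one_closed by blast
    show "a \<in> {a \<in> carrier A. \<phi> a \<in> q} \<or> b \<in> {a \<in> carrier A. \<phi> a \<in> q}"
      if "a \<in> carrier A" "b \<in> carrier A" "a \<otimes>\<^bsub>A\<^esub> b \<in> {a \<in> carrier A. \<phi> a \<in> q}" for a b
      using that q.I_prime[of "\<phi> a" "\<phi> b"] by simp
  qed
qed

text \<open>The quotient of \<open>A\<close> by \<open>p\<close>, on the type over which modules range in \<open>flat_hom\<close>.\<close>

definition qcls :: "('a, 'e) ring_scheme \<Rightarrow> 'a set \<Rightarrow> 'a \<Rightarrow> (nat \<Rightarrow> 'a) set" where
  "qcls A p a = (\<lambda>c _. c) ` (p +>\<^bsub>A\<^esub> a)"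

text \<open>Elements of the quotient are cosets, embedded as sets of constant sequences to reach the
  required type. The operations act on chosen representatives, and another choice changes the result
  only within \<open>p\<close>.\<close>

definition qrep :: "('a, 'e) ring_scheme \<Rightarrow> 'a set \<Rightarrow> (nat \<Rightarrow> 'a) set \<Rightarrow> 'a" where
  "qrep A p X = (SOME a. a \<in> carrier A \<and> qcls A p a = X)"

definition quotient_module :: "('a, 'e) ring_scheme \<Rightarrow> 'a set \<Rightarrow> ('a, (nat \<Rightarrow> 'a) set) module" where
  "quotient_module A p = \<lparr>carrier = qcls A p ` carrier A, monoid.mult = undefined, monoid.one = undefined,
    ring.zero = qcls A p \<zero>\<^bsub>A\<^esub>,
    ring.add = (\<lambda>X Y. qcls A p (qrep A p X \<oplus>\<^bsub>A\<^esub> qrep A p Y)),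
    smult = (\<lambda>r X. qcls A p (r \<otimes>\<^bsub>A\<^esub> qrep A p X))\<rparr>"

locale quotient_mod = cring A + p: ideal p A for A (structure) and p
begin

abbreviation "K \<equiv> qcls A p"
abbreviation "rp \<equiv> qrep A p"
abbreviation "Q \<equiv> quotient_module A p"

lemma K_eq_iff: "a \<in> carrier A \<Longrightarrow> b \<in> carrier A \<Longrightarrow> K a = K b \<longleftrightarrow> a \<ominus> b \<in> p"
proof -
  have "inj (\<lambda>(c::'a) (_::nat). c)" by (auto simp: inj_def fun_eq_iff)
  then show "a \<in> carrier A \<Longrightarrow> b \<in> carrier A \<Longrightarrow> K a = K b \<longleftrightarrow> a \<ominus> b \<in> p"
    unfolding qcls_def quotient_eq_iff_same_a_r_cos[OF p.is_ideal] by (simp add: inj_image_eq_iff)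
qed

lemma rp: "a \<in> carrier A \<Longrightarrow> rp (K a) \<in> carrier A" "a \<in> carrier A \<Longrightarrow> K (rp (K a)) = K a"
  using someI[of "\<lambda>b. b \<in> carrier A \<and> K b = K a" a] unfolding qrep_def by auto

lemma rp_diff: "a \<in> carrier A \<Longrightarrow> rp (K a) \<ominus> a \<in> p"
  using K_eq_iff rp by metis

lemma Q_simps:
  "carrier Q = K ` carrier A" "\<zero>\<^bsub>Q\<^esub> = K \<zero>"
  "a \<in> carrier A \<Longrightarrow> b \<in> carrier A \<Longrightarrow> K a \<oplus>\<^bsub>Q\<^esub> K b = K (a \<oplus> b)"
  "a \<in> carrier A \<Longrightarrow> b \<in> carrier A \<Longrightarrow> a \<odot>\<^bsub>Q\<^esub> K b = K (a \<otimes> b)"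
proof -
  show "a \<in> carrier A \<Longrightarrow> b \<in> carrier A \<Longrightarrow> K a \<oplus>\<^bsub>Q\<^esub> K b = K (a \<oplus> b)"
  proof -
    assume a: "a \<in> carrier A" "b \<in> carrier A"
    note r = rp(1)[OF a(1)] rp(1)[OF a(2)]
    have "(rp (K a) \<oplus> rp (K b)) \<ominus> (a \<oplus> b) = (rp (K a) \<ominus> a) \<oplus> (rp (K b) \<ominus> b)"
      using a r by algebra
    then have "(rp (K a) \<oplus> rp (K b)) \<ominus> (a \<oplus> b) \<in> p"
      using p.a_closed[OF rp_diff[OF a(1)] rp_diff[OF a(2)]] by simp
    then show ?thesis unfolding quotient_module_def using K_eq_iff a r by simp
  qed
  show "a \<in> carrier A \<Longrightarrow> b \<in> carrier A \<Longrightarrow> a \<odot>\<^bsub>Q\<^esub> K b = K (a \<otimes> b)"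
  proof -
    assume a: "a \<in> carrier A" "b \<in> carrier A"
    note r = rp(1)[OF a(2)]
    have "a \<otimes> rp (K b) \<ominus> a \<otimes> b = a \<otimes> (rp (K b) \<ominus> b)"
      using a r by algebra
    then have "a \<otimes> rp (K b) \<ominus> a \<otimes> b \<in> p"
      using p.I_l_closed[OF rp_diff[OF a(2)] a(1)] by simp
    then show ?thesis unfolding quotient_module_def using K_eq_iff a r by simp
  qed
qed (auto simp: quotient_module_def)

lemma Q_module: "module A Q"
proof (rule moduleI[OF is_cring])
  show "abelian_group Q"
  proof (rule abelian_groupI)
    fix x assume "x \<in> carrier Q"
    then obtain a where a: "a \<in> carrier A" "x = K a" unfolding Q_simps by auto
    then show "\<exists>y\<in>carrier Q. y \<oplus>\<^bsub>Q\<^esub> x = \<zero>\<^bsub>Q\<^esub>"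
      using Q_simps(3)[of "\<ominus> a" a] l_neg[OF a(1)] by (intro bexI[of _ "K (\<ominus> a)"]) (auto simp: Q_simps)
  qed (auto simp: Q_simps a_ac)
qed (auto simp: Q_simps l_distr r_distr m_assoc)

end

text \<open>Primality gives injectivity: if \<open>a (x - y)\<close> lies in \<open>p\<close> and
  \<open>a\<close> does not, then \<open>x - y\<close> does. This is the map on which flatness is
  tested.\<close>

lemma (in cring) primeideal_mult_linear:
  assumes p: "primeideal p R" and a: "a \<in> carrier R" "a \<notin> p"
  shows "module_linear R (quotient_module R p) (quotient_module R p) (\<lambda>X. qcls R p (a \<otimes> qrep R p X))"
    and "inj_on (\<lambda>X. qcls R p (a \<otimes> qrep R p X)) (carrier (quotient_module R p))"
    and "\<And>b. b \<in> carrier R \<Longrightarrow> qcls R p (a \<otimes> qrep R p (qcls R p b)) = qcls R p (a \<otimes> b)"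
proof -
  interpret p: primeideal p R by (rule p)
  interpret Q: quotient_mod R p by unfold_locales
  show eq: "Q.K (a \<otimes> Q.rp (Q.K b)) = Q.K (a \<otimes> b)" if "b \<in> carrier R" for b
    using Q.Q_simps(4)[OF a(1) that] unfolding quotient_module_def by simp
  show "module_linear R Q.Q Q.Q (\<lambda>X. Q.K (a \<otimes> Q.rp X))"
    unfolding module_linear_def using a by (auto simp: Q.Q_simps eq r_distr m_ac)
  show "inj_on (\<lambda>X. Q.K (a \<otimes> Q.rp X)) (carrier Q.Q)"
  proof (rule inj_onI)
    fix X Y assume "X \<in> carrier Q.Q" "Y \<in> carrier Q.Q"
      and e: "Q.K (a \<otimes> Q.rp X) = Q.K (a \<otimes> Q.rp Y)"
    then obtain x y where x: "x \<in> carrier R" "X = Q.K x" and y: "y \<in> carrier R" "Y = Q.K y"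
      unfolding Q.Q_simps by auto
    have "a \<otimes> x \<ominus> a \<otimes> y \<in> p" using e x y eq Q.K_eq_iff a by simp
    moreover have "a \<otimes> x \<ominus> a \<otimes> y = a \<otimes> (x \<ominus> y)" using a x y by algebra
    ultimately have "x \<ominus> y \<in> p" using p.I_prime[of a "x \<ominus> y"] a x y by auto
    then show "X = Y" using Q.K_eq_iff x y by simp
  qed
qed

text \<open>Tensoring the injective multiplication by \<open>a\<close> on \<open>A/p\<close> with \<open>B\<close> shows that \<open>\<phi> a\<close> lies
  outside \<open>pB\<close> whenever \<open>a\<close> lies outside \<open>p\<close>.\<close>

lemma flat_local_prime_lift:
  assumes A: "local_ring A" and B: "local_ring B" and loc: "local_hom A B \<phi>"
    and flat: "flat_hom A B \<phi>" and p: "primeideal p A"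
  obtains q where "primeideal q B" "{a \<in> carrier A. \<phi> a \<in> q} = p"
proof -
  interpret A: cring A using A unfolding local_ring_def by simp
  interpret B: cring B using B unfolding local_ring_def by simp
  have \<phi>: "\<phi> \<in> ring_hom A B" using loc unfolding local_hom_def by simp
  interpret h: ring_hom_ring A B \<phi> by (rule ring_hom_ringI2[OF A.ring_axioms B.ring_axioms \<phi>])
  interpret p: primeideal p A by (rule p)
  interpret Q: quotient_mod A p by unfold_locales
  interpret M: module A Q.Q by (rule Q.Q_module)
  interpret T: tensor A B \<phi> Q.Q
    by unfold_locales auto
  define I where "I = Idl\<^bsub>B\<^esub> (\<phi> ` p)"
  have pc: "\<phi> ` p \<subseteq> carrier B" using p.a_subset by auto
  have I: "ideal I B" unfolding I_def by (rule B.genideal_ideal[OF pc])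
  interpret I: ideal I B by (rule I)
  have pI: "\<phi> x \<in> I" if "x \<in> p" for x unfolding I_def using B.genideal_self[OF pc] that by auto
  \<comment> \<open>Elements of \<open>p\<close> are nonunits and \<open>\<phi>\<close> is local, so
    \<open>I\<close> lies in the maximal ideal of \<open>B\<close>.\<close>
  have one: "\<one>\<^bsub>B\<^esub> \<notin> I"
  proof
    assume "\<one>\<^bsub>B\<^esub> \<in> I"
    interpret m: maximalideal "carrier B - Units B" B by (rule local_ring_nonunits(1)[OF B])
    have "\<phi> x \<in> carrier B - Units B" if x: "x \<in> p" for x
    proof -
      have xc: "x \<in> carrier A" using x p.Icarr by auto
      have "x \<notin> Units A"
      proof
        assume "x \<in> Units A"
        then have "inv\<^bsub>A\<^esub> x \<otimes>\<^bsub>A\<^esub> x = \<one>\<^bsub>A\<^esub>" "inv\<^bsub>A\<^esub> x \<in> carrier A" by auto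
        then have "\<one>\<^bsub>A\<^esub> \<in> p" using p.I_l_closed[OF x] by metis
        then show False using p.one_imp_carrier p.I_notcarr by auto
      qed
      then show ?thesis using local_hom_unit_iff[OF A B loc xc] xc by simp
    qed
    then have "I \<subseteq> carrier B - Units B"
      unfolding I_def by (intro B.genideal_minimal[OF m.is_ideal]) auto
    then show False using \<open>\<one>\<^bsub>B\<^esub> \<in> I\<close> by auto
  qed
  have one_notin_rels: "frag_of (\<one>\<^bsub>B\<^esub>, Q.K \<one>\<^bsub>A\<^esub>) \<notin> T.rels"
  proof
    assume r: "frag_of (\<one>\<^bsub>B\<^esub>, Q.K \<one>\<^bsub>A\<^esub>) \<in> T.rels"
    \<comment> \<open>The balanced map to the quotient of \<open>B\<close> by \<open>I\<close>
      induced by multiplying \<open>b\<close> with \<open>\<phi> a\<close>; it sends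
      \<open>1 \<otimes> 1\<close> to 1, which is not 0 there.\<close>
    define \<beta> where "\<beta> = (\<lambda>(b, X). I +>\<^bsub>B\<^esub> (b \<otimes>\<^bsub>B\<^esub> \<phi> (Q.rp X)))"
    have \<beta>: "\<beta> (b, Q.K a) = I +>\<^bsub>B\<^esub> (b \<otimes>\<^bsub>B\<^esub> \<phi> a)" if b: "b \<in> carrier B" and a: "a \<in> carrier A" for b a
    proof -
      note r = Q.rp(1)[OF a]
      have "b \<otimes>\<^bsub>B\<^esub> \<phi> (Q.rp (Q.K a)) \<ominus>\<^bsub>B\<^esub> b \<otimes>\<^bsub>B\<^esub> \<phi> a = b \<otimes>\<^bsub>B\<^esub> (\<phi> (Q.rp (Q.K a)) \<ominus>\<^bsub>B\<^esub> \<phi> a)"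
        using a b r h.hom_closed[OF a] h.hom_closed[OF r] by algebra
      also have "\<phi> (Q.rp (Q.K a)) \<ominus>\<^bsub>B\<^esub> \<phi> a = \<phi> (Q.rp (Q.K a) \<ominus>\<^bsub>A\<^esub> a)"
        using a r by (simp add: a_minus_def)
      finally have "b \<otimes>\<^bsub>B\<^esub> \<phi> (Q.rp (Q.K a)) \<ominus>\<^bsub>B\<^esub> b \<otimes>\<^bsub>B\<^esub> \<phi> a \<in> I"
        using I.I_l_closed[OF pI[OF Q.rp_diff[OF a]] b] by simp
      then show ?thesis
        unfolding \<beta>_def using B.quotient_eq_iff_same_a_r_cos[OF I] a b r by simp
    qed
    have "\<beta> (\<one>\<^bsub>B\<^esub>, Q.K \<one>\<^bsub>A\<^esub>) = \<one>\<^bsub>add_monoid (B Quot I)\<^esub>"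
    proof (rule T.functional[OF _ _ _ _ _ _ _ r])
      have "ring (B Quot I)" by (rule I.quotient_is_ring)
      then show "Group.comm_group (add_monoid (B Quot I))"
        using abelian_group.a_comm_group ring.is_abelian_group by blast
    qed (auto simp: Q.Q_simps \<beta> FactRing_def A_RCOSETS_def RCOSETS_def a_r_coset_def[symmetric]
        I.a_rcos_sum B.l_distr B.r_distr B.m_assoc)
    then have "I +>\<^bsub>B\<^esub> \<one>\<^bsub>B\<^esub> = I" using \<beta>[of "\<one>\<^bsub>B\<^esub>" "\<one>\<^bsub>A\<^esub>"] by (simp add: FactRing_def)
    then have "\<one>\<^bsub>B\<^esub> \<in> I" using I.rcos_const_imp_mem by simp
    then show False using one by simp
  qed
  have zero: "frag_of (b, Q.K \<zero>\<^bsub>A\<^esub>) \<in> T.rels" if "b \<in> carrier B" for b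
    by (rule T.rels_idem[OF that]) (auto simp: Q.Q_simps)
  have zeroI: "frag_of (b, Q.K \<one>\<^bsub>A\<^esub>) \<in> T.rels" if b: "b \<in> I" for b
  proof -
    have K1: "Q.K \<one>\<^bsub>A\<^esub> \<in> carrier Q.Q" unfolding Q.Q_simps by simp
    \<comment> \<open>The annihilator of \<open>1 \<otimes> 1\<close>; the multiplier
      \<open>c\<close> is built in so that closure under multiplication is immediate.\<close>
    define L where "L = {b \<in> carrier B. \<forall>c\<in>carrier B. frag_of (c \<otimes>\<^bsub>B\<^esub> b, Q.K \<one>\<^bsub>A\<^esub>) \<in> T.rels}"
    have sum: "frag_of (x \<oplus>\<^bsub>B\<^esub> y, Q.K \<one>\<^bsub>A\<^esub>) \<in> T.rels \<longleftrightarrow> frag_of (y, Q.K \<one>\<^bsub>A\<^esub>) \<in> T.rels"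
      if x: "x \<in> carrier B" "y \<in> carrier B" "frag_of (x, Q.K \<one>\<^bsub>A\<^esub>) \<in> T.rels" for x y
    proof -
      note r = T.rels_add[OF T.rels_add_left[OF x(1,2) K1] x(3)]
      show ?thesis
        using T.rels_add[OF r] T.rels_diff[OF _ r] by fastforce
    qed
    have z: "frag_of (\<zero>\<^bsub>B\<^esub>, Q.K \<one>\<^bsub>A\<^esub>) \<in> T.rels"
      using T.rels_minus[OF T.rels_add_left[OF B.zero_closed B.zero_closed K1]] by simp
    have "ideal L B"
    proof (rule idealI[OF B.ring_axioms])
      show "subgroup L (add_monoid B)"
      proof (rule group.subgroupI[OF B.a_group])
        show "L \<subseteq> carrier (add_monoid B)" unfolding L_def by auto
        have "\<zero>\<^bsub>B\<^esub> \<in> L" unfolding L_def using z by simp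
        then show "L \<noteq> {}" by auto
        fix x assume x: "x \<in> L"
        have "frag_of (c \<otimes>\<^bsub>B\<^esub> (\<ominus>\<^bsub>B\<^esub> x), Q.K \<one>\<^bsub>A\<^esub>) \<in> T.rels" if c: "c \<in> carrier B" for c
        proof -
          have xc: "x \<in> carrier B" "frag_of (c \<otimes>\<^bsub>B\<^esub> x, Q.K \<one>\<^bsub>A\<^esub>) \<in> T.rels" using x c unfolding L_def by auto
          have "c \<otimes>\<^bsub>B\<^esub> x \<oplus>\<^bsub>B\<^esub> c \<otimes>\<^bsub>B\<^esub> (\<ominus>\<^bsub>B\<^esub> x) = \<zero>\<^bsub>B\<^esub>" using xc c by algebra
          then show ?thesis using sum[of "c \<otimes>\<^bsub>B\<^esub> x" "c \<otimes>\<^bsub>B\<^esub> (\<ominus>\<^bsub>B\<^esub> x)"] z xc c by simp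
        qed
        then show "inv\<^bsub>add_monoid B\<^esub> x \<in> L" using x unfolding L_def a_inv_def[symmetric] by auto
        fix y assume y: "y \<in> L"
        have "frag_of (c \<otimes>\<^bsub>B\<^esub> (x \<oplus>\<^bsub>B\<^esub> y), Q.K \<one>\<^bsub>A\<^esub>) \<in> T.rels" if c: "c \<in> carrier B" for c
          using sum[of "c \<otimes>\<^bsub>B\<^esub> x" "c \<otimes>\<^bsub>B\<^esub> y"] x y c unfolding L_def by (simp add: B.r_distr)
        then show "x \<otimes>\<^bsub>add_monoid B\<^esub> y \<in> L" using x y unfolding L_def by auto
      qed
      fix a x assume a: "a \<in> L" "x \<in> carrier B"
      have "frag_of (c \<otimes>\<^bsub>B\<^esub> (x \<otimes>\<^bsub>B\<^esub> a), Q.K \<one>\<^bsub>A\<^esub>) \<in> T.rels" if c: "c \<in> carrier B" for c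
      proof -
        have "frag_of ((c \<otimes>\<^bsub>B\<^esub> x) \<otimes>\<^bsub>B\<^esub> a, Q.K \<one>\<^bsub>A\<^esub>) \<in> T.rels"
          using a c unfolding L_def by blast
        then show ?thesis using a c B.m_assoc[of c x a] unfolding L_def by simp
      qed
      then show "x \<otimes>\<^bsub>B\<^esub> a \<in> L" using a unfolding L_def by auto
      then show "a \<otimes>\<^bsub>B\<^esub> x \<in> L" using a B.m_comm[of a x] unfolding L_def by auto
    qed
    moreover have "\<phi> ` p \<subseteq> L"
    proof
      fix y assume "y \<in> \<phi> ` p"
      then obtain x where x: "x \<in> p" "y = \<phi> x" by auto
      have xc: "x \<in> carrier A" using x p.Icarr by auto
      have "Q.K x = Q.K \<zero>\<^bsub>A\<^esub>" using Q.K_eq_iff[OF xc A.zero_closed] x xc by (simp add: a_minus_def)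
      then have e: "x \<odot>\<^bsub>Q.Q\<^esub> Q.K \<one>\<^bsub>A\<^esub> = Q.K \<zero>\<^bsub>A\<^esub>" using Q.Q_simps(4)[OF xc A.one_closed] xc by simp
      have "frag_of (c \<otimes>\<^bsub>B\<^esub> \<phi> x, Q.K \<one>\<^bsub>A\<^esub>) \<in> T.rels" if c: "c \<in> carrier B" for c
        using T.rels_add[OF T.rels_scalar[OF c xc K1] zero[OF c]] unfolding e by simp
      then show "y \<in> L" unfolding L_def x using xc by simp
    qed
    ultimately have "I \<subseteq> L" unfolding I_def by (rule B.genideal_minimal)
    then have "frag_of (\<one>\<^bsub>B\<^esub> \<otimes>\<^bsub>B\<^esub> b, Q.K \<one>\<^bsub>A\<^esub>) \<in> T.rels" using b unfolding L_def by blast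
    then show ?thesis using I.Icarr[OF b] by simp
  qed
  have disj: "\<phi> a \<notin> I" if a: "a \<in> carrier A" "a \<notin> p" for a
  proof
    assume aI: "\<phi> a \<in> I"
    let ?h = "\<lambda>X. Q.K (a \<otimes>\<^bsub>A\<^esub> Q.rp X)"
    note lin = A.primeideal_mult_linear[OF p a]
    have inj: "inj_on (base_change_map A B \<phi> Q.Q ?h) (carrier (base_change A B \<phi> Q.Q))"
      using flat Q.Q_module lin(1,2) unfolding flat_hom_def by blast
    have K1: "Q.K \<one>\<^bsub>A\<^esub> \<in> carrier Q.Q" unfolding Q.Q_simps by simp
    have f: "frag_of (\<one>\<^bsub>B\<^esub>, Q.K \<one>\<^bsub>A\<^esub>) \<in> T.F" by (rule T.F_of[OF B.one_closed K1])
    have f0: "0 \<in> T.F" unfolding T.F_iff by simp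
    note map = base_change_map_class[OF T.tensor_axioms T.tensor_axioms lin(1)]
    have "frag_of (\<one>\<^bsub>B\<^esub>, Q.K a) \<in> T.rels"
    proof -
      have "frag_of (\<one>\<^bsub>B\<^esub> \<otimes>\<^bsub>B\<^esub> \<phi> a, Q.K \<one>\<^bsub>A\<^esub>) - frag_of (\<one>\<^bsub>B\<^esub>, Q.K a) \<in> T.rels"
        using T.rels_scalar[OF B.one_closed a(1) K1] Q.Q_simps(4)[OF a(1) A.one_closed] a by simp
      from T.rels_diff[OF zeroI[OF aI] this] show ?thesis using a by simp
    qed
    \<comment> \<open>The injective map sends \<open>1 \<otimes> 1\<close> to
      \<open>1 \<otimes> a\<close>, which equals \<open>\<phi> a \<otimes> 1\<close> and vanishes
      because \<open>\<phi> a\<close> lies in \<open>I\<close>.\<close>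
    then have "base_change_map A B \<phi> Q.Q ?h (T.cls (frag_of (\<one>\<^bsub>B\<^esub>, Q.K \<one>\<^bsub>A\<^esub>))) =
      base_change_map A B \<phi> Q.Q ?h (T.cls 0)"
      unfolding map[OF f] map[OF f0] T.cls_eq_iff using lin(3)[OF A.one_closed] a by simp
    then have "T.cls (frag_of (\<one>\<^bsub>B\<^esub>, Q.K \<one>\<^bsub>A\<^esub>)) = T.cls 0"
      using inj_onD[OF inj] f f0 unfolding T.carrier_base_change by blast
    then show False unfolding T.cls_eq_iff using one_notin_rels by simp
  qed
  have "\<one>\<^bsub>A\<^esub> \<notin> p" using p.one_imp_carrier p.I_notcarr by auto
  \<comment> \<open>A prime that contains \<open>I\<close> and misses the image of the complement of
    \<open>p\<close> contracts to exactly \<open>p\<close>.\<close>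
  then obtain q where q: "primeideal q B" "I \<subseteq> q" "q \<inter> \<phi> ` (carrier A - p) = {}"
  proof (rule_tac B.prime_ideal_disjoint[OF I, of "\<phi> ` (carrier A - p)"])
    show "I \<inter> \<phi> ` (carrier A - p) = {}" using disj by auto
    assume "\<one>\<^bsub>A\<^esub> \<notin> p"
    then show "\<one>\<^bsub>B\<^esub> \<in> \<phi> ` (carrier A - p)" using h.hom_one by (intro image_eqI[of _ _ "\<one>\<^bsub>A\<^esub>"]) auto
    fix x y assume "x \<in> \<phi> ` (carrier A - p)" "y \<in> \<phi> ` (carrier A - p)"
    then obtain a b where ab: "a \<in> carrier A" "a \<notin> p" "b \<in> carrier A" "b \<notin> p" "x = \<phi> a" "y = \<phi> b" by auto
    then show "x \<otimes>\<^bsub>B\<^esub> y \<in> \<phi> ` (carrier A - p)"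
      using p.I_prime[of a b] by (intro image_eqI[of _ _ "a \<otimes>\<^bsub>A\<^esub> b"]) auto
  qed auto
  have "{a \<in> carrier A. \<phi> a \<in> q} = p"
    using q(2,3) pI p.Icarr by blast
  then show ?thesis using that q by blast
qed

section \<open>Generizations\<close>

lemma chartD:
  assumes "chart X U R \<pi> h"
  shows "openin (base X) U" "cring R" "h \<in> ring_hom R (sec X U)" "bij_betw \<pi> U {p. primeideal p R}"
    "\<And>y a. y \<in> U \<Longrightarrow> a \<in> carrier R \<Longrightarrow> germ X y U (h a) \<in> Units (stalk_ring X y) \<longleftrightarrow> a \<notin> \<pi> y"
    "\<And>a. a \<in> carrier R \<Longrightarrow> openin (base X) {y \<in> U. a \<notin> \<pi> y}"
    "\<And>N y. openin (base X) N \<Longrightarrow> y \<in> N \<Longrightarrow> N \<subseteq> U \<Longrightarrow>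
        \<exists>a\<in>carrier R. a \<notin> \<pi> y \<and> {z \<in> U. a \<notin> \<pi> z} \<subseteq> N"
    "\<And>N y s. openin (base X) N \<Longrightarrow> y \<in> N \<Longrightarrow> N \<subseteq> U \<Longrightarrow> s \<in> carrier (sec X N) \<Longrightarrow>
        \<exists>a t V. a \<in> carrier R \<and> t \<in> carrier R \<and> openin (base X) V \<and> y \<in> V \<and> V \<subseteq> N \<and>
           (\<forall>z\<in>V. t \<notin> \<pi> z) \<and> res X U V (h t) \<otimes>\<^bsub>sec X V\<^esub> res X N V s = res X U V (h a)"
proof -
  note c = assms[unfolded chart_def]
  show "openin (base X) U" "cring R" "h \<in> ring_hom R (sec X U)" "bij_betw \<pi> U {p. primeideal p R}"
    using c by simp_all
  show "\<And>y a. y \<in> U \<Longrightarrow> a \<in> carrier R \<Longrightarrow> germ X y U (h a) \<in> Units (stalk_ring X y) \<longleftrightarrow> a \<notin> \<pi> y"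
    by (rule c[THEN conjunct2, THEN conjunct2, THEN conjunct2, THEN conjunct2, THEN conjunct1, rule_format])
  show "\<And>a. a \<in> carrier R \<Longrightarrow> openin (base X) {y \<in> U. a \<notin> \<pi> y}"
    by (rule c[THEN conjunct2, THEN conjunct2, THEN conjunct2, THEN conjunct2, THEN conjunct2, THEN conjunct1, rule_format])
  show "\<And>N y. openin (base X) N \<Longrightarrow> y \<in> N \<Longrightarrow> N \<subseteq> U \<Longrightarrow>
        \<exists>a\<in>carrier R. a \<notin> \<pi> y \<and> {z \<in> U. a \<notin> \<pi> z} \<subseteq> N"
    by (rule c[THEN conjunct2, THEN conjunct2, THEN conjunct2, THEN conjunct2, THEN conjunct2, THEN conjunct2, THEN conjunct1, THEN spec, THEN spec, THEN mp]) simp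
  show "\<And>N y s. openin (base X) N \<Longrightarrow> y \<in> N \<Longrightarrow> N \<subseteq> U \<Longrightarrow> s \<in> carrier (sec X N) \<Longrightarrow>
        \<exists>a t V. a \<in> carrier R \<and> t \<in> carrier R \<and> openin (base X) V \<and> y \<in> V \<and> V \<subseteq> N \<and>
           (\<forall>z\<in>V. t \<notin> \<pi> z) \<and> res X U V (h t) \<otimes>\<^bsub>sec X V\<^esub> res X N V s = res X U V (h a)"
    by (rule c[THEN conjunct2, THEN conjunct2, THEN conjunct2, THEN conjunct2, THEN conjunct2, THEN conjunct2, THEN conjunct2, THEN spec, THEN spec, THEN spec, THEN mp]) simp
qed

lemma chart_prime:
  assumes "chart X U R \<pi> h" "y \<in> U"
  shows "primeideal (\<pi> y) R"
  using bij_betwE[OF chartD(4)[OF assms(1)], rule_format, OF assms(2)] by simp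

lemma chart_point:
  assumes "chart X U R \<pi> h" "primeideal p R"
  obtains y where "y \<in> U" "\<pi> y = p"
proof -
  have "p \<in> \<pi> ` U" using bij_betw_imp_surj_on[OF chartD(4)[OF assms(1)]] assms(2) by simp
  then show ?thesis using that by auto
qed

text \<open>Inside \<open>N\<close> there is a basic open set around \<open>y\<close>, given by some
  \<open>a\<close> outside the prime of \<open>y\<close>, hence outside any smaller prime.\<close>

lemma chart_generization:
  assumes C: "chart X U R \<pi> h" and y: "y \<in> U" "y' \<in> U" "\<pi> y' \<subseteq> \<pi> y"
    and N: "openin (base X) N" "y \<in> N"
  shows "y' \<in> N"
proof -
  have "openin (base X) (N \<inter> U)" "y \<in> N \<inter> U" "N \<inter> U \<subseteq> U" using chartD(1)[OF C] N y by auto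
  from chartD(7)[OF C this] obtain a where "a \<in> carrier R" "a \<notin> \<pi> y" "{z \<in> U. a \<notin> \<pi> z} \<subseteq> N \<inter> U" by blast
  then show ?thesis using y by blast
qed

text \<open>A point of a chart is its prime, and the prime consists of the ring elements whose germs
  are nonunits. So an image point can be identified by testing units.\<close>

lemma chart_separated:
  assumes C: "chart X U R \<pi> h" and y: "y \<in> U" "y' \<in> U"
    and eq: "\<And>a. a \<in> carrier R \<Longrightarrow>
      germ X y U (h a) \<in> Units (stalk_ring X y) \<longleftrightarrow> germ X y' U (h a) \<in> Units (stalk_ring X y')"
  shows "y = y'"
proof -
  have iff: "a \<in> \<pi> y \<longleftrightarrow> a \<in> \<pi> y'" if "a \<in> carrier R" for a
    using eq[OF that] chartD(5)[OF C y(1) that] chartD(5)[OF C y(2) that] by simp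
  have sub: "\<pi> z \<subseteq> carrier R" if "z \<in> U" for z
  proof -
    interpret primeideal "\<pi> z" R by (rule chart_prime[OF C that])
    show ?thesis by (rule a_subset)
  qed
  have "\<pi> y = \<pi> y'" using iff sub[OF y(1)] sub[OF y(2)] by blast
  then show ?thesis using bij_betw_imp_inj_on[OF chartD(4)[OF C]] y by (auto dest: inj_onD)
qed

lemma (in cring) Units_mult_iff:
  assumes "u \<in> Units R" "a \<in> carrier R"
  shows "u \<otimes> a \<in> Units R \<longleftrightarrow> a \<in> Units R"
proof
  assume "u \<otimes> a \<in> Units R"
  then have "inv u \<otimes> (u \<otimes> a) \<in> Units R" using assms by blast
  moreover have "inv u \<otimes> (u \<otimes> a) = a"
    using assms m_assoc[OF Units_inv_closed[OF assms(1)] Units_closed[OF assms(1)] assms(2)] by simp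
  ultimately show "a \<in> Units R" by simp
qed (use assms in blast)

lemma (in primeideal) Units_notin: "u \<in> Units R \<Longrightarrow> u \<notin> I"
proof
  assume "u \<in> Units R" "u \<in> I"
  then have "inv u \<otimes> u \<in> I" using I_l_closed by blast
  then have "\<one> \<in> I" using \<open>u \<in> Units R\<close> by simp
  then show False using one_imp_carrier I_notcarr by auto
qed

lemma (in primeideal) Units_mult_mem_iff:
  assumes "u \<in> Units R" "a \<in> carrier R"
  shows "u \<otimes> a \<in> I \<longleftrightarrow> a \<in> I"
  using I_prime[of u a] Units_notin[OF assms(1)] I_l_closed[of a u] assms by auto

context lringed
begin

text \<open>The prime ideals of the stalk at \<open>z\<close> are the generizations of \<open>z\<close>.\<close>

lemma stalk_prime_point:
  assumes C: "chart X U R \<pi> h" and z: "z \<in> U" and q: "primeideal q (stalk_ring X z)"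
  obtains z' where "z' \<in> U" "\<And>N. op N \<Longrightarrow> z \<in> N \<Longrightarrow> z' \<in> N"
    "\<And>N s. op N \<Longrightarrow> z \<in> N \<Longrightarrow> s \<in> carrier (sec X N) \<Longrightarrow>
      germ X z N s \<in> q \<longleftrightarrow> germ X z' N s \<notin> Units (stalk_ring X z')"
proof -
  note U = chartD(1)[OF C] and hh = chartD(3)[OF C]
  interpret R: cring R by (rule chartD(2)[OF C])
  have zt: "z \<in> topspace (base X)" using op_topspace[OF U z] .
  interpret A: cring "stalk_ring X z" by (rule stalk_cring[OF zt])
  interpret q: primeideal q "stalk_ring X z" by (rule q)
  have hom: "(\<lambda>a. germ X z U (h a)) \<in> ring_hom R (stalk_ring X z)"
    using ring_hom_trans[OF hh germ_hom[OF U z]] unfolding comp_def .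
  \<comment> \<open>Contract \<open>q\<close> to the chart ring; the point belonging to the
    contracted prime is the generization sought.\<close>
  define q' where "q' = {a \<in> carrier R. germ X z U (h a) \<in> q}"
  have "primeideal q' R"
    unfolding q'_def by (rule primeideal_vimage[OF R.is_cring A.is_cring hom q])
  then obtain z' where z': "z' \<in> U" "\<pi> z' = q'" using chart_point[OF C] by blast
  have "q' \<subseteq> \<pi> z"
  proof
    fix a assume "a \<in> q'"
    then have "a \<in> carrier R" "germ X z U (h a) \<notin> Units (stalk_ring X z)"
      unfolding q'_def using q.Units_notin by auto
    then show "a \<in> \<pi> z" using chartD(5)[OF C z] by simp
  qed
  then have gen: "z' \<in> N" if "op N" "z \<in> N" for N
    using chart_generization[OF C z z'(1) _ that] z' by simp
  have zt': "z' \<in> topspace (base X)" using gen[OF _ zt] by simp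
  interpret A': cring "stalk_ring X z'" by (rule stalk_cring[OF zt'])
  have "germ X z N s \<in> q \<longleftrightarrow> germ X z' N s \<notin> Units (stalk_ring X z')"
    if N: "op N" "z \<in> N" and s: "s \<in> carrier (sec X N)" for N s
  proof -
    let ?M = "N \<inter> U"
    have M: "op ?M" "z \<in> ?M" "?M \<subseteq> U" "?M \<subseteq> N" using N U z by auto
    \<comment> \<open>Near \<open>z\<close> the section satisfies \<open>t s = a\<close> with
      \<open>t\<close> a unit at \<open>z\<close> and at \<open>z'\<close>, so it suffices to test
      \<open>a\<close>, for which both conditions say that \<open>a\<close> lies in
      \<open>q'\<close>.\<close>
    from chartD(8)[OF C M(1-3) rclosed[OF N(1) M(1,4) s]]
    obtain a t V where at: "a \<in> carrier R" "t \<in> carrier R" and V: "op V" "z \<in> V" "V \<subseteq> ?M"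
      and t: "\<forall>y\<in>V. t \<notin> \<pi> y"
      and e: "res X U V (h t) \<otimes>\<^bsub>sec X V\<^esub> res X ?M V (res X N ?M s) = res X U V (h a)"
      by (elim exE conjE)
    have VU: "V \<subseteq> U" "V \<subseteq> N" using V by auto
    have hc: "h a \<in> carrier (sec X U)" "h t \<in> carrier (sec X U)"
      using ring_hom_closed[OF hh] at by auto
    have e': "res X U V (h t) \<otimes>\<^bsub>sec X V\<^esub> res X N V s = res X U V (h a)"
      using e rres[OF N(1) M(1) V(1) V(3) M(4) s] by simp
    have prod: "germ X y U (h t) \<otimes>\<^bsub>stalk_ring X y\<^esub> germ X y N s = germ X y U (h a)" if y: "y \<in> V" for y
    proof -
      have "germ X y V (res X U V (h t)) \<otimes>\<^bsub>stalk_ring X y\<^esub> germ X y V (res X N V s) = germ X y V (res X U V (h a))"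
        unfolding germ_mult[OF V(1) y rclosed[OF U V(1) VU(1) hc(2)] rclosed[OF N(1) V(1) VU(2) s]] e' ..
      then show ?thesis
        unfolding germ_rs[OF U hc(1) V(1) y VU(1)] germ_rs[OF U hc(2) V(1) y VU(1)] germ_rs[OF N(1) s V(1) y VU(2)] .
    qed
    have zV: "z' \<in> V" by (rule gen[OF V(1,2)])
    have zN': "z' \<in> N" by (rule gen[OF N])
    have u: "germ X z U (h t) \<in> Units (stalk_ring X z)" "germ X z' U (h t) \<in> Units (stalk_ring X z')"
      using chartD(5)[OF C z at(2)] chartD(5)[OF C z'(1) at(2)] t V zV by auto
    have "germ X z N s \<in> q \<longleftrightarrow> germ X z U (h a) \<in> q"
      using q.Units_mult_mem_iff[OF u(1) germ_closed[OF N s]] prod[OF V(2)] by simp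
    also have "\<dots> \<longleftrightarrow> a \<in> \<pi> z'" unfolding z'(2) q'_def using at by simp
    also have "\<dots> \<longleftrightarrow> germ X z' U (h a) \<notin> Units (stalk_ring X z')"
      using chartD(5)[OF C z'(1) at(1)] by simp
    also have "\<dots> \<longleftrightarrow> germ X z' N s \<notin> Units (stalk_ring X z')"
      using A'.Units_mult_iff[OF u(2) germ_closed[OF N(1) zN' s]] prod[OF zV] by simp
    finally show ?thesis .
  qed
  then show ?thesis using that z'(1) gen by blast
qed

text \<open>Every neighbourhood of \<open>x\<close> contains \<open>x'\<close>, so germs at
  \<open>x\<close> have germs at \<open>x'\<close>; this gives a homomorphism \<open>\<rho>\<close>
  of stalks, along which the maximal ideal at \<open>x'\<close> contracts to
  \<open>p\<close>.\<close>

lemma generization_prime: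
  assumes x: "x \<in> topspace (base X)" and gen: "\<And>N. op N \<Longrightarrow> x \<in> N \<Longrightarrow> x' \<in> N"
  obtains p where "primeideal p (stalk_ring X x)"
    "\<And>N s. op N \<Longrightarrow> x \<in> N \<Longrightarrow> s \<in> carrier (sec X N) \<Longrightarrow>
      germ X x N s \<in> p \<longleftrightarrow> germ X x' N s \<notin> Units (stalk_ring X x')"
proof -
  let ?A = "stalk_ring X x" and ?A' = "stalk_ring X x'"
  have x': "x' \<in> topspace (base X)" using gen[OF _ x] by simp
  interpret A: cring ?A by (rule stalk_cring[OF x])
  interpret A': cring ?A' by (rule stalk_cring[OF x'])
  define \<rho> where "\<rho> a = (SOME c. \<exists>N s. op N \<and> x \<in> N \<and> s \<in> carrier (sec X N) \<and>
    a = germ X x N s \<and> c = germ X x' N s)" for a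
  have \<rho>: "\<rho> (germ X x N s) = germ X x' N s" if N: "op N" "x \<in> N" "s \<in> carrier (sec X N)" for N s
  proof -
    have "\<exists>M t. op M \<and> x \<in> M \<and> t \<in> carrier (sec X M) \<and> germ X x N s = germ X x M t \<and>
        \<rho> (germ X x N s) = germ X x' M t"
      unfolding \<rho>_def by (rule someI[of _ "germ X x' N s"]) (use N in blast)
    then obtain M t where M: "op M" "x \<in> M" "t \<in> carrier (sec X M)" "germ X x N s = germ X x M t"
      "\<rho> (germ X x N s) = germ X x' M t" by (elim exE conjE)
    obtain W where W: "op W" "x \<in> W" "W \<subseteq> N \<inter> M" "res X N W s = res X M W t"
      using M(4) unfolding germ_eq[OF N M(1-3)] by (elim exE conjE)
    have "germ X x' N s = germ X x' M t"
      unfolding germ_eq[OF N(1) gen[OF N(1,2)] N(3) M(1) gen[OF M(1,2)] M(3)]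
      using W gen[OF W(1,2)] by blast
    then show ?thesis using M(5) by simp
  qed
  have T: "op (topspace (base X))" by simp
  have "\<rho> \<in> ring_hom ?A ?A'"
  proof (rule ring_hom_memI)
    fix a assume a: "a \<in> carrier ?A"
    show "\<rho> a \<in> carrier ?A'"
    proof (rule stalkE[OF a T x])
      fix U s assume U: "op U" "x \<in> U" "s \<in> carrier (sec X U)" "a = germ X x U s"
      show ?thesis unfolding U(4) \<rho>[OF U(1-3)] by (rule germ_closed[OF U(1) gen[OF U(1,2)] U(3)])
    qed
    fix b assume b: "b \<in> carrier ?A"
    show "\<rho> (a \<otimes>\<^bsub>?A\<^esub> b) = \<rho> a \<otimes>\<^bsub>?A'\<^esub> \<rho> b"
    proof (rule stalkE2[OF a b T x])
      fix U s t assume U: "op U" "x \<in> U" and s: "s \<in> carrier (sec X U)" and t: "t \<in> carrier (sec X U)"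
        and e: "a = germ X x U s" "b = germ X x U t"
      show ?thesis unfolding e germ_mult[OF U s t] \<rho>[OF U s] \<rho>[OF U t]
          \<rho>[OF U mult_closed[OF U(1) s t]] germ_mult[OF U(1) gen[OF U] s t] ..
    qed
    show "\<rho> (a \<oplus>\<^bsub>?A\<^esub> b) = \<rho> a \<oplus>\<^bsub>?A'\<^esub> \<rho> b"
    proof (rule stalkE2[OF a b T x])
      fix U s t assume U: "op U" "x \<in> U" and s: "s \<in> carrier (sec X U)" and t: "t \<in> carrier (sec X U)"
        and e: "a = germ X x U s" "b = germ X x U t"
      show ?thesis unfolding e germ_add[OF U s t] \<rho>[OF U s] \<rho>[OF U t]
          \<rho>[OF U add_closed[OF U(1) s t]] germ_add[OF U(1) gen[OF U] s t] ..
    qed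
  next
    show "\<rho> \<one>\<^bsub>?A\<^esub> = \<one>\<^bsub>?A'\<^esub>"
      using \<rho>[OF T x one_closed[OF T]] germ_one[OF T x] germ_one[OF T x'] by simp
  qed
  moreover have "primeideal (carrier ?A' - Units ?A') ?A'"
    by (rule A'.maximalideal_prime[OF local_ring_nonunits(1)[OF stalk_local[OF x']]])
  ultimately have "primeideal {a \<in> carrier ?A. \<rho> a \<in> carrier ?A' - Units ?A'} ?A"
    by (rule primeideal_vimage[OF A.is_cring A'.is_cring])
  then show ?thesis
  proof (rule that)
    fix N s assume N: "op N" "x \<in> N" "s \<in> carrier (sec X N)"
    show "germ X x N s \<in> {a \<in> carrier ?A. \<rho> a \<in> carrier ?A' - Units ?A'} \<longleftrightarrow> germ X x' N s \<notin> Units ?A'"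
      using \<rho>[OF N] germ_closed[OF N] germ_closed[OF N(1) gen[OF N(1,2)] N(3)] by simp
  qed
qed

text \<open>In a noetherian chart every point generizes to one of finitely many points, so the part of the
  chart outside \<open>V\<close> is the union of the closures of finitely many of them.\<close>

lemma open_if_stable:
  assumes ch: "\<And>x. x \<in> topspace (base X) \<Longrightarrow> \<exists>U (R :: 'a ring) \<pi> h. x \<in> U \<and> noetherian_ring R \<and> chart X U R \<pi> h"
    and stable: "\<And>U (R :: 'a ring) \<pi> h x x'. chart X U R \<pi> h \<Longrightarrow> x \<in> U \<Longrightarrow> x' \<in> U \<Longrightarrow> \<pi> x' \<subseteq> \<pi> x \<Longrightarrow>
      x' \<notin> V \<longleftrightarrow> x \<notin> V"
    and V: "V \<subseteq> topspace (base X)"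
  shows "op V"
proof (subst openin_subopen, intro ballI)
  fix x assume x: "x \<in> V"
  then obtain U and R :: "'a ring" and \<pi> h where xU: "x \<in> U" and R: "noetherian_ring R" and C: "chart X U R \<pi> h"
    using ch V by blast
  note U = chartD(1)[OF C]
  obtain Ps where Ps: "finite Ps" "\<And>p. p \<in> Ps \<Longrightarrow> primeideal p R"
    "\<And>q. primeideal q R \<Longrightarrow> \<exists>p\<in>Ps. p \<subseteq> q"
    using finite_primes_below_primes[OF chartD(2)[OF C] R] by auto
  \<comment> \<open>The listed primes whose points lie outside \<open>V\<close>; the closures of
    these points make up the complement of \<open>V\<close> in the chart.\<close>
  define Bad where "Bad = {p \<in> Ps. \<exists>y\<in>U. \<pi> y = p \<and> y \<notin> V}"
  have o: "op {y \<in> U. \<not> p \<subseteq> \<pi> y}" if p: "p \<in> Ps" for p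
  proof -
    interpret p: primeideal p R by (rule Ps(2)[OF p])
    have "{y \<in> U. \<not> p \<subseteq> \<pi> y} = (\<Union>a\<in>p. {y \<in> U. a \<notin> \<pi> y})" by auto
    then show ?thesis using chartD(6)[OF C] p.Icarr by auto
  qed
  have eq: "U \<inter> V = (\<Inter>p\<in>Bad. {y \<in> U. \<not> p \<subseteq> \<pi> y}) \<inter> U"
  proof (intro equalityI subsetI)
    fix y assume y: "y \<in> U \<inter> V"
    have "\<not> p \<subseteq> \<pi> y" if "p \<in> Bad" for p
      using that stable[OF C, of y] y unfolding Bad_def by blast
    then show "y \<in> (\<Inter>p\<in>Bad. {y \<in> U. \<not> p \<subseteq> \<pi> y}) \<inter> U" using y by auto
  next
    fix y assume y: "y \<in> (\<Inter>p\<in>Bad. {y \<in> U. \<not> p \<subseteq> \<pi> y}) \<inter> U"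
    then have yU: "y \<in> U" by simp
    \<comment> \<open>Some listed prime lies below the prime of \<open>y\<close>. It is not bad, so
      its point is in \<open>V\<close>, and stability passes this on to \<open>y\<close>.\<close>
    obtain p where p: "p \<in> Ps" "p \<subseteq> \<pi> y" using Ps(3)[OF chart_prime[OF C yU]] by blast
    obtain y' where y': "y' \<in> U" "\<pi> y' = p" using chart_point[OF C Ps(2)[OF p(1)]] by blast
    have "p \<notin> Bad" using y p by auto
    then have "y' \<in> V" using y' p unfolding Bad_def by blast
    then show "y \<in> U \<inter> V" using stable[OF C yU y'(1)] y' p yU by simp
  qed
  have "op ((\<Inter>p\<in>Bad. {y \<in> U. \<not> p \<subseteq> \<pi> y}) \<inter> U)"
  proof (cases "Bad = {}")
    case True
    then show ?thesis using U by simp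
  next
    case False
    have "finite Bad" unfolding Bad_def using Ps(1) by simp
    then have "op (\<Inter>p\<in>Bad. {y \<in> U. \<not> p \<subseteq> \<pi> y})"
      using False o unfolding Bad_def by (intro openin_INT2) auto
    then show ?thesis using U by auto
  qed
  then have "op (U \<inter> V)" unfolding eq .
  then show "\<exists>T. op T \<and> x \<in> T \<and> T \<subseteq> V" using x xU by blast
qed

end

text \<open>Going down. The generization \<open>x'\<close> corresponds to a prime of the stalk at
  the image of \<open>z\<close>, flatness lifts it to a prime of the stalk at \<open>z\<close>, and
  that prime corresponds to a generization \<open>z'\<close> of \<open>z\<close>. That
  \<open>z'\<close> maps to \<open>x'\<close> is checked on units, using functions from the chart of
  \<open>Y\<close>.\<close>

lemma (in lrs_mor) flat_generization_lift:
  assumes flat: "flat_hom (stalk_ring Y (pt_map f z)) (stalk_ring X z) (stalk_map X Y f z)"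
    and CX: "chart X U R \<pi> h" and z: "z \<in> U"
    and CY: "chart Y U' R' \<pi>' h'" and x: "pt_map f z \<in> U'" "x' \<in> U'" "\<pi>' x' \<subseteq> \<pi>' (pt_map f z)"
  obtains z' where "\<And>N. X.op N \<Longrightarrow> z \<in> N \<Longrightarrow> z' \<in> N" "pt_map f z' = x'"
proof -
  let ?A = "stalk_ring Y (pt_map f z)" and ?B = "stalk_ring X z" and ?\<phi> = "stalk_map X Y f z"
  note U' = chartD(1)[OF CY]
  have zt: "z \<in> topspace (base X)" using X.op_topspace[OF chartD(1)[OF CX] z] .
  have ft: "pt_map f z \<in> topspace (base Y)" by (rule pt_closed[OF zt])
  obtain p where p: "primeideal p ?A"
    "\<And>N s. Y.op N \<Longrightarrow> pt_map f z \<in> N \<Longrightarrow> s \<in> carrier (sec Y N) \<Longrightarrow>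
      germ Y (pt_map f z) N s \<in> p \<longleftrightarrow> germ Y x' N s \<notin> Units (stalk_ring Y x')"
    by (rule Y.generization_prime[OF ft chart_generization[OF CY x]], assumption+) (rule that, assumption+)
  obtain q where q: "primeideal q ?B" "{a \<in> carrier ?A. ?\<phi> a \<in> q} = p"
    by (rule flat_local_prime_lift[OF Y.stalk_local[OF ft] X.stalk_local[OF zt] stalk_map_local[OF zt] flat p(1)]) (rule that, assumption+)
  obtain z' where z': "z' \<in> U" "\<And>N. X.op N \<Longrightarrow> z \<in> N \<Longrightarrow> z' \<in> N"
    "\<And>N s. X.op N \<Longrightarrow> z \<in> N \<Longrightarrow> s \<in> carrier (sec X N) \<Longrightarrow>
      germ X z N s \<in> q \<longleftrightarrow> germ X z' N s \<notin> Units (stalk_ring X z')"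
    by (rule X.stalk_prime_point[OF CX z q(1)]) (rule that, assumption+)
  have pre: "X.op (preim X f U')" "z \<in> preim X f U'"
    using preim_open[OF U'] x zt preim_mem by auto
  have zt': "z' \<in> topspace (base X)" and fz': "pt_map f z' \<in> U'"
    using z'(2)[OF pre] preim_mem by auto
  have "pt_map f z' = x'"
  proof (rule chart_separated[OF CY fz' x(2)])
    fix a assume a: "a \<in> carrier R'"
    have s: "h' a \<in> carrier (sec Y U')" by (rule ring_hom_closed[OF chartD(3)[OF CY] a])
    have "germ Y (pt_map f z') U' (h' a) \<in> Units (stalk_ring Y (pt_map f z')) \<longleftrightarrow>
      germ X z' (preim X f U') (sec_map f U' (h' a)) \<in> Units (stalk_ring X z')"
      using sec_unit_iff[OF zt' U' fz' s] by simp
    also have "\<dots> \<longleftrightarrow> germ X z (preim X f U') (sec_map f U' (h' a)) \<notin> q"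
      using z'(3)[OF pre sec_closed[OF U' s]] by simp
    also have "\<dots> \<longleftrightarrow> ?\<phi> (germ Y (pt_map f z) U' (h' a)) \<notin> q"
      unfolding stalk_map_germ[OF zt U' x(1) s] ..
    also have "\<dots> \<longleftrightarrow> germ Y (pt_map f z) U' (h' a) \<notin> p"
      using q(2) Y.germ_closed[OF U' x(1) s] by blast
    also have "\<dots> \<longleftrightarrow> germ Y x' U' (h' a) \<in> Units (stalk_ring Y x')"
      using p(2)[OF U' x(1) s] by simp
    finally show "germ Y (pt_map f z') U' (h' a) \<in> Units (stalk_ring Y (pt_map f z')) \<longleftrightarrow>
      germ Y x' U' (h' a) \<in> Units (stalk_ring Y x')" .
  qed
  then show ?thesis using that z'(2) by blast
qed

section \<open>Compositum of residue fields\<close>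

text \<open>The integral monoid ring. Its multiplication is given on basis elements and extended by
  linearity, with no relations to respect, which makes it a convenient cover of a tensor product of
  rings.\<close>

definition monoid_ring :: "('a, 'e) monoid_scheme \<Rightarrow> ('a \<Rightarrow>\<^sub>0 int) ring" where
  "monoid_ring G = \<lparr>carrier = {c. Poly_Mapping.keys c \<subseteq> carrier G},
     monoid.mult = (\<lambda>c d. frag_extend (\<lambda>x. frag_extend (\<lambda>y. frag_of (x \<otimes>\<^bsub>G\<^esub> y)) d) c),
     monoid.one = frag_of \<one>\<^bsub>G\<^esub>, ring.zero = 0, ring.add = (+)\<rparr>"

locale formal_sums = Group.comm_monoid G for G (structure)
begin

abbreviation "S \<equiv> monoid_ring G"

lemma S_carrier: "c \<in> carrier S \<longleftrightarrow> Poly_Mapping.keys c \<subseteq> carrier G"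
  unfolding monoid_ring_def by simp

lemma S_simps: "\<one>\<^bsub>S\<^esub> = frag_of \<one>" "\<zero>\<^bsub>S\<^esub> = 0" "c \<oplus>\<^bsub>S\<^esub> d = c + d"
  "frag_of x \<otimes>\<^bsub>S\<^esub> frag_of y = frag_of (x \<otimes> y)"
  unfolding monoid_ring_def by simp_all

lemma S_mult_left: "(c + d) \<otimes>\<^bsub>S\<^esub> e = c \<otimes>\<^bsub>S\<^esub> e + d \<otimes>\<^bsub>S\<^esub> e" "(c - d) \<otimes>\<^bsub>S\<^esub> e = c \<otimes>\<^bsub>S\<^esub> e - d \<otimes>\<^bsub>S\<^esub> e"
  "0 \<otimes>\<^bsub>S\<^esub> e = 0"
  unfolding monoid_ring_def by (simp_all add: frag_extend_add frag_extend_diff)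

lemma S_mult_right: "c \<otimes>\<^bsub>S\<^esub> (d - e) = c \<otimes>\<^bsub>S\<^esub> d - c \<otimes>\<^bsub>S\<^esub> e" "c \<otimes>\<^bsub>S\<^esub> 0 = 0"
proof -
  have keys: "Poly_Mapping.keys c \<subseteq> UNIV" by simp
  show "c \<otimes>\<^bsub>S\<^esub> 0 = 0" unfolding monoid_ring_def using keys
    by (induction c rule: frag_induction) (simp_all add: frag_extend_diff)
  show "c \<otimes>\<^bsub>S\<^esub> (d - e) = c \<otimes>\<^bsub>S\<^esub> d - c \<otimes>\<^bsub>S\<^esub> e" unfolding monoid_ring_def using keys
    by (induction c rule: frag_induction) (simp_all add: frag_extend_diff)
qed

lemma S_induct [consumes 1, case_names zero diff of]:
  assumes "c \<in> carrier S" "P 0"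
    "\<And>c d. c \<in> carrier S \<Longrightarrow> d \<in> carrier S \<Longrightarrow> P c \<Longrightarrow> P d \<Longrightarrow> P (c - d)"
    "\<And>x. x \<in> carrier G \<Longrightarrow> P (frag_of x)"
  shows "P c"
  by (rule free_Abelian_group_induct[of c "carrier G" P]) (use assms in \<open>auto simp: S_carrier\<close>)

lemma S_of: "frag_of x \<in> carrier S \<longleftrightarrow> x \<in> carrier G"
  unfolding S_carrier by simp

lemma S_zero: "0 \<in> carrier S"
  unfolding S_carrier by simp

lemma S_diff: "c \<in> carrier S \<Longrightarrow> d \<in> carrier S \<Longrightarrow> c - d \<in> carrier S"
  unfolding S_carrier using keys_diff[of c d] by blast

lemma S_add: "c \<in> carrier S \<Longrightarrow> d \<in> carrier S \<Longrightarrow> c + d \<in> carrier S"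
  unfolding S_carrier using keys_add[of c d] by blast

lemma S_closed:
  assumes c: "c \<in> carrier S" and d: "d \<in> carrier S"
  shows "c \<otimes>\<^bsub>S\<^esub> d \<in> carrier S"
  using c
proof (induction rule: S_induct)
  case (of x)
  then have x: "x \<in> carrier G" .
  show ?case using d
    by (induction rule: S_induct) (simp_all add: S_mult_right S_zero S_diff S_simps S_of x)
qed (simp_all add: S_mult_left S_zero S_diff)

lemma S_comm:
  assumes c: "c \<in> carrier S" and d: "d \<in> carrier S"
  shows "c \<otimes>\<^bsub>S\<^esub> d = d \<otimes>\<^bsub>S\<^esub> c"
  using c
proof (induction rule: S_induct)
  case (of x)
  then have x: "x \<in> carrier G" .
  show ?case using d
    by (induction rule: S_induct) (simp_all add: S_mult_right S_mult_left S_simps x m_comm)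
qed (simp_all add: S_mult_left S_mult_right)

lemma S_assoc:
  assumes c: "c \<in> carrier S" and d: "d \<in> carrier S" and e: "e \<in> carrier S"
  shows "(c \<otimes>\<^bsub>S\<^esub> d) \<otimes>\<^bsub>S\<^esub> e = c \<otimes>\<^bsub>S\<^esub> (d \<otimes>\<^bsub>S\<^esub> e)"
  using c
proof (induction rule: S_induct)
  case (of x)
  then have x: "x \<in> carrier G" .
  show ?case using d
  proof (induction rule: S_induct)
    case (of y)
    then have y: "y \<in> carrier G" .
    show ?case using e
      by (induction rule: S_induct) (simp_all add: S_mult_right S_simps x y m_assoc)
  qed (simp_all add: S_mult_left S_mult_right)
qed (simp_all add: S_mult_left S_mult_right)

lemma monoid_ring_cring: "cring S"
proof (rule cringI)
  show "abelian_group S"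
  proof (rule abelian_groupI)
    fix x assume x: "x \<in> carrier S"
    show "\<exists>y\<in>carrier S. y \<oplus>\<^bsub>S\<^esub> x = \<zero>\<^bsub>S\<^esub>"
      using S_diff[OF S_zero x] by (intro bexI[of _ "0 - x"]) (simp_all add: S_simps)
  qed (auto simp: S_simps S_add S_zero ac_simps)
  show "Group.comm_monoid S"
  proof (rule comm_monoidI)
    fix x assume "x \<in> carrier S"
    then show "\<one>\<^bsub>S\<^esub> \<otimes>\<^bsub>S\<^esub> x = x"
      by (induction rule: S_induct) (simp_all add: S_simps S_mult_right)
    fix y assume "y \<in> carrier S"
    with \<open>x \<in> carrier S\<close> show "x \<otimes>\<^bsub>S\<^esub> y = y \<otimes>\<^bsub>S\<^esub> x" "x \<otimes>\<^bsub>S\<^esub> y \<in> carrier S"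
      by (fact S_comm, fact S_closed)
    fix z assume "z \<in> carrier S"
    show "x \<otimes>\<^bsub>S\<^esub> y \<otimes>\<^bsub>S\<^esub> z = x \<otimes>\<^bsub>S\<^esub> (y \<otimes>\<^bsub>S\<^esub> z)"
      by (rule S_assoc) fact+
  qed (simp add: S_simps S_of)
qed (simp add: S_simps S_mult_left)

lemma S_minus: "c \<in> carrier S \<Longrightarrow> d \<in> carrier S \<Longrightarrow> c \<ominus>\<^bsub>S\<^esub> d = c - d"
proof -
  interpret S: cring S by (rule monoid_ring_cring)
  assume c: "c \<in> carrier S" "d \<in> carrier S"
  have "- d \<in> carrier S" using S_diff[OF S_zero c(2)] by simp
  then have "\<ominus>\<^bsub>S\<^esub> d = - d"
    by (intro S.minus_equality) (simp_all add: S_simps c)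
  then show ?thesis unfolding a_minus_def by (simp add: S_simps)
qed

end

section \<open>Two residue fields over a common one: linear form and compositum\<close>

locale two_local_homs =
  fixes A :: "('a, 'e) ring_scheme" and B :: "('b, 'f) ring_scheme" and C :: "('c, 'g) ring_scheme"
    and \<phi> :: "'a \<Rightarrow> 'b" and \<psi> :: "'a \<Rightarrow> 'c"
  assumes A: "local_ring A" and B: "local_ring B" and C: "local_ring C"
    and \<phi>_local: "local_hom A B \<phi>" and \<psi>_local: "local_hom A C \<psi>"
begin

sublocale A: cring A using A unfolding local_ring_def by simp
sublocale B: cring B using B unfolding local_ring_def by simp
sublocale C: cring C using C unfolding local_ring_def by simp
sublocale \<phi>: ring_hom_ring A B \<phi>
  by (rule ring_hom_ringI2[OF A.ring_axioms B.ring_axioms]) (use \<phi>_local in \<open>simp add: local_hom_def\<close>)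
sublocale \<psi>: ring_hom_ring A C \<psi>
  by (rule ring_hom_ringI2[OF A.ring_axioms C.ring_axioms]) (use \<psi>_local in \<open>simp add: local_hom_def\<close>)

abbreviation "mA \<equiv> carrier A - Units A"
abbreviation "mB \<equiv> carrier B - Units B"
abbreviation "mC \<equiv> carrier C - Units C"

sublocale mA: maximalideal mA A by (rule local_ring_nonunits(1)[OF A])
sublocale mB: maximalideal mB B by (rule local_ring_nonunits(1)[OF B])
sublocale mC: maximalideal mC C by (rule local_ring_nonunits(1)[OF C])

text \<open>The maximal \<open>A\<close>-submodule \<open>hyp\<close> of \<open>C\<close> below induces a hyperplane of the residue field of \<open>C\<close>,
  viewed as a vector space over the residue field of \<open>A\<close>; \<open>lam\<close> is the linear form with this kernel
  and value 1 at 1, up to elements of \<open>mA\<close>.\<close>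

definition submod :: "'c set \<Rightarrow> bool" where
  "submod H \<longleftrightarrow> H \<subseteq> carrier C \<and> mC \<subseteq> H \<and> (\<forall>x\<in>H. \<forall>y\<in>H. x \<oplus>\<^bsub>C\<^esub> y \<in> H) \<and>
    (\<forall>a\<in>carrier A. \<forall>x\<in>H. \<psi> a \<otimes>\<^bsub>C\<^esub> x \<in> H) \<and> \<one>\<^bsub>C\<^esub> \<notin> H"

lemma submod_minus:
  assumes "submod H" "x \<in> H" shows "\<ominus>\<^bsub>C\<^esub> x \<in> H"
proof -
  have x: "x \<in> carrier C" using assms unfolding submod_def by auto
  have "\<forall>a\<in>carrier A. \<forall>x\<in>H. \<psi> a \<otimes>\<^bsub>C\<^esub> x \<in> H" using assms(1) unfolding submod_def by simp
  from this[rule_format, OF A.a_inv_closed[OF A.one_closed] assms(2)]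
  have "\<psi> (\<ominus>\<^bsub>A\<^esub> \<one>\<^bsub>A\<^esub>) \<otimes>\<^bsub>C\<^esub> x \<in> H" .
  moreover have "\<psi> (\<ominus>\<^bsub>A\<^esub> \<one>\<^bsub>A\<^esub>) \<otimes>\<^bsub>C\<^esub> x = \<ominus>\<^bsub>C\<^esub> x" using x by (simp add: C.l_minus)
  ultimately show ?thesis by simp
qed

text \<open>Zorn's lemma, started at \<open>mC\<close>; the union of a chain still omits 1.\<close>

lemma maximal_submod:
  obtains H where "submod H" "\<And>H'. submod H' \<Longrightarrow> H \<subseteq> H' \<Longrightarrow> H' = H"
proof -
  have "\<exists>H\<in>Collect submod. \<forall>H'\<in>Collect submod. H \<subseteq> H' \<longrightarrow> H' = H"
  proof (rule subset_Zorn_nonempty)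
    have "submod mC" unfolding submod_def
      using mC.a_closed mC.I_l_closed by simp
    then show "Collect submod \<noteq> {}" by auto
    fix Ch assume Ch: "Ch \<noteq> {}" "subset.chain (Collect submod) Ch"
    have s: "submod H" if "H \<in> Ch" for H using Ch(2) that unfolding pred_on.chain_def by auto
    have lin: "H \<subseteq> H' \<or> H' \<subseteq> H" if "H \<in> Ch" "H' \<in> Ch" for H H'
      using Ch(2) that unfolding pred_on.chain_def by blast
    show "\<Union>Ch \<in> Collect submod"
      unfolding mem_Collect_eq submod_def
    proof (intro conjI ballI)
      show "\<Union>Ch \<subseteq> carrier C" using s unfolding submod_def by blast
      show "mC \<subseteq> \<Union>Ch" using s Ch(1) unfolding submod_def by blast
      show "\<one>\<^bsub>C\<^esub> \<notin> \<Union>Ch" using s unfolding submod_def by blast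
      fix x assume "x \<in> \<Union>Ch"
      then obtain H where H: "H \<in> Ch" "x \<in> H" by auto
      show "\<psi> a \<otimes>\<^bsub>C\<^esub> x \<in> \<Union>Ch" if "a \<in> carrier A" for a
        using H s[OF H(1)] that unfolding submod_def by blast
      fix y assume "y \<in> \<Union>Ch"
      then obtain H' where H': "H' \<in> Ch" "y \<in> H'" by auto
      show "x \<oplus>\<^bsub>C\<^esub> y \<in> \<Union>Ch"
      proof (cases "H \<subseteq> H'")
        case True
        then have "x \<in> H'" using H by auto
        then show ?thesis using H' s[OF H'(1)] unfolding submod_def by blast
      next
        case False
        then have "y \<in> H" using H H' lin by blast
        then show ?thesis using H s[OF H(1)] unfolding submod_def by blast
      qed
    qed
  qed
  then obtain H where H: "submod H" "\<forall>H'\<in>Collect submod. H \<subseteq> H' \<longrightarrow> H' = H" by auto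
  show ?thesis by (rule that[OF H(1)]) (use H(2) in simp)
qed

definition hyp :: "'c set" where
  "hyp = (SOME H. submod H \<and> (\<forall>H'. submod H' \<longrightarrow> H \<subseteq> H' \<longrightarrow> H' = H))"

lemma hyp: "submod hyp" "submod H' \<Longrightarrow> hyp \<subseteq> H' \<Longrightarrow> H' = hyp"
proof -
  have "\<exists>H. submod H \<and> (\<forall>H'. submod H' \<longrightarrow> H \<subseteq> H' \<longrightarrow> H' = H)"
    by (rule maximal_submod) blast
  from someI_ex[OF this] show "submod hyp" "submod H' \<Longrightarrow> hyp \<subseteq> H' \<Longrightarrow> H' = hyp"
    unfolding hyp_def[symmetric] by auto
qed

lemma hyp_carrier: "x \<in> hyp \<Longrightarrow> x \<in> carrier C"
  using hyp(1) unfolding submod_def by auto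

lemma hyp_m: "x \<in> mC \<Longrightarrow> x \<in> hyp"
  using hyp(1) unfolding submod_def by auto

lemma hyp_add: "x \<in> hyp \<Longrightarrow> y \<in> hyp \<Longrightarrow> x \<oplus>\<^bsub>C\<^esub> y \<in> hyp"
  using hyp(1) unfolding submod_def by auto

lemma hyp_smult: "a \<in> carrier A \<Longrightarrow> x \<in> hyp \<Longrightarrow> \<psi> a \<otimes>\<^bsub>C\<^esub> x \<in> hyp"
  using hyp(1) unfolding submod_def by auto

lemma hyp_one: "\<one>\<^bsub>C\<^esub> \<notin> hyp"
  using hyp(1) unfolding submod_def by auto

lemma hyp_minus: "x \<in> hyp \<Longrightarrow> \<ominus>\<^bsub>C\<^esub> x \<in> hyp"
  using submod_minus[OF hyp(1)] .

lemma hyp_zero: "\<zero>\<^bsub>C\<^esub> \<in> hyp"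
  by (rule hyp_m[OF mC.zero_closed])

text \<open>Codimension one. If \<open>b\<close> is outside \<open>hyp\<close>, maximality puts 1
  into \<open>hyp\<close> plus the multiples of \<open>b\<close>. The coefficient of
  \<open>b\<close> comes from a unit of \<open>A\<close>, as otherwise it would lie in
  \<open>mC\<close> and 1 in \<open>hyp\<close>; dividing by it expresses \<open>b\<close> modulo
  \<open>hyp\<close> by an element of \<open>A\<close>.\<close>

lemma hyp_complement:
  assumes b: "b \<in> carrier C"
  shows "\<exists>c\<in>carrier A. b \<ominus>\<^bsub>C\<^esub> \<psi> c \<in> hyp"
proof (cases "b \<in> hyp")
  case True
  then show ?thesis using b by (intro bexI[of _ "\<zero>\<^bsub>A\<^esub>"]) (auto simp: a_minus_def)
next
  case False
  define H where "H = {x \<oplus>\<^bsub>C\<^esub> \<psi> a \<otimes>\<^bsub>C\<^esub> b | x a. x \<in> hyp \<and> a \<in> carrier A}"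
  have H_I: "x \<oplus>\<^bsub>C\<^esub> \<psi> a \<otimes>\<^bsub>C\<^esub> b \<in> H" if "x \<in> hyp" "a \<in> carrier A" for x a
    unfolding H_def using that by blast
  have sub: "hyp \<subseteq> H"
  proof
    fix x assume x: "x \<in> hyp"
    show "x \<in> H" using H_I[OF x A.zero_closed] hyp_carrier[OF x] b by simp
  qed
  have "b \<in> H" using H_I[OF hyp_zero A.one_closed] b by simp
  then have "H \<noteq> hyp" using False by auto
  then have ns: "\<not> submod H" using hyp(2)[of H] sub by auto
  have h1: "H \<subseteq> carrier C"
  proof
    fix y assume "y \<in> H"
    then obtain x a where "x \<in> hyp" "a \<in> carrier A" "y = x \<oplus>\<^bsub>C\<^esub> \<psi> a \<otimes>\<^bsub>C\<^esub> b" unfolding H_def by blast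
    then show "y \<in> carrier C"
      using C.a_closed[OF hyp_carrier C.m_closed[OF \<psi>.hom_closed b]] by simp
  qed
  have h2: "mC \<subseteq> H" using hyp_m sub by blast
  have h3: "u \<oplus>\<^bsub>C\<^esub> v \<in> H" if uv: "u \<in> H" "v \<in> H" for u v
  proof -
    obtain x a y c where *: "x \<in> hyp" "a \<in> carrier A" "u = x \<oplus>\<^bsub>C\<^esub> \<psi> a \<otimes>\<^bsub>C\<^esub> b"
      "y \<in> hyp" "c \<in> carrier A" "v = y \<oplus>\<^bsub>C\<^esub> \<psi> c \<otimes>\<^bsub>C\<^esub> b" using uv unfolding H_def by blast
    have "u \<oplus>\<^bsub>C\<^esub> v = (x \<oplus>\<^bsub>C\<^esub> y) \<oplus>\<^bsub>C\<^esub> \<psi> (a \<oplus>\<^bsub>A\<^esub> c) \<otimes>\<^bsub>C\<^esub> b"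
    proof -
      have "x \<in> carrier C" "y \<in> carrier C" "\<psi> a \<in> carrier C" "\<psi> c \<in> carrier C"
        using * hyp_carrier by simp_all
      then have "u \<oplus>\<^bsub>C\<^esub> v = (x \<oplus>\<^bsub>C\<^esub> y) \<oplus>\<^bsub>C\<^esub> (\<psi> a \<oplus>\<^bsub>C\<^esub> \<psi> c) \<otimes>\<^bsub>C\<^esub> b"
        unfolding *(3,6) using b by algebra
      then show ?thesis using *(2,5) by simp
    qed
    then show ?thesis using H_I[OF hyp_add[OF *(1,4)] A.a_closed[OF *(2,5)]] by simp
  qed
  have h4: "\<psi> c \<otimes>\<^bsub>C\<^esub> u \<in> H" if uc: "u \<in> H" "c \<in> carrier A" for u c
  proof -
    obtain x a where *: "x \<in> hyp" "a \<in> carrier A" "u = x \<oplus>\<^bsub>C\<^esub> \<psi> a \<otimes>\<^bsub>C\<^esub> b" using uc unfolding H_def by blast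
    have "\<psi> c \<otimes>\<^bsub>C\<^esub> u = \<psi> c \<otimes>\<^bsub>C\<^esub> x \<oplus>\<^bsub>C\<^esub> \<psi> (c \<otimes>\<^bsub>A\<^esub> a) \<otimes>\<^bsub>C\<^esub> b"
    proof -
      have "x \<in> carrier C" "\<psi> a \<in> carrier C" "\<psi> c \<in> carrier C"
        using *(1,2) uc(2) hyp_carrier by simp_all
      then have "\<psi> c \<otimes>\<^bsub>C\<^esub> u = \<psi> c \<otimes>\<^bsub>C\<^esub> x \<oplus>\<^bsub>C\<^esub> (\<psi> c \<otimes>\<^bsub>C\<^esub> \<psi> a) \<otimes>\<^bsub>C\<^esub> b"
        unfolding *(3) using b by algebra
      then show ?thesis using *(2) uc(2) by simp
    qed
    then show ?thesis using H_I[OF hyp_smult[OF uc(2) *(1)] A.m_closed[OF uc(2) *(2)]] by simp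
  qed
  have "\<one>\<^bsub>C\<^esub> \<in> H"
  proof (rule ccontr)
    assume "\<one>\<^bsub>C\<^esub> \<notin> H"
    then have "submod H" unfolding submod_def using h1 h2 h3 h4 by (intro conjI ballI) simp_all
    then show False using ns by simp
  qed
  then obtain x a where *: "x \<in> hyp" "a \<in> carrier A" "\<one>\<^bsub>C\<^esub> = x \<oplus>\<^bsub>C\<^esub> \<psi> a \<otimes>\<^bsub>C\<^esub> b" unfolding H_def by blast
  have xc: "x \<in> carrier C" by (rule hyp_carrier[OF *(1)])
  have "a \<in> Units A"
  proof (rule ccontr)
    assume "a \<notin> Units A"
    then have "\<psi> a \<in> mC" using local_hom_unit_iff[OF A C \<psi>_local *(2)] *(2) by simp
    then have "\<psi> a \<otimes>\<^bsub>C\<^esub> b \<in> hyp" using mC.I_r_closed b hyp_m by blast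
    then have "x \<oplus>\<^bsub>C\<^esub> \<psi> a \<otimes>\<^bsub>C\<^esub> b \<in> hyp" by (rule hyp_add[OF *(1)])
    then show False using hyp_one unfolding *(3)[symmetric] by simp
  qed
  then obtain i where i: "i \<in> carrier A" "i \<otimes>\<^bsub>A\<^esub> a = \<one>\<^bsub>A\<^esub>" by (metis A.Units_inv_closed A.Units_l_inv)
  have ic: "\<psi> i \<in> carrier C" "\<psi> a \<in> carrier C" using i *(2) by auto
  have "\<psi> i \<otimes>\<^bsub>C\<^esub> \<one>\<^bsub>C\<^esub> = \<psi> i \<otimes>\<^bsub>C\<^esub> (x \<oplus>\<^bsub>C\<^esub> \<psi> a \<otimes>\<^bsub>C\<^esub> b)" using *(3) by simp
  then have e: "\<psi> i = \<psi> i \<otimes>\<^bsub>C\<^esub> x \<oplus>\<^bsub>C\<^esub> \<psi> (i \<otimes>\<^bsub>A\<^esub> a) \<otimes>\<^bsub>C\<^esub> b"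
    using ic xc b i(1) *(2) by (simp add: C.r_distr C.m_assoc)
  have e': "\<psi> i = \<psi> i \<otimes>\<^bsub>C\<^esub> x \<oplus>\<^bsub>C\<^esub> b" using e i(2) b by simp
  have "b \<ominus>\<^bsub>C\<^esub> (\<psi> i \<otimes>\<^bsub>C\<^esub> x \<oplus>\<^bsub>C\<^esub> b) = \<ominus>\<^bsub>C\<^esub> (\<psi> i \<otimes>\<^bsub>C\<^esub> x)"
    using ic xc b by algebra
  then have "b \<ominus>\<^bsub>C\<^esub> \<psi> i = \<ominus>\<^bsub>C\<^esub> (\<psi> i \<otimes>\<^bsub>C\<^esub> x)" using e' by simp
  then have "b \<ominus>\<^bsub>C\<^esub> \<psi> i \<in> hyp" using hyp_minus[OF hyp_smult[OF i(1) *(1)]] by simp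
  then show ?thesis using i(1) by blast
qed

definition lam :: "'c \<Rightarrow> 'a" where
  "lam b = (SOME c. c \<in> carrier A \<and> b \<ominus>\<^bsub>C\<^esub> \<psi> c \<in> hyp)"

lemma lam: "b \<in> carrier C \<Longrightarrow> lam b \<in> carrier A" "b \<in> carrier C \<Longrightarrow> b \<ominus>\<^bsub>C\<^esub> \<psi> (lam b) \<in> hyp"
  using someI_ex[of "\<lambda>c. c \<in> carrier A \<and> b \<ominus>\<^bsub>C\<^esub> \<psi> c \<in> hyp"] hyp_complement[of b]
  unfolding lam_def by auto

text \<open>Induces the map from the tensor product of the residue fields of \<open>B\<close> and
  \<open>C\<close> to the residue field of \<open>B\<close> that applies the linear form
  \<open>lam\<close> to the second factor.\<close>

definition \<beta> :: "'b \<times> 'c \<Rightarrow> 'b set" where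
  "\<beta> x = mB +>\<^bsub>B\<^esub> (fst x \<otimes>\<^bsub>B\<^esub> \<phi> (lam (snd x)))"

text \<open>\<open>lam\<close> is a choice; two admissible values differ by some \<open>d\<close>
  with \<open>\<psi> d\<close> in \<open>hyp\<close>. A unit \<open>d\<close> would put 1 into
  \<open>hyp\<close>, so \<open>d\<close> is a nonunit and \<open>\<phi> d\<close> dies in the
  residue field. Additivity in the second argument and balancedness of \<open>\<beta>\<close> follow
  by exhibiting admissible values.\<close>

lemma \<beta>_eq:
  assumes a: "a \<in> carrier B" and b: "b \<in> carrier C" and c: "c \<in> carrier A" "b \<ominus>\<^bsub>C\<^esub> \<psi> c \<in> hyp"
  shows "\<beta> (a, b) = mB +>\<^bsub>B\<^esub> (a \<otimes>\<^bsub>B\<^esub> \<phi> c)"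
proof -
  note l = lam[OF b]
  let ?d = "lam b \<ominus>\<^bsub>A\<^esub> c"
  have d: "?d \<in> carrier A" using l c by simp
  have "?d \<notin> Units A"
  proof
    assume "?d \<in> Units A"
    then obtain i where i: "i \<in> carrier A" "i \<otimes>\<^bsub>A\<^esub> ?d = \<one>\<^bsub>A\<^esub>" by (metis A.Units_inv_closed A.Units_l_inv)
    have "\<psi> ?d = (b \<ominus>\<^bsub>C\<^esub> \<psi> c) \<oplus>\<^bsub>C\<^esub> (\<ominus>\<^bsub>C\<^esub> (b \<ominus>\<^bsub>C\<^esub> \<psi> (lam b)))"
    proof -
      have "\<psi> ?d = \<psi> (lam b) \<ominus>\<^bsub>C\<^esub> \<psi> c" using l c by (simp add: a_minus_def)
      also have "\<dots> = (b \<ominus>\<^bsub>C\<^esub> \<psi> c) \<oplus>\<^bsub>C\<^esub> (\<ominus>\<^bsub>C\<^esub> (b \<ominus>\<^bsub>C\<^esub> \<psi> (lam b)))"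
        using b \<psi>.hom_closed[OF l(1)] \<psi>.hom_closed[OF c(1)] by algebra
      finally show ?thesis .
    qed
    then have "\<psi> ?d \<in> hyp" using hyp_add[OF c(2) hyp_minus[OF l(2)]] by simp
    then have "\<psi> i \<otimes>\<^bsub>C\<^esub> \<psi> ?d \<in> hyp" by (rule hyp_smult[OF i(1)])
    then have "\<one>\<^bsub>C\<^esub> \<in> hyp" using i d \<psi>.hom_mult[OF i(1) d] by simp
    then show False using hyp_one by simp
  qed
  then have "\<phi> ?d \<in> mB" using local_hom_unit_iff[OF A B \<phi>_local d] d by simp
  then have "a \<otimes>\<^bsub>B\<^esub> \<phi> ?d \<in> mB" by (rule mB.I_l_closed[OF _ a])
  moreover have "a \<otimes>\<^bsub>B\<^esub> \<phi> ?d = a \<otimes>\<^bsub>B\<^esub> \<phi> (lam b) \<ominus>\<^bsub>B\<^esub> a \<otimes>\<^bsub>B\<^esub> \<phi> c"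
  proof -
    have "\<phi> ?d = \<phi> (lam b) \<ominus>\<^bsub>B\<^esub> \<phi> c" using l c by (simp add: a_minus_def)
    then show ?thesis using a \<phi>.hom_closed[OF l(1)] \<phi>.hom_closed[OF c(1)] by algebra
  qed
  ultimately have "a \<otimes>\<^bsub>B\<^esub> \<phi> (lam b) \<ominus>\<^bsub>B\<^esub> a \<otimes>\<^bsub>B\<^esub> \<phi> c \<in> mB" by (simp only:)
  then show ?thesis
    unfolding \<beta>_def fst_conv snd_conv
    by (rule iffD1[OF B.quotient_eq_iff_same_a_r_cos[OF mB.is_ideal
      B.m_closed[OF a \<phi>.hom_closed[OF l(1)]] B.m_closed[OF a \<phi>.hom_closed[OF c(1)]]]])
qed

abbreviation "Qt \<equiv> B Quot mB"
sublocale Qt: ring Qt by (rule mB.quotient_is_ring)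

lemma Qt_simps: "\<zero>\<^bsub>Qt\<^esub> = mB" "a \<in> carrier B \<Longrightarrow> mB +>\<^bsub>B\<^esub> a \<in> carrier Qt"
  "a \<in> carrier B \<Longrightarrow> b \<in> carrier B \<Longrightarrow> (mB +>\<^bsub>B\<^esub> a) \<oplus>\<^bsub>Qt\<^esub> (mB +>\<^bsub>B\<^esub> b) = mB +>\<^bsub>B\<^esub> (a \<oplus>\<^bsub>B\<^esub> b)"
  by (auto simp: FactRing_def A_RCOSETS_def RCOSETS_def a_r_coset_def[symmetric] mB.a_rcos_sum)

lemma \<beta>_closed: "a \<in> carrier B \<Longrightarrow> b \<in> carrier C \<Longrightarrow> \<beta> (a, b) \<in> carrier Qt"
  unfolding \<beta>_def using lam by (simp add: Qt_simps)

lemma \<beta>_add_left: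
  assumes "a \<in> carrier B" "a' \<in> carrier B" "b \<in> carrier C"
  shows "\<beta> (a \<oplus>\<^bsub>B\<^esub> a', b) = \<beta> (a, b) \<oplus>\<^bsub>Qt\<^esub> \<beta> (a', b)"
  unfolding \<beta>_def using assms lam by (simp add: Qt_simps B.l_distr)

lemma \<beta>_add_right:
  assumes a: "a \<in> carrier B" and b: "b \<in> carrier C" "b' \<in> carrier C"
  shows "\<beta> (a, b \<oplus>\<^bsub>C\<^esub> b') = \<beta> (a, b) \<oplus>\<^bsub>Qt\<^esub> \<beta> (a, b')"
proof -
  note l = lam[OF b(1)] lam[OF b(2)]
  have "(b \<oplus>\<^bsub>C\<^esub> b') \<ominus>\<^bsub>C\<^esub> \<psi> (lam b \<oplus>\<^bsub>A\<^esub> lam b') = (b \<ominus>\<^bsub>C\<^esub> \<psi> (lam b)) \<oplus>\<^bsub>C\<^esub> (b' \<ominus>\<^bsub>C\<^esub> \<psi> (lam b'))"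
  proof -
    have "\<psi> (lam b \<oplus>\<^bsub>A\<^esub> lam b') = \<psi> (lam b) \<oplus>\<^bsub>C\<^esub> \<psi> (lam b')" using l by simp
    then show ?thesis using b \<psi>.hom_closed[OF l(1)] \<psi>.hom_closed[OF l(3)] by algebra
  qed
  then have h: "(b \<oplus>\<^bsub>C\<^esub> b') \<ominus>\<^bsub>C\<^esub> \<psi> (lam b \<oplus>\<^bsub>A\<^esub> lam b') \<in> hyp" using hyp_add[OF l(2,4)] by (simp only:)
  have "\<beta> (a, b \<oplus>\<^bsub>C\<^esub> b') = mB +>\<^bsub>B\<^esub> (a \<otimes>\<^bsub>B\<^esub> \<phi> (lam b \<oplus>\<^bsub>A\<^esub> lam b'))"
    by (rule \<beta>_eq[OF a C.a_closed[OF b] A.a_closed[OF l(1,3)] h])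
  also have "\<dots> = \<beta> (a, b) \<oplus>\<^bsub>Qt\<^esub> \<beta> (a, b')"
    unfolding \<beta>_def using a l by (simp add: Qt_simps B.r_distr)
  finally show ?thesis .
qed

lemma \<beta>_balanced:
  assumes a: "a \<in> carrier B" and b: "b \<in> carrier C" and c: "c \<in> carrier A"
  shows "\<beta> (a, \<psi> c \<otimes>\<^bsub>C\<^esub> b) = \<beta> (\<phi> c \<otimes>\<^bsub>B\<^esub> a, b)"
proof -
  note l = lam[OF b]
  have "\<psi> c \<otimes>\<^bsub>C\<^esub> b \<ominus>\<^bsub>C\<^esub> \<psi> (c \<otimes>\<^bsub>A\<^esub> lam b) = \<psi> c \<otimes>\<^bsub>C\<^esub> (b \<ominus>\<^bsub>C\<^esub> \<psi> (lam b))"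
  proof -
    have "\<psi> (c \<otimes>\<^bsub>A\<^esub> lam b) = \<psi> c \<otimes>\<^bsub>C\<^esub> \<psi> (lam b)" using l c by simp
    then show ?thesis using b \<psi>.hom_closed[OF l(1)] \<psi>.hom_closed[OF c] by algebra
  qed
  then have h: "\<psi> c \<otimes>\<^bsub>C\<^esub> b \<ominus>\<^bsub>C\<^esub> \<psi> (c \<otimes>\<^bsub>A\<^esub> lam b) \<in> hyp" using hyp_smult[OF c l(2)] by (simp only:)
  have "\<beta> (a, \<psi> c \<otimes>\<^bsub>C\<^esub> b) = mB +>\<^bsub>B\<^esub> (a \<otimes>\<^bsub>B\<^esub> \<phi> (c \<otimes>\<^bsub>A\<^esub> lam b))"
    by (rule \<beta>_eq[OF a C.m_closed[OF \<psi>.hom_closed[OF c] b] A.m_closed[OF c l(1)] h])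
  also have "a \<otimes>\<^bsub>B\<^esub> \<phi> (c \<otimes>\<^bsub>A\<^esub> lam b) = (\<phi> c \<otimes>\<^bsub>B\<^esub> a) \<otimes>\<^bsub>B\<^esub> \<phi> (lam b)"
    using a c l by (simp add: B.m_ac)
  finally show ?thesis unfolding \<beta>_def by simp
qed

lemma \<beta>_m_left:
  assumes "a \<in> mB" "b \<in> carrier C"
  shows "\<beta> (a, b) = mB"
proof -
  have "a \<otimes>\<^bsub>B\<^esub> \<phi> (lam b) \<in> mB" using mB.I_r_closed[OF assms(1)] lam[OF assms(2)] by simp
  then show ?thesis unfolding \<beta>_def using B.a_rcos_zero[OF mB.is_ideal] by simp
qed

lemma \<beta>_m_right:
  assumes "a \<in> carrier B" "b \<in> mC"
  shows "\<beta> (a, b) = mB"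
proof -
  have "b \<ominus>\<^bsub>C\<^esub> \<psi> \<zero>\<^bsub>A\<^esub> \<in> hyp" using hyp_m[OF assms(2)] assms(2) by (simp add: a_minus_def)
  then have "\<beta> (a, b) = mB +>\<^bsub>B\<^esub> (a \<otimes>\<^bsub>B\<^esub> \<phi> \<zero>\<^bsub>A\<^esub>)" using \<beta>_eq[OF assms(1) _ A.zero_closed] assms(2) by simp
  also have "\<dots> = mB" using B.a_rcos_zero[OF mB.is_ideal mB.zero_closed] assms(1) by simp
  finally show ?thesis .
qed

lemma \<beta>_one: "\<beta> (\<one>\<^bsub>B\<^esub>, \<one>\<^bsub>C\<^esub>) \<noteq> mB"
proof
  assume e: "\<beta> (\<one>\<^bsub>B\<^esub>, \<one>\<^bsub>C\<^esub>) = mB"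
  have "\<one>\<^bsub>C\<^esub> \<ominus>\<^bsub>C\<^esub> \<psi> \<one>\<^bsub>A\<^esub> \<in> hyp" using hyp_zero by (simp add: C.r_neg a_minus_def)
  then have "mB +>\<^bsub>B\<^esub> (\<one>\<^bsub>B\<^esub> \<otimes>\<^bsub>B\<^esub> \<phi> \<one>\<^bsub>A\<^esub>) = mB" using \<beta>_eq[OF B.one_closed C.one_closed A.one_closed] e by simp
  then have "\<one>\<^bsub>B\<^esub> \<in> mB" using mB.rcos_const_imp_mem[OF B.one_closed] by simp
  then show False by simp
qed

abbreviation "G \<equiv> B \<times>\<times> C"
sublocale G: formal_sums G
  by (intro formal_sums.intro comm_monoidI) (auto simp: DirProd_def B.m_ac C.m_ac)

sublocale S: cring "monoid_ring G"
  by (rule G.monoid_ring_cring)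

lemma G_simps: "(a, b) \<otimes>\<^bsub>G\<^esub> (a', b') = (a \<otimes>\<^bsub>B\<^esub> a', b \<otimes>\<^bsub>C\<^esub> b')" "\<one>\<^bsub>G\<^esub> = (\<one>\<^bsub>B\<^esub>, \<one>\<^bsub>C\<^esub>)"
  unfolding DirProd_def by simp_all

lemma G_carrier: "(a, b) \<in> carrier G \<longleftrightarrow> a \<in> carrier B \<and> b \<in> carrier C"
  unfolding DirProd_def by simp

text \<open>The monoid ring of \<open>B \<times> C\<close> surjects onto the tensor product of the residue fields over
  \<open>A\<close>; \<open>l\<close> is the additive functional that shows the latter to be nonzero.\<close>

lemma functional_exists:
  "\<exists>l. l \<in> hom (free_Abelian_group (carrier G)) (add_monoid Qt) \<and> (\<forall>x\<in>carrier G. l (frag_of x) = \<beta> x)"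
proof -
  have "\<beta> ` carrier G \<subseteq> carrier (add_monoid Qt)" using \<beta>_closed unfolding DirProd_def by auto
  then show ?thesis
  proof (rule comm_group.free_Abelian_group_universal[OF Qt.a_comm_group])
    fix h assume "h \<in> hom (free_Abelian_group (carrier G)) (add_monoid Qt)"
      "\<And>x. x \<in> carrier G \<Longrightarrow> h (frag_of x) = \<beta> x"
    then show ?thesis by (intro exI[of _ h] conjI ballI)
  qed
qed

definition l :: "('b \<times> 'c \<Rightarrow>\<^sub>0 int) \<Rightarrow> 'b set" where
  "l = (SOME l. l \<in> hom (free_Abelian_group (carrier G)) (add_monoid Qt) \<and> (\<forall>x\<in>carrier G. l (frag_of x) = \<beta> x))"

lemma l_hom: "l \<in> hom (free_Abelian_group (carrier G)) (add_monoid Qt)"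
  and l_of: "a \<in> carrier B \<Longrightarrow> b \<in> carrier C \<Longrightarrow> l (frag_of (a, b)) = \<beta> (a, b)"
  using someI_ex[OF functional_exists] unfolding l_def[symmetric] G_carrier[symmetric] by auto

lemma l_closed: "c \<in> carrier G.S \<Longrightarrow> l c \<in> carrier Qt"
proof -
  assume "c \<in> carrier G.S"
  then have c: "c \<in> carrier (free_Abelian_group (carrier G))" unfolding G.S_carrier by simp
  have "l \<in> carrier (free_Abelian_group (carrier G)) \<rightarrow> carrier Qt" using l_hom unfolding hom_def by simp
  then show ?thesis using c by (rule funcset_mem)
qed

lemma l_diff: "c \<in> carrier G.S \<Longrightarrow> d \<in> carrier G.S \<Longrightarrow> l (c - d) = l c \<ominus>\<^bsub>Qt\<^esub> l d"
proof -
  assume c: "c \<in> carrier G.S" "d \<in> carrier G.S"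
  have "c - d \<in> carrier (free_Abelian_group (carrier G))" "d \<in> carrier (free_Abelian_group (carrier G))"
    using c G.S_diff[OF c] unfolding G.S_carrier by simp_all
  from hom_mult[OF l_hom this] have "l ((c - d) + d) = l (c - d) \<oplus>\<^bsub>Qt\<^esub> l d" by simp
  then have "l c = l (c - d) \<oplus>\<^bsub>Qt\<^esub> l d" by simp
  then show ?thesis
    using l_closed[OF c(1)] l_closed[OF c(2)] l_closed[OF G.S_diff[OF c]]
    by (simp add: a_minus_def Qt.a_assoc Qt.r_neg)
qed

lemma Qt_diff_self: "x \<in> carrier Qt \<Longrightarrow> x \<ominus>\<^bsub>Qt\<^esub> x = mB"
  using Qt.r_neg[of x] unfolding Qt_simps(1) a_minus_def .

lemma Qt_add_diff:
  assumes "x \<in> carrier Qt" "y \<in> carrier Qt"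
  shows "(x \<oplus>\<^bsub>Qt\<^esub> y) \<ominus>\<^bsub>Qt\<^esub> x \<ominus>\<^bsub>Qt\<^esub> y = mB"
proof -
  have "(x \<oplus>\<^bsub>Qt\<^esub> y) \<ominus>\<^bsub>Qt\<^esub> x = y"
    using assms unfolding Qt.a_comm[OF assms] by (simp add: a_minus_def Qt.a_assoc Qt.r_neg)
  then show ?thesis using Qt_diff_self[OF assms(2)] by simp
qed

lemma mB_diff: "mB \<ominus>\<^bsub>Qt\<^esub> mB = mB"
  using Qt_diff_self[OF Qt.zero_closed] unfolding Qt_simps(1) .

lemma l_zero: "l 0 = mB"
proof -
  have "l (0 - 0) = l 0 \<ominus>\<^bsub>Qt\<^esub> l 0" by (rule l_diff[OF G.S_zero G.S_zero])
  then show ?thesis using Qt_diff_self[OF l_closed[OF G.S_zero]] by (simp only: diff_zero)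
qed

text \<open>The largest ideal on which the additive functional \<open>l\<close> vanishes; testing
  all multiples makes up for \<open>l\<close> not being multiplicative. It is proper because
  \<open>l\<close> is nonzero at 1.\<close>

definition ker :: "('b \<times> 'c \<Rightarrow>\<^sub>0 int) set" where
  "ker = {s \<in> carrier G.S. \<forall>t\<in>carrier G.S. l (s \<otimes>\<^bsub>G.S\<^esub> t) = mB}"

lemma kerI:
  assumes s: "s \<in> carrier G.S"
    and z: "\<And>a b. a \<in> carrier B \<Longrightarrow> b \<in> carrier C \<Longrightarrow> l (s \<otimes>\<^bsub>G.S\<^esub> frag_of (a, b)) = mB"
  shows "s \<in> ker"
proof -
  have "l (s \<otimes>\<^bsub>G.S\<^esub> t) = mB" if "t \<in> carrier G.S" for t
    using that
  proof (induction rule: G.S_induct)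
    case (diff c d)
    then show ?case
      using l_diff[OF G.S_closed[OF s diff(1)] G.S_closed[OF s diff(2)]]
      by (simp only: G.S_mult_right mB_diff)
  next
    case (of x)
    then show ?case using z[of "fst x" "snd x"] by (cases x) (simp add: G_carrier)
  qed (simp add: G.S_mult_right l_zero)
  then show ?thesis unfolding ker_def using s by simp
qed

lemma ker_ideal: "ideal ker G.S"
proof (rule idealI[OF S.ring_axioms])
  have d: "x - y \<in> ker" if xy: "x \<in> ker" "y \<in> ker" for x y
  proof -
    have c: "x \<in> carrier G.S" "y \<in> carrier G.S" using xy unfolding ker_def by auto
    show ?thesis
    proof (rule kerI[OF G.S_diff[OF c]])
      fix a b assume "a \<in> carrier B" "b \<in> carrier C"
      then have t: "frag_of (a, b) \<in> carrier G.S" by (simp add: G.S_of G_carrier)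
      show "l ((x - y) \<otimes>\<^bsub>G.S\<^esub> frag_of (a, b)) = mB"
      proof -
        have "l (x \<otimes>\<^bsub>G.S\<^esub> frag_of (a, b)) = mB" "l (y \<otimes>\<^bsub>G.S\<^esub> frag_of (a, b)) = mB"
          using xy t unfolding ker_def by blast+
        then show ?thesis using l_diff[OF G.S_closed[OF c(1) t] G.S_closed[OF c(2) t]]
          by (simp only: G.S_mult_left mB_diff)
      qed
    qed
  qed
  have z: "0 \<in> ker" unfolding ker_def using G.S_zero by (simp add: G.S_mult_left l_zero)
  show "subgroup ker (add_monoid G.S)"
  proof (rule group.subgroupI[OF S.a_group])
    show "ker \<subseteq> carrier (add_monoid G.S)" unfolding ker_def by auto
    show "ker \<noteq> {}" using z by auto
    fix x y assume x: "x \<in> ker" and y: "y \<in> ker"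
    have yc: "x \<in> carrier G.S" using x unfolding ker_def by auto
    have inv: "\<ominus>\<^bsub>G.S\<^esub> x = 0 - x"
      using G.S_minus[OF G.S_zero yc] S.add.inv_closed[OF yc] G.S_simps(2,3) unfolding a_minus_def by simp
    then show "inv\<^bsub>add_monoid G.S\<^esub> x \<in> ker" using d[OF z x] unfolding a_inv_def by simp
    have "x - (0 - y) \<in> ker" using d[OF x d[OF z y]] .
    then show "x \<otimes>\<^bsub>add_monoid G.S\<^esub> y \<in> ker" by (simp add: G.S_simps)
  qed
  fix a x assume a: "a \<in> ker" "x \<in> carrier G.S"
  then have ac: "a \<in> carrier G.S" unfolding ker_def by auto
  have "l (a \<otimes>\<^bsub>G.S\<^esub> x \<otimes>\<^bsub>G.S\<^esub> t) = mB" if t: "t \<in> carrier G.S" for t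
    using a t G.S_assoc[OF ac a(2) t] G.S_closed[OF a(2) t] unfolding ker_def by simp
  then show "a \<otimes>\<^bsub>G.S\<^esub> x \<in> ker" unfolding ker_def using ac a G.S_closed by simp
  then show "x \<otimes>\<^bsub>G.S\<^esub> a \<in> ker" using G.S_comm[OF ac a(2)] by simp
qed

lemma ker_one: "\<one>\<^bsub>G.S\<^esub> \<notin> ker"
proof
  assume "\<one>\<^bsub>G.S\<^esub> \<in> ker"
  then have "l (\<one>\<^bsub>G.S\<^esub> \<otimes>\<^bsub>G.S\<^esub> \<one>\<^bsub>G.S\<^esub>) = mB" unfolding ker_def by blast
  then have "l (frag_of (\<one>\<^bsub>B\<^esub>, \<one>\<^bsub>C\<^esub>)) = mB" by (simp add: G.S_simps G_simps)
  then show False using l_of \<beta>_one by simp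
qed

lemma S_of_mult: "frag_of (a, b) \<otimes>\<^bsub>G.S\<^esub> frag_of (a', b') = frag_of (a \<otimes>\<^bsub>B\<^esub> a', b \<otimes>\<^bsub>C\<^esub> b')"
  by (simp add: G.S_simps G_simps)

lemma S_of_closed: "a \<in> carrier B \<Longrightarrow> b \<in> carrier C \<Longrightarrow> frag_of (a, b) \<in> carrier G.S"
  by (simp add: G.S_of G_carrier)

text \<open>Sending \<open>a\<close> to the pair of \<open>a\<close> and 1 is multiplicative already
  in the monoid ring; additivity has to be imposed. This lemma and the next four place the required
  relations in \<open>ker\<close>: additivity for both factors, agreement on \<open>A\<close>, and
  vanishing of the two maximal ideals.\<close>

lemma ker_add_left:
  assumes "a \<in> carrier B" "a' \<in> carrier B"
  shows "frag_of (a \<oplus>\<^bsub>B\<^esub> a', \<one>\<^bsub>C\<^esub>) - (frag_of (a, \<one>\<^bsub>C\<^esub>) + frag_of (a', \<one>\<^bsub>C\<^esub>)) \<in> ker"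
proof -
  have e: "frag_of (a \<oplus>\<^bsub>B\<^esub> a', \<one>\<^bsub>C\<^esub>) - (frag_of (a, \<one>\<^bsub>C\<^esub>) + frag_of (a', \<one>\<^bsub>C\<^esub>)) =
    frag_of (a \<oplus>\<^bsub>B\<^esub> a', \<one>\<^bsub>C\<^esub>) - frag_of (a, \<one>\<^bsub>C\<^esub>) - frag_of (a', \<one>\<^bsub>C\<^esub>)" by simp
  show ?thesis unfolding e
  proof (rule kerI)
    fix c d assume cd: "c \<in> carrier B" "d \<in> carrier C"
    have p: "a \<otimes>\<^bsub>B\<^esub> c \<in> carrier B" "a' \<otimes>\<^bsub>B\<^esub> c \<in> carrier B" using assms cd by auto
    have q: "\<beta> (a \<otimes>\<^bsub>B\<^esub> c, d) \<in> carrier Qt" "\<beta> (a' \<otimes>\<^bsub>B\<^esub> c, d) \<in> carrier Qt"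
      using \<beta>_closed p cd by auto
    have "(\<beta> (a \<otimes>\<^bsub>B\<^esub> c, d) \<oplus>\<^bsub>Qt\<^esub> \<beta> (a' \<otimes>\<^bsub>B\<^esub> c, d)) \<ominus>\<^bsub>Qt\<^esub> \<beta> (a \<otimes>\<^bsub>B\<^esub> c, d) \<ominus>\<^bsub>Qt\<^esub> \<beta> (a' \<otimes>\<^bsub>B\<^esub> c, d) = mB"
      by (rule Qt_add_diff[OF q])
    then show "l ((frag_of (a \<oplus>\<^bsub>B\<^esub> a', \<one>\<^bsub>C\<^esub>) - frag_of (a, \<one>\<^bsub>C\<^esub>) - frag_of (a', \<one>\<^bsub>C\<^esub>)) \<otimes>\<^bsub>G.S\<^esub> frag_of (c, d)) = mB"
      using assms cd p
      by (simp add: G.S_mult_left S_of_mult l_diff S_of_closed G.S_diff l_of B.l_distr \<beta>_add_left)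
  qed (use assms in \<open>simp add: S_of_closed G.S_diff\<close>)
qed

lemma ker_add_right:
  assumes "b \<in> carrier C" "b' \<in> carrier C"
  shows "frag_of (\<one>\<^bsub>B\<^esub>, b \<oplus>\<^bsub>C\<^esub> b') - (frag_of (\<one>\<^bsub>B\<^esub>, b) + frag_of (\<one>\<^bsub>B\<^esub>, b')) \<in> ker"
proof -
  have e: "frag_of (\<one>\<^bsub>B\<^esub>, b \<oplus>\<^bsub>C\<^esub> b') - (frag_of (\<one>\<^bsub>B\<^esub>, b) + frag_of (\<one>\<^bsub>B\<^esub>, b')) =
    frag_of (\<one>\<^bsub>B\<^esub>, b \<oplus>\<^bsub>C\<^esub> b') - frag_of (\<one>\<^bsub>B\<^esub>, b) - frag_of (\<one>\<^bsub>B\<^esub>, b')" by simp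
  show ?thesis unfolding e
  proof (rule kerI)
    fix c d assume cd: "c \<in> carrier B" "d \<in> carrier C"
    have p: "b \<otimes>\<^bsub>C\<^esub> d \<in> carrier C" "b' \<otimes>\<^bsub>C\<^esub> d \<in> carrier C" using assms cd by auto
    have q: "\<beta> (c, b \<otimes>\<^bsub>C\<^esub> d) \<in> carrier Qt" "\<beta> (c, b' \<otimes>\<^bsub>C\<^esub> d) \<in> carrier Qt"
      using \<beta>_closed p cd by auto
    have "(\<beta> (c, b \<otimes>\<^bsub>C\<^esub> d) \<oplus>\<^bsub>Qt\<^esub> \<beta> (c, b' \<otimes>\<^bsub>C\<^esub> d)) \<ominus>\<^bsub>Qt\<^esub> \<beta> (c, b \<otimes>\<^bsub>C\<^esub> d) \<ominus>\<^bsub>Qt\<^esub> \<beta> (c, b' \<otimes>\<^bsub>C\<^esub> d) = mB"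
      by (rule Qt_add_diff[OF q])
    then show "l ((frag_of (\<one>\<^bsub>B\<^esub>, b \<oplus>\<^bsub>C\<^esub> b') - frag_of (\<one>\<^bsub>B\<^esub>, b) - frag_of (\<one>\<^bsub>B\<^esub>, b')) \<otimes>\<^bsub>G.S\<^esub> frag_of (c, d)) = mB"
      using assms cd p
      by (simp add: G.S_mult_left S_of_mult l_diff S_of_closed G.S_diff l_of C.l_distr \<beta>_add_right)
  qed (use assms in \<open>simp add: S_of_closed G.S_diff\<close>)
qed

lemma ker_balanced:
  assumes "a \<in> carrier A"
  shows "frag_of (\<phi> a, \<one>\<^bsub>C\<^esub>) - frag_of (\<one>\<^bsub>B\<^esub>, \<psi> a) \<in> ker"
proof (rule kerI)
  fix c d assume cd: "c \<in> carrier B" "d \<in> carrier C"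
  have "\<beta> (c, \<psi> a \<otimes>\<^bsub>C\<^esub> d) = \<beta> (\<phi> a \<otimes>\<^bsub>B\<^esub> c, d)" by (rule \<beta>_balanced[OF cd assms])
  moreover have "\<beta> (\<phi> a \<otimes>\<^bsub>B\<^esub> c, d) \<in> carrier Qt" using \<beta>_closed assms cd by simp
  ultimately show "l ((frag_of (\<phi> a, \<one>\<^bsub>C\<^esub>) - frag_of (\<one>\<^bsub>B\<^esub>, \<psi> a)) \<otimes>\<^bsub>G.S\<^esub> frag_of (c, d)) = mB"
    using assms cd by (simp add: G.S_mult_left S_of_mult l_diff S_of_closed l_of Qt_diff_self)
qed (use assms in \<open>simp add: S_of_closed G.S_diff\<close>)

lemma ker_mB: "a \<in> mB \<Longrightarrow> frag_of (a, \<one>\<^bsub>C\<^esub>) \<in> ker"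
proof (rule kerI)
  fix c d assume a: "a \<in> mB" and cd: "c \<in> carrier B" "d \<in> carrier C"
  have "a \<otimes>\<^bsub>B\<^esub> c \<in> mB" by (rule mB.I_r_closed[OF a cd(1)])
  then have "\<beta> (a \<otimes>\<^bsub>B\<^esub> c, d) = mB" using \<beta>_m_left cd by simp
  then show "l (frag_of (a, \<one>\<^bsub>C\<^esub>) \<otimes>\<^bsub>G.S\<^esub> frag_of (c, d)) = mB"
    using a cd by (simp add: S_of_mult l_of)
qed (simp add: S_of_closed)

lemma ker_mC: "b \<in> mC \<Longrightarrow> frag_of (\<one>\<^bsub>B\<^esub>, b) \<in> ker"
proof (rule kerI)
  fix c d assume b: "b \<in> mC" and cd: "c \<in> carrier B" "d \<in> carrier C"
  have "b \<otimes>\<^bsub>C\<^esub> d \<in> mC" by (rule mC.I_r_closed[OF b cd(2)])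
  then have "\<beta> (c, b \<otimes>\<^bsub>C\<^esub> d) = mB" using \<beta>_m_right cd by simp
  then show "l (frag_of (\<one>\<^bsub>B\<^esub>, b) \<otimes>\<^bsub>G.S\<^esub> frag_of (c, d)) = mB"
    using b cd by (simp add: S_of_mult l_of)
qed (simp add: S_of_closed)

text \<open>The monoid ring modulo a maximal ideal above \<open>ker\<close>. Writing the carrier as
  an image of formal sums records a bound on its size, which allows the field to be copied to
  another type.\<close>

lemma compositum:
  obtains K :: "('b \<times> 'c \<Rightarrow>\<^sub>0 int) set ring" and r :: "('b \<times> 'c \<Rightarrow>\<^sub>0 int) \<Rightarrow> ('b \<times> 'c \<Rightarrow>\<^sub>0 int) set" and g h where
    "field K" "carrier K = r ` {c. Poly_Mapping.keys c \<subseteq> carrier B \<times> carrier C}"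
    "g \<in> ring_hom B K" "h \<in> ring_hom C K"
    "\<And>a. a \<in> carrier A \<Longrightarrow> g (\<phi> a) = h (\<psi> a)"
    "\<And>b. b \<in> mB \<Longrightarrow> g b = \<zero>\<^bsub>K\<^esub>" "\<And>c. c \<in> mC \<Longrightarrow> h c = \<zero>\<^bsub>K\<^esub>"
proof -
  obtain m where m: "maximalideal m G.S" "ker \<subseteq> m" using S.maximal_ideal_above[OF ker_ideal ker_one] by blast
  interpret m: maximalideal m G.S by (rule m(1))
  let ?K = "G.S Quot m"
  have eq: "m +>\<^bsub>G.S\<^esub> c = m +>\<^bsub>G.S\<^esub> d" if "c \<in> carrier G.S" "d \<in> carrier G.S" "c - d \<in> ker" for c d
    using S.quotient_eq_iff_same_a_r_cos[OF m.is_ideal that(1,2)] that m(2) G.S_minus[OF that(1,2)] by auto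
  have zero: "m +>\<^bsub>G.S\<^esub> c = \<zero>\<^bsub>?K\<^esub>" if "c \<in> ker" for c
    using S.a_rcos_zero[OF m.is_ideal, of c] that m(2) by (auto simp: FactRing_def)
  define g where "g b = m +>\<^bsub>G.S\<^esub> frag_of (b, \<one>\<^bsub>C\<^esub>)" for b
  define h where "h c = m +>\<^bsub>G.S\<^esub> frag_of (\<one>\<^bsub>B\<^esub>, c)" for c
  have hom: "(+>\<^bsub>G.S\<^esub>) m \<in> ring_hom G.S ?K" by (rule m.rcos_ring_hom)
  have one: "m +>\<^bsub>G.S\<^esub> frag_of (\<one>\<^bsub>B\<^esub>, \<one>\<^bsub>C\<^esub>) = \<one>\<^bsub>?K\<^esub>"
    using ring_hom_one[OF hom] by (simp add: G.S_simps G_simps)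
  note hc = ring_hom_closed[OF hom] and hm = ring_hom_mult[OF hom, symmetric]
    and ha = ring_hom_add[OF hom, symmetric]
  show ?thesis
  proof (rule that[of ?K "(+>\<^bsub>G.S\<^esub>) m" g h])
    show "field ?K" by (rule m.quotient_is_field[OF S.is_cring])
    have "carrier G = carrier B \<times> carrier C" unfolding DirProd_def by simp
    then show "carrier ?K = (+>\<^bsub>G.S\<^esub>) m ` {c. Poly_Mapping.keys c \<subseteq> carrier B \<times> carrier C}"
      unfolding FactRing_def A_RCOSETS_def RCOSETS_def a_r_coset_def[symmetric] monoid_ring_def by auto
    show "g \<in> ring_hom B ?K"
    proof (rule ring_hom_memI)
      fix a b assume ab: "a \<in> carrier B" "b \<in> carrier B"
      note c = S_of_closed[OF ab(1) C.one_closed] S_of_closed[OF ab(2) C.one_closed]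
      show "g a \<in> carrier ?K" unfolding g_def by (rule hc[OF c(1)])
      show "g (a \<otimes>\<^bsub>B\<^esub> b) = g a \<otimes>\<^bsub>?K\<^esub> g b" unfolding g_def hm[OF c] S_of_mult by simp
      show "g (a \<oplus>\<^bsub>B\<^esub> b) = g a \<oplus>\<^bsub>?K\<^esub> g b"
        unfolding g_def ha[OF c] G.S_simps by (rule eq[OF _ _ ker_add_left[OF ab]])
          (use ab c in \<open>simp_all add: S_of_closed G.S_add\<close>)
    qed (simp add: g_def one)
    show "h \<in> ring_hom C ?K"
    proof (rule ring_hom_memI)
      fix a b assume ab: "a \<in> carrier C" "b \<in> carrier C"
      note c = S_of_closed[OF B.one_closed ab(1)] S_of_closed[OF B.one_closed ab(2)]
      show "h a \<in> carrier ?K" unfolding h_def by (rule hc[OF c(1)])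
      show "h (a \<otimes>\<^bsub>C\<^esub> b) = h a \<otimes>\<^bsub>?K\<^esub> h b" unfolding h_def hm[OF c] S_of_mult by simp
      show "h (a \<oplus>\<^bsub>C\<^esub> b) = h a \<oplus>\<^bsub>?K\<^esub> h b"
        unfolding h_def ha[OF c] G.S_simps by (rule eq[OF _ _ ker_add_right[OF ab]])
          (use ab c in \<open>simp_all add: S_of_closed G.S_add\<close>)
    qed (simp add: h_def one)
    show "g (\<phi> a) = h (\<psi> a)" if "a \<in> carrier A" for a
      unfolding g_def h_def by (rule eq[OF _ _ ker_balanced[OF that]]) (use that in \<open>simp_all add: S_of_closed\<close>)
    show "g b = \<zero>\<^bsub>?K\<^esub>" if "b \<in> mB" for b unfolding g_def by (rule zero[OF ker_mB[OF that]])
    show "h c = \<zero>\<^bsub>?K\<^esub>" if "c \<in> mC" for c unfolding h_def by (rule zero[OF ker_mC[OF that]])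
  qed
qed

text \<open>All finite formal sums of pairs fit into any infinite type into which \<open>B\<close> and \<open>C\<close> embed.\<close>

lemma compositum_on_type:
  fixes i :: "'b \<Rightarrow> 'd" and j :: "'c \<Rightarrow> 'd"
  assumes inf: "infinite (UNIV :: 'd set)" and i: "inj_on i (carrier B)" and j: "inj_on j (carrier C)"
  obtains K :: "'d ring" and g h where
    "field K" "g \<in> ring_hom B K" "h \<in> ring_hom C K"
    "\<And>a. a \<in> carrier A \<Longrightarrow> g (\<phi> a) = h (\<psi> a)"
    "\<And>b. b \<in> mB \<Longrightarrow> g b = \<zero>\<^bsub>K\<^esub>" "\<And>c. c \<in> mC \<Longrightarrow> h c = \<zero>\<^bsub>K\<^esub>"
proof -
  obtain K :: "('b \<times> 'c \<Rightarrow>\<^sub>0 int) set ring" and r :: "('b \<times> 'c \<Rightarrow>\<^sub>0 int) \<Rightarrow> ('b \<times> 'c \<Rightarrow>\<^sub>0 int) set" and g h where K: "field K"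
    and r: "carrier K = r ` {c. Poly_Mapping.keys c \<subseteq> carrier B \<times> carrier C}"
    and g: "g \<in> ring_hom B K" and h: "h \<in> ring_hom C K"
    and gh: "\<And>a. a \<in> carrier A \<Longrightarrow> g (\<phi> a) = h (\<psi> a)"
    and gm: "\<And>b. b \<in> mB \<Longrightarrow> g b = \<zero>\<^bsub>K\<^esub>" and hm: "\<And>c. c \<in> mC \<Longrightarrow> h c = \<zero>\<^bsub>K\<^esub>"
    by (rule compositum) (rule that, assumption+)
  let ?BC = "carrier B \<times> carrier C"
  let ?F = "{c :: 'b \<times> 'c \<Rightarrow>\<^sub>0 int. Poly_Mapping.keys c \<subseteq> ?BC}"
  \<comment> \<open>An infinite type has room for its own pairs and, below, for its own finite
    integral formal sums.\<close>
  obtain p :: "'d \<times> 'd \<Rightarrow> 'd" where p: "inj p"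
    using card_of_Times_same_infinite[OF inf] unfolding card_of_ordIso[symmetric] bij_betw_def by auto
  define e where "e x = p (i (fst x), j (snd x))" for x
  have e: "inj_on e ?BC"
  proof (rule inj_onI)
    fix x y assume xy: "x \<in> ?BC" "y \<in> ?BC" "e x = e y"
    then have "(i (fst x), j (snd x)) = (i (fst y), j (snd y))" unfolding e_def using injD[OF p] by blast
    then show "x = y" using xy inj_onD[OF i] inj_onD[OF j] by (auto simp: prod_eq_iff)
  qed
  define m where "m = frag_extend (\<lambda>x. frag_of (e x))"
  define m' where "m' = frag_extend (\<lambda>y. frag_of (inv_into ?BC e y))"
  have "m' (m c) = c" if "Poly_Mapping.keys c \<subseteq> ?BC" for c
    using that unfolding m_def m'_def
    by (induction c rule: frag_induction) (auto simp: frag_extend_diff inv_into_f_f[OF e])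
  then have m: "inj_on m ?F" by (intro inj_on_inverseI[of _ m']) simp
  have "carrier (free_Abelian_group (UNIV :: 'd set)) \<approx> (UNIV :: 'd set)"
    by (rule eqpoll_free_Abelian_group_infinite[OF inf])
  then obtain n :: "('d \<Rightarrow>\<^sub>0 int) \<Rightarrow> 'd" where n: "inj_on n (carrier (free_Abelian_group (UNIV :: 'd set)))"
    unfolding eqpoll_def bij_betw_def by auto
  have n: "inj n" using n unfolding free_Abelian_group_def by simp
  \<comment> \<open>Injective, because a formal sum representing an element of \<open>K\<close>
    determines that element.\<close>
  define \<iota> where "\<iota> X = n (m (inv_into ?F r X))" for X
  have \<iota>: "inj_on \<iota> (carrier K)"
  proof (rule inj_onI)
    fix X Y assume X: "X \<in> carrier K" and Y: "Y \<in> carrier K" and eq: "\<iota> X = \<iota> Y"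
    have X': "X \<in> r ` ?F" and Y': "Y \<in> r ` ?F" using X Y unfolding r by auto
    have "m (inv_into ?F r X) = m (inv_into ?F r Y)" using eq injD[OF n] unfolding \<iota>_def by blast
    then have "inv_into ?F r X = inv_into ?F r Y"
      using inj_onD[OF m] inv_into_into[OF X'] inv_into_into[OF Y'] by blast
    then show "X = Y" using f_inv_into_f[OF X'] f_inv_into_f[OF Y'] by metis
  qed
  interpret K: field K by (rule K)
  have iso: "\<iota> \<in> ring_iso K (image_ring \<iota> K)" by (rule inj_imp_image_ring_iso[OF \<iota>])
  have hom: "\<iota> \<in> ring_hom K (image_ring \<iota> K)" using iso unfolding ring_iso_def by simp
  show ?thesis
  proof (rule that[of "image_ring \<iota> K" "\<iota> \<circ> g" "\<iota> \<circ> h"])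
    show "field (image_ring \<iota> K)" by (rule K.inj_imp_image_ring_is_field[OF \<iota>])
    show "\<iota> \<circ> g \<in> ring_hom B (image_ring \<iota> K)" by (rule ring_hom_trans[OF g hom])
    show "\<iota> \<circ> h \<in> ring_hom C (image_ring \<iota> K)" by (rule ring_hom_trans[OF h hom])
  qed (simp_all add: gh gm hm image_ring_zero)
qed

end

section \<open>One-point schemes\<close>

lemma field_local_ring:
  fixes R (structure)
  assumes "field R"
  shows "local_ring R" "maximalideal m R \<longleftrightarrow> m = {\<zero>}" "Units R = carrier R - {\<zero>}"
proof -
  interpret field R by fact
  have iff: "maximalideal m R \<longleftrightarrow> m = {\<zero>}" for m
  proof
    assume "maximalideal m R"
    then interpret m: maximalideal m R .
    have "m \<in> {{\<zero>}, carrier R}" using all_ideals m.is_ideal by blast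
    then show "m = {\<zero>}" using m.I_notcarr by auto
  qed (simp add: zeromaximalideal)
  show "maximalideal m R \<longleftrightarrow> m = {\<zero>}" by (rule iff)
  show "local_ring R" unfolding local_ring_def iff using is_cring by simp
  show "Units R = carrier R - {\<zero>}" by (rule field_Units)
qed

locale one_point = ringed X for X :: "('x, 'a) ringed_space" +
  fixes x
  assumes base: "base X = discrete_topology {x}" and field: "field (sec X {x})"
begin

lemma op_iff: "op U \<longleftrightarrow> U = {} \<or> U = {x}"
  unfolding base by auto

lemma top: "topspace (base X) = {x}"
  unfolding base by simp

lemma ops: "op {x}" "op {}"
  unfolding op_iff by auto

text \<open>The only neighbourhood of \<open>x\<close> is the whole space, so passing to germs
  neither identifies nor adds anything.\<close>

lemma germ_bij: "bij_betw (germ X x {x}) (carrier (sec X {x})) (carrier (stalk_ring X x))"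
proof (rule bij_betw_imageI)
  show "inj_on (germ X x {x}) (carrier (sec X {x}))"
  proof (rule inj_onI)
    fix s t assume s: "s \<in> carrier (sec X {x})" and t: "t \<in> carrier (sec X {x})"
      and "germ X x {x} s = germ X x {x} t"
    then obtain W where W: "op W" "x \<in> W" "res X {x} W s = res X {x} W t"
      unfolding germ_eq[OF ops(1) singletonI s ops(1) singletonI t] by auto
    have "W = {x}" using W op_iff by auto
    then show "s = t" using W(3) rid[OF ops(1) s] rid[OF ops(1) t] by simp
  qed
  show "germ X x {x} ` carrier (sec X {x}) = carrier (stalk_ring X x)"
  proof
    show "germ X x {x} ` carrier (sec X {x}) \<subseteq> carrier (stalk_ring X x)"
      using germ_closed[OF ops(1)] by blast
    show "carrier (stalk_ring X x) \<subseteq> germ X x {x} ` carrier (sec X {x})"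
    proof
      fix a assume "a \<in> carrier (stalk_ring X x)"
      then obtain U s where U: "op U" "x \<in> U" "s \<in> carrier (sec X U)" "a = germ X x U s"
        unfolding germs_iff by auto
      have "U = {x}" using U op_iff by auto
      then show "a \<in> germ X x {x} ` carrier (sec X {x})" using U by simp
    qed
  qed
qed

lemma germ_iso: "germ X x {x} \<in> ring_iso (sec X {x}) (stalk_ring X x)"
  unfolding ring_iso_def using germ_hom[OF ops(1) singletonI] germ_bij by simp

lemma stalk_field: "field (stalk_ring X x)"
proof -
  interpret field "sec X {x}" by (rule field)
  \<comment> \<open>Transport of fields along an isomorphism speaks of the target with its zero
    replaced by the image of zero; here the two zeros agree.\<close>
  have "field (stalk_ring X x \<lparr> zero := germ X x {x} \<zero>\<^bsub>sec X {x}\<^esub> \<rparr>)"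
    by (rule ring_iso_imp_img_field[OF germ_iso])
  moreover have "stalk_ring X x \<lparr> zero := germ X x {x} \<zero>\<^bsub>sec X {x}\<^esub> \<rparr> = stalk_ring X x"
    unfolding germ_zero[OF ops(1) singletonI] unfolding stalk_ring_def by simp
  ultimately show ?thesis by simp
qed

lemma locally_ringed: "locally_ringed_space X"
  unfolding locally_ringed_space_def top using ringed field_local_ring(1)[OF stalk_field] by simp

end

sublocale one_point \<subseteq> lringed
  by unfold_locales (rule locally_ringed)

text \<open>The open sets are the empty set and the point, so the sheaf axiom reduces to the
  question whether a cover contains the point.\<close>

lemma one_pointI:
  fixes X :: "('x, 'a) ringed_space"
  assumes base: "base X = discrete_topology {x}" and field: "field (sec X {x})"
    and c: "cring (sec X {})" and e: "carrier (sec X {}) = {z}"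
    and id: "\<And>s. s \<in> carrier (sec X {x}) \<Longrightarrow> res X {x} {x} s = s"
    and r: "\<And>U s. U \<subseteq> {x} \<Longrightarrow> s \<in> carrier (sec X U) \<Longrightarrow> res X U {} s = z"
  shows "one_point X x"
proof -
  have o: "openin (base X) U \<longleftrightarrow> U = {} \<or> U = {x}" for U
    unfolding base by auto
  interpret field "sec X {x}" by (rule field)
  interpret c: cring "sec X {}" by (rule c)
  have ze: "\<zero>\<^bsub>sec X {}\<^esub> = z" "\<one>\<^bsub>sec X {}\<^esub> = z" using c.zero_closed c.one_closed unfolding e by auto
  have r': "res X U {} s = z" if "U = {} \<or> U = {x}" "s \<in> carrier (sec X U)" for U s
    using r[OF _ that(2)] that(1) by auto
  have pre: "is_presheaf X"
    unfolding is_presheaf_def o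
  proof (intro conjI allI impI)
    fix U V assume "(U = {} \<or> U = {x}) \<and> (V = {} \<or> V = {x}) \<and> V \<subseteq> U"
    then consider "V = {}" "U = {} \<or> U = {x}" | "U = {x}" "V = {x}" by auto
    then show "res X U V \<in> carrier (sec X U) \<rightarrow> carrier (sec X V)"
    proof cases
      case 1
      then show ?thesis using r'[OF 1(2)] e by simp
    next
      case 2
      then show ?thesis using id by simp
    qed
  next
    fix U s assume "(U = {} \<or> U = {x}) \<and> s \<in> carrier (sec X U)"
    then show "res X U U s = s" using id r'[of "{}" s] e by auto
  next
    fix U V W s assume *: "(U = {} \<or> U = {x}) \<and> (V = {} \<or> V = {x}) \<and> (W = {} \<or> W = {x}) \<and> W \<subseteq> V \<and> V \<subseteq> U \<and> s \<in> carrier (sec X U)"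
    have zz: "res X {} {} z = z" using r'[of "{}" z] e by simp
    show "res X V W (res X U V s) = res X U W s"
    proof (cases "V = {x}")
      case True
      then have "U = {x}" using * by auto
      then show ?thesis using True * id by auto
    next
      case False
      then have "V = {}" "W = {}" using * by auto
      then show ?thesis using * r' zz by auto
    qed
  qed
  have sh: "is_sheaf X"
    unfolding is_sheaf_def
  proof (intro conjI allI impI pre)
    fix \<U> s assume *: "(\<forall>V\<in>\<U>. openin (base X) V \<and> s V \<in> carrier (sec X V)) \<and>
        (\<forall>V\<in>\<U>. \<forall>W\<in>\<U>. res X V (V \<inter> W) (s V) = res X W (V \<inter> W) (s W))"
    have sub: "V = {} \<or> V = {x}" if "V \<in> \<U>" for V using * that unfolding o by blast
    have sz: "s {} = z" if "{} \<in> \<U>" using * that e by auto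
    show "\<exists>!t. t \<in> carrier (sec X (\<Union>\<U>)) \<and> (\<forall>V\<in>\<U>. res X (\<Union>\<U>) V t = s V)"
    proof (cases "{x} \<in> \<U>")
      case True
      have un: "\<Union>\<U> = {x}" using True sub by blast
      have sx: "s {x} \<in> carrier (sec X {x})" using True * by blast
      show ?thesis unfolding un
      proof (rule ex1I[of _ "s {x}"])
        show "s {x} \<in> carrier (sec X {x}) \<and> (\<forall>V\<in>\<U>. res X {x} V (s {x}) = s V)"
        proof (intro conjI ballI sx)
          fix V assume V: "V \<in> \<U>"
          show "res X {x} V (s {x}) = s V" using sub[OF V] id[OF sx] r'[of "{x}", OF _ sx] sz V by auto
        qed
        fix t assume "t \<in> carrier (sec X {x}) \<and> (\<forall>V\<in>\<U>. res X {x} V t = s V)"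
        then show "t = s {x}" using True id by auto
      qed
    next
      case False
      have un: "\<Union>\<U> = {}" using False sub by blast
      show ?thesis unfolding un
      proof (rule ex1I[of _ z])
        show "z \<in> carrier (sec X {}) \<and> (\<forall>V\<in>\<U>. res X {} V z = s V)"
        proof (intro conjI ballI)
          fix V assume V: "V \<in> \<U>"
          then have "V = {}" using sub[OF V] False by auto
          then show "res X {} V z = s V" using r'[of "{}" z] e sz V by simp
        qed (simp add: e)
      qed (simp add: e)
    qed
  qed
  have rs: "is_ringed_space X"
    unfolding is_ringed_space_def
  proof (intro conjI allI impI sh)
    fix U assume "openin (base X) U"
    then show "cring (sec X U)" unfolding o using c is_cring by auto
  next
    fix U V assume "openin (base X) U \<and> openin (base X) V \<and> V \<subseteq> U"
    then consider "V = {}" "U = {} \<or> U = {x}" | "U = {x}" "V = {x}" unfolding o by auto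
    then show "res X U V \<in> ring_hom (sec X U) (sec X V)"
    proof cases
      case 1
      have zc: "z \<in> carrier (sec X {})" using e by simp
      have zs: "z \<otimes>\<^bsub>sec X {}\<^esub> z = z" "z \<oplus>\<^bsub>sec X {}\<^esub> z = z"
        using c.m_closed[OF zc zc] c.a_closed[OF zc zc] unfolding e by auto
      interpret U: cring "sec X U" using 1(2) c is_cring by auto
      show ?thesis unfolding 1(1)
        by (rule ring_hom_memI) (simp_all add: r'[OF 1(2)] e zs ze)
    next
      case 2
      then show ?thesis by (intro ring_hom_memI) (simp_all add: id)
    qed
  qed
  show ?thesis by unfold_locales (rule rs, rule base)
qed

text \<open>The morphism from the spectrum of a field given by a point \<open>z\<close> and a
  homomorphism from its stalk to the field. Open sets missing \<open>z\<close> have empty preimage,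
  over which zero is the only section.\<close>

definition point_morphism :: "('t, 'k) ringed_space \<Rightarrow> ('z, 'c) ringed_space \<Rightarrow> 'z \<Rightarrow>
    (('z set \<times> 'c) set \<Rightarrow> 'k) \<Rightarrow> ('t, 'k, 'z, 'c) morphism" where
  "point_morphism T Z z \<psi> = \<lparr>pt_map = (\<lambda>_. z),
    sec_map = (\<lambda>V s. if z \<in> V then \<psi> (germ Z z V s) else \<zero>\<^bsub>sec T {}\<^esub>)\<rparr>"

text \<open>The assumption \<open>m\<close> is locality: the maximal ideal of a field is zero, so
  the maximal ideal of the stalk has to be killed.\<close>

lemma point_morphism:
  assumes T: "one_point T t" and Z: "locally_ringed_space Z" and z: "z \<in> topspace (base Z)"
    and \<psi>: "\<psi> \<in> ring_hom (stalk_ring Z z) (sec T {t})"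
    and m: "\<And>a. a \<in> carrier (stalk_ring Z z) - Units (stalk_ring Z z) \<Longrightarrow> \<psi> a = \<zero>\<^bsub>sec T {t}\<^esub>"
  shows "lrs_morphism T Z (point_morphism T Z z \<psi>)"
proof -
  interpret T: one_point T t by (rule T)
  interpret Z: lringed Z by unfold_locales (rule Z)
  let ?f = "point_morphism T Z z \<psi>"
  have pt: "pt_map ?f = (\<lambda>_. z)" and sm: "sec_map ?f V s = (if z \<in> V then \<psi> (germ Z z V s) else \<zero>\<^bsub>sec T {}\<^esub>)" for V s
    unfolding point_morphism_def by simp_all
  have pre: "preim T ?f V = (if z \<in> V then {t} else {})" for V
    unfolding preim_def pt T.top by auto
  show ?thesis
    unfolding lrs_morphism_def
  proof (intro conjI allI impI ballI)
    show "continuous_map (base T) (base Z) (pt_map ?f)"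
      unfolding T.base pt using z by simp
  next
    fix V assume V: "Z.op V"
    show "sec_map ?f V \<in> ring_hom (sec Z V) (sec T (preim T ?f V))"
    proof (cases "z \<in> V")
      case True
      have "\<psi> \<circ> germ Z z V \<in> ring_hom (sec Z V) (sec T {t})"
        by (rule ring_hom_trans[OF Z.germ_hom[OF V True] \<psi>])
      moreover have "sec_map ?f V = \<psi> \<circ> germ Z z V" using sm True by auto
      ultimately show ?thesis unfolding pre using True by simp
    next
      case False
      interpret e: cring "sec T {}" by (rule T.sec_cring[OF T.ops(2)])
      have one: "\<one>\<^bsub>sec T {}\<^esub> = \<zero>\<^bsub>sec T {}\<^esub>" by (rule T.sec_empty[OF e.one_closed])
      show ?thesis using False by (intro ring_hom_memI) (simp_all add: pre sm one)
    qed
  next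
    fix V W s assume *: "Z.op V \<and> Z.op W \<and> W \<subseteq> V \<and> s \<in> carrier (sec Z V)"
    show "sec_map ?f W (res Z V W s) = res T (preim T ?f V) (preim T ?f W) (sec_map ?f V s)"
    proof (cases "z \<in> W")
      case True
      then have zV: "z \<in> V" using * by auto
      have c: "\<psi> (germ Z z V s) \<in> carrier (sec T {t})"
        using ring_hom_closed[OF \<psi> Z.germ_closed] * zV by simp
      show ?thesis unfolding sm pre using True zV * Z.germ_rs[of V s W z] T.rid[OF T.ops(1) c] by simp
    next
      case False
      have "sec_map ?f V s \<in> carrier (sec T (preim T ?f V))"
        unfolding sm pre using ring_hom_closed[OF \<psi> Z.germ_closed[of V z s]] * by auto
      moreover have "T.op (preim T ?f V)" unfolding pre T.op_iff by simp
      ultimately have "res T (preim T ?f V) {} (sec_map ?f V s) = \<zero>\<^bsub>sec T {}\<^esub>"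
        by (intro T.sec_empty T.rclosed) auto
      then show ?thesis unfolding pre[of W] sm[of W] using False by simp
    qed
  next
    fix y assume "y \<in> topspace (base T)"
    then have y: "y = t" using T.top by simp
    let ?A = "stalk_ring Z z" and ?B = "stalk_ring T t"
    have top: "Z.op (topspace (base Z))" by simp
    have sp: "stalk_map T Z ?f t a = germ T t {t} (\<psi> a)" if a: "a \<in> carrier ?A" for a
      unfolding stalk_map_def pt
    proof (rule the_equality)
      show "\<exists>V s. Z.op V \<and> z \<in> V \<and> s \<in> carrier (sec Z V) \<and> a = germ Z z V s \<and>
        germ T t {t} (\<psi> a) = germ T t (preim T ?f V) (sec_map ?f V s)"
        using a unfolding Z.germs_iff pre sm by auto
      fix c assume "\<exists>V s. Z.op V \<and> z \<in> V \<and> s \<in> carrier (sec Z V) \<and> a = germ Z z V s \<and>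
        c = germ T t (preim T ?f V) (sec_map ?f V s)"
      then show "c = germ T t {t} (\<psi> a)" unfolding pre sm by auto
    qed
    interpret A: cring ?A by (rule Z.stalk_cring[OF z])
    interpret B: field ?B by (rule T.stalk_field)
    have hom: "germ T t {t} \<circ> \<psi> \<in> ring_hom ?A ?B"
      by (rule ring_hom_trans[OF \<psi> T.germ_hom[OF T.ops(1) singletonI]])
    have hom': "stalk_map T Z ?f t \<in> ring_hom ?A ?B"
    proof (rule ring_hom_memI)
      fix a b assume ab: "a \<in> carrier ?A" "b \<in> carrier ?A"
      show "stalk_map T Z ?f t a \<in> carrier ?B" using ring_hom_closed[OF hom ab(1)] sp[OF ab(1)] by simp
      show "stalk_map T Z ?f t (a \<otimes>\<^bsub>?A\<^esub> b) = stalk_map T Z ?f t a \<otimes>\<^bsub>?B\<^esub> stalk_map T Z ?f t b"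
        using ring_hom_mult[OF hom ab] sp[OF ab(1)] sp[OF ab(2)] sp[OF A.m_closed[OF ab]] by simp
      show "stalk_map T Z ?f t (a \<oplus>\<^bsub>?A\<^esub> b) = stalk_map T Z ?f t a \<oplus>\<^bsub>?B\<^esub> stalk_map T Z ?f t b"
        using ring_hom_add[OF hom ab] sp[OF ab(1)] sp[OF ab(2)] sp[OF A.a_closed[OF ab]] by simp
    next
      show "stalk_map T Z ?f t \<one>\<^bsub>?A\<^esub> = \<one>\<^bsub>?B\<^esub>"
        using ring_hom_one[OF hom] sp[OF A.one_closed] by simp
    qed
    show "local_hom (stalk_ring Z (pt_map ?f y)) (stalk_ring T y) (stalk_map T Z ?f y)"
      unfolding y pt local_hom_def
    proof (intro conjI allI impI hom')
      fix m n assume "maximalideal m ?A \<and> maximalideal n ?B"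
      then have mn: "m = carrier ?A - Units ?A" "n = {\<zero>\<^bsub>?B\<^esub>}"
        using local_ring_nonunits(2)[OF Z.stalk_local[OF z]] field_local_ring(2)[OF T.stalk_field] by auto
      have "stalk_map T Z ?f t a = \<zero>\<^bsub>?B\<^esub>" if a: "a \<in> carrier ?A - Units ?A" for a
        using sp[of a] a m[OF a] T.germ_zero[OF T.ops(1) singletonI] by simp
      then show "stalk_map T Z ?f t ` m \<subseteq> n" unfolding mn by auto
    qed
  qed
qed

text \<open>Both directions are point morphisms, with \<open>\<theta>\<close> and
  \<open>\<theta>'\<close> identifying the stalks with the global sections.\<close>

lemma one_point_iso:
  assumes T: "one_point T t" and Y: "one_point Y y" and \<eta>: "\<eta> \<in> ring_iso (sec Y {y}) (sec T {t})"
  shows "lrs_isomorphic T Y"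
proof -
  interpret T: one_point T t by (rule T)
  interpret Y: one_point Y y by (rule Y)
  have tr: "ring (sec T {t})" "ring (sec Y {y})" using T.sec_ring[OF T.ops(1)] Y.sec_ring[OF Y.ops(1)] by auto
  define \<eta>' where "\<eta>' = inv_into (carrier (sec Y {y})) \<eta>"
  define \<theta> where "\<theta> = inv_into (carrier (sec T {t})) (germ T t {t})"
  define \<theta>' where "\<theta>' = inv_into (carrier (sec Y {y})) (germ Y y {y})"
  have \<eta>_bij: "bij_betw \<eta> (carrier (sec Y {y})) (carrier (sec T {t}))" using \<eta> unfolding ring_iso_def by simp
  have iso: "\<eta>' \<in> ring_iso (sec T {t}) (sec Y {y})" "\<theta> \<in> ring_iso (stalk_ring T t) (sec T {t})"
    "\<theta>' \<in> ring_iso (stalk_ring Y y) (sec Y {y})"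
    unfolding \<eta>'_def \<theta>_def \<theta>'_def
    using ring_iso_set_sym[OF tr(2) \<eta>] ring_iso_set_sym[OF tr(1) T.germ_iso] ring_iso_set_sym[OF tr(2) Y.germ_iso] .
  have hom: "\<eta> \<in> ring_hom (sec Y {y}) (sec T {t})" "\<eta>' \<in> ring_hom (sec T {t}) (sec Y {y})"
    "\<theta> \<in> ring_hom (stalk_ring T t) (sec T {t})" "\<theta>' \<in> ring_hom (stalk_ring Y y) (sec Y {y})"
    using iso \<eta> unfolding ring_iso_def by simp_all
  have \<theta>s: "\<theta> (germ T t {t} s) = s" if "s \<in> carrier (sec T {t})" for s
    unfolding \<theta>_def by (rule bij_betw_inv_into_left[OF T.germ_bij that])
  have \<theta>s': "\<theta>' (germ Y y {y} s) = s" if "s \<in> carrier (sec Y {y})" for s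
    unfolding \<theta>'_def by (rule bij_betw_inv_into_left[OF Y.germ_bij that])
  have h1: "\<eta> \<circ> \<theta>' \<in> ring_hom (stalk_ring Y y) (sec T {t})" by (rule ring_hom_trans[OF hom(4,1)])
  have h2: "\<eta>' \<circ> \<theta> \<in> ring_hom (stalk_ring T t) (sec Y {y})" by (rule ring_hom_trans[OF hom(3,2)])
  have ry: "ring (stalk_ring Y y)" "ring (stalk_ring T t)"
    using Y.stalk_cring T.stalk_cring Y.top T.top cring.axioms(1) by auto
  let ?f = "point_morphism T Y y (\<eta> \<circ> \<theta>')" and ?g = "point_morphism Y T t (\<eta>' \<circ> \<theta>)"
  have f: "lrs_morphism T Y ?f"
  proof (rule point_morphism[OF T Y.locally_ringed _ h1])
    fix a assume "a \<in> carrier (stalk_ring Y y) - Units (stalk_ring Y y)"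
    then have "a = \<zero>\<^bsub>stalk_ring Y y\<^esub>" using field_local_ring(3)[OF Y.stalk_field] by auto
    then show "(\<eta> \<circ> \<theta>') a = \<zero>\<^bsub>sec T {t}\<^esub>" using ring_hom_zero[OF h1 ry(1) tr(1)] by simp
  qed (simp add: Y.top)
  have g: "lrs_morphism Y T ?g"
  proof (rule point_morphism[OF Y T.locally_ringed _ h2])
    fix a assume "a \<in> carrier (stalk_ring T t) - Units (stalk_ring T t)"
    then have "a = \<zero>\<^bsub>stalk_ring T t\<^esub>" using field_local_ring(3)[OF T.stalk_field] by auto
    then show "(\<eta>' \<circ> \<theta>) a = \<zero>\<^bsub>sec Y {y}\<^esub>" using ring_hom_zero[OF h2 ry(2) tr(2)] by simp
  qed (simp add: T.top)
  have pf: "preim T ?f V = (if y \<in> V then {t} else {})" for V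
    unfolding preim_def T.top by (auto simp: point_morphism_def)
  have pg: "preim Y ?g V = (if t \<in> V then {y} else {})" for V
    unfolding preim_def Y.top by (auto simp: point_morphism_def)
  have gf: "morphism_eq T T (morphism_comp Y ?g ?f) morphism_id"
    unfolding morphism_eq_def
  proof (intro conjI ballI allI impI)
    fix u assume "u \<in> topspace (base T)"
    then show "pt_map (morphism_comp Y ?g ?f) u = pt_map morphism_id u"
      unfolding T.top by (simp add: morphism_comp_def morphism_id_def point_morphism_def)
  next
    fix V s assume V: "T.op V \<and> s \<in> carrier (sec T V)"
    then consider "V = {}" | "V = {t}" unfolding T.op_iff by auto
    then show "sec_map (morphism_comp Y ?g ?f) V s = sec_map morphism_id V s"
    proof cases
      case 1
      then show ?thesis using T.sec_empty[of s] V
        by (simp add: morphism_comp_def morphism_id_def pg) (simp add: point_morphism_def)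
    next
      case 2
      then have s: "s \<in> carrier (sec T {t})" using V by simp
      have c: "\<eta>' s \<in> carrier (sec Y {y})" by (rule ring_hom_closed[OF hom(2) s])
      have "\<eta> (\<eta>' s) = s" unfolding \<eta>'_def by (rule bij_betw_inv_into_right[OF \<eta>_bij s])
      then show ?thesis using 2 \<theta>s[OF s] \<theta>s'[OF c]
        by (simp add: morphism_comp_def morphism_id_def pg) (simp add: point_morphism_def)
    qed
  qed
  have fg: "morphism_eq Y Y (morphism_comp T ?f ?g) morphism_id"
    unfolding morphism_eq_def
  proof (intro conjI ballI allI impI)
    fix u assume "u \<in> topspace (base Y)"
    then show "pt_map (morphism_comp T ?f ?g) u = pt_map morphism_id u"
      unfolding Y.top by (simp add: morphism_comp_def morphism_id_def point_morphism_def)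
  next
    fix V s assume V: "Y.op V \<and> s \<in> carrier (sec Y V)"
    then consider "V = {}" | "V = {y}" unfolding Y.op_iff by auto
    then show "sec_map (morphism_comp T ?f ?g) V s = sec_map morphism_id V s"
    proof cases
      case 1
      then show ?thesis using Y.sec_empty[of s] V
        by (simp add: morphism_comp_def morphism_id_def pf) (simp add: point_morphism_def)
    next
      case 2
      then have s: "s \<in> carrier (sec Y {y})" using V by simp
      have c: "\<eta> s \<in> carrier (sec T {t})" by (rule ring_hom_closed[OF hom(1) s])
      have "\<eta>' (\<eta> s) = s" unfolding \<eta>'_def by (rule bij_betw_inv_into_left[OF \<eta>_bij s])
      then show ?thesis using 2 \<theta>s'[OF s] \<theta>s[OF c]
        by (simp add: morphism_comp_def morphism_id_def pf) (simp add: point_morphism_def)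
    qed
  qed
  show ?thesis unfolding lrs_isomorphic_def using f g gf fg by (intro exI conjI)
qed

section \<open>Spectra of fields and their copies on prescribed types\<close>

lemma trivial_cring:
  assumes "carrier R = {z}" "\<And>a b. a \<otimes>\<^bsub>R\<^esub> b = z" "\<And>a b. a \<oplus>\<^bsub>R\<^esub> b = z" "\<one>\<^bsub>R\<^esub> = z" "\<zero>\<^bsub>R\<^esub> = z"
  shows "cring R"
  by (intro cringI abelian_groupI comm_monoidI) (auto simp: assms)

text \<open>Zero is the only prime, so a section is a single fraction; its denominator is invertible
  in the field, which makes \<open>loc\<close> surjective.\<close>

lemma Spec_field:
  fixes K :: "('k, 'e) ring_scheme"
  assumes K: "field K"
  shows "one_point (Spec K) {\<zero>\<^bsub>K\<^esub>}" "\<exists>\<eta>. \<eta> \<in> ring_iso K (sec (Spec K) {{\<zero>\<^bsub>K\<^esub>}})"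
proof -
  interpret field K by (rule K)
  interpret spec_ring K by unfold_locales
  let ?p = "{\<zero>\<^bsub>K\<^esub>}"
  have P: "P = {?p}"
  proof -
    have "p = ?p" if "primeideal p K" for p
    proof -
      interpret p: primeideal p K by (rule that)
      have "p \<in> {?p, carrier K}" using all_ideals p.is_ideal by blast
      then show ?thesis using p.I_notcarr by auto
    qed
    then show ?thesis using zeroprimeideal by blast
  qed
  have b: "base Y = discrete_topology {?p}"
  proof -
    have t: "topspace (zariski K) = {?p}" using Ybase P by simp
    have "openin (zariski K) U \<longleftrightarrow> openin (discrete_topology {?p}) U" for U
    proof
      assume "openin (zariski K) U"
      then show "openin (discrete_topology {?p}) U" using openin_subset t by force
    next
      assume "openin (discrete_topology {?p}) U"
      then consider "U = {}" | "U = topspace (zariski K)" unfolding t by auto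
      then show "openin (zariski K) U" by cases auto
    qed
    then show ?thesis unfolding Ybase topology_eq by simp
  qed
  interpret M: mult_set K "carrier K - ?p" by (rule primeideal_mult_set[OF zeroprimeideal])
  have inj: "inj_on loc (carrier K)"
  proof (rule inj_onI)
    fix a c assume a: "a \<in> carrier K" and c: "c \<in> carrier K" and "loc a = loc c"
    then have "loc a ?p = loc c ?p" by simp
    then have "frac K (carrier K - ?p) a \<one>\<^bsub>K\<^esub> = frac K (carrier K - ?p) c \<one>\<^bsub>K\<^esub>"
      unfolding loc_def P by simp
    then have "\<exists>u\<in>carrier K - ?p. u \<otimes>\<^bsub>K\<^esub> (\<one>\<^bsub>K\<^esub> \<otimes>\<^bsub>K\<^esub> a) = u \<otimes>\<^bsub>K\<^esub> (\<one>\<^bsub>K\<^esub> \<otimes>\<^bsub>K\<^esub> c)"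
      unfolding M.frac_eq_iff[OF a M.S_one c M.S_one] .
    then obtain u where u: "u \<in> carrier K" "u \<noteq> \<zero>\<^bsub>K\<^esub>" "u \<otimes>\<^bsub>K\<^esub> a = u \<otimes>\<^bsub>K\<^esub> c" using a c by auto
    then show "a = c" using m_lcancel[OF u(2,1) a c] by simp
  qed
  have surj: "\<sigma> \<in> loc ` carrier K" if \<sigma>: "\<sigma> \<in> carrier (sec Y {?p})" for \<sigma>
  proof -
    have PE: "\<sigma> \<in> (\<Pi>\<^sub>E p\<in>{?p}. carrier (localization_at K p))" using \<sigma> unfolding Spec_def by simp
    then have "\<sigma> ?p \<in> carrier (localization K (carrier K - ?p))" unfolding localization_at_def by auto
    then obtain a s where a: "a \<in> carrier K" and s: "s \<in> carrier K - ?p" and e: "\<sigma> ?p = frac K (carrier K - ?p) a s"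
      unfolding localization_def by auto
    have su: "s \<in> Units K" using s field_Units by simp
    let ?c = "inv\<^bsub>K\<^esub> s \<otimes>\<^bsub>K\<^esub> a"
    note sc = Units_closed[OF su] Units_inv_closed[OF su]
    have ci: "?c \<in> carrier K" by (rule m_closed[OF sc(2) a])
    have "s \<otimes>\<^bsub>K\<^esub> ?c = a"
      unfolding m_assoc[OF sc a, symmetric] Units_r_inv[OF su] by (rule l_one[OF a])
    then have "\<one>\<^bsub>K\<^esub> \<otimes>\<^bsub>K\<^esub> (\<one>\<^bsub>K\<^esub> \<otimes>\<^bsub>K\<^esub> a) = \<one>\<^bsub>K\<^esub> \<otimes>\<^bsub>K\<^esub> (s \<otimes>\<^bsub>K\<^esub> ?c)"
      using a by (simp only: l_one)
    then have "\<exists>u\<in>carrier K - ?p. u \<otimes>\<^bsub>K\<^esub> (\<one>\<^bsub>K\<^esub> \<otimes>\<^bsub>K\<^esub> a) = u \<otimes>\<^bsub>K\<^esub> (s \<otimes>\<^bsub>K\<^esub> ?c)"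
      by (rule bexI[OF _ M.S_one])
    then have "frac K (carrier K - ?p) a s = frac K (carrier K - ?p) ?c \<one>\<^bsub>K\<^esub>"
      by (rule iffD2[OF M.frac_eq_iff[OF a s ci M.S_one]])
    then have "\<sigma> = loc ?c"
      using PE e unfolding loc_def P
      by (intro extensionalityI[of \<sigma> "{?p}"]) (auto simp: PiE_def)
    then show ?thesis using ci by blast
  qed
  have bij: "bij_betw loc (carrier K) (carrier (sec Y {?p}))"
    using inj surj loc_closed unfolding P by (intro bij_betw_imageI) auto
  have iso: "loc \<in> ring_iso K (sec Y {?p})"
    unfolding ring_iso_def using bij loc_hom unfolding P by simp
  then show "\<exists>\<eta>. \<eta> \<in> ring_iso K (sec (Spec K) {{\<zero>\<^bsub>K\<^esub>}})" by blast
  have fl: "field (sec Y {?p})"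
  proof -
    have "field (sec Y {?p} \<lparr> zero := loc \<zero>\<^bsub>K\<^esub> \<rparr>)" by (rule ring_iso_imp_img_field[OF iso])
    moreover have "loc \<zero>\<^bsub>K\<^esub> = \<zero>\<^bsub>sec Y {?p}\<^esub>"
      unfolding loc_def P Spec_def localization_at_def localization_def by simp
    moreover have "sec Y {?p} \<lparr> zero := \<zero>\<^bsub>sec Y {?p}\<^esub> \<rparr> = sec Y {?p}" by simp
    ultimately show ?thesis by simp
  qed
  have e: "carrier (sec Y {}) = {\<lambda>_. undefined}"
    unfolding Spec_def by auto
  show "one_point (Spec K) ?p"
  proof (rule one_pointI[OF b fl _ e])
    show "cring (sec Y {})" by (rule trivial_cring[OF e]) (simp_all add: Spec_def restrict_def)
    show "res Y {?p} {?p} s = s" if "s \<in> carrier (sec Y {?p})" for s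
      using that unfolding Spec_def by (auto intro: PiE_restrict)
    show "res Y U {} s = (\<lambda>_. undefined)" for U s unfolding Spec_def by (simp add: restrict_def)
  qed
qed

text \<open>A copy of the spectrum of \<open>K\<close> whose point may come from any type and whose
  sections are the elements of \<open>K\<close>. The spectrum itself has sets as points and
  functions as sections, whereas a test scheme for the fibre product must have both in
  \<open>fp_type\<close>.\<close>

definition point_space :: "'t \<Rightarrow> 'k ring \<Rightarrow> ('t, 'k) ringed_space" where
  "point_space t K = \<lparr>base = discrete_topology {t},
    sec = (\<lambda>U. if t \<in> U then K else \<lparr>carrier = {\<zero>\<^bsub>K\<^esub>}, monoid.mult = (\<lambda>_ _. \<zero>\<^bsub>K\<^esub>), monoid.one = \<zero>\<^bsub>K\<^esub>,
      ring.zero = \<zero>\<^bsub>K\<^esub>, ring.add = (\<lambda>_ _. \<zero>\<^bsub>K\<^esub>)\<rparr>),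
    res = (\<lambda>U V s. if t \<in> V then s else \<zero>\<^bsub>K\<^esub>)\<rparr>"

lemma point_space:
  fixes K :: "'k ring"
  assumes K: "field K"
  shows "one_point (point_space t K) t" "scheme (point_space t K)" "sec (point_space t K) {t} = K"
proof -
  let ?T = "point_space t K"
  show s: "sec ?T {t} = K" unfolding point_space_def by simp
  show T: "one_point ?T t"
  proof (rule one_pointI[of _ _ "\<zero>\<^bsub>K\<^esub>"])
    show "field (sec ?T {t})" using s K by simp
    show "cring (sec ?T {})" by (rule trivial_cring[of _ "\<zero>\<^bsub>K\<^esub>"]) (simp_all add: point_space_def)
  qed (simp_all add: point_space_def)
  interpret T: one_point ?T t by (rule T)
  have sub: "open_sub ?T {t} = ?T"
    unfolding open_sub_def using T.base by (simp add: point_space_def)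
  obtain \<eta> where \<eta>: "\<eta> \<in> ring_iso K (sec (Spec K) {{\<zero>\<^bsub>K\<^esub>}})" using Spec_field(2)[OF K] by auto
  interpret K: field K by (rule K)
  have "inv_into (carrier K) \<eta> \<in> ring_iso (sec (Spec K) {{\<zero>\<^bsub>K\<^esub>}}) (sec ?T {t})"
    unfolding s by (rule ring_iso_set_sym[OF K.ring_axioms \<eta>])
  then have iso: "lrs_isomorphic ?T (Spec K)" by (rule one_point_iso[OF T Spec_field(1)[OF K]])
  show "scheme ?T" unfolding scheme_def
  proof (intro conjI ballI T.locally_ringed)
    fix x assume "x \<in> topspace (base ?T)"
    then have x: "x = t" using T.top by simp
    show "\<exists>U (R :: 'k ring). T.op U \<and> x \<in> U \<and> cring R \<and> lrs_isomorphic (open_sub ?T U) (Spec R)"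
    proof (rule exI[of _ "{t}"], rule exI[of _ K], intro conjI)
      show "lrs_isomorphic (open_sub ?T {t}) (Spec K)" unfolding sub by (rule iso)
    qed (simp_all add: x T.ops(1) K.is_cring)
  qed
qed

section \<open>Points of the fibre product with given projections\<close>

lemma stalk_embedding:
  fixes X :: "('x, 'a) ringed_space" and u :: "'x \<Rightarrow> 'i" and v :: "'a \<Rightarrow> 'i"
  assumes X: "is_ringed_space X" and u: "inj u" and v: "inj v" and uv: "\<And>y a. u y \<noteq> v a"
  shows "\<exists>i :: ('x set \<times> 'a) set \<Rightarrow> 'i set. inj_on i (carrier (stalk_ring X x))"
proof -
  interpret ringed X by unfold_locales (rule X)
  define pick where "pick c = (SOME p. op (fst p) \<and> x \<in> fst p \<and> snd p \<in> carrier (sec X (fst p)) \<and>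
    c = germ X x (fst p) (snd p))" for c
  have pick: "c = germ X x (fst (pick c)) (snd (pick c))" if "c \<in> carrier (stalk_ring X x)" for c
  proof -
    have "\<exists>p. op (fst p) \<and> x \<in> fst p \<and> snd p \<in> carrier (sec X (fst p)) \<and> c = germ X x (fst p) (snd p)"
      using that unfolding germs_iff by auto
    from someI_ex[OF this] show ?thesis unfolding pick_def[symmetric] by simp
  qed
  \<comment> \<open>A representative of a germ, an open set with a section, is coded as one set of
    tagged elements; the disjoint ranges of \<open>u\<close> and \<open>v\<close> allow it to be
    decoded.\<close>
  define enc where "enc p = insert (v (snd p)) (u ` fst p)" for p
  have enc: "p = q" if e: "enc p = enc q" for p q
  proof -
    have "v (snd p) \<in> enc q" "v (snd q) \<in> enc p" using e unfolding enc_def by auto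
    then have s: "snd p = snd q" unfolding enc_def using uv injD[OF v] by (metis image_iff insertE)
    have mem: "y \<in> fst p \<longleftrightarrow> u y \<in> enc p" for y p
      unfolding enc_def using uv[of y "snd p"] inj_image_mem_iff[OF u] by simp
    have "fst p = fst q" by (intro equalityI subsetI) (simp_all only: mem e)
    then show ?thesis using s by (simp add: prod_eq_iff)
  qed
  have "inj_on (\<lambda>c. enc (pick c)) (carrier (stalk_ring X x))"
    by (rule inj_onI) (metis enc pick)
  then show ?thesis by blast
qed

text \<open>A field that receives both stalks compatibly over the stalk of \<open>X\<close> gives
  two morphisms from a one-point scheme with the same composite to \<open>X\<close>. The universal
  property merges them into one morphism to \<open>P\<close>, whose image point is the one
  wanted.\<close>

lemma fibre_product_point:
  fixes X :: "('x, 'a) ringed_space" and Y :: "('y, 'b) ringed_space" and Z :: "('z, 'c) ringed_space"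
    and P :: "('y, 'b, 'z, 'c) fp_space"
  assumes X: "locally_ringed_space X" and Y: "locally_ringed_space Y" and Z: "locally_ringed_space Z"
    and f: "lrs_morphism Y X f" and g: "lrs_morphism Z X g"
    and P: "is_fibre_product X Y Z f g P p q"
    and y: "y \<in> topspace (base Y)" and z: "z \<in> topspace (base Z)" and eq: "pt_map f y = pt_map g z"
  obtains w where "w \<in> topspace (base P)" "pt_map p w = y" "pt_map q w = z"
proof -
  interpret f: lrs_mor Y X f by unfold_locales (rule Y X f)+
  interpret g: lrs_mor Z X g by unfold_locales (rule Z X g)+
  let ?A = "stalk_ring X (pt_map f y)" and ?B = "stalk_ring Y y" and ?C = "stalk_ring Z z"
  interpret two_local_homs ?A ?B ?C "stalk_map Y X f y" "stalk_map Z X g z"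
  proof
    show "local_ring ?A" by (rule f.Y.stalk_local[OF f.pt_closed[OF y]])
    show "local_ring ?B" by (rule f.X.stalk_local[OF y])
    show "local_ring ?C" by (rule g.X.stalk_local[OF z])
    show "local_hom ?A ?B (stalk_map Y X f y)" by (rule f.stalk_map_local[OF y])
    show "local_hom ?A ?C (stalk_map Z X g z)" unfolding eq by (rule g.stalk_map_local[OF z])
  qed
  \<comment> \<open>The summand \<open>nat\<close> makes the type infinite whatever the other types
    are.\<close>
  have inf: "infinite (UNIV :: ('y, 'b, 'z, 'c) fp_type set)"
  proof -
    have "inj (\<lambda>n. {Inl n :: nat + 'y + 'b + 'z + 'c})" by (auto simp: inj_def)
    then have "infinite (range (\<lambda>n. {Inl n :: nat + 'y + 'b + 'z + 'c}))" by (rule range_inj_infinite)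
    then show ?thesis using finite_subset[OF subset_UNIV] by blast
  qed
  obtain i :: "('y set \<times> 'b) set \<Rightarrow> ('y, 'b, 'z, 'c) fp_type" where i: "inj_on i (carrier ?B)"
    using stalk_embedding[OF f.X.ringed, of "\<lambda>y. Inr (Inl y)" "\<lambda>b. Inr (Inr (Inl b))"]
    by (auto simp: inj_def)
  obtain j :: "('z set \<times> 'c) set \<Rightarrow> ('y, 'b, 'z, 'c) fp_type" where j: "inj_on j (carrier ?C)"
    using stalk_embedding[OF g.X.ringed, of "\<lambda>z. Inr (Inr (Inr (Inl z)))" "\<lambda>c. Inr (Inr (Inr (Inr c)))"]
    by (auto simp: inj_def)
  obtain K :: "('y, 'b, 'z, 'c) fp_type ring" and \<psi> \<chi> where K: "field K"
    and \<psi>: "\<psi> \<in> ring_hom ?B K" and \<chi>: "\<chi> \<in> ring_hom ?C K"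
    and \<psi>\<chi>: "\<And>a. a \<in> carrier ?A \<Longrightarrow> \<psi> (stalk_map Y X f y a) = \<chi> (stalk_map Z X g z a)"
    and \<psi>0: "\<And>b. b \<in> carrier ?B - Units ?B \<Longrightarrow> \<psi> b = \<zero>\<^bsub>K\<^esub>"
    and \<chi>0: "\<And>c. c \<in> carrier ?C - Units ?C \<Longrightarrow> \<chi> c = \<zero>\<^bsub>K\<^esub>"
    by (rule compositum_on_type[OF inf i j]) (rule that, assumption+)
  \<comment> \<open>Any element of \<open>fp_type\<close> can serve as the single point.\<close>
  let ?t = "{} :: ('y, 'b, 'z, 'c) fp_type"
  let ?T = "point_space ?t K"
  note T = point_space[OF K, of ?t]
  interpret T: one_point ?T ?t by (rule T(1))
  let ?a = "point_morphism ?T Y y \<psi>" and ?b = "point_morphism ?T Z z \<chi>"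
  have a: "lrs_morphism ?T Y ?a"
    by (rule point_morphism[OF T(1) Y y]) (simp_all add: T(3) \<psi> \<psi>0)
  have b: "lrs_morphism ?T Z ?b"
    by (rule point_morphism[OF T(1) Z z]) (simp_all add: T(3) \<chi> \<chi>0)
  have ab: "morphism_eq ?T X (morphism_comp Y f ?a) (morphism_comp Z g ?b)"
    unfolding morphism_eq_def
  proof (intro conjI ballI allI impI)
    show "pt_map (morphism_comp Y f ?a) u = pt_map (morphism_comp Z g ?b) u" for u
      using eq by (simp add: morphism_comp_def point_morphism_def)
  next
    fix V s assume V: "f.Y.op V \<and> s \<in> carrier (sec X V)"
    have "sec_map (morphism_comp Y f ?a) V s = (if pt_map f y \<in> V then \<psi> (germ Y y (preim Y f V) (sec_map f V s)) else \<zero>\<^bsub>sec ?T {}\<^esub>)"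
      using f.preim_mem[of y V] y by (simp add: morphism_comp_def point_morphism_def)
    moreover have "sec_map (morphism_comp Z g ?b) V s = (if pt_map g z \<in> V then \<chi> (germ Z z (preim Z g V) (sec_map g V s)) else \<zero>\<^bsub>sec ?T {}\<^esub>)"
      using g.preim_mem[of z V] z by (simp add: morphism_comp_def point_morphism_def)
    \<comment> \<open>Both sides come from the germ of \<open>s\<close> in the stalk of
      \<open>X\<close>, on which the maps through the two stalks agree by
      \<open>\<psi>\<chi>\<close>.\<close>
    moreover have "\<psi> (germ Y y (preim Y f V) (sec_map f V s)) = \<chi> (germ Z z (preim Z g V) (sec_map g V s))"
      if "pt_map f y \<in> V"
      using \<psi>\<chi>[OF f.Y.germ_closed[of V "pt_map f y" s]] f.stalk_map_germ[OF y, of V s]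
        g.stalk_map_germ[OF z, of V s] V that eq by simp
    ultimately show "sec_map (morphism_comp Y f ?a) V s = sec_map (morphism_comp Z g ?b) V s"
      using eq by simp
  qed
  have "\<exists>h. lrs_morphism ?T P h \<and> morphism_eq ?T Y (morphism_comp P p h) ?a \<and>
      morphism_eq ?T Z (morphism_comp P q h) ?b"
    using P a b ab T(2) unfolding is_fibre_product_def by blast
  then obtain h where h: "lrs_morphism ?T P h" "morphism_eq ?T Y (morphism_comp P p h) ?a"
      "morphism_eq ?T Z (morphism_comp P q h) ?b" by auto
  show ?thesis
  proof (rule that[of "pt_map h ?t"])
    have "continuous_map (base ?T) (base P) (pt_map h)" using h(1) unfolding lrs_morphism_def by simp
    then show "pt_map h ?t \<in> topspace (base P)" unfolding T.base by auto
    show "pt_map p (pt_map h ?t) = y" "pt_map q (pt_map h ?t) = z"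
      using h(2,3) T.top unfolding morphism_eq_def by (auto simp: morphism_comp_def point_morphism_def)
  qed
qed

section \<open>Pullback of idempotent ideals\<close>

locale clopen_pullback = lrs_mor X Y f
  for X :: "('x, 'a) ringed_space" and Y :: "('y, 'b) ringed_space" and f :: "('x, 'a, 'y, 'b) morphism" +
  fixes W :: "'y set"
  assumes W_closed: "closedin (base Y) W" and W_open: "openin (base Y) W"
begin

abbreviation "J \<equiv> clopen_ideal Y W"
abbreviation "M \<equiv> ideal_module Y J"

lemma J: "ideal_sheaf Y J"
  by (rule Y.clopen_ideal_sheaf[OF W_closed])

lemma M_simps: "base M = base Y" "carrier (sec M U) = J U" "res M = res Y"
  "a \<oplus>\<^bsub>sec M U\<^esub> b = a \<oplus>\<^bsub>sec Y U\<^esub> b" "c \<odot>\<^bsub>sec M U\<^esub> b = c \<otimes>\<^bsub>sec Y U\<^esub> b"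
  unfolding ideal_module_def by simp_all

lemma M_presheaf: "is_presheaf M"
  unfolding is_presheaf_def M_simps
proof (intro conjI allI impI)
  fix U V assume "Y.op U \<and> Y.op V \<and> V \<subseteq> U"
  then show "res Y U V \<in> J U \<rightarrow> J V" using Y.ideal_sheaf_res[OF J] by blast
next
  fix U s assume "Y.op U \<and> s \<in> J U"
  then show "res Y U U s = s" using Y.rid Y.ideal_sheaf_carrier[OF J] by blast
next
  fix U V N s assume *: "Y.op U \<and> Y.op V \<and> Y.op N \<and> N \<subseteq> V \<and> V \<subseteq> U \<and> s \<in> J U"
  then have "s \<in> carrier (sec Y U)" using Y.ideal_sheaf_carrier[OF J] by blast
  then show "res Y V N (res Y U V s) = res Y U N s" using * Y.rres by simp
qed

lemma J_add: "Y.op U \<Longrightarrow> s \<in> J U \<Longrightarrow> t \<in> J U \<Longrightarrow> s \<oplus>\<^bsub>sec Y U\<^esub> t \<in> J U"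
  using additive_subgroup.a_closed[OF ideal.axioms(1)[OF Y.ideal_sheaf_ideal[OF J]]] .

lemma J_smult: "Y.op U \<Longrightarrow> c \<in> carrier (sec Y U) \<Longrightarrow> t \<in> J U \<Longrightarrow> c \<otimes>\<^bsub>sec Y U\<^esub> t \<in> J U"
  using ideal.I_l_closed[OF Y.ideal_sheaf_ideal[OF J]] by simp

lemma J_carrier: "Y.op U \<Longrightarrow> s \<in> J U \<Longrightarrow> s \<in> carrier (sec Y U)"
  by (rule Y.ideal_sheaf_carrier[OF J])

abbreviation "St \<equiv> stalk_module Y M"

lemma St_add:
  assumes "Y.op U" "y \<in> U" "s \<in> J U" "t \<in> J U"
  shows "germ M y U s \<oplus>\<^bsub>St y\<^esub> germ M y U t = germ M y U (s \<oplus>\<^bsub>sec Y U\<^esub> t)"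
proof -
  have "germ_op M M y (\<lambda>U. ring.add (sec M U)) (germ M y U s) (germ M y U t) = germ M y U (s \<oplus>\<^bsub>sec M U\<^esub> t)"
    by (rule germ_op_germ[OF M_presheaf M_presheaf])
      (use assms in \<open>simp_all add: M_simps J_add Y.res_add J_carrier\<close>)
  then show ?thesis unfolding stalk_module_def by (simp add: M_simps)
qed

lemma St_smult:
  assumes "Y.op U" "y \<in> U" "c \<in> carrier (sec Y U)" "t \<in> J U"
  shows "germ Y y U c \<odot>\<^bsub>St y\<^esub> germ M y U t = germ M y U (c \<otimes>\<^bsub>sec Y U\<^esub> t)"
proof -
  have "germ_op Y M y (\<lambda>U. smult (sec M U)) (germ Y y U c) (germ M y U t) = germ M y U (c \<odot>\<^bsub>sec M U\<^esub> t)"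
    by (rule germ_op_germ[OF Y.presheaf M_presheaf])
      (use assms in \<open>simp_all add: M_simps J_smult Y.res_mult J_carrier\<close>)
  then show ?thesis unfolding stalk_module_def by (simp add: M_simps)
qed

lemma St_carrier: "carrier (St y) = germs M y"
  unfolding stalk_module_def by simp

lemma St_E:
  assumes "m \<in> carrier (St y)" "Y.op N" "y \<in> N"
  obtains U s where "Y.op U" "y \<in> U" "U \<subseteq> N" "s \<in> J U" "m = germ M y U s"
  using germsE_within[OF M_presheaf, of m y N] assms unfolding St_carrier M_simps by blast

lemma St_germ: "Y.op U \<Longrightarrow> y \<in> U \<Longrightarrow> s \<in> J U \<Longrightarrow> germ M y U s \<in> carrier (St y)"
  unfolding St_carrier by (rule germ_in_germs) (simp_all add: M_simps)

lemma M_germ_res: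
  assumes "Y.op U" "s \<in> J U" "Y.op V" "y \<in> V" "V \<subseteq> U"
  shows "germ M y V (res Y U V s) = germ M y U s"
  using germ_res[OF M_presheaf, of U s V y] assms unfolding M_simps by simp

lemma St_E2:
  assumes "m \<in> carrier (St y)" "n \<in> carrier (St y)" "y \<in> topspace (base Y)"
  obtains U s t where "Y.op U" "y \<in> U" "s \<in> J U" "t \<in> J U" "m = germ M y U s" "n = germ M y U t"
proof -
  obtain V t where V: "Y.op V" "y \<in> V" "t \<in> J V" "n = germ M y V t"
    by (rule St_E[OF assms(2) openin_topspace assms(3)])
  obtain U s where U: "Y.op U" "y \<in> U" "U \<subseteq> V" "s \<in> J U" "m = germ M y U s"
    by (rule St_E[OF assms(1) V(1,2)])
  show ?thesis
    by (rule that[OF U(1,2,4) Y.ideal_sheaf_res[OF J V(1) U(1,3) V(3)] U(5)])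
      (simp add: V(4) M_germ_res[OF V(1,3) U(1,2,3)])
qed

lemma St_E_smult:
  assumes "a \<in> carrier (stalk_ring Y y)" "n \<in> carrier (St y)" "y \<in> topspace (base Y)"
  obtains U s t where "Y.op U" "y \<in> U" "s \<in> carrier (sec Y U)" "t \<in> J U" "a = germ Y y U s" "n = germ M y U t"
proof -
  obtain V t where V: "Y.op V" "y \<in> V" "t \<in> J V" "n = germ M y V t"
    by (rule St_E[OF assms(2) openin_topspace assms(3)])
  obtain U s where U: "Y.op U" "y \<in> U" "U \<subseteq> V" "s \<in> carrier (sec Y U)" "a = germ Y y U s"
    by (rule Y.stalkE[OF assms(1) V(1,2)])
  show ?thesis
    by (rule that[OF U(1,2,4) Y.ideal_sheaf_res[OF J V(1) U(1,3) V(3)] U(5)])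
      (simp add: V(4) M_germ_res[OF V(1,3) U(1,2,3)])
qed

lemma tensor_St:
  assumes x: "x \<in> topspace (base X)"
  shows "tensor (stalk_ring Y (pt_map f x)) (stalk_ring X x) (stalk_map X Y f x) (St (pt_map f x))"
proof -
  let ?y = "pt_map f x"
  have y: "?y \<in> topspace (base Y)" by (rule pt_closed[OF x])
  show ?thesis
  proof (rule tensor.intro)
    show "ring (stalk_ring X x)" using X.stalk_cring[OF x] cring.axioms(1) by blast
    show "stalk_map X Y f x a \<in> carrier (stalk_ring X x)" if "a \<in> carrier (stalk_ring Y ?y)" for a
      by (rule ring_hom_closed[OF stalk_map_hom[OF x] that])
    show "m \<oplus>\<^bsub>St ?y\<^esub> n \<in> carrier (St ?y)" if "m \<in> carrier (St ?y)" "n \<in> carrier (St ?y)" for m n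
    proof (rule St_E2[OF that y])
      fix U s t assume *: "Y.op U" "?y \<in> U" "s \<in> J U" "t \<in> J U" "m = germ M ?y U s" "n = germ M ?y U t"
      show ?thesis unfolding *(5,6) St_add[OF *(1-4)] by (rule St_germ[OF *(1,2) J_add[OF *(1,3,4)]])
    qed
    show "a \<odot>\<^bsub>St ?y\<^esub> n \<in> carrier (St ?y)" if "a \<in> carrier (stalk_ring Y ?y)" "n \<in> carrier (St ?y)" for a n
    proof (rule St_E_smult[OF that y])
      fix U s t assume *: "Y.op U" "?y \<in> U" "s \<in> carrier (sec Y U)" "t \<in> J U" "a = germ Y ?y U s" "n = germ M ?y U t"
      show ?thesis unfolding *(5,6) St_smult[OF *(1-4)] by (rule St_germ[OF *(1,2) J_smult[OF *(1,3,4)]])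
    qed
  qed
qed

abbreviation "cls x \<equiv> tensor_class (stalk_ring Y (pt_map f x)) (stalk_ring X x) (stalk_map X Y f x) (St (pt_map f x))"

text \<open>Near the image point \<open>J\<close> is zero, so each stalk element satisfies
  \<open>m + m = m\<close> and every pure tensor is a relation.\<close>

lemma fibre_outside:
  assumes x: "x \<in> topspace (base X)" and W: "pt_map f x \<notin> W"
  shows "carrier (pullback_fibre X Y f M x) \<subseteq> {cls x 0}"
proof -
  let ?y = "pt_map f x"
  have y: "?y \<in> topspace (base Y)" by (rule pt_closed[OF x])
  have oW: "Y.op (topspace (base Y) - W)" using W_closed by blast
  interpret T: tensor "stalk_ring Y ?y" "stalk_ring X x" "stalk_map X Y f x" "St ?y" by (rule tensor_St[OF x])
  have idem: "m \<oplus>\<^bsub>St ?y\<^esub> m = m" if m: "m \<in> carrier (St ?y)" for m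
  proof (rule St_E[OF m oW])
    show "?y \<in> topspace (base Y) - W" using y W by simp
    fix U s assume *: "Y.op U" "?y \<in> U" "U \<subseteq> topspace (base Y) - W" "s \<in> J U" "m = germ M ?y U s"
    have "U \<inter> W = {}" using *(3) by auto
    then have s: "s = \<zero>\<^bsub>sec Y U\<^esub>" using Y.clopen_ideal_outside[OF *(1)] *(4) by simp
    interpret ring "sec Y U" by (rule Y.sec_ring[OF *(1)])
    show "m \<oplus>\<^bsub>St ?y\<^esub> m = m" unfolding *(5) St_add[OF *(1,2,4,4)] unfolding s by simp
  qed
  have "c \<in> T.rels" if "Poly_Mapping.keys c \<subseteq> carrier (stalk_ring X x) \<times> carrier (St ?y)" for c
    using that
  proof (induction c rule: frag_induction)
    case (one p)
    then show ?case using T.rels_idem[of "fst p" "snd p"] idem by auto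
  qed (simp_all add: T.rels_zero T.rels_diff)
  then have "cls x c = cls x 0" if "c \<in> T.F" for c
    using that unfolding T.cls_eq_iff T.F_iff by simp
  then show ?thesis unfolding pullback_fibre_def T.carrier_base_change by blast
qed

text \<open>A germ of the ideal, as a set of representatives with sections in \<open>J\<close>, is
  in general a different set from the germ of the same section in the structure sheaf. The inclusion
  of stalks is therefore a map that has to be chosen and shown to be well defined.\<close>

lemma stalk_inclusion:
  assumes y: "y \<in> topspace (base Y)"
  obtains \<iota> where "\<And>U s. Y.op U \<Longrightarrow> y \<in> U \<Longrightarrow> s \<in> J U \<Longrightarrow> \<iota> (germ M y U s) = germ Y y U s"
proof -
  define \<iota> where "\<iota> m = (SOME c. \<exists>U s. Y.op U \<and> y \<in> U \<and> s \<in> J U \<and> m = germ M y U s \<and> c = germ Y y U s)" for m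
  have "\<iota> (germ M y U s) = germ Y y U s" if U: "Y.op U" "y \<in> U" "s \<in> J U" for U s
  proof -
    have "\<exists>V t. Y.op V \<and> y \<in> V \<and> t \<in> J V \<and> germ M y U s = germ M y V t \<and> \<iota> (germ M y U s) = germ Y y V t"
      unfolding \<iota>_def by (rule someI[of _ "germ Y y U s"]) (use U in blast)
    then obtain V t where V: "Y.op V" "y \<in> V" "t \<in> J V" "germ M y U s = germ M y V t" "\<iota> (germ M y U s) = germ Y y V t"
      by (elim exE conjE)
    have "\<exists>N. Y.op N \<and> y \<in> N \<and> N \<subseteq> U \<inter> V \<and> res Y U N s = res Y V N t"
      using V(4) germ_eq_iff[OF M_presheaf, of U y s V t] U V(1-3) unfolding M_simps by simp
    then have "germ Y y U s = germ Y y V t"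
      using Y.germ_eq[OF U(1,2) J_carrier[OF U(1,3)] V(1,2) J_carrier[OF V(1,3)]] by simp
    then show ?thesis using V(5) by simp
  qed
  then show ?thesis using that by blast
qed

lemma J_one: "\<one>\<^bsub>sec Y W\<^esub> \<in> J W"
  using Y.clopen_ideal_inside[OF W_open order_refl] Y.one_closed[OF W_open] by simp

text \<open>The balanced map that multiplies an element of the stalk of \<open>X\<close> with the
  pullback of a germ of \<open>J\<close> sends \<open>1 \<otimes> 1\<close> to 1, which is nonzero
  in a local ring.\<close>

lemma fibre_inside:
  assumes x: "x \<in> topspace (base X)" and W: "pt_map f x \<in> W"
  shows "cls x (frag_of (\<one>\<^bsub>stalk_ring X x\<^esub>, germ M (pt_map f x) W \<one>\<^bsub>sec Y W\<^esub>)) \<noteq> cls x 0"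
proof
  let ?y = "pt_map f x" and ?A = "stalk_ring Y (pt_map f x)" and ?B = "stalk_ring X x"
  let ?\<phi> = "stalk_map X Y f x"
  have y: "?y \<in> topspace (base Y)" by (rule pt_closed[OF x])
  interpret T: tensor ?A ?B ?\<phi> "St ?y" by (rule tensor_St[OF x])
  interpret B: cring ?B by (rule X.stalk_cring[OF x])
  interpret A: cring ?A by (rule Y.stalk_cring[OF y])
  interpret \<phi>: ring_hom_ring ?A ?B ?\<phi>
    by (rule ring_hom_ringI2[OF A.ring_axioms B.ring_axioms stalk_map_hom[OF x]])
  obtain \<iota> where \<iota>: "\<And>U s. Y.op U \<Longrightarrow> ?y \<in> U \<Longrightarrow> s \<in> J U \<Longrightarrow> \<iota> (germ M ?y U s) = germ Y ?y U s"
    by (rule stalk_inclusion[OF y]) (rule that, assumption)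
  have \<iota>_closed: "\<iota> m \<in> carrier ?A" if m: "m \<in> carrier (St ?y)" for m
  proof (rule St_E[OF m openin_topspace y])
    fix U s assume *: "Y.op U" "?y \<in> U" "s \<in> J U" "m = germ M ?y U s"
    show ?thesis unfolding *(4) \<iota>[OF *(1-3)] by (rule Y.germ_closed[OF *(1,2) J_carrier[OF *(1,3)]])
  qed
  have \<iota>_add: "\<iota> (m \<oplus>\<^bsub>St ?y\<^esub> n) = \<iota> m \<oplus>\<^bsub>?A\<^esub> \<iota> n" if mn: "m \<in> carrier (St ?y)" "n \<in> carrier (St ?y)" for m n
  proof (rule St_E2[OF mn y])
    fix U s t assume *: "Y.op U" "?y \<in> U" "s \<in> J U" "t \<in> J U" "m = germ M ?y U s" "n = germ M ?y U t"
    show ?thesis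
      unfolding *(5,6) St_add[OF *(1-4)] \<iota>[OF *(1-3)] \<iota>[OF *(1,2,4)] \<iota>[OF *(1,2) J_add[OF *(1,3,4)]]
      by (rule Y.germ_add[OF *(1,2) J_carrier[OF *(1,3)] J_carrier[OF *(1,4)], symmetric])
  qed
  have \<iota>_smult: "\<iota> (a \<odot>\<^bsub>St ?y\<^esub> n) = a \<otimes>\<^bsub>?A\<^esub> \<iota> n" if an: "a \<in> carrier ?A" "n \<in> carrier (St ?y)" for a n
  proof (rule St_E_smult[OF an y])
    fix U s t assume *: "Y.op U" "?y \<in> U" "s \<in> carrier (sec Y U)" "t \<in> J U" "a = germ Y ?y U s" "n = germ M ?y U t"
    show ?thesis
      unfolding *(5,6) St_smult[OF *(1-4)] \<iota>[OF *(1,2,4)] \<iota>[OF *(1,2) J_smult[OF *(1,3,4)]]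
      by (rule Y.germ_mult[OF *(1-3) J_carrier[OF *(1,4)], symmetric])
  qed
  let ?e = "germ M ?y W \<one>\<^bsub>sec Y W\<^esub>"
  have e: "?e \<in> carrier (St ?y)" by (rule St_germ[OF W_open W J_one])
  assume "cls x (frag_of (\<one>\<^bsub>?B\<^esub>, ?e)) = cls x 0"
  then have r: "frag_of (\<one>\<^bsub>?B\<^esub>, ?e) \<in> T.rels" unfolding T.cls_eq_iff by simp
  define \<beta> where "\<beta> p = fst p \<otimes>\<^bsub>?B\<^esub> ?\<phi> (\<iota> (snd p))" for p
  have "\<beta> (\<one>\<^bsub>?B\<^esub>, ?e) = \<one>\<^bsub>add_monoid ?B\<^esub>"
  proof (rule T.functional[OF B.a_comm_group _ _ _ _ B.one_closed e r])
    fix b b' m m' a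
    assume m: "m \<in> carrier (St ?y)" and b: "b \<in> carrier ?B"
    note c = \<phi>.hom_closed[OF \<iota>_closed[OF m]]
    show "\<beta> (b, m) \<in> carrier (add_monoid ?B)" unfolding \<beta>_def using b c by simp
    show "\<beta> (b \<oplus>\<^bsub>?B\<^esub> b', m) = \<beta> (b, m) \<otimes>\<^bsub>add_monoid ?B\<^esub> \<beta> (b', m)" if "b' \<in> carrier ?B"
      unfolding \<beta>_def using b that c by (simp add: B.l_distr)
    show "\<beta> (b, m \<oplus>\<^bsub>St ?y\<^esub> m') = \<beta> (b, m) \<otimes>\<^bsub>add_monoid ?B\<^esub> \<beta> (b, m')" if "m' \<in> carrier (St ?y)"
      unfolding \<beta>_def using b c \<phi>.hom_closed[OF \<iota>_closed[OF that]] \<iota>_closed[OF m] \<iota>_closed[OF that]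
      by (simp add: B.r_distr \<iota>_add[OF m that])
    show "\<beta> (b \<otimes>\<^bsub>?B\<^esub> ?\<phi> a, m) = \<beta> (b, a \<odot>\<^bsub>St ?y\<^esub> m)" if "a \<in> carrier ?A"
      unfolding \<beta>_def using b c that \<iota>_closed[OF m] by (simp add: \<iota>_smult[OF that m] B.m_assoc)
  qed
  moreover have "\<beta> (\<one>\<^bsub>?B\<^esub>, ?e) = \<one>\<^bsub>?B\<^esub>"
    unfolding \<beta>_def using \<iota>[OF W_open W J_one] Y.germ_one[OF W_open W] by simp
  ultimately show False using local_ring_one_not_zero[OF X.stalk_local[OF x]] by simp
qed

text \<open>Sections of the pullback are functions into the fibres, and off the preimage of
  \<open>W\<close> the fibres have at most one element.\<close>

lemma sections_outside:
  assumes U: "X.op U" "\<And>x. x \<in> U \<Longrightarrow> pt_map f x \<notin> W"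
    and \<sigma>: "\<sigma> \<in> carrier (sec (pullback X Y f M) U)" and \<tau>: "\<tau> \<in> carrier (sec (pullback X Y f M) U)"
  shows "\<sigma> = \<tau>"
proof -
  have PE: "\<sigma> \<in> (\<Pi>\<^sub>E x\<in>U. carrier (pullback_fibre X Y f M x))" "\<tau> \<in> (\<Pi>\<^sub>E x\<in>U. carrier (pullback_fibre X Y f M x))"
    using \<sigma> \<tau> unfolding pullback_def by simp_all
  show ?thesis
  proof (rule PiE_ext[OF PE])
    fix x assume x: "x \<in> U"
    show "\<sigma> x = \<tau> x"
      using PiE_mem[OF PE(1) x] PiE_mem[OF PE(2) x] fibre_outside[OF X.op_topspace[OF U(1) x] U(2)[OF x]] by auto
  qed
qed

text \<open>The pure tensor of 1 with 1 and the empty sum define sections over all of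
  \<open>U\<close>; they differ already in the fibre at \<open>x\<close>.\<close>

lemma sections_inside:
  assumes U: "X.op U" "\<And>x. x \<in> U \<Longrightarrow> pt_map f x \<in> W" and x: "x \<in> U"
  shows "\<exists>\<sigma>\<in>carrier (sec (pullback X Y f M) U). \<exists>\<tau>\<in>carrier (sec (pullback X Y f M) U). \<sigma> \<noteq> \<tau>"
proof -
  define ev where "ev V c w = cls w (frag_extend (\<lambda>(a, m). frag_of (germ X w U a, germ M (pt_map f w) V m)) c)" for V c w
  have sec: "(\<lambda>w\<in>U. ev W c w) \<in> carrier (sec (pullback X Y f M) U)"
    if c: "c \<in> carrier (tensor_free (sec X U) (sec M W))" for c
  proof -
    have mem: "ev W c w \<in> carrier (pullback_fibre X Y f M w)" if w: "w \<in> U" for w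
    proof -
      have wt: "w \<in> topspace (base X)" by (rule X.op_topspace[OF U(1) w])
      interpret T: tensor "stalk_ring Y (pt_map f w)" "stalk_ring X w" "stalk_map X Y f w" "St (pt_map f w)"
        by (rule tensor_St[OF wt])
      have "Poly_Mapping.keys c \<subseteq> carrier (sec X U) \<times> J W" using c unfolding tensor_free_def M_simps by simp
      then have "frag_extend (\<lambda>(a, m). frag_of (germ X w U a, germ M (pt_map f w) W m)) c \<in> T.F"
      proof (induction c rule: frag_induction)
        case (one p)
        then show ?case
          using X.germ_closed[OF U(1) w, of "fst p"] St_germ[OF W_open U(2)[OF w], of "snd p"]
          by (auto intro!: T.F_of)
      qed (simp_all add: frag_extend_diff T.F_diff T.F_iff[of 0])
      then show ?thesis unfolding ev_def pullback_fibre_def T.carrier_base_change by blast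
    qed
    have "\<exists>N V c'. X.op N \<and> y \<in> N \<and> N \<subseteq> U \<and> Y.op V \<and> N \<subseteq> preim X f V \<and>
      c' \<in> carrier (tensor_free (sec X N) (sec M V)) \<and>
      (\<forall>w\<in>N. (\<lambda>w\<in>U. ev W c w) w = cls w (frag_extend (\<lambda>(a, m). frag_of (germ X w N a, germ M (pt_map f w) V m)) c'))"
      if y: "y \<in> U" for y
    proof (rule exI[of _ U], rule exI[of _ W], rule exI[of _ c], intro conjI)
      show "U \<subseteq> preim X f W" using U X.op_topspace[OF U(1)] preim_mem by blast
    qed (simp_all add: U(1) y W_open c ev_def)
    then show ?thesis using mem unfolding pullback_def by auto
  qed
  have xt: "x \<in> topspace (base X)" by (rule X.op_topspace[OF U(1) x])
  let ?c = "frag_of (\<one>\<^bsub>sec X U\<^esub>, \<one>\<^bsub>sec Y W\<^esub>)"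
  have c: "?c \<in> carrier (tensor_free (sec X U) (sec M W))" "0 \<in> carrier (tensor_free (sec X U) (sec M W))"
    unfolding tensor_free_def using X.one_closed[OF U(1)] J_one by (simp_all add: M_simps)
  have "(\<lambda>w\<in>U. ev W ?c w) x \<noteq> (\<lambda>w\<in>U. ev W 0 w) x"
    using fibre_inside[OF xt U(2)[OF x]] x X.germ_one[OF U(1) x] by (simp add: ev_def)
  then have "(\<lambda>w\<in>U. ev W ?c w) \<noteq> (\<lambda>w\<in>U. ev W 0 w)" by metis
  then show ?thesis using sec[OF c(1)] sec[OF c(2)] by blast
qed

end

text \<open>Counting sections: on the open set where the first preimage of \<open>W\<close> leaves
  the second, one pullback would have at least two sections and the other at most one, against the
  bijection between them.\<close>

lemma pullback_iso_preim:
  assumes P: "locally_ringed_space P" and Z: "locally_ringed_space Z"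
    and p: "lrs_morphism P Z p" and q: "lrs_morphism P Z q"
    and W: "closedin (base Z) W" "openin (base Z) W"
    and iso: "module_sheaf_isomorphic P (pullback P Z p (ideal_module Z (clopen_ideal Z W)))
       (pullback P Z q (ideal_module Z (clopen_ideal Z W)))"
    and x: "x \<in> topspace (base P)" "pt_map p x \<in> W"
  shows "pt_map q x \<in> W"
proof (rule ccontr)
  assume n: "pt_map q x \<notin> W"
  interpret p: clopen_pullback P Z p W by unfold_locales (rule P Z p W)+
  interpret q: clopen_pullback P Z q W by unfold_locales (rule q W)+
  define U where "U = preim P p W - preim P q W"
  have U: "p.X.op U" unfolding U_def by (rule openin_diff[OF p.preim_open[OF W(2)] q.preim_closed[OF W(1)]])
  have xU: "x \<in> U" unfolding U_def using x n p.preim_mem q.preim_mem by simp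
  have pU: "pt_map p u \<in> W" and qU: "pt_map q u \<notin> W" if "u \<in> U" for u
    using that p.preim_mem q.preim_mem unfolding U_def by auto
  obtain h where h: "bij_betw (h U) (carrier (sec (pullback P Z p p.M) U)) (carrier (sec (pullback P Z q p.M) U))"
    using iso U unfolding module_sheaf_isomorphic_def by (auto simp: pullback_def)
  obtain \<sigma> \<tau> where \<sigma>: "\<sigma> \<in> carrier (sec (pullback P Z p p.M) U)" "\<tau> \<in> carrier (sec (pullback P Z p p.M) U)" "\<sigma> \<noteq> \<tau>"
    using p.sections_inside[OF U pU xU] by blast
  have hc: "h U \<sigma> \<in> carrier (sec (pullback P Z q p.M) U)" "h U \<tau> \<in> carrier (sec (pullback P Z q p.M) U)"
    using bij_betwE[OF h] \<sigma> by auto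
  have "h U \<sigma> = h U \<tau>" by (rule q.sections_outside[OF U qU hc])
  then show False using inj_onD[OF bij_betw_imp_inj_on[OF h]] \<sigma> by blast
qed

section \<open>Descent of idempotent ideals\<close>

lemma scheme_locally_ringed: "scheme X \<Longrightarrow> locally_ringed_space X"
  unfolding scheme_def by simp

lemma scheme_chart:
  fixes X :: "('x, 'a) ringed_space"
  assumes "scheme X" "x \<in> topspace (base X)"
  shows "\<exists>U (R :: 'a ring) \<pi> h. x \<in> U \<and> chart X U R \<pi> h"
proof -
  have rs: "is_ringed_space X" using scheme_locally_ringed[OF assms(1)] unfolding locally_ringed_space_def by simp
  obtain U and R :: "'a ring" where U: "openin (base X) U" "x \<in> U" "cring R" "lrs_isomorphic (open_sub X U) (Spec R)"
    using assms(1)[unfolded scheme_def, THEN conjunct2, rule_format, OF assms(2)] by (elim exE conjE)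
  obtain \<pi> h where "chart X U R \<pi> h" by (rule chart_exists[OF rs U(1,3,4)]) (rule that)
  then show ?thesis using U(2) by (intro exI conjI)
qed

lemma noetherian_scheme_chart:
  fixes X :: "('x, 'a) ringed_space"
  assumes "noetherian_scheme X" "x \<in> topspace (base X)"
  shows "\<exists>U (R :: 'a ring) \<pi> h. x \<in> U \<and> noetherian_ring R \<and> chart X U R \<pi> h"
proof -
  have "scheme X" using assms(1) unfolding noetherian_scheme_def by simp
  then have rs: "is_ringed_space X" using scheme_locally_ringed unfolding locally_ringed_space_def by blast
  obtain U and R :: "'a ring" where U: "openin (base X) U" "x \<in> U" "cring R" "noetherian_ring R"
    "lrs_isomorphic (open_sub X U) (Spec R)"
    using assms(1)[unfolded noetherian_scheme_def, THEN conjunct2, THEN conjunct2, rule_format, OF assms(2)]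
    by (elim exE conjE)
  obtain \<pi> h where "chart X U R \<pi> h" by (rule chart_exists[OF rs U(1,3,5)]) (rule that)
  then show ?thesis using U(2,4) by (intro exI conjI)
qed

theorem propositionC8:
  fixes X :: "('x, 'a) ringed_space" and Z :: "('z, 'b) ringed_space"
    and g :: "('z, 'b, 'x, 'a) morphism"
    and P :: "('z, 'b, 'z, 'b) fp_space"
    and \<pi>\<^sub>1 \<pi>\<^sub>2 :: "(('z, 'b, 'z, 'b) fp_type, ('z, 'b, 'z, 'b) fp_type, 'z, 'b) morphism"
    and J :: "'z set \<Rightarrow> 'b set"
  assumes "noetherian_scheme X" and "noetherian_scheme Z"
    and "faithfully_flat_morphism Z X g"
    and "is_fibre_product X Z Z g g P \<pi>\<^sub>1 \<pi>\<^sub>2"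
    and "idempotent_ideal Z J"
    and "module_sheaf_isomorphic P (pullback P Z \<pi>\<^sub>1 (ideal_module Z J))
           (pullback P Z \<pi>\<^sub>2 (ideal_module Z J))"
  shows "\<exists>!I. idempotent_ideal X I \<and> J = extended_ideal Z X g I"
proof -
  have schemes: "scheme X" "scheme Z" using assms(1,2) unfolding noetherian_scheme_def by simp_all
  note lX = scheme_locally_ringed[OF schemes(1)] and lZ = scheme_locally_ringed[OF schemes(2)]
  have g: "lrs_morphism Z X g" and surj: "pt_map g ` topspace (base Z) = topspace (base X)"
    and flat: "\<And>z. z \<in> topspace (base Z) \<Longrightarrow>
      flat_hom (stalk_ring X (pt_map g z)) (stalk_ring Z z) (stalk_map Z X g z)"
    using assms(3) unfolding faithfully_flat_morphism_def flat_morphism_def by auto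
  have P: "scheme P" and \<pi>: "lrs_morphism P Z \<pi>\<^sub>1" "lrs_morphism P Z \<pi>\<^sub>2"
    using assms(4) unfolding is_fibre_product_def by simp_all
  interpret g: lrs_mor Z X g by unfold_locales (rule lZ lX g)+
  obtain W where W: "closedin (base Z) W" "g.X.op W" and J: "J = clopen_ideal Z W"
    by (rule g.X.idempotent_is_clopen_ideal[OF assms(5)]) (rule that)
  \<comment> \<open>\<open>W\<close> is a union of fibres of \<open>g\<close>: a point of the fibre
    product above the pair of \<open>w\<close> and \<open>z\<close> carries membership from the
    first projection to the second.\<close>
  have sat: "z \<in> W" if w: "w \<in> W" and z: "z \<in> topspace (base Z)" and eq: "pt_map g w = pt_map g z" for w z
  proof -
    have wt: "w \<in> topspace (base Z)" by (rule g.X.op_topspace[OF W(2) w])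
    obtain y where y: "y \<in> topspace (base P)" "pt_map \<pi>\<^sub>1 y = w" "pt_map \<pi>\<^sub>2 y = z"
      by (rule fibre_product_point[OF lX lZ lZ g g assms(4) wt z eq]) (rule that)
    have "pt_map \<pi>\<^sub>2 y \<in> W"
      by (rule pullback_iso_preim[OF scheme_locally_ringed[OF P] lZ \<pi> W])
        (use assms(6) J y w in simp_all)
    then show ?thesis using y by simp
  qed
  define V where "V = pt_map g ` W"
  have Wt: "W \<subseteq> topspace (base Z)" using openin_subset[OF W(2)] .
  have Vt: "V \<subseteq> topspace (base X)" unfolding V_def using surj Wt by auto
  have pre: "preim Z g V = W"
    unfolding V_def preim_def using sat Wt by auto
  \<comment> \<open>Generizations lifted along \<open>g\<close> stay in every open set around
    \<open>z\<close>. This is applied to \<open>W\<close> and to its complement, both of which are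
    open.\<close>
  have lift: "x' \<in> pt_map g ` N"
    if N: "g.X.op N" "z \<in> N" and C: "chart X U R \<pi> h" and x: "pt_map g z \<in> U" "x' \<in> U" "\<pi> x' \<subseteq> \<pi> (pt_map g z)"
    for N z U and R :: "'a ring" and \<pi> h x'
  proof -
    have zt: "z \<in> topspace (base Z)" by (rule g.X.op_topspace[OF N])
    obtain U' and R' :: "'b ring" and \<pi>' h' where U': "z \<in> U'" "chart Z U' R' \<pi>' h'"
      using scheme_chart[OF schemes(2) zt] by (elim exE conjE)
    obtain z' where z': "\<And>N. g.X.op N \<Longrightarrow> z \<in> N \<Longrightarrow> z' \<in> N" "pt_map g z' = x'"
      by (rule g.flat_generization_lift[OF flat[OF zt] U'(2,1) C x]) (rule that, assumption+)
    show ?thesis using z'(1)[OF N] z'(2) by blast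
  qed
  have stable: "x' \<in> V \<longleftrightarrow> x \<in> V"
    if C: "chart X U R \<pi> h" and x: "x \<in> U" "x' \<in> U" "\<pi> x' \<subseteq> \<pi> x" for U and R :: "'a ring" and \<pi> h x x'
  proof
    assume "x \<in> V"
    then obtain z where z: "z \<in> W" "x = pt_map g z" unfolding V_def by auto
    show "x' \<in> V" unfolding V_def by (rule lift[OF W(2) z(1) C]) (use x z in simp_all)
  next
    \<comment> \<open>If \<open>x\<close> were outside \<open>V\<close>, it would come from the
      complement of \<open>W\<close>; then \<open>x'\<close> would have one preimage there and
      another in \<open>W\<close>, against saturation.\<close>
    assume x'V: "x' \<in> V"
    show "x \<in> V"
    proof (rule ccontr)
      assume nV: "x \<notin> V"
      have "x \<in> topspace (base X)" using g.Y.op_topspace[OF chartD(1)[OF C] x(1)] .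
      then obtain z where z: "z \<in> topspace (base Z)" "x = pt_map g z" using surj by blast
      have o: "g.X.op (topspace (base Z) - W)" using W(1) by blast
      have zW: "z \<in> topspace (base Z) - W" using z nV unfolding V_def by auto
      have "x' \<in> pt_map g ` (topspace (base Z) - W)" by (rule lift[OF o zW C]) (use x z in simp_all)
      then obtain z' where z': "z' \<in> topspace (base Z)" "z' \<notin> W" "x' = pt_map g z'" by auto
      obtain w where w: "w \<in> W" "x' = pt_map g w" using x'V unfolding V_def by auto
      then show False using sat[OF w(1) z'(1)] z' by simp
    qed
  qed
  have Vo: "g.Y.op V"
  proof (rule g.Y.open_if_stable[OF noetherian_scheme_chart[OF assms(1)] _ Vt])
    fix U and R :: "'a ring" and \<pi> h x x' assume "chart X U R \<pi> h" "x \<in> U" "x' \<in> U" "\<pi> x' \<subseteq> \<pi> x"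
    from stable[OF this] show "x' \<notin> V \<longleftrightarrow> x \<notin> V" by simp
  qed
  \<comment> \<open>Stability is an equivalence, hence symmetric in \<open>V\<close> and its
    complement, so the same criterion gives closedness.\<close>
  have "g.Y.op (topspace (base X) - V)"
  proof (rule g.Y.open_if_stable[OF noetherian_scheme_chart[OF assms(1)]])
    fix U and R :: "'a ring" and \<pi> h x x' assume C: "chart X U R \<pi> h" and x: "x \<in> U" "x' \<in> U" "\<pi> x' \<subseteq> \<pi> x"
    have "x \<in> topspace (base X)" "x' \<in> topspace (base X)"
      using g.Y.op_topspace[OF chartD(1)[OF C]] x by auto
    then show "x' \<notin> topspace (base X) - V \<longleftrightarrow> x \<notin> topspace (base X) - V"
      using stable[OF C x] by simp
  qed auto
  then have Vc: "closedin (base X) V" using Vt unfolding closedin_def by simp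
  show ?thesis
  proof (rule ex1I[of _ "clopen_ideal X V"])
    show "idempotent_ideal X (clopen_ideal X V) \<and> J = extended_ideal Z X g (clopen_ideal X V)"
      using g.Y.clopen_ideal_idempotent[OF Vc Vo] g.extended_clopen_ideal[OF Vc Vo] J pre by simp
    fix I assume I: "idempotent_ideal X I \<and> J = extended_ideal Z X g I"
    then have "idempotent_ideal X I" by simp
    then obtain V' where V': "closedin (base X) V'" "g.Y.op V'" "I = clopen_ideal X V'"
      by (rule g.Y.idempotent_is_clopen_ideal) (rule that)
    \<comment> \<open>Uniqueness is settled on sets: the preimage of \<open>V'\<close> is forced to
      be \<open>W\<close>, and surjectivity of \<open>g\<close> recovers \<open>V'\<close> as the
      image of its preimage.\<close>
    have "clopen_ideal Z W = clopen_ideal Z (preim Z g V')"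
      using I J g.extended_clopen_ideal[OF V'(1,2)] V'(3) by simp
    then have "W = preim Z g V'"
      by (rule g.X.clopen_ideal_inj[OF W(2,1) g.preim_open[OF V'(2)] g.preim_closed[OF V'(1)]])
    then have "V = pt_map g ` preim Z g V'" unfolding V_def by simp
    also have "\<dots> = V'"
    proof
      show "pt_map g ` preim Z g V' \<subseteq> V'" unfolding preim_def by auto
      show "V' \<subseteq> pt_map g ` preim Z g V'"
      proof
        fix v assume v: "v \<in> V'"
        then have "v \<in> topspace (base X)" by (rule g.Y.op_topspace[OF V'(2)])
        then obtain z where "z \<in> topspace (base Z)" "v = pt_map g z" using surj by blast
        then show "v \<in> pt_map g ` preim Z g V'" using v unfolding preim_def by auto
      qed
    qed
    finally show "I = clopen_ideal X V" using V'(3) by simp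
  qed
qed

end
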